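(* Let $k$ be a field and let $\mathbf{C}$ and $\mathbf{C'}$ be any two of the five classes $\mathbf{PA1}$, $\mathbf{WPA}$, $\mathbf{MA}$, $\mathbf{CMA}$, $\mathbf{CMA1}$ of finitely presented $\mathbb{N}$-graded $k$-algebras. If $A$ belongs to $\mathbf{C}$, then there is an algebra $A'$ in $\mathbf{C'}$ and an equivalence of categories $F:\operatorname{QGr} A \to \operatorname{QGr} A'$ such that $F(M(1))\cong F(M)(1)$ for all $M\in \operatorname{QGr} A$.
   Context: For an $\mathbb{N}$-graded $k$-algebra $A$, $\operatorname{Gr} A$ is the category of $\mathbb{Z}$-graded right $A$-modules with degree-preserving $A$-module homomorphisms; $\operatorname{Fdim} A\subseteq \operatorname{Gr} A$ is the localizing subcategory of graded modules that are the sum of their finite-dimensional submodules; $\operatorname{QGr} A$ is the quotient category $\operatorname{Gr} A/\operatorname{Fdim} A$. For $M\in\operatorname{Gr}A$, the shift $M(1)$ is $M$ with grading $M(1)_i=M_{i+1}$; the auto-equivalence $(1)$ of $\operatorname{Gr} A$ descends to an auto-equivalence of $\operatorname{QGr} A$, still denoted $(1)$. A quiver is a directed graph (loops and multiple arrows allowed); it is finite if it has finitely many vertices and arrows. A weighted path algebra $kQ$ of a finite quiver $Q$ is its path algebra, $\mathbb{N}$-graded by assigning each arrow a degree $\ge 1$ (trivial paths have degree $0$). The five classes are: $\mathbf{PA1}$: path algebras of finite quivers, graded with all arrows in degree $1$. $\mathbf{WPA}$: weighted path algebras of finite quivers. $\mathbf{MA}$ (monomial algebras): algebras $kQ/I$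 where $kQ$ is a weighted path algebra of a finite quiver $Q$ and $I$ is an ideal generated by a finite set of paths. $\mathbf{CMA}$ (connected monomial algebras): monomial algebras $kQ/I$ in which $Q$ has only one vertex. $\mathbf{CMA1}$: connected monomial algebras that are generated by elements of degree $1$. *)

theory Defs
  imports
    "HOL-Algebra.Module"
    "HOL-Algebra.QuotRing"
    "HOL-Algebra.Subrings"
    "HOL-Algebra.Generated_Groups"
    "HOL-Library.Equipollence"
    "Graph_Theory.Arc_Walk"
begin

section \<open>Categories, functors, equivalences\<close>

record ('o, 'm) cat =
  Obj :: "'o set"
  Hom :: "'o \<Rightarrow> 'o \<Rightarrow> 'm set"
  Idn :: "'o \<Rightarrow> 'm"
  Cmp :: "'m \<Rightarrow> 'm \<Rightarrow> 'm"  \<comment> \<open>\<open>Cmp C g f\<close> is "first \<open>f\<close>, then \<open>g\<close>"\<close>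

locale category =
  fixes C :: "('o, 'm) cat"
  assumes id_hom: "x \<in> Obj C \<Longrightarrow> Idn C x \<in> Hom C x x"
    and comp_hom: "\<lbrakk> x \<in> Obj C; y \<in> Obj C; z \<in> Obj C; f \<in> Hom C x y; g \<in> Hom C y z \<rbrakk>
      \<Longrightarrow> Cmp C g f \<in> Hom C x z"
    and id_left: "\<lbrakk> x \<in> Obj C; y \<in> Obj C; f \<in> Hom C x y \<rbrakk> \<Longrightarrow> Cmp C (Idn C y) f = f"
    and id_right: "\<lbrakk> x \<in> Obj C; y \<in> Obj C; f \<in> Hom C x y \<rbrakk> \<Longrightarrow> Cmp C f (Idn C x) = f"
    and comp_assoc: "\<lbrakk> w \<in> Obj C; x \<in> Obj C; y \<in> Obj C; z \<in> Obj C;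
      f \<in> Hom C w x; g \<in> Hom C x y; h \<in> Hom C y z \<rbrakk>
      \<Longrightarrow> Cmp C h (Cmp C g f) = Cmp C (Cmp C h g) f"
    and hom_disjoint: "\<lbrakk> x \<in> Obj C; y \<in> Obj C; x' \<in> Obj C; y' \<in> Obj C;
      f \<in> Hom C x y; f \<in> Hom C x' y' \<rbrakk> \<Longrightarrow> x = x' \<and> y = y'"

definition is_iso :: "('o, 'm) cat \<Rightarrow> 'o \<Rightarrow> 'o \<Rightarrow> 'm \<Rightarrow> bool" where
  "is_iso C x y f \<longleftrightarrow> f \<in> Hom C x y \<and>
     (\<exists>g \<in> Hom C y x. Cmp C g f = Idn C x \<and> Cmp C f g = Idn C y)"

definition isomorphic :: "('o, 'm) cat \<Rightarrow> 'o \<Rightarrow> 'o \<Rightarrow> bool" where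
  "isomorphic C x y \<longleftrightarrow> (\<exists>f. is_iso C x y f)"

record ('o, 'm, 'p, 'n) funct =
  fobj :: "'o \<Rightarrow> 'p"
  farr :: "'m \<Rightarrow> 'n"

definition is_functor ::
    "('o, 'm) cat \<Rightarrow> ('p, 'n) cat \<Rightarrow> ('o, 'm, 'p, 'n) funct \<Rightarrow> bool" where
  "is_functor C D F \<longleftrightarrow> category C \<and> category D \<and>
     (\<forall>x \<in> Obj C. fobj F x \<in> Obj D \<and> farr F (Idn C x) = Idn D (fobj F x)) \<and>
     (\<forall>x \<in> Obj C. \<forall>y \<in> Obj C. \<forall>f \<in> Hom C x y. farr F f \<in> Hom D (fobj F x) (fobj F y)) \<and>
     (\<forall>x \<in> Obj C. \<forall>y \<in> Obj C. \<forall>z \<in> Obj C. \<forall>f \<in> Hom C x y. \<forall>g \<in> Hom C y z.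
        farr F (Cmp C g f) = Cmp D (farr F g) (farr F f))"

definition id_funct :: "('o, 'm, 'o, 'm) funct" where
  "id_funct = \<lparr> fobj = id, farr = id \<rparr>"

definition comp_funct ::
    "('p, 'n, 'q, 'l) funct \<Rightarrow> ('o, 'm, 'p, 'n) funct \<Rightarrow> ('o, 'm, 'q, 'l) funct" where
  "comp_funct G F = \<lparr> fobj = fobj G \<circ> fobj F, farr = farr G \<circ> farr F \<rparr>"

definition nat_isomorphic :: "('o, 'm) cat \<Rightarrow> ('p, 'n) cat \<Rightarrow>
    ('o, 'm, 'p, 'n) funct \<Rightarrow> ('o, 'm, 'p, 'n) funct \<Rightarrow> bool" where
  "nat_isomorphic C D F G \<longleftrightarrow> (\<exists>\<eta>.
     (\<forall>x \<in> Obj C. is_iso D (fobj F x) (fobj G x) (\<eta> x)) \<and>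
     (\<forall>x \<in> Obj C. \<forall>y \<in> Obj C. \<forall>f \<in> Hom C x y.
        Cmp D (\<eta> y) (farr F f) = Cmp D (farr G f) (\<eta> x)))"

definition is_equivalence ::
    "('o, 'm) cat \<Rightarrow> ('p, 'n) cat \<Rightarrow> ('o, 'm, 'p, 'n) funct \<Rightarrow> bool" where
  "is_equivalence C D F \<longleftrightarrow> is_functor C D F \<and>
     (\<exists>G. is_functor D C G \<and>
          nat_isomorphic C C id_funct (comp_funct G F) \<and>
          nat_isomorphic D D (comp_funct F G) id_funct)"


section \<open>Graded algebras\<close>

text \<open>\<open>M\<close> is the (internal) direct sum of the family of additive subgroups \<open>D\<close>.\<close>

definition direct_sum_decomp :: "('m, 'x) ring_scheme \<Rightarrow> ('i \<Rightarrow> 'm set) \<Rightarrow> bool" where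
  "direct_sum_decomp M D \<longleftrightarrow> (\<forall>i. subgroup (D i) (add_monoid M)) \<and>
     (\<forall>x \<in> carrier M. \<exists>!d. (\<forall>i. d i \<in> D i) \<and> finite {i. d i \<noteq> \<zero>\<^bsub>M\<^esub>} \<and>
        x = (\<Oplus>\<^bsub>M\<^esub>i\<in>{i. d i \<noteq> \<zero>\<^bsub>M\<^esub>}. d i))"

record ('k, 'a) graded_algebra = "('k, 'a) module" +
  adeg :: "nat \<Rightarrow> 'a set"

text \<open>The library locale \<open>algebra\<close> is restricted to commutative algebras, so associative
  unital algebras are introduced here.\<close>

locale graded_algebra = module K A + ring A
  for K :: "'k ring" (structure) and A :: "('k, 'a) graded_algebra" (structure) +
  assumes smult_mult_left: "\<lbrakk> c \<in> carrier K; x \<in> carrier A; y \<in> carrier A \<rbrakk>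
      \<Longrightarrow> (c \<odot>\<^bsub>A\<^esub> x) \<otimes>\<^bsub>A\<^esub> y = c \<odot>\<^bsub>A\<^esub> (x \<otimes>\<^bsub>A\<^esub> y)"
    and smult_mult_right: "\<lbrakk> c \<in> carrier K; x \<in> carrier A; y \<in> carrier A \<rbrakk>
      \<Longrightarrow> x \<otimes>\<^bsub>A\<^esub> (c \<odot>\<^bsub>A\<^esub> y) = c \<odot>\<^bsub>A\<^esub> (x \<otimes>\<^bsub>A\<^esub> y)"
    and adeg_decomp: "direct_sum_decomp A (adeg A)"
    and adeg_smult: "\<lbrakk> c \<in> carrier K; x \<in> adeg A i \<rbrakk> \<Longrightarrow> c \<odot>\<^bsub>A\<^esub> x \<in> adeg A i"
    and adeg_mult: "\<lbrakk> x \<in> adeg A i; y \<in> adeg A j \<rbrakk> \<Longrightarrow> x \<otimes>\<^bsub>A\<^esub> y \<in> adeg A (i + j)"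

definition graded_algebra_isomorphic ::
    "'k ring \<Rightarrow> ('k, 'a) graded_algebra \<Rightarrow> ('k, 'b) graded_algebra \<Rightarrow> bool" where
  "graded_algebra_isomorphic K A B \<longleftrightarrow> (\<exists>h \<in> ring_hom A B.
     bij_betw h (carrier A) (carrier B) \<and>
     (\<forall>c \<in> carrier K. \<forall>x \<in> carrier A. h (c \<odot>\<^bsub>A\<^esub> x) = c \<odot>\<^bsub>B\<^esub> h x) \<and>
     (\<forall>n. h ` adeg A n = adeg B n))"

definition quotient_algebra ::
    "('k, 'a) graded_algebra \<Rightarrow> 'a set \<Rightarrow> ('k, 'a set) graded_algebra" where
  "quotient_algebra A I =
     \<lparr> carrier = carrier (A Quot I), mult = mult (A Quot I), one = one (A Quot I),
       zero = zero (A Quot I), add = add (A Quot I),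
       smult = (\<lambda>c X. \<Union>x\<in>X. I +>\<^bsub>A\<^esub> (c \<odot>\<^bsub>A\<^esub> x)),
       adeg = (\<lambda>n. (\<lambda>x. I +>\<^bsub>A\<^esub> x) ` adeg A n) \<rparr>"

definition generated_subalgebra ::
    "'k ring \<Rightarrow> ('k, 'a) graded_algebra \<Rightarrow> 'a set \<Rightarrow> 'a set" where
  "generated_subalgebra K A X = \<Inter>{S. subring S A \<and> submodule S K A \<and> X \<subseteq> S}"


section \<open>Path algebras and monomial algebras\<close>

text \<open>A quiver is a \<^typ>\<open>('v, 'e) pre_digraph\<close> satisfying \<^locale>\<open>wf_digraph\<close>, a finite quiver
  one satisfying \<^locale>\<open>fin_digraph\<close>; both allow loops and parallel arcs. A path is recorded as
  its starting vertex together with its list of arrows, so that \<open>(v, [])\<close> is the trivial path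
  at \<open>v\<close>.\<close>

type_synonym ('v, 'e) qpath = "'v \<times> 'e list"

definition qpaths :: "('v, 'e) pre_digraph \<Rightarrow> ('v, 'e) qpath set" where
  "qpaths Q = {(u, p). \<exists>v. pre_digraph.awalk Q u p v}"

definition qpath_end :: "('v, 'e) pre_digraph \<Rightarrow> ('v, 'e) qpath \<Rightarrow> 'v" where
  "qpath_end Q x = pre_digraph.awlast Q (fst x) (snd x)"

text \<open>Elements of the path algebra are the finitely supported functions from paths to scalars.
  The product of paths \<open>y z\<close> is "first \<open>y\<close>, then \<open>z\<close>" if \<open>y\<close> ends where \<open>z\<close> starts, and \<open>0\<close>
  otherwise. The weight function \<open>w\<close> gives the degrees of the arrows.\<close>

definition path_algebra :: "'k ring \<Rightarrow> ('v, 'e) pre_digraph \<Rightarrow> ('e \<Rightarrow> nat) \<Rightarrow>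
    ('k, ('v, 'e) qpath \<Rightarrow> 'k) graded_algebra" where
  "path_algebra K Q w = (let
     U = {f. (\<forall>x. f x \<in> carrier K) \<and> finite {x. f x \<noteq> \<zero>\<^bsub>K\<^esub>} \<and> {x. f x \<noteq> \<zero>\<^bsub>K\<^esub>} \<subseteq> qpaths Q} in
     \<lparr> carrier = U,
       mult = (\<lambda>f g x. finsum K (\<lambda>(y, z). f y \<otimes>\<^bsub>K\<^esub> g z)
         {(y, z). y \<in> qpaths Q \<and> z \<in> qpaths Q \<and> qpath_end Q y = fst z \<and>
                  x = (fst y, snd y @ snd z)}),
       one = (\<lambda>(u, p). if u \<in> verts Q \<and> p = [] then \<one>\<^bsub>K\<^esub> else \<zero>\<^bsub>K\<^esub>),
       zero = (\<lambda>x. \<zero>\<^bsub>K\<^esub>),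
       add = (\<lambda>f g x. f x \<oplus>\<^bsub>K\<^esub> g x),
       smult = (\<lambda>c f x. c \<otimes>\<^bsub>K\<^esub> f x),
       adeg = (\<lambda>n. {f \<in> U. \<forall>x. f x \<noteq> \<zero>\<^bsub>K\<^esub> \<longrightarrow> sum_list (map w (snd x)) = n}) \<rparr>)"

definition path_elem :: "'k ring \<Rightarrow> ('v, 'e) qpath \<Rightarrow> ('v, 'e) qpath \<Rightarrow> 'k" where
  "path_elem K x = (\<lambda>y. if y = x then \<one>\<^bsub>K\<^esub> else \<zero>\<^bsub>K\<^esub>)"

definition weighted_quiver :: "('v, 'e) pre_digraph \<Rightarrow> ('e \<Rightarrow> nat) \<Rightarrow> bool" where
  "weighted_quiver Q w \<longleftrightarrow> fin_digraph Q \<and> (\<forall>e \<in> arcs Q. 1 \<le> w e)"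

definition monomial_quotient :: "'k ring \<Rightarrow> ('v, 'e) pre_digraph \<Rightarrow> ('e \<Rightarrow> nat) \<Rightarrow>
    ('v, 'e) qpath set \<Rightarrow> ('k, (('v, 'e) qpath \<Rightarrow> 'k) set) graded_algebra" where
  "monomial_quotient K Q w S =
     quotient_algebra (path_algebra K Q w) (Idl\<^bsub>path_algebra K Q w\<^esub> (path_elem K ` S))"

datatype algebra_class = PA1 | WPA | MA | CMA | CMA1

text \<open>Membership in a class is understood up to isomorphism of graded algebras. For this reason
  it is no restriction to label the vertices and arrows of the (finite) quivers by natural
  numbers.\<close>

definition is_monomial_via :: "'k ring \<Rightarrow> ('k, 'a) graded_algebra \<Rightarrow> (nat, nat) pre_digraph \<Rightarrow>
    (nat \<Rightarrow> nat) \<Rightarrow> (nat, nat) qpath set \<Rightarrow> bool" where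
  "is_monomial_via K A Q w S \<longleftrightarrow> graded_algebra K A \<and> weighted_quiver Q w \<and>
     finite S \<and> S \<subseteq> qpaths Q \<and> graded_algebra_isomorphic K A (monomial_quotient K Q w S)"

fun in_class :: "'k ring \<Rightarrow> algebra_class \<Rightarrow> ('k, 'a) graded_algebra \<Rightarrow> bool" where
  "in_class K PA1 A \<longleftrightarrow> graded_algebra K A \<and>
     (\<exists>Q :: (nat, nat) pre_digraph. fin_digraph Q \<and>
        graded_algebra_isomorphic K A (path_algebra K Q (\<lambda>_. 1)))"
| "in_class K WPA A \<longleftrightarrow> graded_algebra K A \<and>
     (\<exists>(Q :: (nat, nat) pre_digraph) w. weighted_quiver Q w \<and>
        graded_algebra_isomorphic K A (path_algebra K Q w))"
| "in_class K MA A \<longleftrightarrow> (\<exists>Q w S. is_monomial_via K A Q w S)"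
| "in_class K CMA A \<longleftrightarrow> (\<exists>Q w S. is_monomial_via K A Q w S \<and> card (verts Q) = 1)"
| "in_class K CMA1 A \<longleftrightarrow> (\<exists>Q w S. is_monomial_via K A Q w S \<and> card (verts Q) = 1) \<and>
     generated_subalgebra K A (adeg A 1) = carrier A"


section \<open>Graded right modules\<close>

text \<open>The inherited fields \<open>mult\<close> and \<open>one\<close> play no role (as for the library's
  \<^type>\<open>module_ext\<close>). The vector space structure is \<open>c m = m (c 1)\<close>.\<close>

record ('a, 'm) graded_module = "'m ring" +
  ract :: "'m \<Rightarrow> 'a \<Rightarrow> 'm"
  mdeg :: "int \<Rightarrow> 'm set"

locale graded_right_module = graded_algebra K A + mod: abelian_group M
  for K :: "'k ring" and A :: "('k, 'a) graded_algebra" and M :: "('a, 'm) graded_module" +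
  assumes ract_closed: "\<lbrakk> m \<in> carrier M; a \<in> carrier A \<rbrakk> \<Longrightarrow> ract M m a \<in> carrier M"
    and ract_add_left: "\<lbrakk> m \<in> carrier M; m' \<in> carrier M; a \<in> carrier A \<rbrakk>
      \<Longrightarrow> ract M (m \<oplus>\<^bsub>M\<^esub> m') a = ract M m a \<oplus>\<^bsub>M\<^esub> ract M m' a"
    and ract_add_right: "\<lbrakk> m \<in> carrier M; a \<in> carrier A; b \<in> carrier A \<rbrakk>
      \<Longrightarrow> ract M m (a \<oplus>\<^bsub>A\<^esub> b) = ract M m a \<oplus>\<^bsub>M\<^esub> ract M m b"
    and ract_mult: "\<lbrakk> m \<in> carrier M; a \<in> carrier A; b \<in> carrier A \<rbrakk>
      \<Longrightarrow> ract M m (a \<otimes>\<^bsub>A\<^esub> b) = ract M (ract M m a) b"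
    and ract_one: "m \<in> carrier M \<Longrightarrow> ract M m \<one>\<^bsub>A\<^esub> = m"
    and mdeg_decomp: "direct_sum_decomp M (mdeg M)"
    and mdeg_ract: "\<lbrakk> m \<in> mdeg M i; a \<in> adeg A j \<rbrakk> \<Longrightarrow> ract M m a \<in> mdeg M (i + int j)"

definition gr_hom :: "('k, 'a) graded_algebra \<Rightarrow> ('a, 'm) graded_module \<Rightarrow>
    ('a, 'n) graded_module \<Rightarrow> ('m \<Rightarrow> 'n) set" where
  "gr_hom A M N = {f \<in> hom (add_monoid M) (add_monoid N).
     (\<forall>m \<in> carrier M. \<forall>a \<in> carrier A. f (ract M m a) = ract N (f m) a) \<and>
     (\<forall>i. f ` mdeg M i \<subseteq> mdeg N i)}"

definition shift :: "('a, 'm) graded_module \<Rightarrow> ('a, 'm) graded_module" where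
  "shift M = M\<lparr> mdeg := (\<lambda>i. mdeg M (i + 1)) \<rparr>"

definition submod :: "('a, 'm) graded_module \<Rightarrow> 'm set \<Rightarrow> ('a, 'm) graded_module" where
  "submod M N = M\<lparr> carrier := N, mdeg := (\<lambda>i. mdeg M i \<inter> N) \<rparr>"

definition gr_submodule ::
    "'k ring \<Rightarrow> ('k, 'a) graded_algebra \<Rightarrow> 'm set \<Rightarrow> ('a, 'm) graded_module \<Rightarrow> bool" where
  "gr_submodule K A N M \<longleftrightarrow> N \<subseteq> carrier M \<and> graded_right_module K A (submod M N)"

definition quotmod :: "('a, 'm) graded_module \<Rightarrow> 'm set \<Rightarrow> ('a, 'm set) graded_module" where
  "quotmod M N =
     \<lparr> carrier = a_rcosets\<^bsub>M\<^esub> N, mult = undefined, one = undefined,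
       zero = N, add = set_add M,
       ract = (\<lambda>X a. \<Union>x\<in>X. N +>\<^bsub>M\<^esub> ract M x a),
       mdeg = (\<lambda>i. (\<lambda>x. N +>\<^bsub>M\<^esub> x) ` mdeg M i) \<rparr>"

definition fin_dim ::
    "'k ring \<Rightarrow> ('k, 'a) graded_algebra \<Rightarrow> ('a, 'm) graded_module \<Rightarrow> bool" where
  "fin_dim K A M \<longleftrightarrow> (\<exists>B. finite B \<and> B \<subseteq> carrier M \<and>
     carrier M = {\<Oplus>\<^bsub>M\<^esub>b\<in>B. ract M b (c b \<odot>\<^bsub>A\<^esub> \<one>\<^bsub>A\<^esub>) | c. \<forall>b \<in> B. c b \<in> carrier K})"

text \<open>The sum of a family of submodules is the additive subgroup generated by their union.\<close>

definition in_Fdim ::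
    "'k ring \<Rightarrow> ('k, 'a) graded_algebra \<Rightarrow> ('a, 'm) graded_module \<Rightarrow> bool" where
  "in_Fdim K A M \<longleftrightarrow> graded_right_module K A M \<and>
     carrier M =
       generate (add_monoid M) (\<Union>{N. gr_submodule K A N M \<and> fin_dim K A (submod M N)})"


section \<open>The quotient category\<close>

text \<open>Gabriel's construction: the morphisms \<open>M \<rightarrow> N\<close> of \<open>Gr A / Fdim A\<close> are the elements of the
  direct limit of the groups \<open>Hom(M', N/N')\<close> over the graded submodules \<open>M' \<subseteq> M\<close> and \<open>N' \<subseteq> N\<close>
  for which \<open>M/M'\<close> and \<open>N'\<close> lie in \<open>Fdim A\<close>. A representative is a triple \<open>(M', N', f)\<close>; the
  values of \<open>f\<close> are cosets of \<open>N'\<close>.\<close>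

type_synonym 'u frac = "'u set \<times> 'u set \<times> ('u \<Rightarrow> 'u set)"

definition fracs :: "'k ring \<Rightarrow> ('k, 'a) graded_algebra \<Rightarrow>
    ('a, 'u) graded_module \<Rightarrow> ('a, 'u) graded_module \<Rightarrow> 'u frac set" where
  "fracs K A M N = {(M', N', f).
     gr_submodule K A M' M \<and> in_Fdim K A (quotmod M M') \<and>
     gr_submodule K A N' N \<and> in_Fdim K A (submod N N') \<and>
     f \<in> gr_hom A (submod M M') (quotmod N N')}"

text \<open>Two representatives are identified if their images in \<open>Hom(M'', N/N'')\<close> agree for some
  admissible \<open>M'' \<subseteq> M\<^sub>1 \<inter> M\<^sub>2\<close> and \<open>N'' \<supseteq> N\<^sub>1 \<union> N\<^sub>2\<close>; the image of the coset \<open>X\<close> in \<open>N/N''\<close> is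
  \<open>X + N''\<close>.\<close>

definition frac_rel :: "'k ring \<Rightarrow> ('k, 'a) graded_algebra \<Rightarrow>
    ('a, 'u) graded_module \<Rightarrow> ('a, 'u) graded_module \<Rightarrow> ('u frac \<times> 'u frac) set" where
  "frac_rel K A M N = {((M1, N1, f1), (M2, N2, f2)).
     (M1, N1, f1) \<in> fracs K A M N \<and> (M2, N2, f2) \<in> fracs K A M N \<and>
     (\<exists>M' N'. gr_submodule K A M' M \<and> in_Fdim K A (quotmod M M') \<and> M' \<subseteq> M1 \<inter> M2 \<and>
        gr_submodule K A N' N \<and> in_Fdim K A (submod N N') \<and> N1 \<union> N2 \<subseteq> N' \<and>
        (\<forall>m \<in> M'. f1 m <+>\<^bsub>N\<^esub> N' = f2 m <+>\<^bsub>N\<^esub> N'))}"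

text \<open>For \<open>f : M' \<rightarrow> N/N'\<close> and \<open>g : N'' \<rightarrow> P/P''\<close> the composite is
  \<open>f\<^sup>-\<^sup>1((N' + N'')/N') \<rightarrow> (N' + N'')/N' \<cong> N''/(N' \<inter> N'') \<rightarrow> P/P'''\<close>, where
  \<open>P'''/P'' = g(N' \<inter> N'')\<close>. The coset \<open>f m\<close> of \<open>N'\<close> lies in \<open>(N' + N'')/N'\<close> iff it meets \<open>N''\<close>,
  and the corresponding coset of \<open>N' \<inter> N''\<close> is then \<open>f m \<inter> N''\<close>.\<close>

definition frac_comp :: "'u frac \<Rightarrow> 'u frac \<Rightarrow> 'u frac" where
  "frac_comp s r = (case s of (N'', P'', g) \<Rightarrow> case r of (M', N', f) \<Rightarrow>
     ({m \<in> M'. f m \<inter> N'' \<noteq> {}},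
      \<Union> (g ` (N' \<inter> N'')),
      (\<lambda>m. \<Union> (g ` (f m \<inter> N'')))))"

text \<open>An arrow carries its source and target. All modules have their elements in the type \<open>'u\<close>,
  which plays the role of the universe.\<close>

type_synonym ('a, 'u) qgr_arrow =
  "('a, 'u) graded_module \<times> ('a, 'u) graded_module \<times> 'u frac set"

definition QGr :: "'k ring \<Rightarrow> ('k, 'a) graded_algebra \<Rightarrow>
    (('a, 'u) graded_module, ('a, 'u) qgr_arrow) cat" where
  "QGr K A =
     \<lparr> Obj = {M. graded_right_module K A M},
       Hom = (\<lambda>M N. {(M, N, X) | X. X \<in> fracs K A M N // frac_rel K A M N}),
       Idn = (\<lambda>M. (M, M, frac_rel K A M M ``
         {(carrier M, {\<zero>\<^bsub>M\<^esub>}, (\<lambda>m. {\<zero>\<^bsub>M\<^esub>} +>\<^bsub>M\<^esub> m))})),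
       Cmp = (\<lambda>(_, P, Y) (M, _, X).
         (M, P, \<Union>s\<in>Y. \<Union>r\<in>X. frac_rel K A M P `` {frac_comp s r})) \<rparr>"

end

theory Submission
  imports Defs
begin

text \<open>
  The category \<open>QGr A\<close> only sees modules in large degrees, and in large degrees a monomial algebra
  looks like the path algebra of a quiver with all arrows in degree 1. Let \<open>A = kQ/I\<close>, and choose
  \<open>l \<ge> 1\<close> such that the paths that generate \<open>I\<close> have length at most \<open>l + 1\<close>. Whether a word
  avoids these paths can be read off from its subwords of length \<open>l + 1\<close>; so the long words that are
  nonzero in \<open>A\<close> are the walks in a finite quiver whose vertices are the allowed words \<open>u\<close> of length
  \<open>l\<close>. To put every arrow in degree 1, a vertex also carries a clock \<open>j < w (hd u)\<close>, and the first
  letter of \<open>u\<close> is consumed in \<open>w (hd u)\<close> unit steps. Let \<open>B\<close> be the path algebra of this quiver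
  \<open>G\<close> (locale \<open>unfolded_quiver\<close>), and let \<open>ee\<close> be the sum of its trivial paths at clock 0.

  Sending a path \<open>q\<close> of \<open>Q\<close> to the sum \<open>bb q\<close> of the walks of \<open>G\<close> that read \<open>q\<close> is multiplicative
  and kills \<open>I\<close>. Hence the corner \<open>M ee\<close> of a \<open>B\<close>-module \<open>M\<close> is an \<open>A\<close>-module \<open>Rm M\<close>. This
  functor commutes with the shift and induces an equivalence of the quotient categories:

  \<^item> It is fully faithful. A long path of \<open>G\<close> factors through some \<open>bb q\<close>, up to pieces of bounded
  length (\<open>long_path\<close>); so torsion over \<open>B\<close> can be tested in the corner (\<open>sat_from_corner\<close>).
  Conversely the product of a walk with \<open>bb q\<close> for a long \<open>q\<close> is zero or again of the form \<open>bb q'\<close>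
  (\<open>P_bb\<close>); so a saturated \<open>A\<close>-submodule of a corner is stable under \<open>ee B ee\<close> and comes from a
  \<open>B\<close>-submodule (\<open>corner_induced\<close>).

  \<^item> It is essentially surjective. An \<open>A\<close>-module \<open>L\<close> gives a representation \<open>coind\<close> of \<open>G\<close> with the
  space \<open>L\<close> at every vertex, where an arrow acts by the letter of \<open>Q\<close> that it completes, if any. The
  map \<open>m \<mapsto> (m u)\<^sub>u\<close> from \<open>L\<close> to the corner of \<open>coind\<close> has torsion kernel and cokernel
  (\<open>ess_surj\<close>).

  The quiver \<open>G\<close> has no parallel arrows. It therefore also arises, with \<open>l = 1\<close>, from the free algebra
  on its vertices modulo the products \<open>x y\<close> for which there is no arrow from \<open>x\<close> to \<open>y\<close>
  (\<open>loop_unfolding\<close>). This second algebra is connected and generated in degree 1, while \<open>B\<close> is a path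
  algebra with all arrows in degree 1; together they represent all five classes.

  The morphisms of \<open>QGr A\<close> are handled as linear relations. A fraction \<open>M' \<rightarrow> N/N'\<close> is the same thing
  as a graded submodule of \<open>M \<times> N\<close>, its graph, which is defined on almost all of \<open>M\<close> and is single
  valued up to torsion (\<open>almost\<close>). Fractions compose as relations, and two of them define the same
  morphism iff their graphs have the same saturation (\<open>frac_rel_iff\<close>). This rests on the description
  of \<open>Fdim A\<close> by elements (\<open>in_Fdim_iff\<close>): a module lies in \<open>Fdim A\<close> iff each of its elements is
  killed by all \<open>A\<^sub>j\<close> with \<open>j\<close> large.
\<close>

type_synonym ('a, 'u) qcat = "(('a, 'u) graded_module, ('a, 'u) qgr_arrow) cat"

abbreviation (input) gr_mod where "gr_mod \<equiv> graded_right_module"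

abbreviation (input) car where "car \<equiv> carrier"

section \<open>Fully faithful, essentially surjective functors\<close>

text \<open>It is easier to prove this property of a functor than to exhibit a quasi-inverse, and it is closed
  under composition and inversion.\<close>

definition ff_es :: "('o, 'm) cat => ('p, 'n) cat => ('o, 'm, 'p, 'n) funct => bool" where
 "ff_es C D F \<longleftrightarrow> is_functor C D F &
 (ALL x : Obj C. ALL y : Obj C. bij_betw (farr F) (Hom C x y) (Hom D (fobj F x) (fobj F y))) &
 (ALL d : Obj D. EX c : Obj C. isomorphic D (fobj F c) d)"

lemma bij_betw_surjD: "bij_betw f A B ==> b : B ==> EX a : A. f a = b" by (auto simp: bij_betw_def)

lemma is_functorD:
 assumes "is_functor C D F"
 shows "category C" "category D"
 "x : Obj C ==> fobj F x : Obj D"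
 "x : Obj C ==> farr F (Idn C x) = Idn D (fobj F x)"
 "[| x : Obj C; y : Obj C; f : Hom C x y |] ==> farr F f : Hom D (fobj F x) (fobj F y)"
 "[| x : Obj C; y : Obj C; z : Obj C; f : Hom C x y; g : Hom C y z |]
 ==> farr F (Cmp C g f) = Cmp D (farr F g) (farr F f)"
proof -
 have 1: "category C" and 2: "category D"
 and 3: "ALL x : Obj C. fobj F x : Obj D & farr F (Idn C x) = Idn D (fobj F x)"
 and 4: "ALL x : Obj C. ALL y : Obj C. ALL f : Hom C x y. farr F f : Hom D (fobj F x) (fobj F y)"
 and 5: "ALL x : Obj C. ALL y : Obj C. ALL z : Obj C. ALL f : Hom C x y. ALL g : Hom C y z.
 farr F (Cmp C g f) = Cmp D (farr F g) (farr F f)"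
 using assms unfolding is_functor_def by - (elim conjE, assumption)+
 show "category C" "category D" by (rule 1, rule 2)
 show "x : Obj C ==> fobj F x : Obj D"
 "x : Obj C ==> farr F (Idn C x) = Idn D (fobj F x)"
 using 3 by simp_all
 show "[| x : Obj C; y : Obj C; f : Hom C x y |] ==> farr F f : Hom D (fobj F x) (fobj F y)"
 using 4 by simp
 show "[| x : Obj C; y : Obj C; z : Obj C; f : Hom C x y; g : Hom C y z |]
 ==> farr F (Cmp C g f) = Cmp D (farr F g) (farr F f)"
 using 5 by simp
qed

lemma isomorphicE:
 assumes "isomorphic C x y"
 obtains f g where "f : Hom C x y" "g : Hom C y x" "Cmp C g f = Idn C x" "Cmp C f g = Idn C y"
 using assms unfolding isomorphic_def is_iso_def by blast

lemma isomorphicI: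
 assumes "f : Hom C x y" "g : Hom C y x" "Cmp C g f = Idn C x" "Cmp C f g = Idn C y"
 shows "isomorphic C x y"
 using assms unfolding isomorphic_def is_iso_def by blast

lemma isomorphic_sym: "isomorphic C x y ==> isomorphic C y x"
 unfolding isomorphic_def is_iso_def by blast

lemma (in category) isomorphic_trans:
 assumes "isomorphic C x y" "isomorphic C y z" and o: "x : Obj C" "y : Obj C" "z : Obj C"
 shows "isomorphic C x z"
proof -
 obtain f f' where f: "f : Hom C x y" "f' : Hom C y x"
 "Cmp C f' f = Idn C x" "Cmp C f f' = Idn C y" using assms(1) by (rule isomorphicE)
 obtain g g' where g: "g : Hom C y z" "g' : Hom C z y"
 "Cmp C g' g = Idn C y" "Cmp C g g' = Idn C z" using assms(2) by (rule isomorphicE)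
 show ?thesis
 proof (rule isomorphicI)
 show gf: "Cmp C g f : Hom C x z" using f g o comp_hom by blast
 show fg: "Cmp C f' g' : Hom C z x" using f g o comp_hom by blast
 have "Cmp C (Cmp C f' g') (Cmp C g f) = Cmp C f' (Cmp C g' (Cmp C g f))"
 using comp_assoc[OF o(1,3,2,1) gf g(2) f(2)] by simp
 also have "Cmp C g' (Cmp C g f) = f"
 using comp_assoc[OF o(1,2,3,2) f(1) g(1) g(2)] g(3) id_left[OF o(1,2) f(1)] by simp
 finally show "Cmp C (Cmp C f' g') (Cmp C g f) = Idn C x" using f(3) by simp
 have "Cmp C (Cmp C g f) (Cmp C f' g') = Cmp C g (Cmp C f (Cmp C f' g'))"
 using comp_assoc[OF o(3,1,2,3) fg f(1) g(1)] by simp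
 also have "Cmp C f (Cmp C f' g') = g'"
 using comp_assoc[OF o(3,2,1,2) g(2) f(2) f(1)] f(4) id_left[OF o(3,2) g(2)] by simp
 finally show "Cmp C (Cmp C g f) (Cmp C f' g') = Idn C z" using g(4) by simp
 qed
qed

lemma functor_isomorphic:
 assumes F: "is_functor C D F" and "isomorphic C x y" and o: "x : Obj C" "y : Obj C"
 shows "isomorphic D (fobj F x) (fobj F y)"
proof -
 obtain f g where f: "f : Hom C x y" "g : Hom C y x" "Cmp C g f = Idn C x" "Cmp C f g = Idn C y"
 using assms(2) by (rule isomorphicE)
 note F' = is_functorD[OF F]
 show ?thesis
 proof (rule isomorphicI)
 show "farr F f : Hom D (fobj F x) (fobj F y)" "farr F g : Hom D (fobj F y) (fobj F x)"
 using F'(5) f o by blast+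
 show "Cmp D (farr F g) (farr F f) = Idn D (fobj F x)"
 using F'(6)[of x y x f g] F'(4)[of x] f o by simp
 show "Cmp D (farr F f) (farr F g) = Idn D (fobj F y)"
 using F'(6)[of y x y g f] F'(4)[of y] f o by simp
 qed
qed

text \<open>The two inverse arrows lift along the bijections on arrows, and injectivity shows that the
  lifts are inverse to each other.\<close>

lemma ff_es_reflects:
 assumes F: "ff_es C D F" and "isomorphic D (fobj F x) (fobj F y)"
 and o: "x : Obj C" "y : Obj C"
 shows "isomorphic C x y"
proof -
 have Fu: "is_functor C D F" using F unfolding ff_es_def by blast
 note F' = is_functorD[OF Fu]
 interpret C: category C by (rule F')
 have bij: "!!x y. x : Obj C ==> y : Obj C ==>
 bij_betw (farr F) (Hom C x y) (Hom D (fobj F x) (fobj F y))"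
 using F unfolding ff_es_def by blast
 obtain p q where pq: "p : Hom D (fobj F x) (fobj F y)" "q : Hom D (fobj F y) (fobj F x)"
 "Cmp D q p = Idn D (fobj F x)" "Cmp D p q = Idn D (fobj F y)"
 using assms(2) by (rule isomorphicE)
 obtain f where f: "f : Hom C x y" "farr F f = p"
 using bij_betw_surjD[OF bij[OF o] pq(1)] by (elim bexE)
 obtain g where g: "g : Hom C y x" "farr F g = q"
 using bij_betw_surjD[OF bij[OF o(2,1)] pq(2)] by (elim bexE)
 have inj: "!!x. x : Obj C ==> inj_on (farr F) (Hom C x x)"
 using bij by (simp add: bij_betw_def)
 show ?thesis
 proof (rule isomorphicI[OF f(1) g(1)])
 show "Cmp C g f = Idn C x"
 proof (rule inj_onD[OF inj[OF o(1)]])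
 show "farr F (Cmp C g f) = farr F (Idn C x)"
 using F'(6)[OF o(1,2,1) f(1) g(1)] F'(4)[OF o(1)] pq f g by simp
 qed (use C.comp_hom[OF o(1,2,1) f(1) g(1)] C.id_hom o in auto)
 show "Cmp C f g = Idn C y"
 proof (rule inj_onD[OF inj[OF o(2)]])
 show "farr F (Cmp C f g) = farr F (Idn C y)"
 using F'(6)[OF o(2,1,2) g(1) f(1)] F'(4)[OF o(2)] pq f g by simp
 qed (use C.comp_hom[OF o(2,1,2) g(1) f(1)] C.id_hom o in auto)
 qed
qed

lemma ff_es_comp:
 assumes F: "ff_es C D F" and G: "ff_es D E G"
 shows "ff_es C E (comp_funct G F)"
proof -
 have Fu: "is_functor C D F" and Gu: "is_functor D E G" using F G unfolding ff_es_def by blast+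
 note F' = is_functorD[OF Fu] and G' = is_functorD[OF Gu]
 interpret E: category E by (rule G')
 have "is_functor C E (comp_funct G F)"
 unfolding is_functor_def comp_funct_def funct.simps o_apply
 proof (intro conjI ballI)
 fix x y z f g assume "x : Obj C" "y : Obj C" "z : Obj C" "f : Hom C x y" "g : Hom C y z"
 then show "farr G (farr F (Cmp C g f)) = Cmp E (farr G (farr F g)) (farr G (farr F f))"
 using F'(6) G'(6)[OF F'(3) F'(3) F'(3) F'(5) F'(5)] by metis
 qed (simp_all add: F'(1,3-5) G'(2-5))
 moreover have "bij_betw (farr (comp_funct G F)) (Hom C x y)
 (Hom E (fobj (comp_funct G F) x) (fobj (comp_funct G F) y))"
 if "x : Obj C" "y : Obj C" for x y
 unfolding comp_funct_def funct.simps by (rule bij_betw_trans[of _ _ "Hom D (fobj F x) (fobj F y)"])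
 (use F G that F'(3) in \<open>simp_all add: ff_es_def\<close>)
 moreover have "EX c : Obj C. isomorphic E (fobj (comp_funct G F) c) e" if e: "e : Obj E" for e
 proof -
 obtain d where d: "d : Obj D" "isomorphic E (fobj G d) e"
 using G e unfolding ff_es_def by blast
 obtain c where c: "c : Obj C" "isomorphic D (fobj F c) d"
 using F d unfolding ff_es_def by blast
 have "isomorphic E (fobj G (fobj F c)) e"
 using E.isomorphic_trans[OF functor_isomorphic[OF Gu c(2)] d(2)] F' G' c d e by blast
 then show ?thesis using c by (auto simp: comp_funct_def)
 qed
 ultimately show ?thesis unfolding ff_es_def by blast
qed

text \<open>The usual construction of a quasi-inverse: choose for every object \<open>d\<close> an object \<open>g d\<close> and
  an isomorphism \<open>\<epsilon> d : F (g d) \<rightarrow> d\<close> with inverse \<open>\<delta> d\<close>, and let \<open>G f\<close> be the only arrow with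
  \<open>F (G f) = \<delta> f \<epsilon>\<close>. Because hom-sets are disjoint, \<open>f\<close> determines its source and target.\<close>

lemma ff_es_inverse:
 assumes F: "ff_es C D F"
 shows "EX G. ff_es D C G & is_equivalence C D F & (ALL d : Obj D. isomorphic D (fobj F (fobj G d)) d)"
proof -
 have Fu: "is_functor C D F" using F unfolding ff_es_def by blast
 note F' = is_functorD[OF Fu]
 interpret C: category C by (rule F')
 interpret D: category D by (rule F')
 have bij: "!!x y. x : Obj C ==> y : Obj C ==>
 bij_betw (farr F) (Hom C x y) (Hom D (fobj F x) (fobj F y))"
 using F unfolding ff_es_def by blast
 have inj: "!!x y f f'. [| x : Obj C; y : Obj C; f : Hom C x y; f' : Hom C x y; farr F f = farr F f' |]
 ==> f = f'"
 using bij by (metis bij_betw_imp_inj_on inj_onD)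
 have surj: "!!x y p. [| x : Obj C; y : Obj C; p : Hom D (fobj F x) (fobj F y) |]
 ==> EX f : Hom C x y. farr F f = p" by (rule bij_betw_surjD[OF bij])
 have "EX t. fst t : Obj C & fst (snd t) : Hom D (fobj F (fst t)) d &
 snd (snd t) : Hom D d (fobj F (fst t)) &
 Cmp D (snd (snd t)) (fst (snd t)) = Idn D (fobj F (fst t)) &
 Cmp D (fst (snd t)) (snd (snd t)) = Idn D d" if d: "d : Obj D" for d
 proof -
 obtain c where c: "c : Obj C" "isomorphic D (fobj F c) d" using F d unfolding ff_es_def by blast
 obtain e e' where "e : Hom D (fobj F c) d" "e' : Hom D d (fobj F c)"
 "Cmp D e' e = Idn D (fobj F c)" "Cmp D e e' = Idn D d" using c(2) by (rule isomorphicE)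
 then show ?thesis using c(1) by (intro exI[of _ "(c, e, e')"]) simp
 qed
 then obtain t where t: "!!d. d : Obj D ==> fst (t d) : Obj C &
 fst (snd (t d)) : Hom D (fobj F (fst (t d))) d &
 snd (snd (t d)) : Hom D d (fobj F (fst (t d))) &
 Cmp D (snd (snd (t d))) (fst (snd (t d))) = Idn D (fobj F (fst (t d))) &
 Cmp D (fst (snd (t d))) (snd (snd (t d))) = Idn D d" by metis
 define g where "g d = fst (t d)" for d
 define ep where "ep d = fst (snd (t d))" for d
 define de where "de d = snd (snd (t d))" for d
 have g: "!!d. d : Obj D ==> g d : Obj C"
 and ep: "!!d. d : Obj D ==> ep d : Hom D (fobj F (g d)) d"
 and de: "!!d. d : Obj D ==> de d : Hom D d (fobj F (g d))"
 and deep: "!!d. d : Obj D ==> Cmp D (de d) (ep d) = Idn D (fobj F (g d))"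
 and epde: "!!d. d : Obj D ==> Cmp D (ep d) (de d) = Idn D d"
 using t unfolding g_def ep_def de_def by blast+
 have Fg: "!!d. d : Obj D ==> fobj F (g d) : Obj D" using F'(3) g by blast
 define P where "P f h \<longleftrightarrow> (EX x:Obj D. EX y:Obj D. f : Hom D x y & h : Hom C (g x) (g y) &
 farr F h = Cmp D (de y) (Cmp D f (ep x)))" for f h
 define ga where "ga f = (SOME h. P f h)" for f
 have dfe: "Cmp D (de y) (Cmp D f (ep x)) : Hom D (fobj F (g x)) (fobj F (g y))"
 if "x : Obj D" "y : Obj D" "f : Hom D x y" for x y f
 using that D.comp_hom[OF Fg[OF that(1)] that(2) Fg[OF that(2)] D.comp_hom[OF Fg[OF that(1)] that(1,2)]]
 ep de by blast
 have ga: "ga f : Hom C (g x) (g y) & farr F (ga f) = Cmp D (de y) (Cmp D f (ep x))"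
 if xy: "x : Obj D" "y : Obj D" "f : Hom D x y" for x y f
 proof -
 have "EX h. P f h"
 unfolding P_def using surj[OF g[OF xy(1)] g[OF xy(2)] dfe[OF xy]] xy by blast
 then have "P f (ga f)" unfolding ga_def by (rule someI_ex)
 then show ?thesis unfolding P_def using D.hom_disjoint xy by metis
 qed
 \<comment> \<open>the form of the defining equation that is used for naturality\<close>
 have natep: "Cmp D (ep y) (farr F (ga f)) = Cmp D f (ep x)"
 if xy: "x : Obj D" "y : Obj D" "f : Hom D x y" for x y f
 proof -
 have c: "Cmp D f (ep x) : Hom D (fobj F (g x)) y" using D.comp_hom ep Fg xy by blast
 have "Cmp D (ep y) (farr F (ga f)) = Cmp D (Cmp D (ep y) (de y)) (Cmp D f (ep x))"
 using ga[OF xy] D.comp_assoc[OF Fg[OF xy(1)] xy(2) Fg[OF xy(2)] xy(2) c de[OF xy(2)] ep[OF xy(2)]] by simp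
 then show ?thesis using epde[OF xy(2)] D.id_left[OF Fg[OF xy(1)] xy(2) c] by simp
 qed
 \<comment> \<open>cancelling the isomorphism \<open>ep\<close>\<close>
 have can: "u = v" if "x : Obj C" "y : Obj D" "u : Hom C x (g y)" "v : Hom C x (g y)"
 "Cmp D (ep y) (farr F u) = Cmp D (ep y) (farr F v)" for x y u v
 proof -
 have Fx: "fobj F x : Obj D" using F'(3) that by blast
 have *: "farr F u = Cmp D (de y) (Cmp D (ep y) (farr F u))" if "u : Hom C x (g y)" for u
 proof -
 have Fu: "farr F u : Hom D (fobj F x) (fobj F (g y))"
 using F'(5)[OF \<open>x : Obj C\<close> g[OF \<open>y : Obj D\<close>] that] .
 show ?thesis
 using D.comp_assoc[OF Fx Fg[OF \<open>y : Obj D\<close>] \<open>y : Obj D\<close> Fg[OF \<open>y : Obj D\<close>] Fu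
 ep[OF \<open>y : Obj D\<close>] de[OF \<open>y : Obj D\<close>]] deep[OF \<open>y : Obj D\<close>]
 D.id_left[OF Fx Fg[OF \<open>y : Obj D\<close>] Fu] by simp
 qed
 show ?thesis using inj[OF that(1) g[OF that(2)] that(3,4)] *[OF that(3)] *[OF that(4)] that(5) by simp
 qed
 define G where "G = \<lparr> fobj = g, farr = ga \<rparr>"
 have Gu: "is_functor D C G"
 unfolding is_functor_def G_def funct.simps
 proof (intro conjI ballI)
 show "category D" "category C" by unfold_locales
 show "!!x. x : Obj D ==> g x : Obj C" by (rule g)
 show "ga (Idn D x) = Idn C (g x)" if x: "x : Obj D" for x
 proof (rule can[OF g[OF x] x])
 show "Cmp D (ep x) (farr F (ga (Idn D x))) = Cmp D (ep x) (farr F (Idn C (g x)))"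
 using natep[OF x x D.id_hom[OF x]] F'(4)[OF g[OF x]] D.id_left[OF Fg[OF x] x ep[OF x]]
 D.id_right[OF Fg[OF x] x ep[OF x]] by simp
 qed (use ga[OF x x D.id_hom[OF x]] C.id_hom[OF g[OF x]] in auto)
 show "!!x y f. x : Obj D ==> y : Obj D ==> f : Hom D x y ==> ga f : Hom C (g x) (g y)"
 using ga by blast
 show "ga (Cmp D h f) = Cmp C (ga h) (ga f)"
 if o: "x : Obj D" "y : Obj D" "z : Obj D" and fh: "f : Hom D x y" "h : Hom D y z" for x y z f h
 proof (rule can[OF g[OF o(1)] o(3)])
 have hf: "Cmp D h f : Hom D x z" using D.comp_hom[OF o fh] .
 show "ga (Cmp D h f) : Hom C (g x) (g z)" using ga[OF o(1,3) hf] by blast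
 have gf: "ga f : Hom C (g x) (g y)" "ga h : Hom C (g y) (g z)" using ga o fh by blast+
 then show "Cmp C (ga h) (ga f) : Hom C (g x) (g z)" using C.comp_hom g o by blast
 have Fgf: "farr F (ga f) : Hom D (fobj F (g x)) (fobj F (g y))"
 "farr F (ga h) : Hom D (fobj F (g y)) (fobj F (g z))"
 using F'(5) g o gf by blast+
 have "Cmp D (ep z) (farr F (Cmp C (ga h) (ga f)))
 = Cmp D (Cmp D (ep z) (farr F (ga h))) (farr F (ga f))"
 using F'(6)[OF g[OF o(1)] g[OF o(2)] g[OF o(3)] gf]
 D.comp_assoc[OF Fg[OF o(1)] Fg[OF o(2)] Fg[OF o(3)] o(3) Fgf ep[OF o(3)]] by simp
 also have "... = Cmp D h (Cmp D (ep y) (farr F (ga f)))"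
 using natep[OF o(2,3) fh(2)] D.comp_assoc[OF Fg[OF o(1)] Fg[OF o(2)] o(2,3) Fgf(1) ep[OF o(2)] fh(2)] by simp
 also have "... = Cmp D (Cmp D h f) (ep x)"
 using natep[OF o(1,2) fh(1)] D.comp_assoc[OF Fg[OF o(1)] o ep[OF o(1)] fh] by simp
 finally show "Cmp D (ep z) (farr F (ga (Cmp D h f))) = Cmp D (ep z) (farr F (Cmp C (ga h) (ga f)))"
 using natep[OF o(1,3) hf] by simp
 qed
 qed
 have FG: "isomorphic D (fobj F (fobj G d)) d" if d: "d : Obj D" for d
 using isomorphicI[OF ep[OF d] de[OF d] deep[OF d] epde[OF d]] by (simp add: G_def)
 have Gbij: "bij_betw ga (Hom D x y) (Hom C (g x) (g y))" if o: "x : Obj D" "y : Obj D" for x y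
 proof (intro bij_betwI')
 have unG: "Cmp D (Cmp D (ep y) (farr F (ga f))) (de x) = f" if f: "f : Hom D x y" for f
 using natep[OF o f] D.comp_assoc[OF o(1) Fg[OF o(1)] o de[OF o(1)] ep[OF o(1)] f]
 epde[OF o(1)] D.id_right[OF o f] by simp
 fix f f' assume "f : Hom D x y" "f' : Hom D x y"
 then show "(ga f = ga f') = (f = f')" using unG by metis
 next
 show "!!f. f : Hom D x y ==> ga f : Hom C (g x) (g y)" using ga o by blast
 next
 fix h assume h: "h : Hom C (g x) (g y)"
 have Fh: "farr F h : Hom D (fobj F (g x)) (fobj F (g y))" using F'(5) g o h by blast
 define f where "f = Cmp D (Cmp D (ep y) (farr F h)) (de x)"
 have c: "Cmp D (ep y) (farr F h) : Hom D (fobj F (g x)) y"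
 using D.comp_hom[OF Fg[OF o(1)] Fg[OF o(2)] o(2) Fh ep[OF o(2)]] .
 have f: "f : Hom D x y" unfolding f_def using D.comp_hom[OF o(1) Fg[OF o(1)] o(2) de[OF o(1)] c] .
 have "Cmp D f (ep x) = Cmp D (ep y) (farr F h)"
 unfolding f_def using D.comp_assoc[OF Fg[OF o(1)] o(1) Fg[OF o(1)] o(2) ep[OF o(1)] de[OF o(1)] c]
 deep[OF o(1)] D.id_right[OF Fg[OF o(1)] o(2) c] by simp
 then have "ga f = h"
 using can[OF g[OF o(1)] o(2)] ga[OF o f] h natep[OF o f] by simp
 then show "EX f : Hom D x y. h = ga f" using f by blast
 qed
 have Ges: "isomorphic C (fobj G (fobj F c)) c" if c: "c : Obj C" for c
 using ff_es_reflects[OF F FG] F'(3)[OF c] g c by (simp add: G_def)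
 have 1: "ff_es D C G"
 unfolding ff_es_def
 proof (intro conjI ballI)
 show "EX d:Obj D. isomorphic C (fobj G d) c" if "c : Obj C" for c
 using Ges[OF that] F'(3)[OF that] by blast
 qed (use Gu Gbij in \<open>simp_all add: G_def\<close>)
 \<comment> \<open>the unit is the lift of the inverses of the chosen isomorphisms\<close>
 have "EX \<eta>. ALL c:Obj C. \<eta> c : Hom C c (g (fobj F c)) & farr F (\<eta> c) = de (fobj F c)"
 proof -
 have "ALL c:Obj C. EX h. h : Hom C c (g (fobj F c)) & farr F h = de (fobj F c)"
 using surj[OF _ g[OF F'(3)] de[OF F'(3)]] by blast
 then show ?thesis by (rule bchoice)
 qed
 then obtain \<eta> where \<eta>: "!!c. c : Obj C ==> \<eta> c : Hom C c (g (fobj F c))"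
 "!!c. c : Obj C ==> farr F (\<eta> c) = de (fobj F c)" by blast
 have \<eta>iso: "is_iso C c (g (fobj F c)) (\<eta> c)" if c: "c : Obj C" for c
 proof -
 note Fc = F'(3)[OF c] and gc = g[OF F'(3)[OF c]]
 obtain \<theta> where \<theta>: "\<theta> : Hom C (g (fobj F c)) c" "farr F \<theta> = ep (fobj F c)"
 using surj[OF gc c ep[OF Fc]] by blast
 have "Cmp C \<theta> (\<eta> c) = Idn C c"
 using inj[OF c c C.comp_hom[OF c gc c \<eta>(1)[OF c] \<theta>(1)] C.id_hom[OF c]]
 F'(6)[OF c gc c \<eta>(1)[OF c] \<theta>(1)] F'(4)[OF c] \<eta>(2)[OF c] \<theta>(2) epde[OF Fc] by simp
 moreover have "Cmp C (\<eta> c) \<theta> = Idn C (g (fobj F c))"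
 using inj[OF gc gc C.comp_hom[OF gc c gc \<theta>(1) \<eta>(1)[OF c]] C.id_hom[OF gc]]
 F'(6)[OF gc c gc \<theta>(1) \<eta>(1)[OF c]] F'(4)[OF gc] \<eta>(2)[OF c] \<theta>(2) deep[OF Fc] by simp
 ultimately show ?thesis unfolding is_iso_def using \<eta>(1)[OF c] \<theta>(1) by blast
 qed
 have \<eta>nat: "Cmp C (\<eta> y) f = Cmp C (ga (farr F f)) (\<eta> x)"
 if o: "x : Obj C" "y : Obj C" and f: "f : Hom C x y" for x y f
 proof (rule can[OF o(1) F'(3)[OF o(2)]])
 note Fx = F'(3)[OF o(1)] and Fy = F'(3)[OF o(2)]
 have Ff: "farr F f : Hom D (fobj F x) (fobj F y)" using F'(5)[OF o f] .
 note gf = ga[OF Fx Fy Ff]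
 have Fgf: "farr F (ga (farr F f)) : Hom D (fobj F (g (fobj F x))) (fobj F (g (fobj F y)))"
 using F'(5) gf g Fx Fy by blast
 show "Cmp C (\<eta> y) f : Hom C x (g (fobj F y))"
 using C.comp_hom[OF o g[OF Fy] f \<eta>(1)[OF o(2)]] .
 show "Cmp C (ga (farr F f)) (\<eta> x) : Hom C x (g (fobj F y))"
 using C.comp_hom[OF o(1) g[OF Fx] g[OF Fy] \<eta>(1)[OF o(1)]] gf by blast
 have l: "Cmp D (ep (fobj F y)) (farr F (Cmp C (\<eta> y) f)) = farr F f"
 using F'(6)[OF o g[OF Fy] f \<eta>(1)[OF o(2)]] \<eta>(2)[OF o(2)]
 D.comp_assoc[OF Fx Fy Fg[OF Fy] Fy Ff de[OF Fy] ep[OF Fy]] epde[OF Fy] D.id_left[OF Fx Fy Ff] by simp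
 have "Cmp D (ep (fobj F y)) (farr F (Cmp C (ga (farr F f)) (\<eta> x)))
 = Cmp D (Cmp D (ep (fobj F y)) (farr F (ga (farr F f)))) (de (fobj F x))"
 using F'(6)[OF o(1) g[OF Fx] g[OF Fy] \<eta>(1)[OF o(1)]] gf \<eta>(2)[OF o(1)]
 D.comp_assoc[OF Fx Fg[OF Fx] Fg[OF Fy] Fy de[OF Fx] Fgf ep[OF Fy]] by simp
 also have "... = farr F f"
 using natep[OF Fx Fy Ff] D.comp_assoc[OF Fx Fg[OF Fx] Fx Fy de[OF Fx] ep[OF Fx] Ff]
 epde[OF Fx] D.id_right[OF Fx Fy Ff] by simp
 finally show "Cmp D (ep (fobj F y)) (farr F (Cmp C (\<eta> y) f))
 = Cmp D (ep (fobj F y)) (farr F (Cmp C (ga (farr F f)) (\<eta> x)))" using l by simp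
 qed
 have episo: "is_iso D (fobj F (g d)) d (ep d)" if d: "d : Obj D" for d
 unfolding is_iso_def using ep[OF d] de[OF d] deep[OF d] epde[OF d] by blast
 have "nat_isomorphic C C id_funct (comp_funct G F)"
 unfolding nat_isomorphic_def id_funct_def comp_funct_def G_def
 using \<eta>iso \<eta>nat by (intro exI[of _ \<eta>]) simp
 moreover have "nat_isomorphic D D (comp_funct F G) id_funct"
 unfolding nat_isomorphic_def id_funct_def comp_funct_def G_def
 using episo natep by (intro exI[of _ ep]) simp
 ultimately have eq: "is_equivalence C D F" unfolding is_equivalence_def using Fu Gu by blast
 show ?thesis using 1 FG eq by blast
qed

section \<open>Direct sum decompositions and graded submodules\<close>

text \<open>Under \<open>direct_sum_decomp\<close> the description is unique, so this is the family of homogeneous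
  components.\<close>

definition component :: "('m, 'x) ring_scheme => ('i => 'm set) => 'm => 'i => 'm" where
 "component M D m = (THE d. (ALL i. d i : D i) & finite {i. d i ~= \<zero>\<^bsub>M\<^esub>} &
 m = (\<Oplus>\<^bsub>M\<^esub>i\<in>{i. d i ~= \<zero>\<^bsub>M\<^esub>}. d i))"

lemma (in abelian_group) add_subgroupI:
 assumes "D \<subseteq> car G" "\<zero> : D" "!!x y. x : D ==> y : D ==> x \<oplus> y : D" "!!x. x : D ==> \<ominus> x : D"
 shows "subgroup D (add_monoid G)"
 by (rule subgroup.intro) (use assms in \<open>auto simp: a_inv_def[symmetric]\<close>)

lemma (in abelian_monoid) finsum_closed_under:
 assumes "finite I" "!!i. i : I ==> f i : car G & P (f i)" "P \<zero>"
 "!!x y. [| x : car G; y : car G; P x; P y |] ==> P (x \<oplus> y)"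
 shows "P (finsum G f I)"
 using assms(1,2)
proof (induction I rule: finite_induct)
 case empty then show ?case by (simp add: assms(3))
next
 case (insert i I)
 then have "f : I \<rightarrow> car G" "f i : car G" by auto
 then show ?case using insert assms(4) by (simp add: finsum_closed)
qed

lemma (in abelian_group) minus_add_cancel: "[| x : car G; y : car G |] ==> x \<ominus> y \<oplus> y = x"
 by (simp add: a_minus_def a_assoc l_neg)

lemma (in abelian_group) neg_zero: "\<ominus> \<zero> = \<zero>" by (rule minus_equality) simp_all

lemma (in abelian_group) minus_zero_right: "x : car G ==> x \<ominus> \<zero> = x"
 by (simp add: a_minus_def neg_zero)

text \<open>The components of an element are additive and idempotent in the sense of the assumptions
  below, and conversely such maps determine a direct sum decomposition. Checking these conditions
  avoids all sums.\<close>

lemma direct_sum_decompI: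
 fixes M (structure)
 assumes "abelian_group M"
 and sub: "!!i. subgroup (D i) (add_monoid M)"
 and mem: "!!m i. m : car M ==> c m i : D i"
 and fin: "!!m. m : car M ==> finite {i. c m i ~= \<zero>}"
 and add: "!!m n i. m : car M ==> n : car M ==> c (m \<oplus> n) i = c m i \<oplus> c n i"
 and same: "!!m i. m : D i ==> c m i = m"
 and other: "!!m i j. m : D i ==> i ~= j ==> c m j = \<zero>"
 and zero: "!!m. m : car M ==> (!!i. c m i = \<zero>) ==> m = \<zero>"
 shows "direct_sum_decomp M D & (ALL m:car M. component M D m = c m)"
proof -
 interpret abelian_group M by fact
 have D: "D i \<subseteq> car M" "\<zero> : D i" for i
 using subgroup.subset[OF sub] subgroup.one_closed[OF sub] by auto
 have c0: "c \<zero> i = \<zero>" for i using same[OF D(2)] .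
 have csum: "c (\<Oplus>j\<in>J. d j) i = (if i : J then d i else \<zero>)" if "finite J" "!!j. d j : D j" for J d i
 using that(1)
 proof (induction J rule: finite_induct)
 case empty then show ?case by (simp add: c0)
 next
 case (insert j J)
 have dc: "!!j. d j : car M" using that(2) D by blast
 have "c (\<Oplus>j\<in>insert j J. d j) i = c (d j) i \<oplus> c (\<Oplus>j\<in>J. d j) i"
 using insert dc by (simp add: add finsum_closed)
 then show ?case using insert same[OF that(2)] other[OF that(2)] dc by (cases "i = j") auto
 qed
 have ex: "m = (\<Oplus>i\<in>{i. c m i ~= \<zero>}. c m i)" if m: "m : car M" for m
 proof -
 let ?s = "\<Oplus>i\<in>{i. c m i ~= \<zero>}. c m i"
 have cc: "c m i : car M" for i using mem[OF m] D by blast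
 have s: "?s : car M" using cc by (simp add: finsum_closed)
 have "c (m \<ominus> ?s) i = \<zero>" for i
 proof -
 have "c ?s i = c m i" using csum[OF fin[OF m] mem[OF m]] by auto
 moreover have "c (m \<ominus> ?s \<oplus> ?s) i = c (m \<ominus> ?s) i \<oplus> c ?s i"
 using add[of "m \<ominus> ?s" ?s] m s by blast
 moreover have "m \<ominus> ?s \<oplus> ?s = m" using m s by (rule minus_add_cancel)
 ultimately have "c (m \<ominus> ?s) i \<oplus> c m i = c m i" by simp
 moreover have "c (m \<ominus> ?s) i : car M" using mem[of "m \<ominus> ?s" i] m s D by auto
 ultimately show ?thesis using cc[of i] by simp
 qed
 then have "m \<ominus> ?s = \<zero>" using zero m s by simp
 then show "m = ?s" using m s minus_add_cancel[of m ?s] by simp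
 qed
 have uni: "d = c m" if "!!i. d i : D i" "finite {i. d i ~= \<zero>}" "m = (\<Oplus>i\<in>{i. d i ~= \<zero>}. d i)" for d m
 using csum[OF that(2,1)] that(3) by auto
 have ex1: "(ALL i. d i : D i) & finite {i. d i ~= \<zero>} & m = (\<Oplus>i\<in>{i. d i ~= \<zero>}. d i) \<longleftrightarrow> d = c m"
 if m: "m : car M" for d m
 using uni[of d m] mem[OF m] fin[OF m] ex[OF m] by blast
 have "direct_sum_decomp M D"
 unfolding direct_sum_decomp_def using sub ex1 by auto
 moreover have "component M D m = c m" if "m : car M" for m
 unfolding component_def using ex1[OF that] by simp
 ultimately show ?thesis by blast
qed

locale graded_group = abelian_group M for M (structure) +
 fixes D :: "'i => 'a set"
 assumes decomp: "direct_sum_decomp M D"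
begin

lemma D_subgroup: "subgroup (D i) (add_monoid M)"
 using decomp unfolding direct_sum_decomp_def by blast

lemma D_carrier: "x : D i ==> x : car M"
 using subgroup.subset[OF D_subgroup] by auto

lemma D_zero: "\<zero> : D i" using subgroup.one_closed[OF D_subgroup] by simp

lemma D_add: "x : D i ==> y : D i ==> x \<oplus> y : D i"
 using subgroup.m_closed[OF D_subgroup] by simp

lemma D_neg: "x : D i ==> \<ominus> x : D i"
 using subgroup.m_inv_closed[OF D_subgroup] by (simp add: a_inv_def)

abbreviation "cp \<equiv> component M D"

lemma component_props:
 assumes "m : car M"
 shows "cp m i : D i" "finite {i. cp m i ~= \<zero>}" "m = (\<Oplus>i\<in>{i. cp m i ~= \<zero>}. cp m i)"
proof -
 have "\<exists>!d. (ALL i. d i : D i) & finite {i. d i ~= \<zero>} & m = (\<Oplus>i\<in>{i. d i ~= \<zero>}. d i)"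
 using decomp assms unfolding direct_sum_decomp_def by blast
 from theI'[OF this] show "cp m i : D i" "finite {i. cp m i ~= \<zero>}"
 "m = (\<Oplus>i\<in>{i. cp m i ~= \<zero>}. cp m i)" unfolding component_def by blast+
qed

lemma component_carrier: "m : car M ==> cp m i : car M"
 using component_props(1) D_carrier by blast

lemma component_eqI:
 assumes "finite I" "!!i. d i : D i" "!!i. i \<notin> I ==> d i = \<zero>" "m = (\<Oplus>i\<in>I. d i)"
 shows "cp m = d"
proof -
 have dc: "d i : car M" for i using assms(2) D_carrier by blast
 have m: "m : car M" using assms(4) dc by (simp add: finsum_closed)
 have f: "{i. d i ~= \<zero>} \<subseteq> I" using assms(3) by blast
 have "m = (\<Oplus>i\<in>{i. d i ~= \<zero>}. d i)"
 unfolding assms(4) by (rule add.finprod_mono_neutral_cong_right[OF assms(1) f]) (use dc in auto)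
 moreover have "\<exists>!d. (ALL i. d i : D i) & finite {i. d i ~= \<zero>} & m = (\<Oplus>i\<in>{i. d i ~= \<zero>}. d i)"
 using decomp m unfolding direct_sum_decomp_def by blast
 ultimately show ?thesis
 unfolding component_def using assms(2) finite_subset[OF f assms(1)] by (intro the1_equality) auto
qed

lemma component_homogeneous: "m : D i ==> cp m j = (if j = i then m else \<zero>)"
 using component_eqI[of "{i}" "%j. if j = i then m else \<zero>" m] D_zero D_carrier[of m i] by simp

lemma component_zero [simp]: "cp \<zero> j = \<zero>"
 using component_homogeneous[OF D_zero] by simp

lemma component_add:
 assumes "m : car M" "n : car M"
 shows "cp (m \<oplus> n) i = cp m i \<oplus> cp n i"
proof -
 let ?I = "{i. cp m i ~= \<zero>} \<union> {i. cp n i ~= \<zero>}"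
 have f: "finite ?I" using component_props(2) assms by blast
 have "x = (\<Oplus>i\<in>?I. cp x i)" if "x : car M" "{i. cp x i ~= \<zero>} \<subseteq> ?I" for x
 proof -
 have "(\<Oplus>i\<in>{i. cp x i ~= \<zero>}. cp x i) = (\<Oplus>i\<in>?I. cp x i)"
 by (rule add.finprod_mono_neutral_cong_left[OF f that(2)]) (use component_carrier[OF that(1)] in auto)
 then show ?thesis using component_props(3)[OF that(1)] by simp
 qed
 then have "m \<oplus> n = (\<Oplus>i\<in>?I. cp m i) \<oplus> (\<Oplus>i\<in>?I. cp n i)" using assms by auto
 also have "... = (\<Oplus>i\<in>?I. cp m i \<oplus> cp n i)"
 using component_carrier[OF assms(1)] component_carrier[OF assms(2)] by (subst finsum_addf) auto
 finally have "cp (m \<oplus> n) = (%i. cp m i \<oplus> cp n i)"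
 by (intro component_eqI[OF f]) (use component_props(1) assms D_add in auto)
 then show ?thesis by simp
qed

lemma component_neg: "m : car M ==> cp (\<ominus> m) i = \<ominus> cp m i"
 using component_add[of m "\<ominus> m" i] component_carrier[of m i] component_carrier[of "\<ominus> m" i]
 by (simp add: r_neg) (metis minus_equality a_comm)

lemma homogeneous_induct [consumes 1, case_names zero hom add]:
 assumes "m : car M" "P \<zero>" "!!i x. x : D i ==> P x"
 "!!x y. [| x : car M; y : car M; P x; P y |] ==> P (x \<oplus> y)"
 shows "P m"
proof -
 have "P (\<Oplus>i\<in>{i. cp m i ~= \<zero>}. cp m i)"
 using component_props(2)[OF assms(1)] by (rule finsum_closed_under)
 (use assms(2-4) component_props(1)[OF assms(1)] component_carrier[OF assms(1)] in blast)+
 then show ?thesis using component_props(3)[OF assms(1)] by simp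
qed

lemma components_zero: "m : car M ==> (!!i. cp m i = \<zero>) ==> m = \<zero>"
 using component_props(3)[of m] by (simp add: finsum_empty)

text \<open>An element is the sum of its finitely many nonzero components.\<close>

lemma in_subset_if_components:
 assumes "m : car M" "!!i. cp m i : N" "\<zero> : N" "!!x y. x : N ==> y : N ==> x \<oplus> y : N"
 shows "m : N"
proof -
 have "(\<Oplus>i\<in>{i. cp m i ~= \<zero>}. cp m i) : N"
 by (rule finsum_closed_under) (use component_props[OF assms(1)] component_carrier assms in auto)
 then show ?thesis using component_props(3)[OF assms(1)] by simp
qed

end

text \<open>Graded submodules by closure properties. Homogeneous scalars suffice, because every element of
  \<open>A\<close> is a sum of homogeneous ones.\<close>

definition gsub :: "('k, 'a) graded_algebra => ('a, 'm) graded_module => 'm set => bool" where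
 "gsub A M N \<longleftrightarrow> N \<subseteq> car M & \<zero>\<^bsub>M\<^esub> : N & (ALL x:N. ALL y:N. x \<oplus>\<^bsub>M\<^esub> y : N) &
 (ALL j. ALL a:adeg A j. ALL x:N. ract M x a : N) & (ALL x:N. ALL i. component M (mdeg M) x i : N)"

lemma gsubD:
 assumes "gsub A M N"
 shows "x : N ==> x : car M" "\<zero>\<^bsub>M\<^esub> : N" "[| x : N; y : N |] ==> x \<oplus>\<^bsub>M\<^esub> y : N"
 "[| x : N; a : adeg A j |] ==> ract M x a : N" "x : N ==> component M (mdeg M) x i : N"
 using assms unfolding gsub_def by blast+

context graded_algebra begin

lemma graded_group: "graded_group A (adeg A)" by unfold_locales (rule adeg_decomp)

lemma adeg_carrier: "a : adeg A i ==> a : car A"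
 using graded_group.D_carrier[OF graded_group] .

end

context graded_right_module begin

sublocale mg: graded_group M "mdeg M" by unfold_locales (rule mdeg_decomp)

sublocale ag: graded_group A "adeg A" by (rule graded_group)

lemma ract_zero_left [simp]: "a : car A ==> ract M \<zero>\<^bsub>M\<^esub> a = \<zero>\<^bsub>M\<^esub>"
 using ract_add_left[of "\<zero>\<^bsub>M\<^esub>" "\<zero>\<^bsub>M\<^esub>" a] ract_closed[of "\<zero>\<^bsub>M\<^esub>" a] by (simp add: mod.add.l_cancel_one)

lemma ract_zero_right [simp]: "m : car M ==> ract M m \<zero>\<^bsub>A\<^esub> = \<zero>\<^bsub>M\<^esub>"
 using ract_add_right[of m "\<zero>\<^bsub>A\<^esub>" "\<zero>\<^bsub>A\<^esub>"] ract_closed[of m "\<zero>\<^bsub>A\<^esub>"] by (simp add: mod.add.l_cancel_one)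

lemma ract_neg_left: "m : car M ==> a : car A ==> ract M (\<ominus>\<^bsub>M\<^esub> m) a = \<ominus>\<^bsub>M\<^esub> ract M m a"
 using ract_add_left[of "\<ominus>\<^bsub>M\<^esub> m" m a] by (simp add: mod.l_neg ract_closed mod.minus_equality)

lemma ract_neg_right: "m : car M ==> a : car A ==> ract M m (\<ominus>\<^bsub>A\<^esub> a) = \<ominus>\<^bsub>M\<^esub> ract M m a"
 using ract_add_right[of m "\<ominus>\<^bsub>A\<^esub> a" a] by (simp add: l_neg ract_closed mod.minus_equality)

lemma component_ract:
 assumes m: "m : car M" and a: "a : adeg A j"
 shows "mg.cp (ract M m a) i = ract M (mg.cp m (i - int j)) a"
proof -
 have aA: "a : car A" using a by (rule adeg_carrier)
 show ?thesis using m
 proof (induction m rule: mg.homogeneous_induct)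
 case (hom l x)
 then show ?case
 using mg.component_homogeneous[OF hom] mg.component_homogeneous[OF mdeg_ract[OF hom a]] aA by auto
 next
 case (add x y)
 then show ?case using aA by (simp add: mg.component_add ract_closed ract_add_left mg.component_carrier)
 qed (use aA in auto)
qed

lemma gsub_ract:
 assumes N: "gsub A M N" and x: "x : N" and a: "a : car A"
 shows "ract M x a : N"
 using a
proof (induction a rule: ag.homogeneous_induct)
 case zero then show ?case using gsubD(1,2)[OF N] x by simp
next
 case (hom i a) then show ?case using gsubD(4)[OF N x] by blast
next
 case (add a b) then show ?case using gsubD(1,3)[OF N] x ract_add_right by simp
qed

lemma gsub_neg: "gsub A M N ==> x : N ==> \<ominus>\<^bsub>M\<^esub> x : N"
 using gsub_ract[of N x "\<ominus>\<^bsub>A\<^esub> \<one>\<^bsub>A\<^esub>"] gsubD(1)[of A M N x] by (simp add: ract_neg_right ract_one)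

lemma gsub_subgroup: "gsub A M N ==> subgroup N (add_monoid M)"
 by (rule mod.add_subgroupI) (auto intro: gsubD gsub_neg)

lemma gsub_carrier: "gsub A M (car M)"
 unfolding gsub_def by (auto intro: ract_closed adeg_carrier mg.component_carrier)

lemma gsub_zero: "gsub A M {\<zero>\<^bsub>M\<^esub>}"
 unfolding gsub_def by (auto simp: adeg_carrier)

lemma gsub_Int: "gsub A M N ==> gsub A M N' ==> gsub A M (N \<inter> N')"
 unfolding gsub_def by blast

lemma submod_sel [simp]: "car (submod M N) = N" "add (submod M N) = add M" "zero (submod M N) = zero M"
 "ract (submod M N) = ract M" "mdeg (submod M N) = (%i. mdeg M i \<inter> N)" by (simp_all add: submod_def)

lemma gsub_submod:
 assumes N: "gsub A M N"
 shows "gr_mod K A (submod M N)"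
proof -
 have ab: "abelian_group (submod M N)"
 proof (rule abelian_groupI)
 fix x assume x: "x : car (submod M N)"
 show "EX y:car (submod M N). y \<oplus>\<^bsub>submod M N\<^esub> x = \<zero>\<^bsub>submod M N\<^esub>"
 using x gsub_neg[OF N] gsubD(1)[OF N] mod.l_neg by auto
 next
 fix x y z assume "x : car (submod M N)" "y : car (submod M N)" "z : car (submod M N)"
 then show "x \<oplus>\<^bsub>submod M N\<^esub> y \<oplus>\<^bsub>submod M N\<^esub> z = x \<oplus>\<^bsub>submod M N\<^esub> (y \<oplus>\<^bsub>submod M N\<^esub> z)"
 using gsubD(1)[OF N] mod.a_assoc by simp
 qed (use gsubD[OF N] mod.a_comm in auto)
 interpret s: abelian_group "submod M N" by fact
 have neg: "\<ominus>\<^bsub>submod M N\<^esub> x = \<ominus>\<^bsub>M\<^esub> x" if "x : N" for x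
 using s.minus_equality[of "\<ominus>\<^bsub>M\<^esub> x" x] that gsub_neg[OF N that] gsubD(1)[OF N that] mod.l_neg by simp
 have "direct_sum_decomp (submod M N) (mdeg (submod M N))"
 proof (rule direct_sum_decompI[OF ab, where c = mg.cp, THEN conjunct1])
 show "subgroup (mdeg (submod M N) i) (add_monoid (submod M N))" for i
 by (rule s.add_subgroupI) (use gsubD[OF N] mg.D_zero mg.D_add mg.D_neg neg gsub_neg[OF N] in auto)
 next
 fix m assume "m : car (submod M N)"
 then have m: "m : N" "m : car M" using gsubD(1)[OF N] by auto
 show "mg.cp m i : mdeg (submod M N) i" for i
 using m gsubD(5)[OF N] mg.component_props(1) by simp
 show "finite {i. mg.cp m i ~= \<zero>\<^bsub>submod M N\<^esub>}" using mg.component_props(2)[OF m(2)] by simp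
 show "mg.cp (m \<oplus>\<^bsub>submod M N\<^esub> n) i = mg.cp m i \<oplus>\<^bsub>submod M N\<^esub> mg.cp n i"
 if "n : car (submod M N)" for n i
 using that m gsubD(1)[OF N] by (simp add: mg.component_add)
 show "m = \<zero>\<^bsub>submod M N\<^esub>" if "!!i. mg.cp m i = \<zero>\<^bsub>submod M N\<^esub>"
 using mg.components_zero[OF m(2)] that by simp
 qed (auto simp: mg.component_homogeneous)
 then show ?thesis by (intro graded_right_module.intro graded_right_module_axioms.intro)
 (use gsubD(1,4)[OF N] gsub_ract[OF N] mdeg_ract ab graded_algebra_axioms in
 \<open>auto simp: ract_add_left ract_add_right ract_mult ract_one\<close>)
qed

lemma gr_submodule_iff: "gr_submodule K A N M \<longleftrightarrow> gsub A M N"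
proof
 assume "gsub A M N" then show "gr_submodule K A N M"
 by (simp add: gr_submodule_def gsub_submod) (simp add: gsub_def)
next
 assume "gr_submodule K A N M"
 then have sub: "N \<subseteq> car M" and "gr_mod K A (submod M N)"
 unfolding gr_submodule_def by blast+
 then interpret s: graded_right_module K A "submod M N" by simp
 have sum: "finsum (submod M N) f I = finsum M f I" if "finite I" "f : I \<rightarrow> N" for f I
 using that
 proof (induction I rule: finite_induct)
 case (insert i I)
 then have "f : I \<rightarrow> N" "f i : N" "f : I \<rightarrow> car M" "f i : car M" using sub by auto
 then show ?case using insert by (simp add: s.mod.finsum_insert)
 qed (simp add: s.mod.finsum_empty)
 have "mg.cp x i : N" if x: "x : N" for x i
 proof -
 let ?d = "s.mg.cp x"
 have d: "?d i : N" "?d i : mdeg M i" for i using s.mg.component_props(1)[of x i] x by auto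
 have f: "finite {i. ?d i ~= \<zero>\<^bsub>M\<^esub>}" using s.mg.component_props(2)[of x] x by simp
 have "x = (\<Oplus>\<^bsub>M\<^esub>i\<in>{i. ?d i ~= \<zero>\<^bsub>M\<^esub>}. ?d i)"
 using s.mg.component_props(3)[of x] x sum[OF f, of ?d] d by auto
 then have "mg.cp x = ?d" using mg.component_eqI[OF f, of ?d] d by blast
 then show ?thesis using d by simp
 qed
 then show "gsub A M N"
 unfolding gsub_def using sub s.mod.zero_closed s.mod.a_closed s.ract_closed adeg_carrier by simp
qed

end

section \<open>Torsion modules\<close>

text \<open>For a graded submodule \<open>N\<close>, the quotient \<open>sat A M N / N\<close> is the torsion submodule of
  \<open>M / N\<close>.\<close>

definition sat :: "('k, 'a) graded_algebra => ('a, 'm) graded_module => 'm set => 'm set" where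
 "sat A M N = {x : car M. EX k. \<forall>j\<ge>k. ALL a:adeg A j. ract M x a : N}"

abbreviation tors :: "('k, 'a) graded_algebra => ('a, 'm) graded_module => 'm set" where
 "tors A M \<equiv> sat A M {\<zero>\<^bsub>M\<^esub>}"

text \<open>That \<open>V\<close> lies in the linear span of \<open>X\<close>, stated as an induction principle.\<close>

definition spanned_by :: "'k ring => ('k, 'a) graded_algebra => 'a set => 'a set => bool" where
 "spanned_by K A X V \<longleftrightarrow> (ALL P. \<zero>\<^bsub>A\<^esub> : P --> (ALL x:P. ALL y:P. x \<oplus>\<^bsub>A\<^esub> y : P) -->
 (ALL c:car K. ALL x:X. c \<odot>\<^bsub>A\<^esub> x : P) --> V \<subseteq> P)"

text \<open>Each \<open>A\<^sub>n\<close> is spanned by finitely many elements that can be cut into two factors at any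
  prescribed degree, up to an error \<open>d\<close>. So \<open>A\<close> is locally finite, and each right ideal
  \<open>\<Oplus>\<^sub>j\<^sub>\<ge>\<^sub>k A\<^sub>j\<close> is generated by finitely many elements, namely those of degree at most \<open>k + d\<close>.\<close>

definition tame :: "'k ring => ('k, 'a) graded_algebra => bool" where
 "tame K A \<longleftrightarrow> (EX W d. ALL n. finite (W n) & W n \<subseteq> adeg A n & spanned_by K A (W n) (adeg A n) &
 (ALL k u. k + d <= n & u : W n -->
 (EX i v v'. k <= i & i <= k + d & v : W i & v' : W (n - i) & u = v \<otimes>\<^bsub>A\<^esub> v')))"

lemma tameE:
 assumes "tame K A"
 obtains W d where "!!n. finite (W n)" "!!n. W n \<subseteq> adeg A n" "!!n. spanned_by K A (W n) (adeg A n)"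
 "!!n k u. k + d <= n ==> u : W n ==>
 EX i v v'. k <= i & i <= k + d & v : W i & v' : W (n - i) & u = v \<otimes>\<^bsub>A\<^esub> v'"
proof -
 from assms obtain W d where "ALL n. finite (W n) & W n \<subseteq> adeg A n & spanned_by K A (W n) (adeg A n) &
 (ALL k u. k + d <= n & u : W n -->
 (EX i v v'. k <= i & i <= k + d & v : W i & v' : W (n - i) & u = v \<otimes>\<^bsub>A\<^esub> v'))"
 unfolding tame_def by (elim exE)
 then show thesis by (intro that[of W d]) simp_all
qed

lemma spanned_byD:
 assumes "spanned_by K A X V" "a : V" "\<zero>\<^bsub>A\<^esub> : P" "!!x y. x : P ==> y : P ==> x \<oplus>\<^bsub>A\<^esub> y : P"
 "!!c x. c : car K ==> x : X ==> c \<odot>\<^bsub>A\<^esub> x : P"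
 shows "a : P"
 using assms(1)[unfolded spanned_by_def, rule_format, of P] assms(2-5) by auto

context graded_algebra begin

interpretation ag: graded_group A "adeg A" by (rule graded_group)

lemma component_mult:
 assumes a: "a : adeg A j" and b: "b : car A"
 shows "ag.cp (a \<otimes>\<^bsub>A\<^esub> b) (j + i) = a \<otimes>\<^bsub>A\<^esub> ag.cp b i"
 using b
proof (induction b rule: ag.homogeneous_induct)
 case zero then show ?case using adeg_carrier[OF a] by simp
next
 case (hom l x)
 then show ?case using ag.component_homogeneous[OF hom] ag.component_homogeneous[OF adeg_mult[OF a hom]]
 adeg_carrier[OF a] by simp
next
 case (add x y)
 then show ?case using adeg_carrier[OF a] by (simp add: r_distr ag.component_add ag.component_carrier)
qed

text \<open>The degree 0 component of the identity is a right identity, hence equal to it.\<close>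

lemma one_adeg: "\<one>\<^bsub>A\<^esub> : adeg A 0"
proof -
 define e where "e = ag.cp \<one>\<^bsub>A\<^esub> 0"
 have e: "e : adeg A 0" unfolding e_def by (rule ag.component_props(1)) simp
 have "x \<otimes>\<^bsub>A\<^esub> e = x" if "x : car A" for x
 using that
 proof (induction x rule: ag.homogeneous_induct)
 case zero then show ?case using adeg_carrier[OF e] by simp
 next
 case (hom i x)
 then show ?case using component_mult[OF hom, of "\<one>\<^bsub>A\<^esub>" 0] ag.component_homogeneous[OF hom, of i]
 adeg_carrier[OF hom] by (simp add: e_def)
 next
 case (add x y) then show ?case using adeg_carrier[OF e] by (simp add: l_distr)
 qed
 from this[of "\<one>\<^bsub>A\<^esub>"] show ?thesis using e adeg_carrier[OF e] by simp
qed

lemma scalar_adeg: "c : car K ==> c \<odot>\<^bsub>A\<^esub> \<one>\<^bsub>A\<^esub> : adeg A 0"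
 using adeg_smult one_adeg by blast

lemma scalar_carrier: "c : car K ==> c \<odot>\<^bsub>A\<^esub> \<one>\<^bsub>A\<^esub> : car A"
 by (simp add: smult_closed)

lemma mult_scalar: "c : car K ==> a : car A ==> a \<otimes>\<^bsub>A\<^esub> (c \<odot>\<^bsub>A\<^esub> \<one>\<^bsub>A\<^esub>) = c \<odot>\<^bsub>A\<^esub> a"
 by (simp add: smult_mult_right)

lemma scalar_mult: "c : car K ==> a : car A ==> (c \<odot>\<^bsub>A\<^esub> \<one>\<^bsub>A\<^esub>) \<otimes>\<^bsub>A\<^esub> a = c \<odot>\<^bsub>A\<^esub> a"
 by (simp add: smult_mult_left)

lemma scalar_add: "c : car K ==> d : car K ==>
 (c \<oplus>\<^bsub>K\<^esub> d) \<odot>\<^bsub>A\<^esub> \<one>\<^bsub>A\<^esub> = c \<odot>\<^bsub>A\<^esub> \<one>\<^bsub>A\<^esub> \<oplus>\<^bsub>A\<^esub> d \<odot>\<^bsub>A\<^esub> \<one>\<^bsub>A\<^esub>"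
 by (simp add: smult_l_distr)

end

context graded_right_module begin

lemma sat_carrier: "x : sat A M N ==> x : car M" by (simp add: sat_def)

lemma satI: "x : car M ==> (!!j a. k <= j ==> a : adeg A j ==> ract M x a : N) ==> x : sat A M N"
 unfolding sat_def by blast

lemma satE:
 assumes "x : sat A M N"
 obtains k where "!!j a. k <= j ==> a : adeg A j ==> ract M x a : N"
 using assms unfolding sat_def by blast

lemma sat_mono: "N \<subseteq> N' ==> sat A M N \<subseteq> sat A M N'"
 unfolding sat_def by blast

lemma subset_sat: "gsub A M N ==> N \<subseteq> sat A M N"
 using gsubD(1,4)[of A M N] by (auto intro!: satI[of _ 0])

lemma sat_gsub:
 assumes N: "gsub A M N"
 shows "gsub A M (sat A M N)"
 unfolding gsub_def
proof (intro conjI ballI allI)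
 show "sat A M N \<subseteq> car M" using sat_carrier by blast
 show "\<zero>\<^bsub>M\<^esub> : sat A M N" using subset_sat[OF N] gsubD(2)[OF N] by blast
 show "x \<oplus>\<^bsub>M\<^esub> y : sat A M N" if xy: "x : sat A M N" "y : sat A M N" for x y
 proof -
 note c = xy[THEN sat_carrier]
 obtain k where k: "!!j a. k <= j ==> a : adeg A j ==> ract M x a : N" using xy(1) by (rule satE) blast
 obtain l where l: "!!j a. l <= j ==> a : adeg A j ==> ract M y a : N" using xy(2) by (rule satE) blast
 show ?thesis
 proof (rule satI[of _ "max k l"])
 fix j a assume "max k l <= j" and a: "a : adeg A j"
 then show "ract M (x \<oplus>\<^bsub>M\<^esub> y) a : N"
 using gsubD(3)[OF N k[OF _ a] l[OF _ a]] by (simp add: ract_add_left c adeg_carrier)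
 qed (use c in simp)
 qed
 show "ract M x b : sat A M N" if b: "b : adeg A i" and x: "x : sat A M N" for i b x
 proof -
 note c = sat_carrier[OF x] adeg_carrier[OF b]
 obtain k where k: "!!j a. k <= j ==> a : adeg A j ==> ract M x a : N" using x by (rule satE) blast
 show ?thesis
 proof (rule satI[of _ k])
 fix j a assume "k <= j" and a: "a : adeg A j"
 then have "ract M x (b \<otimes>\<^bsub>A\<^esub> a) : N" using k[OF _ adeg_mult[OF b a]] by simp
 then show "ract M (ract M x b) a : N" using ract_mult[OF c adeg_carrier[OF a]] by simp
 qed (use c ract_closed in simp)
 qed
 show "mg.cp x i : sat A M N" if x: "x : sat A M N" for x i
 proof -
 obtain k where k: "!!j a. k <= j ==> a : adeg A j ==> ract M x a : N" using x by (rule satE) blast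
 show ?thesis
 proof (rule satI[of _ k])
 fix j a assume "k <= j" and a: "a : adeg A j"
 then have "mg.cp (ract M x a) (i + int j) : N" using k gsubD(5)[OF N] by blast
 then show "ract M (mg.cp x i) a : N" using component_ract[OF sat_carrier[OF x] a, of "i + int j"] by simp
 qed (use mg.component_carrier[OF sat_carrier[OF x]] in simp)
 qed
qed

lemma ract_spanned:
 assumes "gsub A M N" "x : car M" "spanned_by K A X (adeg A n)" "X \<subseteq> car A"
 "!!w. w : X ==> ract M x w : N" "a : adeg A n"
 shows "ract M x a : N"
proof -
 have "a : {a : car A. ract M x a : N}"
 using assms(3,6)
 proof (rule spanned_byD)
 fix c w assume c: "c : car K" and w: "w : X"
 have "ract M (ract M x w) (c \<odot>\<^bsub>A\<^esub> \<one>\<^bsub>A\<^esub>) : N"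
 by (rule gsub_ract[OF assms(1) assms(5)[OF w] scalar_carrier[OF c]])
 then show "c \<odot>\<^bsub>A\<^esub> w : {a : car A. ract M x a : N}"
 using ract_mult[OF assms(2) _ scalar_carrier[OF c], of w] mult_scalar[OF c, of w] w assms(4) c
 by (auto simp: smult_closed)
 qed (use assms(1,2) gsubD(2,3)[OF assms(1)] ract_add_right in auto)
 then show ?thesis by simp
qed

lemma finsum_submod:
 assumes N: "gsub A M N" and "finite I" "f : I \<rightarrow> N"
 shows "finsum (submod M N) f I = finsum M f I"
 using assms(2,3)
proof (induction I rule: finite_induct)
 interpret s: graded_right_module K A "submod M N" by (rule gsub_submod[OF N])
 case empty then show ?case by (simp add: s.mod.finsum_empty)
next
 interpret s: graded_right_module K A "submod M N" by (rule gsub_submod[OF N])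
 case (insert i I)
 then have "f : I \<rightarrow> N" "f i : N" "f : I \<rightarrow> car M" "f i : car M"
 using gsubD(1)[OF N] by auto
 then show ?case using insert by (simp add: s.mod.finsum_insert)
qed

text \<open>Finite-dimensional graded modules live in finitely many degrees, so that elements of large
  degree have to annihilate them.\<close>

lemma fin_dim_torsion:
 assumes N: "gsub A M N" and fd: "fin_dim K A (submod M N)"
 shows "N \<subseteq> tors A M"
proof
 fix x assume x: "x : N"
 interpret s: graded_right_module K A "submod M N" by (rule gsub_submod[OF N])
 obtain B where B: "finite B" "B \<subseteq> N"
 "N = {finsum (submod M N) (%b. ract M b (c b \<odot>\<^bsub>A\<^esub> \<one>\<^bsub>A\<^esub>)) B | c. ALL b:B. c b : car K}"
 using fd unfolding fin_dim_def by auto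
 define I where "I = (\<Union>b\<in>B. {i. mg.cp b i ~= \<zero>\<^bsub>M\<^esub>})"
 have Bc: "b : car M" if "b : B" for b using B(2) that gsubD(1)[OF N] by blast
 have "finite I" unfolding I_def using B(1) Bc mg.component_props(2) by blast
 then obtain b where b: "!!i. i : I ==> \<bar>i\<bar> <= b" by (metis (no_types) finite_imageI Max_ge imageI)
 have supp: "mg.cp y i = \<zero>\<^bsub>M\<^esub>" if y: "y : N" and i: "i \<notin> I" for y i
 proof -
 obtain c where c: "y = finsum (submod M N) (%b. ract M b (c b \<odot>\<^bsub>A\<^esub> \<one>\<^bsub>A\<^esub>)) B" "ALL b:B. c b : car K"
 using y B(3) by blast
 have r: "ract M b (c b \<odot>\<^bsub>A\<^esub> \<one>\<^bsub>A\<^esub>) : N" if "b : B" for b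
 using gsub_ract[OF N] that B(2) c(2) scalar_carrier by blast
 have "y = finsum M (%b. ract M b (c b \<odot>\<^bsub>A\<^esub> \<one>\<^bsub>A\<^esub>)) B"
 unfolding c(1) by (rule finsum_submod[OF N B(1)]) (use r in auto)
 moreover have "mg.cp (finsum M (%b. ract M b (c b \<odot>\<^bsub>A\<^esub> \<one>\<^bsub>A\<^esub>)) B) i = \<zero>\<^bsub>M\<^esub>"
 proof (rule mod.finsum_closed_under[OF B(1)])
 fix b assume b: "b : B"
 then have "mg.cp b i = \<zero>\<^bsub>M\<^esub>" using i by (auto simp: I_def)
 then show "ract M b (c b \<odot>\<^bsub>A\<^esub> \<one>\<^bsub>A\<^esub>) : car M & mg.cp (ract M b (c b \<odot>\<^bsub>A\<^esub> \<one>\<^bsub>A\<^esub>)) i = \<zero>\<^bsub>M\<^esub>"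
 using component_ract[OF Bc[OF b] scalar_adeg, of "c b" i] c(2) b r[OF b] gsubD(1)[OF N] scalar_carrier by simp
 qed (simp_all add: mg.component_add)
 ultimately show ?thesis by simp
 qed
 show "x : tors A M"
 proof (rule satI[of _ "nat (2 * b + 1)"])
 fix j a assume j: "nat (2 * b + 1) <= j" and a: "a : adeg A j"
 have xa: "ract M x a : N" using gsubD(4)[OF N x a] .
 have "mg.cp (ract M x a) i = \<zero>\<^bsub>M\<^esub>" for i
 proof (cases "i : I")
 case True
 then have "i - int j \<notin> I" using b[of i] b[of "i - int j"] j by linarith
 then show ?thesis
 using component_ract[OF gsubD(1)[OF N x] a] supp[OF x] adeg_carrier[OF a] by simp
 qed (use supp[OF xa] in blast)
 then show "ract M x a : {\<zero>\<^bsub>M\<^esub>}"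
 using mg.components_zero gsubD(1)[OF N xa] by blast
 qed (rule gsubD(1)[OF N x])
qed

definition lin :: "'m set => 'm set" where
 "lin F = {\<Oplus>\<^bsub>M\<^esub>b\<in>F. ract M b (c b \<odot>\<^bsub>A\<^esub> \<one>\<^bsub>A\<^esub>) | c. ALL b : F. c b : car K}"

lemma lin_props:
 assumes F: "finite F" "F \<subseteq> car M"
 shows "\<zero>\<^bsub>M\<^esub> : lin F" "[| x : lin F; y : lin F |] ==> x \<oplus>\<^bsub>M\<^esub> y : lin F"
 "[| b : F; c : car K |] ==> ract M b (c \<odot>\<^bsub>A\<^esub> \<one>\<^bsub>A\<^esub>) : lin F"
 "lin F \<subseteq> car M"
proof -
 have r: "ract M b (c \<odot>\<^bsub>A\<^esub> \<one>\<^bsub>A\<^esub>) : car M" if "b : F" "c : car K" for b c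
 using that F(2) ract_closed scalar_carrier by blast
 have "(\<Oplus>\<^bsub>M\<^esub>b\<in>F. ract M b (\<zero>\<^bsub>K\<^esub> \<odot>\<^bsub>A\<^esub> \<one>\<^bsub>A\<^esub>)) = \<zero>\<^bsub>M\<^esub>"
 by (rule mod.add.finprod_one_eqI) (use F(2) in auto)
 then show "\<zero>\<^bsub>M\<^esub> : lin F" unfolding lin_def by (intro CollectI exI[of _ "%_. \<zero>\<^bsub>K\<^esub>"]) auto
 show "ract M b (c \<odot>\<^bsub>A\<^esub> \<one>\<^bsub>A\<^esub>) : lin F" if b: "b : F" "c : car K" for b c
 proof -
 have "(\<Oplus>\<^bsub>M\<^esub>b'\<in>F. ract M b' ((if b' = b then c else \<zero>\<^bsub>K\<^esub>) \<odot>\<^bsub>A\<^esub> \<one>\<^bsub>A\<^esub>))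
 = (\<Oplus>\<^bsub>M\<^esub>b'\<in>{b}. ract M b' (c \<odot>\<^bsub>A\<^esub> \<one>\<^bsub>A\<^esub>))"
 by (rule mod.add.finprod_mono_neutral_cong_right[OF F(1)]) (use b F(2) r in auto)
 also have "... = ract M b (c \<odot>\<^bsub>A\<^esub> \<one>\<^bsub>A\<^esub>)" using r[OF b] by simp
 finally show ?thesis unfolding lin_def
 using b by (intro CollectI exI[of _ "%b'. if b' = b then c else \<zero>\<^bsub>K\<^esub>"]) auto
 qed
 show "x \<oplus>\<^bsub>M\<^esub> y : lin F" if "x : lin F" "y : lin F"
 proof -
 obtain c where c: "x = (\<Oplus>\<^bsub>M\<^esub>b\<in>F. ract M b (c b \<odot>\<^bsub>A\<^esub> \<one>\<^bsub>A\<^esub>))" "ALL b:F. c b : car K"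
 using \<open>x : lin F\<close> unfolding lin_def by blast
 obtain d where d: "y = (\<Oplus>\<^bsub>M\<^esub>b\<in>F. ract M b (d b \<odot>\<^bsub>A\<^esub> \<one>\<^bsub>A\<^esub>))" "ALL b:F. d b : car K"
 using \<open>y : lin F\<close> unfolding lin_def by blast
 have "x \<oplus>\<^bsub>M\<^esub> y = (\<Oplus>\<^bsub>M\<^esub>b\<in>F. ract M b (c b \<odot>\<^bsub>A\<^esub> \<one>\<^bsub>A\<^esub>) \<oplus>\<^bsub>M\<^esub> ract M b (d b \<odot>\<^bsub>A\<^esub> \<one>\<^bsub>A\<^esub>))"
 unfolding c(1) d(1) by (rule mod.finsum_addf[symmetric]) (use r c(2) d(2) in auto)
 also have "... = (\<Oplus>\<^bsub>M\<^esub>b\<in>F. ract M b ((c b \<oplus>\<^bsub>K\<^esub> d b) \<odot>\<^bsub>A\<^esub> \<one>\<^bsub>A\<^esub>))"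
 by (rule mod.finsum_cong')
 (use r c(2) d(2) F(2) in \<open>auto simp: scalar_add ract_add_right scalar_carrier subset_iff\<close>)
 finally show ?thesis unfolding lin_def
 using c(2) d(2) by (intro CollectI exI[of _ "%b. c b \<oplus>\<^bsub>K\<^esub> d b"]) auto
 qed
 show "lin F \<subseteq> car M" unfolding lin_def using r by (auto intro!: mod.finsum_closed)
qed

lemma lin_induct:
 assumes F: "finite F" "F \<subseteq> car M" and "y : lin F" "P \<zero>\<^bsub>M\<^esub>"
 "!!x y. [| x : car M; y : car M; P x; P y |] ==> P (x \<oplus>\<^bsub>M\<^esub> y)"
 "!!b c. [| b : F; c : car K |] ==> P (ract M b (c \<odot>\<^bsub>A\<^esub> \<one>\<^bsub>A\<^esub>))"
 shows "P y"
proof -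
 obtain c where c: "y = (\<Oplus>\<^bsub>M\<^esub>b\<in>F. ract M b (c b \<odot>\<^bsub>A\<^esub> \<one>\<^bsub>A\<^esub>))" "ALL b:F. c b : car K"
 using assms(3) unfolding lin_def by blast
 have r: "ract M b (c b \<odot>\<^bsub>A\<^esub> \<one>\<^bsub>A\<^esub>) : car M" if "b : F" for b
 using that F(2) c(2) ract_closed scalar_carrier by blast
 show ?thesis unfolding c(1) by (rule mod.finsum_closed_under[OF F(1)]) (use assms(4-6) c(2) r in auto)
qed

end

locale tame_algebra = graded_algebra +
 assumes tame: "tame K A"

locale tame_module = tame_algebra K A + graded_right_module K A M for K A M
begin

text \<open>Torsion modules are closed under extensions because the right ideal of all elements of
  degree at least \<open>k\<close> is generated by its finitely many generators in degrees \<open>k, \<dots>, k + d\<close>.\<close>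

lemma sat_sat:
 assumes N: "gsub A M N"
 shows "sat A M (sat A M N) = sat A M N"
proof
 show "sat A M N \<subseteq> sat A M (sat A M N)" by (rule subset_sat[OF sat_gsub[OF N]])
 show "sat A M (sat A M N) \<subseteq> sat A M N"
 proof
 fix x assume x: "x : sat A M (sat A M N)"
 note xc = sat_carrier[OF x]
 obtain W d where W: "!!n. finite (W n)" "!!n. W n \<subseteq> adeg A n" "!!n. spanned_by K A (W n) (adeg A n)"
 "!!n k u. k + d <= n ==> u : W n ==>
 EX i v v'. k <= i & i <= k + d & v : W i & v' : W (n - i) & u = v \<otimes>\<^bsub>A\<^esub> v'"
 using tameE[OF tame] by metis
 have Wc: "W n \<subseteq> car A" for n using W(2) adeg_carrier by blast
 obtain k where k: "!!j a. k <= j ==> a : adeg A j ==> ract M x a : sat A M N" using x by (rule satE) blast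
 let ?F = "\<Union>i\<in>{k..k+d}. W i"
 have "EX l. \<forall>j\<ge>l. ALL a:adeg A j. ract M (ract M x v) a : N" if v: "v : ?F" for v
 proof -
 obtain i where i: "k <= i" "v : W i" using v by auto
 then have "ract M x v : sat A M N" using k[of i v] W(2)[of i] by blast
 then show ?thesis by (simp add: sat_def)
 qed
 then obtain l where l: "!!v j a. v : ?F ==> l v <= j ==> a : adeg A j ==> ract M (ract M x v) a : N" by metis
 have fF: "finite ?F" using W(1) by blast
 define L where "L = Max (insert 0 (l ` ?F))"
 have L: "l v <= L" if "v : ?F" for v unfolding L_def using fF that by (intro Max_ge) auto
 show "x : sat A M N"
 proof (rule satI[OF xc, of "k + d + L"])
 fix n a assume n: "k + d + L <= n" and a: "a : adeg A n"
 show "ract M x a : N"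
 proof (rule ract_spanned[OF N xc W(3) Wc _ a])
 fix u assume "u : W n"
 then obtain i v v' where v: "k <= i" "i <= k + d" "v : W i" "v' : W (n - i)" "u = v \<otimes>\<^bsub>A\<^esub> v'"
 using W(4)[of k n u] n by auto
 have vF: "v : ?F" using v by auto
 have "ract M (ract M x v) v' : N" by (rule l[OF vF, of "n - i"]) (use L[OF vF] n v W(2) in auto)
 moreover have "v : car A" "v' : car A" using v(3,4) Wc by auto
 ultimately show "ract M x u : N" using ract_mult[OF xc] v(5) by simp
 qed
 qed
 qed
qed

text \<open>A torsion element \<open>x\<close> is killed from some degree on, so that \<open>x A\<close> is spanned by the products
  of \<open>x\<close> with the finitely many spanning elements of smaller degree.\<close>

lemma torsion_homogeneous_in_fin_dim:
 assumes x: "x : tors A M" "x : mdeg M l"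
 shows "EX N. gsub A M N & fin_dim K A (submod M N) & x : N"
proof -
 note xc = sat_carrier[OF x(1)]
 obtain W d where W: "!!n. finite (W n)" "!!n. W n \<subseteq> adeg A n" "!!n. spanned_by K A (W n) (adeg A n)"
 using tameE[OF tame] by metis
 have Wc: "W n \<subseteq> car A" for n using W(2) adeg_carrier by blast
 obtain k where k: "!!j a. k <= j ==> a : adeg A j ==> ract M x a = \<zero>\<^bsub>M\<^esub>"
 using x(1) by (rule satE) blast
 define F where "F = (\<Union>j\<in>{..<k}. ract M x ` W j)"
 have F: "finite F" "F \<subseteq> car M"
 unfolding F_def using W(1) Wc ract_closed[OF xc] by auto
 note lin = lin_props[OF F]
 have xa: "ract M x a : lin F" if a: "a : adeg A j" for a j
 proof (cases "j < k")
 case True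
 have "a : {a : car A. ract M x a : lin F}"
 using W(3) a
 proof (rule spanned_byD)
 fix c w assume cw: "c : car K" "w : W j"
 have w: "w : car A" using cw Wc by blast
 have "ract M (ract M x w) (c \<odot>\<^bsub>A\<^esub> \<one>\<^bsub>A\<^esub>) : lin F"
 by (rule lin(3)) (use cw True in \<open>auto simp: F_def\<close>)
 then show "c \<odot>\<^bsub>A\<^esub> w : {a : car A. ract M x a : lin F}"
 using ract_mult[OF xc w scalar_carrier] mult_scalar w cw by (simp add: smult_closed)
 qed (use lin ract_add_right xc in auto)
 then show ?thesis by simp
 next
 case False
 then show ?thesis using k[OF _ a] lin(1) by simp
 qed
 have N: "gsub A M (lin F)"
 unfolding gsub_def
 proof (intro conjI ballI allI)
 show "lin F \<subseteq> car M" "\<zero>\<^bsub>M\<^esub> : lin F" by (rule lin)+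
 show "y \<oplus>\<^bsub>M\<^esub> z : lin F" if "y : lin F" "z : lin F" for y z using lin that by blast
 show "ract M y a : lin F" if a: "a : adeg A j" and y: "y : lin F" for j a y
 using y
 proof (rule lin_induct[OF F])
 fix b c assume bc: "b : F" "c : car K"
 obtain i w where b: "b = ract M x w" "w : W i" using bc(1) unfolding F_def by blast
 have "ract M (ract M b (c \<odot>\<^bsub>A\<^esub> \<one>\<^bsub>A\<^esub>)) a = ract M x (w \<otimes>\<^bsub>A\<^esub> (c \<odot>\<^bsub>A\<^esub> a))"
 using b bc Wc[of i] adeg_carrier[OF a] xc
 by (simp add: ract_mult[symmetric] scalar_carrier smult_closed ract_closed subset_iff m_assoc scalar_mult)
 moreover have "w \<otimes>\<^bsub>A\<^esub> (c \<odot>\<^bsub>A\<^esub> a) : adeg A (i + j)"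
 using adeg_mult[OF _ adeg_smult[OF bc(2) a]] W(2) b by blast
 ultimately show "ract M (ract M b (c \<odot>\<^bsub>A\<^esub> \<one>\<^bsub>A\<^esub>)) a : lin F" using xa by simp
 qed (use adeg_carrier[OF a] lin ract_add_left in auto)
 show "mg.cp y i : lin F" if y: "y : lin F" for y i
 using y
 proof (rule lin_induct[OF F])
 fix b c assume bc: "b : F" "c : car K"
 obtain j w where b: "b = ract M x w" "w : W j" using bc(1) unfolding F_def by blast
 have "b : mdeg M (l + int j)" using mdeg_ract[OF x(2)] b W(2) by blast
 then have "ract M b (c \<odot>\<^bsub>A\<^esub> \<one>\<^bsub>A\<^esub>) : mdeg M (l + int j)"
 using mdeg_ract[OF _ scalar_adeg[OF bc(2)]] by fastforce
 then show "mg.cp (ract M b (c \<odot>\<^bsub>A\<^esub> \<one>\<^bsub>A\<^esub>)) i : lin F"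
 using mg.component_homogeneous lin(1) lin(3)[OF bc] by simp
 qed (use lin mg.component_add in auto)
 qed
 have FN: "F \<subseteq> lin F"
 proof
 fix b assume "b : F"
 then obtain j w where "b = ract M x w" "w : W j" unfolding F_def by blast
 then show "b : lin F" using xa W(2) by blast
 qed
 have "fin_dim K A (submod M (lin F))"
 unfolding fin_dim_def
 proof (intro exI[of _ F] conjI)
 have "finsum (submod M (lin F)) (%b. ract M b (c b \<odot>\<^bsub>A\<^esub> \<one>\<^bsub>A\<^esub>)) F = (\<Oplus>\<^bsub>M\<^esub>b\<in>F. ract M b (c b \<odot>\<^bsub>A\<^esub> \<one>\<^bsub>A\<^esub>))"
 if "ALL b:F. c b : car K" for c by (rule finsum_submod[OF N F(1)]) (use that lin(3) in auto)
 then show "car (submod M (lin F)) = {\<Oplus>\<^bsub>submod M (lin F)\<^esub>b\<in>F. ract (submod M (lin F)) b (c b \<odot>\<^bsub>A\<^esub> \<one>\<^bsub>A\<^esub>)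
 | c. ALL b:F. c b : car K}" by (simp add: lin_def) (metis (lifting))
 qed (use F FN in auto)
 moreover have "x : lin F" using xa[OF one_adeg] xc by (simp add: ract_one)
 ultimately show ?thesis using N by blast
qed

text \<open>Elements of finite-dimensional graded modules are torsion, sums of torsion elements are torsion,
  and conversely a homogeneous torsion element generates a finite-dimensional submodule.\<close>

lemma in_Fdim_iff: "in_Fdim K A M \<longleftrightarrow> car M \<subseteq> tors A M"
proof
 assume "in_Fdim K A M"
 then have "car M = generate (add_monoid M) (\<Union>{N. gsub A M N & fin_dim K A (submod M N)})"
 unfolding in_Fdim_def gr_submodule_iff by blast
 also have "... \<subseteq> tors A M"
 by (rule group.generate_subgroup_incl[OF mod.a_group _ gsub_subgroup[OF sat_gsub[OF gsub_zero]]])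
 (use fin_dim_torsion in blast)
 finally show "car M \<subseteq> tors A M" .
next
 assume t: "car M \<subseteq> tors A M"
 let ?S = "\<Union>{N. gsub A M N & fin_dim K A (submod M N)}"
 have "x : generate (add_monoid M) ?S" if "x : car M" for x
 using that
 proof (induction x rule: mg.homogeneous_induct)
 case zero show ?case using generate.one[of "add_monoid M"] by simp
 next
 case (hom i x)
 have "x : ?S" using torsion_homogeneous_in_fin_dim[OF _ hom] t mg.D_carrier[OF hom] by blast
 then show ?case by (rule generate.incl)
 next
 case (add x y) then show ?case using generate.eng[of x "add_monoid M" ?S y] by simp
 qed
 moreover have "generate (add_monoid M) ?S \<subseteq> car (add_monoid M)"
 by (rule group.generate_incl[OF mod.a_group]) (auto dest: gsubD(1))
 ultimately show "in_Fdim K A M"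
 unfolding in_Fdim_def gr_submodule_iff using graded_right_module_axioms by auto
qed

end

section \<open>Quotients and products of graded modules\<close>

context graded_right_module begin

lemma component_submod:
 assumes N: "gsub A M N" and x: "x : N"
 shows "component (submod M N) (mdeg (submod M N)) x = mg.cp x"
proof -
 interpret s: graded_right_module K A "submod M N" by (rule gsub_submod[OF N])
 note xc = gsubD(1)[OF N x]
 show ?thesis
 proof (rule s.mg.component_eqI[of "{i. mg.cp x i ~= \<zero>\<^bsub>M\<^esub>}"])
 show "finite {i. mg.cp x i ~= \<zero>\<^bsub>M\<^esub>}" by (rule mg.component_props(2)[OF xc])
 show "mg.cp x i : mdeg (submod M N) i" for i
 using mg.component_props(1)[OF xc] gsubD(5)[OF N x] by simp
 show "x = finsum (submod M N) (mg.cp x) {i. mg.cp x i ~= \<zero>\<^bsub>M\<^esub>}"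
 using mg.component_props(3)[OF xc] finsum_submod[OF N mg.component_props(2)[OF xc], of "mg.cp x"]
 gsubD(5)[OF N x] by auto
 qed auto
qed

context
 fixes N assumes N: "gsub A M N"
begin

lemma abelian_subgroup: "abelian_subgroup N M"
 by (rule abelian_subgroupI3[OF additive_subgroup.intro[OF gsub_subgroup[OF N]] mod.abelian_group_axioms])

lemma coset_mem: "x : car M ==> y : N +>\<^bsub>M\<^esub> x \<longleftrightarrow> y : car M & y \<ominus>\<^bsub>M\<^esub> x : N"
proof
 assume x: "x : car M" and "y : N +>\<^bsub>M\<^esub> x"
 then obtain h where h: "h : N" "y = h \<oplus>\<^bsub>M\<^esub> x" unfolding a_r_coset_def' by blast
 then show "y : car M & y \<ominus>\<^bsub>M\<^esub> x : N"
 using x gsubD(1)[OF N h(1)] by (simp add: a_minus_def mod.a_assoc mod.r_neg)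
next
 assume x: "x : car M" and y: "y : car M & y \<ominus>\<^bsub>M\<^esub> x : N"
 then have "y = (y \<ominus>\<^bsub>M\<^esub> x) \<oplus>\<^bsub>M\<^esub> x" by (simp add: mod.minus_add_cancel)
 then show "y : N +>\<^bsub>M\<^esub> x" unfolding a_r_coset_def' using y by blast
qed

lemma coset_self: "x : car M ==> x : N +>\<^bsub>M\<^esub> x"
 using coset_mem gsubD(2)[OF N] by (simp add: a_minus_def mod.r_neg)

lemma coset_eqI: "x : car M ==> y : N +>\<^bsub>M\<^esub> x ==> N +>\<^bsub>M\<^esub> y = N +>\<^bsub>M\<^esub> x"
 using mod.a_repr_independence[of y N x] gsub_subgroup[OF N] by simp

lemma coset_eq_iff: "x : car M ==> y : car M ==> N +>\<^bsub>M\<^esub> x = N +>\<^bsub>M\<^esub> y \<longleftrightarrow> x \<ominus>\<^bsub>M\<^esub> y : N"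
 using coset_eqI[of y x] coset_mem[of y x] coset_self[of x] by auto

lemma coset_zero: "N +>\<^bsub>M\<^esub> \<zero>\<^bsub>M\<^esub> = N"
 using mod.a_coset_add_zero gsubD(1)[OF N] by blast

lemma coset_add: "x : car M ==> y : car M ==>
 (N +>\<^bsub>M\<^esub> x) <+>\<^bsub>M\<^esub> (N +>\<^bsub>M\<^esub> y) = N +>\<^bsub>M\<^esub> (x \<oplus>\<^bsub>M\<^esub> y)"
 by (rule abelian_subgroup.a_rcos_sum[OF abelian_subgroup])

lemma quotmod_sel: "car (quotmod M N) = (%x. N +>\<^bsub>M\<^esub> x) ` car M"
 "add (quotmod M N) = set_add M" "zero (quotmod M N) = N"
 "mdeg (quotmod M N) = (%i. (%x. N +>\<^bsub>M\<^esub> x) ` mdeg M i)"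
 by (auto simp: quotmod_def A_RCOSETS_def')

lemma coset_UN:
 assumes x: "x : car M"
 and g: "!!y. y : car M ==> g y : car M" "!!y. y : car M ==> y \<ominus>\<^bsub>M\<^esub> x : N ==> g y \<ominus>\<^bsub>M\<^esub> g x : N"
 shows "(\<Union>y\<in>N +>\<^bsub>M\<^esub> x. N +>\<^bsub>M\<^esub> g y) = N +>\<^bsub>M\<^esub> g x"
proof -
 have "N +>\<^bsub>M\<^esub> g y = N +>\<^bsub>M\<^esub> g x" if "y : N +>\<^bsub>M\<^esub> x" for y
 using that coset_mem[OF x] g x coset_eq_iff by simp
 then show ?thesis using coset_self[OF x] by blast
qed

lemma quotmod_ract:
 assumes "x : car M" "a : car A"
 shows "ract (quotmod M N) (N +>\<^bsub>M\<^esub> x) a = N +>\<^bsub>M\<^esub> (ract M x a)"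
proof -
 have "ract M y a \<ominus>\<^bsub>M\<^esub> ract M x a : N" if "y : car M" "y \<ominus>\<^bsub>M\<^esub> x : N" for y
 using gsub_ract[OF N that(2) assms(2)] that assms by (simp add: a_minus_def ract_add_left ract_neg_left)
 then show ?thesis
 using coset_UN[OF assms(1), of "%y. ract M y a"] assms ract_closed by (simp add: quotmod_def)
qed

lemma quotmod_component:
 defines "c X i \<equiv> (\<Union>y\<in>X. N +>\<^bsub>M\<^esub> mg.cp y i)"
 assumes "x : car M"
 shows "c (N +>\<^bsub>M\<^esub> x) i = N +>\<^bsub>M\<^esub> mg.cp x i"
proof -
 have "mg.cp y i \<ominus>\<^bsub>M\<^esub> mg.cp x i : N" if "y : car M" "y \<ominus>\<^bsub>M\<^esub> x : N" for y
 using gsubD(5)[OF N that(2), of i] that assms by (simp add: a_minus_def mg.component_add mg.component_neg)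
 then show ?thesis unfolding c_def
 using coset_UN[OF assms(2), of "%y. mg.cp y i"] assms mg.component_carrier by simp
qed

lemma quotmod_abelian_group: "abelian_group (quotmod M N)"
proof (rule abelian_groupI)
 fix X Y assume "X : car (quotmod M N)" "Y : car (quotmod M N)"
 then obtain x y where xy: "X = N +>\<^bsub>M\<^esub> x" "x : car M" "Y = N +>\<^bsub>M\<^esub> y" "y : car M"
 by (auto simp: quotmod_sel)
 show "X \<oplus>\<^bsub>quotmod M N\<^esub> Y : car (quotmod M N)"
 using xy by (simp add: quotmod_sel coset_add)
 show "X \<oplus>\<^bsub>quotmod M N\<^esub> Y = Y \<oplus>\<^bsub>quotmod M N\<^esub> X"
 using xy by (simp add: quotmod_sel coset_add mod.a_comm)
 show "\<zero>\<^bsub>quotmod M N\<^esub> \<oplus>\<^bsub>quotmod M N\<^esub> X = X"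
 using xy coset_add[of "\<zero>\<^bsub>M\<^esub>" x] by (simp add: quotmod_sel coset_zero)
 show "EX Z:car (quotmod M N). Z \<oplus>\<^bsub>quotmod M N\<^esub> X = \<zero>\<^bsub>quotmod M N\<^esub>"
 by (rule bexI[of _ "N +>\<^bsub>M\<^esub> (\<ominus>\<^bsub>M\<^esub> x)"])
 (use xy in \<open>simp_all add: quotmod_sel coset_add mod.l_neg coset_zero\<close>)
 show "X \<oplus>\<^bsub>quotmod M N\<^esub> Y \<oplus>\<^bsub>quotmod M N\<^esub> Z = X \<oplus>\<^bsub>quotmod M N\<^esub> (Y \<oplus>\<^bsub>quotmod M N\<^esub> Z)"
 if Z: "Z : car (quotmod M N)" for Z
 proof -
 obtain z where "Z = N +>\<^bsub>M\<^esub> z" "z : car M" using Z by (auto simp: quotmod_sel)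
 then show ?thesis using xy by (simp add: quotmod_sel coset_add mod.a_assoc)
 qed
next
 show "\<zero>\<^bsub>quotmod M N\<^esub> : car (quotmod M N)"
 using coset_zero imageI[OF mod.zero_closed, of "%x. N +>\<^bsub>M\<^esub> x"] by (simp add: quotmod_sel)
qed

lemma quotmod_module_component:
 shows quotmod_module: "gr_mod K A (quotmod M N)"
 and component_quotmod: "x : car M ==>
 component (quotmod M N) (mdeg (quotmod M N)) (N +>\<^bsub>M\<^esub> x) i = N +>\<^bsub>M\<^esub> mg.cp x i"
proof -
 note ab = quotmod_abelian_group
 interpret q: abelian_group "quotmod M N" by (rule ab)
 define c where "c X i = (\<Union>y\<in>X. N +>\<^bsub>M\<^esub> mg.cp y i)" for X i
 have c: "c (N +>\<^bsub>M\<^esub> x) i = N +>\<^bsub>M\<^esub> mg.cp x i" if "x : car M" for x i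
 unfolding c_def by (rule quotmod_component[OF that])
 have neg: "\<ominus>\<^bsub>quotmod M N\<^esub> (N +>\<^bsub>M\<^esub> x) = N +>\<^bsub>M\<^esub> (\<ominus>\<^bsub>M\<^esub> x)" if "x : car M" for x
 using q.minus_equality[of "N +>\<^bsub>M\<^esub> (\<ominus>\<^bsub>M\<^esub> x)" "N +>\<^bsub>M\<^esub> x"] that
 by (simp add: quotmod_sel coset_add mod.l_neg coset_zero)
 have dec: "direct_sum_decomp (quotmod M N) (mdeg (quotmod M N))
 & (ALL X:car (quotmod M N). component (quotmod M N) (mdeg (quotmod M N)) X = c X)"
 proof (rule direct_sum_decompI[OF ab, where c = c])
 fix i show "subgroup (mdeg (quotmod M N) i) (add_monoid (quotmod M N))"
 proof (rule q.add_subgroupI)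
 fix X Y assume "X : mdeg (quotmod M N) i" "Y : mdeg (quotmod M N) i"
 then obtain x y where xy: "X = N +>\<^bsub>M\<^esub> x" "Y = N +>\<^bsub>M\<^esub> y" "x : mdeg M i" "y : mdeg M i"
 by (auto simp: quotmod_sel)
 then show "X \<oplus>\<^bsub>quotmod M N\<^esub> Y : mdeg (quotmod M N) i"
 using coset_add[OF mg.D_carrier[OF xy(3)] mg.D_carrier[OF xy(4)]] mg.D_add by (simp add: quotmod_sel)
 show "\<ominus>\<^bsub>quotmod M N\<^esub> X : mdeg (quotmod M N) i"
 using xy neg[OF mg.D_carrier[OF xy(3)]] mg.D_neg by (simp add: quotmod_sel)
 next
 show "\<zero>\<^bsub>quotmod M N\<^esub> : mdeg (quotmod M N) i"
 using mg.D_zero[of i] coset_zero by (simp add: quotmod_sel) (metis imageI)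
 qed (use mg.D_carrier in \<open>auto simp: quotmod_sel\<close>)
 next
 fix X assume "X : car (quotmod M N)"
 then obtain x where x: "X = N +>\<^bsub>M\<^esub> x" "x : car M" by (auto simp: quotmod_sel)
 show "c X i : mdeg (quotmod M N) i" for i
 using x c mg.component_props(1) by (simp add: quotmod_sel)
 have "{i. c X i ~= \<zero>\<^bsub>quotmod M N\<^esub>} \<subseteq> {i. mg.cp x i ~= \<zero>\<^bsub>M\<^esub>}"
 using x c coset_zero by (auto simp: quotmod_sel)
 then show "finite {i. c X i ~= \<zero>\<^bsub>quotmod M N\<^esub>}"
 using mg.component_props(2)[OF x(2)] finite_subset by blast
 show "c (X \<oplus>\<^bsub>quotmod M N\<^esub> Y) i = c X i \<oplus>\<^bsub>quotmod M N\<^esub> c Y i" if "Y : car (quotmod M N)" for Y i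
 proof -
 obtain y where y: "Y = N +>\<^bsub>M\<^esub> y" "y : car M" using \<open>Y : car (quotmod M N)\<close> by (auto simp: quotmod_sel)
 show ?thesis using x y c coset_add mg.component_add mg.component_carrier by (simp add: quotmod_sel)
 qed
 show "X = \<zero>\<^bsub>quotmod M N\<^esub>" if z: "!!i. c X i = \<zero>\<^bsub>quotmod M N\<^esub>"
 proof -
 have "mg.cp x i : N" for i
 using z[of i] c[OF x(2)] x coset_self[OF mg.component_carrier[OF x(2)], of i] by (simp add: quotmod_sel)
 then have "x : N" using mg.in_subset_if_components[OF x(2)] gsubD(2,3)[OF N] by blast
 then have "N +>\<^bsub>M\<^esub> x = N +>\<^bsub>M\<^esub> \<zero>\<^bsub>M\<^esub>" using coset_eq_iff[OF x(2)] x(2) by (simp add: mod.minus_zero_right)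
 then show ?thesis using x(1) coset_zero by (simp add: quotmod_sel)
 qed
 next
 fix X i assume "X : mdeg (quotmod M N) i"
 then obtain x where x: "X = N +>\<^bsub>M\<^esub> x" "x : mdeg M i" by (auto simp: quotmod_sel)
 show "c X i = X" using x c[OF mg.D_carrier[OF x(2)]] mg.component_homogeneous[OF x(2)] by simp
 show "c X j = \<zero>\<^bsub>quotmod M N\<^esub>" if "i ~= j" for j
 using x c[OF mg.D_carrier[OF x(2)]] mg.component_homogeneous[OF x(2)] that coset_zero
 by (simp add: quotmod_sel)
 qed
 show "x : car M ==>
 component (quotmod M N) (mdeg (quotmod M N)) (N +>\<^bsub>M\<^esub> x) i = N +>\<^bsub>M\<^esub> mg.cp x i"
 using dec c by (simp add: quotmod_sel)
 show "gr_mod K A (quotmod M N)"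
 proof (intro graded_right_module.intro graded_right_module_axioms.intro)
 fix X a assume "X : car (quotmod M N)" and a: "a : car A"
 then obtain x where x: "X = N +>\<^bsub>M\<^esub> x" "x : car M" by (auto simp: quotmod_sel)
 show "ract (quotmod M N) X a : car (quotmod M N)"
 using x a quotmod_ract ract_closed by (simp add: quotmod_sel)
 show "ract (quotmod M N) (X \<oplus>\<^bsub>quotmod M N\<^esub> Y) a = ract (quotmod M N) X a \<oplus>\<^bsub>quotmod M N\<^esub> ract (quotmod M N) Y a"
 if "Y : car (quotmod M N)" for Y
 proof -
 obtain y where y: "Y = N +>\<^bsub>M\<^esub> y" "y : car M" using \<open>Y : car (quotmod M N)\<close> by (auto simp: quotmod_sel)
 show "ract (quotmod M N) (X \<oplus>\<^bsub>quotmod M N\<^esub> Y) a = ract (quotmod M N) X a \<oplus>\<^bsub>quotmod M N\<^esub> ract (quotmod M N) Y a"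
 using x y a by (simp add: quotmod_sel coset_add quotmod_ract ract_add_left ract_closed)
 qed
 show "ract (quotmod M N) X (a \<oplus>\<^bsub>A\<^esub> b) = ract (quotmod M N) X a \<oplus>\<^bsub>quotmod M N\<^esub> ract (quotmod M N) X b"
 if "b : car A" for b
 using x a that by (simp add: quotmod_sel coset_add quotmod_ract ract_add_right ract_closed)
 show "ract (quotmod M N) X (a \<otimes>\<^bsub>A\<^esub> b) = ract (quotmod M N) (ract (quotmod M N) X a) b"
 if "b : car A" for b
 using x a that by (simp add: quotmod_ract ract_mult ract_closed)
 next
 fix X assume "X : car (quotmod M N)"
 then obtain x where x: "X = N +>\<^bsub>M\<^esub> x" "x : car M" by (auto simp: quotmod_sel)
 show "ract (quotmod M N) X \<one>\<^bsub>A\<^esub> = X"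
 using x quotmod_ract by (simp add: ract_one)
 next
 fix X i a j assume "X : mdeg (quotmod M N) i" and a: "a : adeg A j"
 then obtain x where x: "X = N +>\<^bsub>M\<^esub> x" "x : mdeg M i" by (auto simp: quotmod_sel)
 show "ract (quotmod M N) X a : mdeg (quotmod M N) (i + int j)"
 using x a quotmod_ract[OF mg.D_carrier[OF x(2)] adeg_carrier[OF a]] mdeg_ract[OF x(2) a]
 by (simp add: quotmod_sel)
 qed (rule graded_algebra_axioms, rule ab, rule dec[THEN conjunct1])
qed

end

end

context tame_module begin

lemma in_Fdim_submod:
 assumes N: "gsub A M N"
 shows "in_Fdim K A (submod M N) \<longleftrightarrow> N \<subseteq> tors A M"
proof -
 interpret s: tame_module K A "submod M N"
 by (rule tame_module.intro[OF tame_algebra_axioms gsub_submod[OF N]])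
 show ?thesis using s.in_Fdim_iff gsubD(1)[OF N] by (auto simp: sat_def)
qed

lemma in_Fdim_quotmod:
 assumes N: "gsub A M N"
 shows "in_Fdim K A (quotmod M N) \<longleftrightarrow> car M \<subseteq> sat A M N"
proof -
 interpret q: tame_module K A "quotmod M N"
 by (rule tame_module.intro[OF tame_algebra_axioms quotmod_module[OF N]])
 have "ract (quotmod M N) (N +>\<^bsub>M\<^esub> x) a = \<zero>\<^bsub>quotmod M N\<^esub> \<longleftrightarrow> ract M x a : N"
 if "x : car M" "a : adeg A j" for x a j
 proof -
 note a = adeg_carrier[OF that(2)]
 note xa = ract_closed[OF that(1) a]
 show ?thesis
 using quotmod_ract[OF N that(1) a] coset_eq_iff[OF N xa mod.zero_closed] coset_zero[OF N] xa
 by (simp add: quotmod_sel(3)[OF N] mod.minus_zero_right)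
 qed
 then have "N +>\<^bsub>M\<^esub> x : tors A (quotmod M N) \<longleftrightarrow> x : sat A M N" if "x : car M" for x
 using that by (simp add: sat_def quotmod_sel(1)[OF N])
 then show ?thesis unfolding q.in_Fdim_iff by (auto simp: quotmod_sel(1)[OF N])
qed

end

text \<open>Relations between \<open>M\<close> and \<open>N\<close> are submodules of this module.\<close>

definition prodmod :: "('a, 'm) graded_module => ('a, 'n) graded_module => ('a, 'm \<times> 'n) graded_module" where
 "prodmod M N = \<lparr> carrier = car M \<times> car N, mult = undefined, one = undefined,
 zero = (\<zero>\<^bsub>M\<^esub>, \<zero>\<^bsub>N\<^esub>), add = (%x y. (fst x \<oplus>\<^bsub>M\<^esub> fst y, snd x \<oplus>\<^bsub>N\<^esub> snd y)),
 ract = (%x a. (ract M (fst x) a, ract N (snd x) a)),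
 mdeg = (%i. mdeg M i \<times> mdeg N i) \<rparr>"

lemma prodmod_sel [simp]:
 "car (prodmod M N) = car M \<times> car N" "zero (prodmod M N) = (\<zero>\<^bsub>M\<^esub>, \<zero>\<^bsub>N\<^esub>)"
 "x \<oplus>\<^bsub>prodmod M N\<^esub> y = (fst x \<oplus>\<^bsub>M\<^esub> fst y, snd x \<oplus>\<^bsub>N\<^esub> snd y)"
 "ract (prodmod M N) x a = (ract M (fst x) a, ract N (snd x) a)"
 "mdeg (prodmod M N) i = mdeg M i \<times> mdeg N i" by (simp_all add: prodmod_def)

lemma prodmod_module_component:
 assumes "gr_mod K A M" "gr_mod K A N"
 shows prodmod_module: "gr_mod K A (prodmod M N)"
 and component_prodmod: "x : car (prodmod M N) ==>
 component (prodmod M N) (mdeg (prodmod M N)) x i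
 = (component M (mdeg M) (fst x) i, component N (mdeg N) (snd x) i)"
proof -
 interpret M: graded_right_module K A M by fact
 interpret N: graded_right_module K A N by fact
 have ab: "abelian_group (prodmod M N)"
 proof (rule abelian_groupI)
 fix x assume x: "x : car (prodmod M N)"
 show "EX y:car (prodmod M N). y \<oplus>\<^bsub>prodmod M N\<^esub> x = \<zero>\<^bsub>prodmod M N\<^esub>"
 using x by (intro bexI[of _ "(\<ominus>\<^bsub>M\<^esub> fst x, \<ominus>\<^bsub>N\<^esub> snd x)"]) (auto simp: M.mod.l_neg N.mod.l_neg)
 next
 fix x y z
 assume "x : car (prodmod M N)" "y : car (prodmod M N)" "z : car (prodmod M N)"
 then show "x \<oplus>\<^bsub>prodmod M N\<^esub> y \<oplus>\<^bsub>prodmod M N\<^esub> z = x \<oplus>\<^bsub>prodmod M N\<^esub> (y \<oplus>\<^bsub>prodmod M N\<^esub> z)"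
 by (auto simp: M.mod.a_assoc N.mod.a_assoc)
 qed (auto simp: M.mod.a_comm N.mod.a_comm)
 interpret p: abelian_group "prodmod M N" by (rule ab)
 have neg: "\<ominus>\<^bsub>prodmod M N\<^esub> x = (\<ominus>\<^bsub>M\<^esub> fst x, \<ominus>\<^bsub>N\<^esub> snd x)" if "x : car (prodmod M N)" for x
 using p.minus_equality[of "(\<ominus>\<^bsub>M\<^esub> fst x, \<ominus>\<^bsub>N\<^esub> snd x)" x] that by (auto simp: M.mod.l_neg N.mod.l_neg)
 let ?c = "%x i. (M.mg.cp (fst x) i, N.mg.cp (snd x) i)"
 have dec: "direct_sum_decomp (prodmod M N) (mdeg (prodmod M N))
 & (ALL x:car (prodmod M N). component (prodmod M N) (mdeg (prodmod M N)) x = ?c x)"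
 proof (rule direct_sum_decompI[OF ab, where c = ?c])
 fix i show "subgroup (mdeg (prodmod M N) i) (add_monoid (prodmod M N))" by (rule p.add_subgroupI)
 (use M.mg.D_carrier N.mg.D_carrier in \<open>auto simp: neg M.mg.D_zero N.mg.D_zero M.mg.D_add N.mg.D_add
 M.mg.D_neg N.mg.D_neg\<close>)
 next
 fix x assume x: "x : car (prodmod M N)"
 show "?c x i : mdeg (prodmod M N) i" for i using x M.mg.component_props(1) N.mg.component_props(1) by auto
 have "{i. ?c x i ~= \<zero>\<^bsub>prodmod M N\<^esub>} \<subseteq>
 {i. M.mg.cp (fst x) i ~= \<zero>\<^bsub>M\<^esub>} \<union> {i. N.mg.cp (snd x) i ~= \<zero>\<^bsub>N\<^esub>}" by auto
 then show "finite {i. ?c x i ~= \<zero>\<^bsub>prodmod M N\<^esub>}"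
 using x M.mg.component_props(2) N.mg.component_props(2) by (auto intro: finite_subset)
 show "x = \<zero>\<^bsub>prodmod M N\<^esub>" if z: "!!i. ?c x i = \<zero>\<^bsub>prodmod M N\<^esub>"
 proof -
 have "fst x = \<zero>\<^bsub>M\<^esub>" by (rule M.mg.components_zero) (use x z in auto)
 moreover have "snd x = \<zero>\<^bsub>N\<^esub>" by (rule N.mg.components_zero) (use x z in auto)
 ultimately show ?thesis by (simp add: prod_eq_iff)
 qed
 qed (auto simp: M.mg.component_add N.mg.component_add M.mg.component_homogeneous N.mg.component_homogeneous)
 show "x : car (prodmod M N) ==>
 component (prodmod M N) (mdeg (prodmod M N)) x i = ?c x i" using dec[THEN conjunct2, rule_format, of x] by simp
 show "gr_mod K A (prodmod M N)" by (intro graded_right_module.intro graded_right_module_axioms.intro)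
 (use M.graded_algebra_axioms ab dec[THEN conjunct1] in \<open>auto simp: M.ract_closed N.ract_closed M.ract_add_left
 N.ract_add_left M.ract_add_right N.ract_add_right M.ract_mult N.ract_mult M.ract_one N.ract_one
 M.mdeg_ract N.mdeg_ract\<close>)
qed

section \<open>Morphisms of the quotient category as linear relations\<close>

text \<open>Relations that are defined on \<open>M\<close> and single valued, both up to torsion.\<close>

definition almost :: "('k, 'a) graded_algebra => ('a, 'm) graded_module => ('a, 'n) graded_module =>
 ('m \<times> 'n) set => bool" where
 "almost A M N G \<longleftrightarrow> gsub A (prodmod M N) G & car M \<subseteq> sat A M (Domain G) &
 G `` {\<zero>\<^bsub>M\<^esub>} \<subseteq> tors A N"

abbreviation rsat :: "('k, 'a) graded_algebra => ('a, 'm) graded_module => ('a, 'n) graded_module =>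
 ('m \<times> 'n) set => ('m \<times> 'n) set" where
 "rsat A M N G \<equiv> sat A (prodmod M N) G"

locale graded_pair = M: graded_right_module K A M + N: graded_right_module K A N for K A M N
begin

sublocale MN: graded_right_module K A "prodmod M N"
 by (rule prodmod_module[OF M.graded_right_module_axioms N.graded_right_module_axioms])

lemma component_pair: "(m, n) : car (prodmod M N) ==> MN.mg.cp (m, n) i = (M.mg.cp m i, N.mg.cp n i)"
 using component_prodmod[OF M.graded_right_module_axioms N.graded_right_module_axioms, of "(m, n)"] by simp

lemma gsub_relD:
 assumes G: "gsub A (prodmod M N) G"
 shows "(m, n) : G ==> m : car M" "(m, n) : G ==> n : car N" "(\<zero>\<^bsub>M\<^esub>, \<zero>\<^bsub>N\<^esub>) : G"
 "[| (m, n) : G; (m', n') : G |] ==> (m \<oplus>\<^bsub>M\<^esub> m', n \<oplus>\<^bsub>N\<^esub> n') : G"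
 "[| (m, n) : G; (m', n') : G |] ==> (m \<ominus>\<^bsub>M\<^esub> m', n \<ominus>\<^bsub>N\<^esub> n') : G"
 "[| (m, n) : G; a : car A |] ==> (ract M m a, ract N n a) : G"
 "(m, n) : G ==> (M.mg.cp m i, N.mg.cp n i) : G"
proof -
 note g = gsubD[OF G]
 show c: "m : car M" "n : car N" if "(m, n) : G" for m n using g(1)[OF that] by auto
 show "(\<zero>\<^bsub>M\<^esub>, \<zero>\<^bsub>N\<^esub>) : G" using g(2) by simp
 show add: "(m \<oplus>\<^bsub>M\<^esub> m', n \<oplus>\<^bsub>N\<^esub> n') : G" if "(m, n) : G" "(m', n') : G" for m n m' n'
 using g(3)[OF that] by simp
 show r: "(ract M m a, ract N n a) : G" if "(m, n) : G" "a : car A" for m n a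
 using MN.gsub_ract[OF G that] by simp
 show "(m \<ominus>\<^bsub>M\<^esub> m', n \<ominus>\<^bsub>N\<^esub> n') : G" if "(m, n) : G" "(m', n') : G"
 proof -
 have "(\<ominus>\<^bsub>M\<^esub> m', \<ominus>\<^bsub>N\<^esub> n') : G"
 using r[OF that(2), of "\<ominus>\<^bsub>A\<^esub> \<one>\<^bsub>A\<^esub>"] c[OF that(2)]
 by (simp add: M.ract_neg_right N.ract_neg_right M.ract_one N.ract_one)
 then show ?thesis using add[OF that(1)] by (simp add: a_minus_def)
 qed
 show "(M.mg.cp m i, N.mg.cp n i) : G" if "(m, n) : G"
 using g(5)[OF that, of i] component_pair[OF g(1)[OF that], of i] by simp
qed

lemma gsub_relI:
 assumes "G \<subseteq> car M \<times> car N" "(\<zero>\<^bsub>M\<^esub>, \<zero>\<^bsub>N\<^esub>) : G"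
 "!!m n m' n'. [| (m, n) : G; (m', n') : G |] ==> (m \<oplus>\<^bsub>M\<^esub> m', n \<oplus>\<^bsub>N\<^esub> n') : G"
 "!!m n a j. [| (m, n) : G; a : adeg A j |] ==> (ract M m a, ract N n a) : G"
 "!!m n i. (m, n) : G ==> (M.mg.cp m i, N.mg.cp n i) : G"
 shows "gsub A (prodmod M N) G"
 unfolding gsub_def
proof (intro conjI ballI allI)
 show "component (prodmod M N) (mdeg (prodmod M N)) x i : G" if "x : G" for x i
 using that assms(1,5) component_pair[of "fst x" "snd x" i] by (cases x) auto
 show "x \<oplus>\<^bsub>prodmod M N\<^esub> y : G" if "x : G" "y : G" for x y
 using that assms(3)[of "fst x" "snd x" "fst y" "snd y"] by simp
 show "ract (prodmod M N) x a : G" if "a : adeg A j" "x : G" for j a x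
 using that assms(4)[of "fst x" "snd x" a j] by simp
qed (use assms(1,2) in auto)

lemma gsub_Domain: "gsub A (prodmod M N) G ==> gsub A M (Domain G)"
proof -
 assume G: "gsub A (prodmod M N) G"
 note g = gsub_relD[OF G]
 show ?thesis
 unfolding gsub_def
 proof (intro conjI ballI allI)
 show "\<zero>\<^bsub>M\<^esub> : Domain G" using g(3) by blast
 show "x \<oplus>\<^bsub>M\<^esub> y : Domain G" if "x : Domain G" "y : Domain G" for x y using that g(4) by blast
 show "ract M x a : Domain G" if "a : adeg A j" "x : Domain G" for j a x
 using that g(6) M.adeg_carrier by blast
 show "M.mg.cp x i : Domain G" if "x : Domain G" for x i using that g(7) by blast
 qed (use g(1) in blast)
qed

lemma gsub_zero_image: "gsub A (prodmod M N) G ==> gsub A N (G `` {\<zero>\<^bsub>M\<^esub>})"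
proof -
 assume G: "gsub A (prodmod M N) G"
 note g = gsub_relD[OF G]
 show ?thesis
 unfolding gsub_def
 proof (intro conjI ballI allI)
 show "\<zero>\<^bsub>N\<^esub> : G `` {\<zero>\<^bsub>M\<^esub>}" using g(3) by blast
 show "x \<oplus>\<^bsub>N\<^esub> y : G `` {\<zero>\<^bsub>M\<^esub>}" if "x : G `` {\<zero>\<^bsub>M\<^esub>}" "y : G `` {\<zero>\<^bsub>M\<^esub>}" for x y
 using that g(4)[of "\<zero>\<^bsub>M\<^esub>" x "\<zero>\<^bsub>M\<^esub>" y] by simp
 show "ract N x a : G `` {\<zero>\<^bsub>M\<^esub>}" if "a : adeg A j" "x : G `` {\<zero>\<^bsub>M\<^esub>}" for j a x
 using that g(6)[of "\<zero>\<^bsub>M\<^esub>" x a] M.adeg_carrier by simp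
 show "N.mg.cp x i : G `` {\<zero>\<^bsub>M\<^esub>}" if "x : G `` {\<zero>\<^bsub>M\<^esub>}" for x i
 using that g(7)[of "\<zero>\<^bsub>M\<^esub>" x i] by simp
 qed (use g(2) in blast)
qed

end

locale tame_pair = tame_algebra K A + graded_pair K A M N for K A M N
begin

sublocale M: tame_module K A M ..
sublocale N: tame_module K A N ..
sublocale MN: tame_module K A "prodmod M N" ..

lemma almostD:
 assumes "almost A M N G"
 shows "gsub A (prodmod M N) G" "m : car M ==> m : sat A M (Domain G)" "(\<zero>\<^bsub>M\<^esub>, n) : G ==> n : tors A N"
 using assms unfolding almost_def by auto

text \<open>If \<open>(0, n)\<close> is in the saturation, then \<open>n a\<close> is torsion for all \<open>a\<close> of large degree, and
  torsion is closed under extensions.\<close>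

lemma almost_rsat:
 assumes G: "almost A M N G"
 shows "almost A M N (rsat A M N G)"
 unfolding almost_def
proof (intro conjI)
 note g = almostD[OF G]
 show "gsub A (prodmod M N) (rsat A M N G)" by (rule MN.sat_gsub[OF g(1)])
 have "Domain G \<subseteq> Domain (rsat A M N G)" using MN.subset_sat[OF g(1)] by blast
 then show "car M \<subseteq> sat A M (Domain (rsat A M N G))" using M.sat_mono g(2) by blast
 show "rsat A M N G `` {\<zero>\<^bsub>M\<^esub>} \<subseteq> tors A N"
 proof
 fix n assume "n : rsat A M N G `` {\<zero>\<^bsub>M\<^esub>}"
 then have n: "(\<zero>\<^bsub>M\<^esub>, n) : rsat A M N G" by simp
 obtain k where k: "!!j a. k <= j ==> a : adeg A j ==> ract (prodmod M N) (\<zero>\<^bsub>M\<^esub>, n) a : G"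
 using n by (rule MN.satE) blast
 have "n : sat A N (tors A N)"
 proof (rule N.satI[of _ k])
 show "n : car N" using MN.sat_carrier[OF n] by simp
 show "ract N n a : tors A N" if "k <= j" "a : adeg A j" for j a
 using k[OF that] g(3) adeg_carrier[OF that(2)] by simp
 qed
 then show "n : tors A N" using N.sat_sat[OF N.gsub_zero] by simp
 qed
qed

text \<open>For \<open>(m, n)\<close> in the larger relation and \<open>a\<close> of large degree, \<open>m a\<close> is in the domain of
  the smaller one. The two values of \<open>m a\<close> differ by a torsion element, so that \<open>(m, n)\<close> lies in
  the saturation of the smaller relation.\<close>

lemma rsat_eq_if_subset:
 assumes G: "almost A M N G" and H: "almost A M N H" and sub: "G \<subseteq> H"
 shows "rsat A M N G = rsat A M N H"
proof
 note g = almostD[OF G] and h = almostD[OF H]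
 note hr = gsub_relD[OF h(1)]
 have gs: "gsub A (prodmod M N) (rsat A M N G)" by (rule MN.sat_gsub[OF g(1)])
 show "rsat A M N G \<subseteq> rsat A M N H" by (rule MN.sat_mono[OF sub])
 have "(m, n) : rsat A M N G" if mn: "(m, n) : H" for m n
 proof -
 note c = hr(1,2)[OF mn]
 have "m : sat A M (Domain G)" using g(2) c by blast
 then obtain k where k: "!!j a. k <= j ==> a : adeg A j ==> ract M m a : Domain G" by (rule M.satE) blast
 have "(m, n) : rsat A M N (rsat A M N G)"
 proof (rule MN.satI[of _ k])
 show "(m, n) : car (prodmod M N)" using c by simp
 fix j a assume "k <= j" and a: "a : adeg A j"
 note ac = adeg_carrier[OF a]
 obtain n' where n': "(ract M m a, n') : G" using k[OF \<open>k <= j\<close> a] by blast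
 have n'c: "n' : car N" using gsub_relD(2)[OF g(1) n'] .
 have na: "ract N n a : car N" and ma: "ract M m a : car M"
 using c ac by (simp_all add: N.ract_closed M.ract_closed)
 have "(ract M m a \<ominus>\<^bsub>M\<^esub> ract M m a, ract N n a \<ominus>\<^bsub>N\<^esub> n') : H"
 using hr(5)[OF hr(6)[OF mn ac]] n' sub by blast
 then have t: "ract N n a \<ominus>\<^bsub>N\<^esub> n' : tors A N" using h(3) ma by (simp add: a_minus_def M.mod.r_neg)
 then obtain l where l: "!!j b. l <= j ==> b : adeg A j ==> ract N (ract N n a \<ominus>\<^bsub>N\<^esub> n') b = \<zero>\<^bsub>N\<^esub>"
 by (rule N.satE) blast
 have "(\<zero>\<^bsub>M\<^esub>, ract N n a \<ominus>\<^bsub>N\<^esub> n') : rsat A M N G"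
 by (rule MN.satI[of _ l])
 (use l N.sat_carrier[OF t] gsub_relD(3)[OF g(1)] adeg_carrier in auto)
 moreover have "(ract M m a, n') : rsat A M N G" using MN.subset_sat[OF g(1)] n' by blast
 ultimately have "(\<zero>\<^bsub>M\<^esub> \<oplus>\<^bsub>M\<^esub> ract M m a, (ract N n a \<ominus>\<^bsub>N\<^esub> n') \<oplus>\<^bsub>N\<^esub> n') : rsat A M N G"
 by (rule gsub_relD(4)[OF gs])
 then show "ract (prodmod M N) (m, n) a : rsat A M N G"
 using na ma n'c by (simp add: N.mod.minus_add_cancel)
 qed
 then show ?thesis using MN.sat_sat[OF g(1)] by simp
 qed
 then have "rsat A M N H \<subseteq> rsat A M N (rsat A M N G)" by (intro MN.sat_mono) auto
 then show "rsat A M N H \<subseteq> rsat A M N G" using MN.sat_sat[OF g(1)] by simp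
qed

lemma rsat_rsat: "almost A M N G ==> rsat A M N (rsat A M N G) = rsat A M N G"
 using MN.sat_sat almostD(1) by blast

end

lemma (in tame_algebra) tame_pairI:
 "gr_mod K A M ==> graded_right_module K A N ==> tame_pair K A M N"
 by (intro tame_pair.intro graded_pair.intro tame_algebra_axioms)

context tame_algebra begin

text \<open>Both conditions follow from those on the factors because an iterated saturation is a
  saturation.\<close>

lemma almost_comp:
 assumes mod: "gr_mod K A M" "gr_mod K A N" "gr_mod K A P"
 and G: "almost A M N G" and H: "almost A N P H"
 shows "almost A M P (G O H)"
proof -
 interpret MN: tame_pair K A M N by (rule tame_pairI[OF mod(1,2)])
 interpret NP: tame_pair K A N P by (rule tame_pairI[OF mod(2,3)])
 interpret MP: tame_pair K A M P by (rule tame_pairI[OF mod(1,3)])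
 note g = MN.almostD[OF G] and h = NP.almostD[OF H]
 note gr = MN.gsub_relD[OF g(1)] and hr = NP.gsub_relD[OF h(1)]
 have sub: "gsub A (prodmod M P) (G O H)"
 proof (rule MP.gsub_relI)
 show "G O H \<subseteq> car M \<times> car P" using gr(1) hr(2) by blast
 show "(\<zero>\<^bsub>M\<^esub>, \<zero>\<^bsub>P\<^esub>) : G O H" using gr(3) hr(3) by blast
 show "(m \<oplus>\<^bsub>M\<^esub> m', p \<oplus>\<^bsub>P\<^esub> p') : G O H" if "(m, p) : G O H" "(m', p') : G O H" for m p m' p'
 using that gr(4) hr(4) by blast
 show "(ract M m a, ract P p a) : G O H" if "(m, p) : G O H" "a : adeg A j" for m p a j
 using that gr(6) hr(6) adeg_carrier by blast
 show "(MN.M.mg.cp m i, NP.N.mg.cp p i) : G O H" if "(m, p) : G O H" for m p i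
 using that gr(7) hr(7) by blast
 qed
 show ?thesis
 unfolding almost_def
 proof (intro conjI sub subsetI)
 fix m assume m: "m : car M"
 then have "m : sat A M (Domain G)" using g(2) by blast
 then obtain k where k: "!!j a. k <= j ==> a : adeg A j ==> ract M m a : Domain G" by (rule MN.M.satE) blast
 have "m : sat A M (sat A M (Domain (G O H)))"
 proof (rule MN.M.satI[OF m, of k])
 fix j a assume "k <= j" and a: "a : adeg A j"
 obtain n where n: "(ract M m a, n) : G" using k[OF \<open>k <= j\<close> a] by blast
 have "n : sat A N (Domain H)" using h(2) gr(2)[OF n] by blast
 then obtain l where l: "!!j b. l <= j ==> b : adeg A j ==> ract N n b : Domain H" by (rule MN.N.satE) blast
 show "ract M m a : sat A M (Domain (G O H))"
 proof (rule MN.M.satI[of _ l])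
 show "ract M (ract M m a) b : Domain (G O H)" if "l <= j" "b : adeg A j" for j b
 using l[OF that] gr(6)[OF n adeg_carrier[OF that(2)]] by blast
 qed (use gr(1)[OF n] in simp)
 qed
 then show "m : sat A M (Domain (G O H))" using MN.M.sat_sat[OF MP.gsub_Domain[OF sub]] by simp
 next
 fix p assume "p : (G O H) `` {\<zero>\<^bsub>M\<^esub>}"
 then obtain n where n: "(\<zero>\<^bsub>M\<^esub>, n) : G" "(n, p) : H" by blast
 obtain k where k: "!!j a. k <= j ==> a : adeg A j ==> ract N n a = \<zero>\<^bsub>N\<^esub>"
 using g(3)[OF n(1)] by (rule MN.N.satE) blast
 have "p : sat A P (tors A P)"
 proof (rule NP.N.satI[of _ k])
 fix j a assume "k <= j" and a: "a : adeg A j"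
 then show "ract P p a : tors A P"
 using hr(6)[OF n(2) adeg_carrier[OF a]] k h(3) by simp
 qed (rule hr(2)[OF n(2)])
 then show "p : tors A P" using NP.N.sat_sat[OF NP.N.gsub_zero] by simp
 qed
qed

lemma rsat_comp_eq:
 assumes mod: "gr_mod K A M" "gr_mod K A N" "gr_mod K A P"
 and G: "almost A M N G" "almost A M N G'" "rsat A M N G = rsat A M N G'"
 and H: "almost A N P H" "almost A N P H'" "rsat A N P H = rsat A N P H'"
 shows "rsat A M P (G O H) = rsat A M P (G' O H')"
proof -
 interpret MN: tame_pair K A M N by (rule tame_pairI[OF mod(1,2)])
 interpret NP: tame_pair K A N P by (rule tame_pairI[OF mod(2,3)])
 interpret MP: tame_pair K A M P by (rule tame_pairI[OF mod(1,3)])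
 have *: "rsat A M P (G O H) = rsat A M P (rsat A M N G O rsat A N P H)"
 if "almost A M N G" "almost A N P H" for G H
 proof (rule MP.rsat_eq_if_subset)
 show "almost A M P (G O H)" by (rule almost_comp[OF mod that])
 show "almost A M P (rsat A M N G O rsat A N P H)"
 by (rule almost_comp[OF mod MN.almost_rsat[OF that(1)] NP.almost_rsat[OF that(2)]])
 show "G O H \<subseteq> rsat A M N G O rsat A N P H"
 using MN.MN.subset_sat[OF MN.almostD(1)[OF that(1)]] NP.MN.subset_sat[OF NP.almostD(1)[OF that(2)]] by blast
 qed
 show ?thesis using *[OF G(1) H(1)] *[OF G(2) H(2)] G(3) H(3) by simp
qed

lemma almost_Id_on:
 assumes "gr_mod K A M" "gsub A M D" "car M \<subseteq> sat A M D"
 shows "almost A M M (Id_on D)"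
proof -
 interpret MM: tame_pair K A M M by (rule tame_pairI[OF assms(1,1)])
 have "gsub A (prodmod M M) (Id_on D)" by (rule MM.gsub_relI) (use gsubD[OF assms(2)] in auto)
 moreover have "\<zero>\<^bsub>M\<^esub> : tors A M" by (rule MM.M.satI[of _ 0]) (auto simp: adeg_carrier)
 ultimately show ?thesis using assms(3) by (auto simp: almost_def)
qed

end

subsection \<open>Fractions\<close>

text \<open>The values of a fraction are cosets, so its graph is the union of these cosets over its domain;
  the torsion part is recovered as the fibre over 0.\<close>

definition graph :: "'m set \<times> 'n set \<times> ('m => 'n set) => ('m \<times> 'n) set" where
 "graph r = {(m, n). m : fst r & n : snd (snd r) m}"

lemma graph_Pair: "(m, n) : graph (D, T, h) \<longleftrightarrow> m : D & n : h m" by (simp add: graph_def)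

lemma graph_frac_comp: "graph (frac_comp s r) = graph r O graph s"
proof -
 obtain N'' P'' g M' N' f where "s = (N'', P'', g)" "r = (M', N', f)" by (metis prod_cases3)
 then show ?thesis by (auto simp: frac_comp_def graph_def relcomp_def)
qed

locale frac_pair = tame_pair K A M N for K A and M N :: "('b, 'u) graded_module"
begin

text \<open>A triple is a fraction iff its graph is an almost map that determines the triple.\<close>

lemma frac_almost:
 assumes "(D, T, h) : fracs K A M N"
 shows "almost A M N (graph (D, T, h)) & h \<zero>\<^bsub>M\<^esub> = T & (ALL m:D. h m ~= {})"
proof -
 have D: "gsub A M D" and T: "gsub A N T"
 using assms unfolding fracs_def M.gr_submodule_iff N.gr_submodule_iff by blast+
 have Ds: "car M \<subseteq> sat A M D" and Tt: "T \<subseteq> tors A N" and h: "h : gr_hom A (submod M D) (quotmod N T)"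
 using assms M.in_Fdim_quotmod[OF D] N.in_Fdim_submod[OF T] unfolding fracs_def by blast+
 note qs = N.quotmod_sel[OF T]
 interpret s: graded_right_module K A "submod M D" by (rule M.gsub_submod[OF D])
 interpret q: graded_right_module K A "quotmod N T" by (rule N.quotmod_module[OF T])
 have hq: "h m : car (quotmod N T)" if "m : D" for m
 using h that by (simp add: gr_hom_def hom_def Pi_iff)
 have hc: "EX n:car N. h m = T +>\<^bsub>N\<^esub> n" if "m : D" for m
 using hq[OF that] by (auto simp: qs)
 have hadd: "h (m \<oplus>\<^bsub>M\<^esub> m') = h m <+>\<^bsub>N\<^esub> h m'" if "m : D" "m' : D" for m m'
 using h that unfolding gr_hom_def hom_def by (simp add: qs)
 have hract: "h (ract M m a) = ract (quotmod N T) (h m) a" if "m : D" "a : car A" for m a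
 using h that unfolding gr_hom_def by simp
 have hdeg: "h m : mdeg (quotmod N T) i" if "m : mdeg M i" "m : D" for m i
 proof -
 have "h ` (mdeg M i \<inter> D) \<subseteq> mdeg (quotmod N T) i" using h by (simp add: gr_hom_def)
 then show ?thesis using that by blast
 qed
 have h0: "h \<zero>\<^bsub>M\<^esub> = T"
 proof -
 have "h \<zero>\<^bsub>M\<^esub> \<oplus>\<^bsub>quotmod N T\<^esub> h \<zero>\<^bsub>M\<^esub> = h \<zero>\<^bsub>M\<^esub>"
 using hadd[OF gsubD(2)[OF D] gsubD(2)[OF D]] by (simp add: qs)
 moreover have "h \<zero>\<^bsub>M\<^esub> : car (quotmod N T)" using hc[OF gsubD(2)[OF D]] by (auto simp: qs)
 ultimately have "h \<zero>\<^bsub>M\<^esub> = \<zero>\<^bsub>quotmod N T\<^esub>" by simp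
 then show ?thesis by (simp add: qs)
 qed
 have hcp: "q.mg.cp (h m) i = h (s.mg.cp m i)" if "m : car (submod M D)" for m i
 using that
 proof (induction m rule: s.mg.homogeneous_induct)
 case zero then show ?case using h0 q.mg.component_zero s.mg.component_zero by (simp add: qs)
 next
 case (hom j x)
 have "h x : mdeg (quotmod N T) j" using hdeg hom by simp
 then show ?case using q.mg.component_homogeneous s.mg.component_homogeneous[OF hom] h0 by (simp add: qs)
 next
 case (add x y)
 then have "h x : car (quotmod N T)" "h y : car (quotmod N T)" using hq by simp_all
 then have "q.mg.cp (h x <+>\<^bsub>N\<^esub> h y) i = q.mg.cp (h x) i <+>\<^bsub>N\<^esub> q.mg.cp (h y) i"
 using q.mg.component_add[of "h x" "h y" i] by (simp add: qs)
 moreover have "s.mg.cp x i : D" "s.mg.cp y i : D" using s.mg.component_carrier add by auto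
 ultimately show ?case using add hadd s.mg.component_add[of x y i] by simp
 qed
 have mem: "n : h m \<longleftrightarrow> n : car N & h m = T +>\<^bsub>N\<^esub> n" if m: "m : D" for m n
 proof -
 obtain n' where n': "n' : car N" "h m = T +>\<^bsub>N\<^esub> n'" using hc[OF m] by blast
 show ?thesis using n' N.coset_mem[OF T n'(1)] N.coset_eqI[OF T n'(1), of n] N.coset_self[OF T, of n] by auto
 qed
 have "gsub A (prodmod M N) (graph (D, T, h))"
 proof (rule gsub_relI)
 show "graph (D, T, h) \<subseteq> car M \<times> car N" using mem gsubD(1)[OF D] by (auto simp: graph_def)
 show "(\<zero>\<^bsub>M\<^esub>, \<zero>\<^bsub>N\<^esub>) : graph (D, T, h)" using h0 gsubD(2)[OF D] gsubD(2)[OF T] by (simp add: graph_Pair)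
 fix m n assume "(m, n) : graph (D, T, h)"
 then have m: "m : D" and n: "n : car N" "h m = T +>\<^bsub>N\<^esub> n" using mem by (auto simp: graph_Pair)
 show "(m \<oplus>\<^bsub>M\<^esub> m', n \<oplus>\<^bsub>N\<^esub> n') : graph (D, T, h)" if mn': "(m', n') : graph (D, T, h)" for m' n'
 proof -
 have m': "m' : D" and n': "n' : car N" "h m' = T +>\<^bsub>N\<^esub> n'" using mem mn' by (auto simp: graph_Pair)
 show ?thesis
 using hadd[OF m m'] n n' N.coset_add[OF T n(1) n'(1)] mem[OF gsubD(3)[OF D m m']] gsubD(3)[OF D m m']
 by (simp add: graph_Pair)
 qed
 show "(ract M m a, ract N n a) : graph (D, T, h)" if a: "a : adeg A j" for a j
 using hract[OF m adeg_carrier[OF a]] n N.quotmod_ract[OF T n(1) adeg_carrier[OF a]]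
 mem[OF gsubD(4)[OF D m a]] gsubD(4)[OF D m a] N.ract_closed[OF n(1) adeg_carrier[OF a]]
 by (simp add: graph_Pair)
 show "(M.mg.cp m i, N.mg.cp n i) : graph (D, T, h)" for i
 using hcp[of m i] m n M.component_submod[OF D m] N.component_quotmod[OF T n(1), of i]
 mem[OF gsubD(5)[OF D m, of i]] gsubD(5)[OF D m, of i] N.mg.component_carrier[OF n(1)]
 by (simp add: graph_Pair)
 qed
 moreover have "h m ~= {}" if "m : D" for m using hc[OF that] N.coset_self[OF T] by blast
 moreover from this have "Domain (graph (D, T, h)) = D" by (auto simp: graph_def)
 moreover have "graph (D, T, h) `` {\<zero>\<^bsub>M\<^esub>} = T" using h0 gsubD(2)[OF D] by (auto simp: graph_def)
 ultimately show ?thesis unfolding almost_def using Ds Tt h0 by simp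
qed

lemma fracsI:
 assumes G: "almost A M N (graph (D, T, h))" and h0: "h \<zero>\<^bsub>M\<^esub> = T" and ne: "!!m. m : D ==> h m ~= {}"
 shows "(D, T, h) : fracs K A M N"
proof -
 define H where "H = graph (D, T, h)"
 note g = almostD[OF G[folded H_def]]
 note gr = gsub_relD[OF g(1)]
 have dom: "Domain H = D" using ne by (auto simp: graph_def H_def)
 have D: "gsub A M D" using gsub_Domain[OF g(1)] dom by simp
 have T0: "H `` {\<zero>\<^bsub>M\<^esub>} = T" using h0 gsubD(2)[OF D] by (auto simp: graph_def H_def)
 have T: "gsub A N T" using gsub_zero_image[OF g(1)] T0 by simp
 note qs = N.quotmod_sel[OF T]
 have coset: "h m = T +>\<^bsub>N\<^esub> n" if mn: "(m, n) : H" for m n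
 proof -
 note mc = gr(1)[OF mn] and nc = gr(2)[OF mn]
 have m: "m : D" using mn by (simp add: H_def graph_Pair)
 have "n' : h m \<longleftrightarrow> n' : T +>\<^bsub>N\<^esub> n" for n'
 proof
 assume "n' : h m"
 then have n': "(m, n') : H" using m by (simp add: H_def graph_Pair)
 have "(m \<ominus>\<^bsub>M\<^esub> m, n' \<ominus>\<^bsub>N\<^esub> n) : H" by (rule gr(5)[OF n' mn])
 then have "n' \<ominus>\<^bsub>N\<^esub> n : T" using T0 mc by (auto simp: a_minus_def M.mod.r_neg)
 then show "n' : T +>\<^bsub>N\<^esub> n" using N.coset_mem[OF T nc] gr(2)[OF n'] by blast
 next
 assume "n' : T +>\<^bsub>N\<^esub> n"
 then have n': "n' : car N" "(\<zero>\<^bsub>M\<^esub>, n' \<ominus>\<^bsub>N\<^esub> n) : H" using N.coset_mem[OF T nc] T0 by auto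
 have "(\<zero>\<^bsub>M\<^esub> \<oplus>\<^bsub>M\<^esub> m, (n' \<ominus>\<^bsub>N\<^esub> n) \<oplus>\<^bsub>N\<^esub> n) : H" by (rule gr(4)[OF n'(2) mn])
 then show "n' : h m" using mc nc n' by (simp add: N.mod.minus_add_cancel H_def graph_Pair)
 qed
 then show ?thesis by blast
 qed
 have ex: "EX n. (m, n) : H" if "m : D" for m using that dom by blast
 have "h : gr_hom A (submod M D) (quotmod N T)"
 unfolding gr_hom_def hom_def
 proof (intro CollectI conjI ballI allI Pi_I image_subsetI; simp add: qs)
 fix m assume m: "m : D"
 then obtain n where n: "(m, n) : H" using ex by blast
 show "h m : (%x. T +>\<^bsub>N\<^esub> x) ` car N" using coset[OF n] gr(2)[OF n] by blast
 show "h (m \<oplus>\<^bsub>M\<^esub> m') = h m <+>\<^bsub>N\<^esub> h m'" if m': "m' : D" for m'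
 proof -
 obtain n' where n': "(m', n') : H" using ex m' by blast
 show ?thesis using coset[OF gr(4)[OF n n']] coset[OF n] coset[OF n'] N.coset_add[OF T gr(2)[OF n] gr(2)[OF n']]
 by simp
 qed
 show "h (ract M m a) = ract (quotmod N T) (h m) a" if a: "a : car A" for a
 using coset[OF gr(6)[OF n a]] coset[OF n] N.quotmod_ract[OF T gr(2)[OF n] a] by simp
 next
 fix i m assume m: "m : mdeg M i & m : D"
 then obtain n where n: "(m, n) : H" using ex by blast
 have "(m, N.mg.cp n i) : H" using gr(7)[OF n, of i] M.mg.component_homogeneous[of m i i] m by simp
 from coset[OF this] show "h m : (%x. T +>\<^bsub>N\<^esub> x) ` mdeg N i"
 using N.mg.component_props(1)[OF gr(2)[OF n]] by blast
 qed
 moreover have "car M \<subseteq> sat A M D" "T \<subseteq> tors A N" using g(2,3) dom T0 by auto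
 ultimately show ?thesis
 unfolding fracs_def M.gr_submodule_iff N.gr_submodule_iff
 using D T M.in_Fdim_quotmod[OF D] N.in_Fdim_submod[OF T] by simp
qed

lemma frac_graph_almost: "r : fracs K A M N ==> almost A M N (graph r)"
 using frac_almost[of "fst r" "fst (snd r)" "snd (snd r)"] by simp

lemma almost_is_graph:
 assumes G: "almost A M N G"
 shows "EX r : fracs K A M N. graph r = G"
proof -
 have "graph (Domain G, G `` {\<zero>\<^bsub>M\<^esub>}, %m. G `` {m}) = G" by (auto simp: graph_def)
 moreover from this have "(Domain G, G `` {\<zero>\<^bsub>M\<^esub>}, %m. G `` {m}) : fracs K A M N"
 using G by (intro fracsI) auto
 ultimately show ?thesis by blast
qed

end

text \<open>In this direct limit two homomorphisms are identified iff their graphs have the same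
  saturation.\<close>

lemma (in tame_algebra) frac_rel_iff:
 fixes M N :: "('b, 'u) graded_module"
 assumes mod: "gr_mod K A M" "gr_mod K A N"
 shows "(r, s) : frac_rel K A M N \<longleftrightarrow>
 r : fracs K A M N & s : fracs K A M N & rsat A M N (graph r) = rsat A M N (graph s)"
proof -
 interpret frac_pair K A M N by (rule frac_pair.intro[OF tame_pairI[OF mod]])
 obtain M1 N1 f1 where r: "r = (M1, N1, f1)" by (metis prod_cases3)
 obtain M2 N2 f2 where s: "s = (M2, N2, f2)" by (metis prod_cases3)
 have coset: "f m <+>\<^bsub>N\<^esub> N' = N' +>\<^bsub>N\<^esub> n"
 if fr: "(D, T, f) : fracs K A M N" and N': "gsub A N N'" "T \<subseteq> N'" and mn: "(m, n) : graph (D, T, f)"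
 for D T f N' m n
 proof -
 note fa = frac_almost[OF fr]
 note g = almostD[OF fa[THEN conjunct1]]
 note gr = gsub_relD[OF g(1)]
 note nc = gr(2)[OF mn] and mc = gr(1)[OF mn]
 have m: "m : D" and n: "n : f m" using mn by (simp_all add: graph_Pair)
 show ?thesis
 proof (rule equalityI; rule subsetI)
 fix y assume "y : f m <+>\<^bsub>N\<^esub> N'"
 then obtain n' t where y: "n' : f m" "t : N'" "y = n' \<oplus>\<^bsub>N\<^esub> t" unfolding set_add_def' by blast
 have n': "(m, n') : graph (D, T, f)" using m y by (simp add: graph_Pair)
 have "(m \<ominus>\<^bsub>M\<^esub> m, n' \<ominus>\<^bsub>N\<^esub> n) : graph (D, T, f)" by (rule gr(5)[OF n' mn])
 then have "n' \<ominus>\<^bsub>N\<^esub> n : N'" using mc fa N'(2) by (auto simp: a_minus_def M.mod.r_neg graph_Pair)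
 then have "(n' \<ominus>\<^bsub>N\<^esub> n) \<oplus>\<^bsub>N\<^esub> t : N'" using y(2) gsubD(3)[OF N'(1)] by blast
 moreover have "(n' \<ominus>\<^bsub>N\<^esub> n) \<oplus>\<^bsub>N\<^esub> t = y \<ominus>\<^bsub>N\<^esub> n"
 using nc gr(2)[OF n'] gsubD(1)[OF N'(1) y(2)] y(3) by (simp add: a_minus_def N.mod.a_ac)
 ultimately show "y : N' +>\<^bsub>N\<^esub> n"
 using N.coset_mem[OF N'(1) nc] gr(2)[OF n'] gsubD(1)[OF N'(1) y(2)] y(3) by simp
 next
 fix y assume "y : N' +>\<^bsub>N\<^esub> n"
 then have y: "y : car N" "y \<ominus>\<^bsub>N\<^esub> n : N'" using N.coset_mem[OF N'(1) nc] by auto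
 have "y = n \<oplus>\<^bsub>N\<^esub> (y \<ominus>\<^bsub>N\<^esub> n)"
 using y nc N.mod.minus_add_cancel[of y n] N.mod.a_comm[of n "y \<ominus>\<^bsub>N\<^esub> n"] by simp
 then show "y : f m <+>\<^bsub>N\<^esub> N'" unfolding set_add_def' using n y(2) by blast
 qed
 qed
 show ?thesis
 proof
 assume "(r, s) : frac_rel K A M N"
 then obtain M' N' where fr: "r : fracs K A M N" "s : fracs K A M N"
 and M': "gsub A M M'" "car M \<subseteq> sat A M M'" "M' \<subseteq> M1 \<inter> M2"
 and N': "gsub A N N'" "N' \<subseteq> tors A N" "N1 \<union> N2 \<subseteq> N'"
 and eq: "ALL m:M'. f1 m <+>\<^bsub>N\<^esub> N' = f2 m <+>\<^bsub>N\<^esub> N'"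
 unfolding frac_rel_def r s M.gr_submodule_iff N.gr_submodule_iff
 using M.in_Fdim_quotmod N.in_Fdim_submod by blast
 note fr' = fr[unfolded r s]
 \<comment> \<open>both graphs contain, up to \<open>N'\<close>, the graph of their common restriction\<close>
 define H where "H = {(m, n). m : M' & n : car N & f1 m <+>\<^bsub>N\<^esub> N' = N' +>\<^bsub>N\<^esub> n}"
 have *: "rsat A M N (graph (D, T, f)) = rsat A M N H"
 if fr: "(D, T, f) : fracs K A M N" and sub: "M' \<subseteq> D" "T \<subseteq> N'"
 and eqf: "!!m. m : M' ==> f1 m <+>\<^bsub>N\<^esub> N' = f m <+>\<^bsub>N\<^esub> N'" for D T f
 proof -
 define G where "G = graph (D, T, f)"
 note fa = frac_almost[OF fr]
 note g = almostD[OF fa[THEN conjunct1, folded G_def]]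
 note gr = gsub_relD[OF g(1)]
 define G' where "G' = {(m, n) : G. m : M'}"
 have ex: "EX n. (m, n) : G'" if "m : M'" for m
 proof -
 have "m : D" using that sub(1) by blast
 then have "f m ~= {}" using fa by blast
 then show ?thesis using that \<open>m : D\<close> by (auto simp: G'_def G_def graph_def)
 qed
 have dom: "Domain G' = M'" using ex by (auto simp: G'_def)
 have sub': "gsub A (prodmod M N) G'" by (rule gsub_relI)
 (use gr gsubD[OF M'(1)] adeg_carrier in \<open>auto simp: G'_def\<close>)
 have G'G: "G' \<subseteq> G" by (auto simp: G'_def)
 have G': "almost A M N G'"
 unfolding almost_def using sub' dom M'(2) g(3) G'G by auto
 have HG: "(m, n) : H \<longleftrightarrow> m : M' & n : car N & (EX n'. (m, n') : G' & n \<ominus>\<^bsub>N\<^esub> n' : N')" for m n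
 proof (cases "m : M'")
 case True
 have "f1 m <+>\<^bsub>N\<^esub> N' = N' +>\<^bsub>N\<^esub> n'" if "(m, n') : G'" for n'
 using coset[OF fr N'(1) sub(2), of m n'] that eqf[OF True] by (simp add: G'_def G_def)
 moreover have "n' : car N" if "(m, n') : G'" for n' using that gr(2) by (auto simp: G'_def)
 ultimately show ?thesis using ex[OF True] True N.coset_eq_iff[OF N'(1), of n]
 N.coset_eq_iff[OF N'(1), of _ n] by (auto simp: H_def) (metis N.coset_eq_iff N'(1))+
 qed (simp add: H_def)
 have HI: "(m, n) : H" if "(m, n') : G'" "n : car N" "n \<ominus>\<^bsub>N\<^esub> n' : N'" for m n n'
 using HG that by (auto simp: G'_def)
 have G'H: "G' \<subseteq> H"
 proof
 fix x assume "x : G'"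
 moreover obtain m n where x: "x = (m, n)" by (cases x)
 ultimately show "x : H" using HG[of m n] gr(2)[of m n] gsubD(2)[OF N'(1)] dom
 by (auto simp: G'_def a_minus_def N.mod.r_neg)
 qed
 have "gsub A (prodmod M N) H"
 proof (rule gsub_relI)
 show "H \<subseteq> car M \<times> car N" using gsubD(1)[OF M'(1)] by (auto simp: H_def)
 show "(\<zero>\<^bsub>M\<^esub>, \<zero>\<^bsub>N\<^esub>) : H" using gsubD(2)[OF sub'] G'H by auto
 fix m n assume mn: "(m, n) : H"
 then obtain n0 where n: "m : M'" "n : car N" "(m, n0) : G'" "n \<ominus>\<^bsub>N\<^esub> n0 : N'" using HG by blast
 have n0: "n0 : car N" using n(3) gr(2) by (auto simp: G'_def)
 show "(m \<oplus>\<^bsub>M\<^esub> m', n \<oplus>\<^bsub>N\<^esub> n') : H" if "(m', n') : H" for m' n'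
 proof -
 obtain n1 where n': "m' : M'" "n' : car N" "(m', n1) : G'" "n' \<ominus>\<^bsub>N\<^esub> n1 : N'"
 using HG[of m' n'] \<open>(m', n') : H\<close> by blast
 have n1: "n1 : car N" using n'(3) gr(2) by (auto simp: G'_def)
 have "(n \<oplus>\<^bsub>N\<^esub> n') \<ominus>\<^bsub>N\<^esub> (n0 \<oplus>\<^bsub>N\<^esub> n1) = (n \<ominus>\<^bsub>N\<^esub> n0) \<oplus>\<^bsub>N\<^esub> (n' \<ominus>\<^bsub>N\<^esub> n1)"
 using n(2) n'(2) n0 n1 by (simp add: a_minus_def N.mod.a_ac N.mod.minus_add)
 then show ?thesis
 using n n' HI[OF gsub_relD(4)[OF sub' n(3) n'(3)]] gsubD(3)[OF N'(1) n(4) n'(4)] by simp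
 qed
 show "(ract M m a, ract N n a) : H" if a: "a : adeg A j" for a j
 proof -
 have "ract N n a \<ominus>\<^bsub>N\<^esub> ract N n0 a = ract N (n \<ominus>\<^bsub>N\<^esub> n0) a"
 using n n0 adeg_carrier[OF a] by (simp add: a_minus_def N.ract_add_left N.ract_neg_left)
 then show ?thesis
 using n HI[OF gsub_relD(6)[OF sub' n(3) adeg_carrier[OF a]]]
 gsubD(4)[OF N'(1) n(4) a] N.ract_closed adeg_carrier[OF a] by simp
 qed
 show "(M.mg.cp m i, N.mg.cp n i) : H" for i
 proof -
 have "N.mg.cp n i \<ominus>\<^bsub>N\<^esub> N.mg.cp n0 i = N.mg.cp (n \<ominus>\<^bsub>N\<^esub> n0) i"
 using n n0 by (simp add: a_minus_def N.mg.component_add N.mg.component_neg)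
 then show ?thesis
 using n HI[OF gsub_relD(7)[OF sub' n(3)]]
 gsubD(5)[OF N'(1) n(4)] N.mg.component_carrier by simp
 qed
 qed
 moreover have "car M \<subseteq> sat A M (Domain H)"
 using M'(2) M.sat_mono[of M' "Domain H"] dom G'H by blast
 moreover have "n : tors A N" if n0H: "(\<zero>\<^bsub>M\<^esub>, n) : H" for n
 proof -
 obtain n0 where n: "n : car N" "(\<zero>\<^bsub>M\<^esub>, n0) : G'" "n \<ominus>\<^bsub>N\<^esub> n0 : N'"
 using n0H HG[of "\<zero>\<^bsub>M\<^esub>" n] by blast
 have "n0 : tors A N" using g(3) n(2) by (auto simp: G'_def)
 moreover have "n \<ominus>\<^bsub>N\<^esub> n0 : tors A N" using n(3) N'(2) by blast
 ultimately have "(n \<ominus>\<^bsub>N\<^esub> n0) \<oplus>\<^bsub>N\<^esub> n0 : tors A N"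
 using gsubD(3)[OF N.sat_gsub[OF N.gsub_zero]] by blast
 then show ?thesis using n(1) N.sat_carrier[OF \<open>n0 : tors A N\<close>] by (simp add: N.mod.minus_add_cancel)
 qed
 ultimately have H: "almost A M N H" unfolding almost_def by blast
 show ?thesis
 using rsat_eq_if_subset[OF G' _ G'G] rsat_eq_if_subset[OF G' H G'H] fa by (simp add: G_def)
 qed
 have "rsat A M N (graph r) = rsat A M N H" using *[OF fr'(1)] M'(3) N'(3) r by simp
 moreover have "rsat A M N (graph s) = rsat A M N H" using *[OF fr'(2)] M'(3) N'(3) s eq by simp
 ultimately show "r : fracs K A M N & s : fracs K A M N & rsat A M N (graph r) = rsat A M N (graph s)"
 using fr by simp
 next
 assume a: "r : fracs K A M N & s : fracs K A M N & rsat A M N (graph r) = rsat A M N (graph s)"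
 then have fr: "(M1, N1, f1) : fracs K A M N" "(M2, N2, f2) : fracs K A M N" by (simp_all add: r s)
 have D: "gsub A M M1" "gsub A M M2" "gsub A N N1" "gsub A N N2"
 using fr unfolding fracs_def M.gr_submodule_iff N.gr_submodule_iff by blast+
 have t: "car M \<subseteq> sat A M M1" "car M \<subseteq> sat A M M2" "N1 \<subseteq> tors A N" "N2 \<subseteq> tors A N"
 using fr M.in_Fdim_quotmod[OF D(1)] M.in_Fdim_quotmod[OF D(2)]
 N.in_Fdim_submod[OF D(3)] N.in_Fdim_submod[OF D(4)] unfolding fracs_def by blast+
 let ?M' = "M1 \<inter> M2" and ?N' = "tors A N"
 have M': "gsub A M ?M'" using M.gsub_Int[OF D(1,2)] .
 have N': "gsub A N ?N'" using N.sat_gsub[OF N.gsub_zero] .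
 have Ms: "car M \<subseteq> sat A M ?M'"
 proof
 fix m assume m: "m : car M"
 obtain k where k: "!!j a. k <= j ==> a : adeg A j ==> ract M m a : M1" using t(1) m M.satE by blast
 obtain l where l: "!!j a. l <= j ==> a : adeg A j ==> ract M m a : M2" using t(2) m M.satE by blast
 show "m : sat A M ?M'" by (rule M.satI[OF m, of "max k l"]) (use k l in auto)
 qed
 have "f1 m <+>\<^bsub>N\<^esub> ?N' = f2 m <+>\<^bsub>N\<^esub> ?N'" if m: "m : ?M'" for m
 proof -
 note fa = frac_almost[OF fr(1)] frac_almost[OF fr(2)]
 obtain n1 where n1: "(m, n1) : graph (M1, N1, f1)" using fa(1) m by (auto simp: graph_Pair)
 obtain n2 where n2: "(m, n2) : graph (M2, N2, f2)" using fa(2) m by (auto simp: graph_Pair)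
 note g = almostD[OF fa(1)[THEN conjunct1]] almostD[OF fa(2)[THEN conjunct1]]
 let ?R = "rsat A M N (graph (M1, N1, f1))"
 have R: "almost A M N ?R" using almost_rsat fa(1) by blast
 have "(m, n1) : ?R" using MN.subset_sat[OF g(1)] n1 by blast
 moreover have "(m, n2) : ?R" using MN.subset_sat[OF g(4)] n2 a by (auto simp: r s)
 ultimately have "(m \<ominus>\<^bsub>M\<^esub> m, n1 \<ominus>\<^bsub>N\<^esub> n2) : ?R" by (rule gsub_relD(5)[OF almostD(1)[OF R]])
 moreover have "m \<ominus>\<^bsub>M\<^esub> m = \<zero>\<^bsub>M\<^esub>" using gsubD(1)[OF D(1)] m by (simp add: a_minus_def M.mod.r_neg)
 ultimately have "n1 \<ominus>\<^bsub>N\<^esub> n2 : ?N'" using almostD(3)[OF R] by simp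
 then have "?N' +>\<^bsub>N\<^esub> n1 = ?N' +>\<^bsub>N\<^esub> n2"
 using N.coset_eq_iff[OF N'] gsub_relD(2)[OF g(1) n1] gsub_relD(2)[OF g(4) n2] by blast
 then show ?thesis using coset[OF fr(1) N' t(3) n1] coset[OF fr(2) N' t(4) n2] by simp
 qed
 then show "(r, s) : frac_rel K A M N"
 unfolding frac_rel_def r s M.gr_submodule_iff N.gr_submodule_iff
 using fr M' N' M.in_Fdim_quotmod[OF M'] N.in_Fdim_submod[OF N'] Ms t(3,4) by blast
 qed
qed

section \<open>The quotient category\<close>

text \<open>The arrow that is represented by the fractions whose graph has the same saturation as \<open>G\<close>.\<close>

definition qarr :: "'k ring => ('k, 'a) graded_algebra => ('a, 'u) graded_module => ('a, 'u) graded_module =>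
 ('u \<times> 'u) set => ('a, 'u) qgr_arrow" where
 "qarr K A M N G = (M, N, {r : fracs K A M N. rsat A M N (graph r) = rsat A M N G})"

lemma UN_UN_const:
 assumes "X ~= {}" "Y ~= {}" "!!r s. r : X ==> s : Y ==> f s r = Z"
 shows "(\<Union>s\<in>Y. \<Union>r\<in>X. f s r) = Z"
 using assms by fastforce

lemma Obj_QGr: "M : Obj (QGr K A) \<longleftrightarrow> graded_right_module K A M" by (simp add: QGr_def)

context tame_algebra begin

lemma frac_pairI:
 "gr_mod K A M ==> graded_right_module K A N ==> frac_pair K A M N" by (intro frac_pair.intro tame_pairI)

lemma frac_rel_Image:
 assumes "gr_mod K A M" "gr_mod K A N" "r : fracs K A M N"
 shows "frac_rel K A M N `` {r} = {s : fracs K A M N. rsat A M N (graph s) = rsat A M N (graph r)}"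
 using frac_rel_iff[OF assms(1,2), of r] assms(3) by auto

lemma Hom_QGr:
 assumes mod: "gr_mod K A M" "gr_mod K A N"
 shows "Hom (QGr K A) M N = {qarr K A M N G | G. almost A M N G}"
proof -
 interpret frac_pair K A M N by (rule frac_pairI[OF mod])
 have "X : fracs K A M N // frac_rel K A M N \<longleftrightarrow>
 (EX G. almost A M N G & X = {r : fracs K A M N. rsat A M N (graph r) = rsat A M N G})" for X
 proof
 assume "X : fracs K A M N // frac_rel K A M N"
 then obtain r where "r : fracs K A M N" "X = frac_rel K A M N `` {r}" by (rule quotientE)
 then show "EX G. almost A M N G & X = {r : fracs K A M N. rsat A M N (graph r) = rsat A M N G}"
 using frac_rel_Image[OF mod] frac_graph_almost by blast
 next
 assume "EX G. almost A M N G & X = {r : fracs K A M N. rsat A M N (graph r) = rsat A M N G}"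
 then obtain G where G: "almost A M N G" "X = {r : fracs K A M N. rsat A M N (graph r) = rsat A M N G}" by blast
 obtain r where r: "r : fracs K A M N" "graph r = G" using almost_is_graph[OF G(1)] by blast
 then have "X = frac_rel K A M N `` {r}" using frac_rel_Image[OF mod r(1)] G(2) by simp
 then show "X : fracs K A M N // frac_rel K A M N" using quotientI[OF r(1)] by simp
 qed
 then show ?thesis by (auto simp: QGr_def qarr_def)
qed

lemma qarr_Hom:
 "[| gr_mod K A M; gr_mod K A N; almost A M N G |] ==> qarr K A M N G : Hom (QGr K A) M N"
 using Hom_QGr by blast

lemma qarr_eq_iff:
 assumes mod: "gr_mod K A M" "gr_mod K A N" and G: "almost A M N G" "almost A M N H"
 shows "qarr K A M N G = qarr K A M N H \<longleftrightarrow> rsat A M N G = rsat A M N H"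
proof
 interpret frac_pair K A M N by (rule frac_pairI[OF mod])
 assume e: "qarr K A M N G = qarr K A M N H"
 obtain r where "r : fracs K A M N" "graph r = G" using almost_is_graph[OF G(1)] by blast
 then have "r : snd (snd (qarr K A M N G))" "graph r = G" by (simp_all add: qarr_def)
 then show "rsat A M N G = rsat A M N H" unfolding e by (simp add: qarr_def)
qed (simp add: qarr_def)

text \<open>The saturation is itself the graph of a representative, the largest one. So an arrow of the
  quotient category determines a canonical relation.\<close>

lemma UN_graph_qarr:
 assumes mod: "gr_mod K A M" "gr_mod K A N" and G: "almost A M N G"
 shows "\<Union> (graph ` snd (snd (qarr K A M N G))) = rsat A M N G"
proof -
 interpret frac_pair K A M N by (rule frac_pairI[OF mod])
 obtain r where r: "r : fracs K A M N" "graph r = rsat A M N G"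
 using almost_is_graph[OF almost_rsat[OF G]] by blast
 then have "r : snd (snd (qarr K A M N G))" using rsat_rsat[OF G] by (simp add: qarr_def)
 then have "rsat A M N G \<subseteq> \<Union> (graph ` snd (snd (qarr K A M N G)))" using r(2) by blast
 moreover have "graph s \<subseteq> rsat A M N G" if "s : snd (snd (qarr K A M N G))" for s
 proof -
 have s: "s : fracs K A M N" "rsat A M N (graph s) = rsat A M N G" using that by (simp_all add: qarr_def)
 show ?thesis using MN.subset_sat[OF almostD(1)[OF frac_graph_almost[OF s(1)]]] s(2) by simp
 qed
 ultimately show ?thesis by blast
qed

lemma Cmp_qarr:
 assumes mod: "gr_mod K A M" "gr_mod K A N" "gr_mod K A P"
 and G: "almost A M N G" and H: "almost A N P H"
 shows "Cmp (QGr K A) (qarr K A N P H) (qarr K A M N G) = qarr K A M P (G O H)"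
proof -
 interpret MN: frac_pair K A M N by (rule frac_pairI[OF mod(1,2)])
 interpret NP: frac_pair K A N P by (rule frac_pairI[OF mod(2,3)])
 interpret MP: frac_pair K A M P by (rule frac_pairI[OF mod(1,3)])
 let ?X = "{r : fracs K A M N. rsat A M N (graph r) = rsat A M N G}"
 let ?Y = "{r : fracs K A N P. rsat A N P (graph r) = rsat A N P H}"
 let ?Z = "{r : fracs K A M P. rsat A M P (graph r) = rsat A M P (G O H)}"
 have Z: "frac_rel K A M P `` {frac_comp s r} = ?Z" if r: "r : ?X" and s: "s : ?Y" for r s
 proof -
 have ra: "almost A M N (graph r)" and sa: "almost A N P (graph s)"
 using r s MN.frac_graph_almost NP.frac_graph_almost by auto
 have rs: "rsat A M P (graph r O graph s) = rsat A M P (G O H)"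
 by (rule rsat_comp_eq[OF mod ra G _ sa H]) (use r s in auto)
 have "frac_comp s r : fracs K A M P"
 proof -
 obtain N'' P'' g where s': "s = (N'', P'', g)" by (metis prod_cases3)
 obtain M' N' f where r': "r = (M', N', f)" by (metis prod_cases3)
 obtain D T h where c: "frac_comp s r = (D, T, h)" by (metis prod_cases3)
 have fa: "f \<zero>\<^bsub>M\<^esub> = N'" "!!n. n : N'' ==> g n ~= {}"
 using MN.frac_almost[of M' N' f] NP.frac_almost[of N'' P'' g] r s by (auto simp: r' s')
 have "almost A M P (graph (D, T, h))"
 using graph_frac_comp[of s r] almost_comp[OF mod ra sa] c by simp
 then show ?thesis unfolding c by (rule MP.fracsI) (use c fa in \<open>auto simp: s' r' frac_comp_def\<close>)
 qed
 then show ?thesis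
 using frac_rel_Image[OF mod(1,3)] rs graph_frac_comp[of s r] by simp
 qed
 have "?X ~= {}" "?Y ~= {}" using MN.almost_is_graph[OF G] NP.almost_is_graph[OF H] by blast+
 then have "(\<Union>s\<in>?Y. \<Union>r\<in>?X. frac_rel K A M P `` {frac_comp s r}) = ?Z"
 using Z by (rule UN_UN_const)
 then show ?thesis by (simp add: QGr_def qarr_def)
qed

lemma zero_coset: "gr_mod K A M ==> x : car M ==> {\<zero>\<^bsub>M\<^esub>} +>\<^bsub>M\<^esub> x = {x}"
proof -
 assume "gr_mod K A M" and x: "x : car M"
 then interpret graded_right_module K A M by simp
 show "{\<zero>\<^bsub>M\<^esub>} +>\<^bsub>M\<^esub> x = {x}" using x by (simp add: a_r_coset_def')
qed

lemma almost_Id: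
 assumes "gr_mod K A M"
 shows "almost A M M (Id_on (car M))"
proof -
 interpret graded_right_module K A M by fact
 show ?thesis by (rule almost_Id_on[OF assms gsub_carrier subset_sat[OF gsub_carrier]])
qed

lemma Idn_qarr:
 assumes mod: "gr_mod K A M"
 shows "Idn (QGr K A) M = qarr K A M M (Id_on (car M))"
proof -
 interpret frac_pair K A M M by (rule frac_pairI[OF mod mod])
 let ?r = "(car M, {\<zero>\<^bsub>M\<^esub>}, %m. {\<zero>\<^bsub>M\<^esub>} +>\<^bsub>M\<^esub> m)"
 have g: "graph ?r = Id_on (car M)" using zero_coset[OF mod] by (auto simp: graph_def)
 have "?r : fracs K A M M" by (rule fracsI) (use g almost_Id[OF mod] zero_coset[OF mod] in auto)
 then show ?thesis using frac_rel_Image[OF mod mod, of ?r] g by (simp add: QGr_def qarr_def)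
qed

lemma Id_on_comp:
 assumes "gr_mod K A M" "gr_mod K A N" "almost A M N G"
 shows "Id_on (car M) O G = G" "G O Id_on (car N) = G"
proof -
 have "G \<subseteq> car M \<times> car N" using assms(3) by (auto simp: almost_def gsub_def)
 then show "Id_on (car M) O G = G" "G O Id_on (car N) = G" by auto
qed

lemma category_QGr: "category (QGr K A :: ('b, 'u) qcat)"
proof
 fix x y z w :: "('b, 'u) graded_module" and f g h :: "('b, 'u) qgr_arrow"
 let ?C = "QGr K A :: ('b, 'u) qcat"
 show "Idn ?C x : Hom ?C x x" if "x : Obj ?C"
 proof -
 have o: "gr_mod K A x" using that by (simp add: Obj_QGr)
 show ?thesis unfolding Idn_qarr[OF o] by (rule qarr_Hom[OF o o almost_Id[OF o]])
 qed
 show "Cmp ?C g f : Hom ?C x z"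
 if "x : Obj ?C" "y : Obj ?C" "z : Obj ?C" and f: "f : Hom ?C x y" and g: "g : Hom ?C y z"
 proof -
 have o: "gr_mod K A x" "gr_mod K A y" "gr_mod K A z"
 using that by (simp_all add: Obj_QGr)
 obtain F where F: "f = qarr K A x y F" "almost A x y F" using f Hom_QGr[OF o(1,2)] by blast
 obtain G where G: "g = qarr K A y z G" "almost A y z G" using g Hom_QGr[OF o(2,3)] by blast
 show ?thesis using Cmp_qarr[OF o F(2) G(2)] almost_comp[OF o F(2) G(2)] qarr_Hom[OF o(1,3)] F G by simp
 qed
 show "Cmp ?C (Idn ?C y) f = f" "Cmp ?C f (Idn ?C x) = f"
 if "x : Obj ?C" "y : Obj ?C" and f: "f : Hom ?C x y"
 proof -
 have o: "gr_mod K A x" "gr_mod K A y"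
 using that by (simp_all add: Obj_QGr)
 obtain F where F: "f = qarr K A x y F" "almost A x y F" using f Hom_QGr[OF o(1,2)] by blast
 show "Cmp ?C (Idn ?C y) f = f" "Cmp ?C f (Idn ?C x) = f"
 using Cmp_qarr[OF o o(2) F(2) almost_Id[OF o(2)]] Cmp_qarr[OF o(1) o almost_Id[OF o(1)] F(2)] Id_on_comp[OF o F(2)]
 Idn_qarr[OF o(1)] Idn_qarr[OF o(2)] F(1) by simp_all
 qed
 show "Cmp ?C h (Cmp ?C g f) = Cmp ?C (Cmp ?C h g) f"
 if "w : Obj ?C" "x : Obj ?C" "y : Obj ?C" "z : Obj ?C"
 and f: "f : Hom ?C w x" and g: "g : Hom ?C x y" and h: "h : Hom ?C y z"
 proof -
 have o: "gr_mod K A w" "gr_mod K A x" "gr_mod K A y"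
 "gr_mod K A z" using that by (simp_all add: Obj_QGr)
 obtain F where F: "f = qarr K A w x F" "almost A w x F" using f Hom_QGr[OF o(1,2)] by blast
 obtain G where G: "g = qarr K A x y G" "almost A x y G" using g Hom_QGr[OF o(2,3)] by blast
 obtain H where H: "h = qarr K A y z H" "almost A y z H" using h Hom_QGr[OF o(3,4)] by blast
 show ?thesis
 using Cmp_qarr[OF o(1,2,3) F(2) G(2)] Cmp_qarr[OF o(2,3,4) G(2) H(2)]
 Cmp_qarr[OF o(1,3,4) almost_comp[OF o(1,2,3) F(2) G(2)] H(2)]
 Cmp_qarr[OF o(1,2,4) F(2) almost_comp[OF o(2,3,4) G(2) H(2)]] F G H by (simp add: O_assoc)
 qed
 show "x = w & y = z" if "f : Hom ?C x y" "f : Hom ?C w z"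
 using that by (auto simp: QGr_def)
qed

lemma isomorphic_QGr_iff:
 assumes mod: "gr_mod K A M" "gr_mod K A N"
 shows "isomorphic (QGr K A) M N \<longleftrightarrow> (EX G H. almost A M N G & almost A N M H &
 rsat A M M (G O H) = rsat A M M (Id_on (car M)) &
 rsat A N N (H O G) = rsat A N N (Id_on (car N)))"
proof
 assume "isomorphic (QGr K A) M N"
 then obtain f g where fg: "f : Hom (QGr K A) M N" "g : Hom (QGr K A) N M"
 "Cmp (QGr K A) g f = Idn (QGr K A) M" "Cmp (QGr K A) f g = Idn (QGr K A) N" by (rule isomorphicE)
 obtain G where G: "f = qarr K A M N G" "almost A M N G" using fg(1) Hom_QGr[OF mod] by blast
 obtain H where H: "g = qarr K A N M H" "almost A N M H" using fg(2) Hom_QGr[OF mod(2,1)] by blast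
 have "qarr K A M M (G O H) = qarr K A M M (Id_on (car M))"
 "qarr K A N N (H O G) = qarr K A N N (Id_on (car N))"
 using fg(3,4) Cmp_qarr[OF mod mod(1) G(2) H(2)] Cmp_qarr[OF mod(2,1,2) H(2) G(2)]
 Idn_qarr[OF mod(1)] Idn_qarr[OF mod(2)] G(1) H(1) by simp_all
 then show "EX G H. almost A M N G & almost A N M H &
 rsat A M M (G O H) = rsat A M M (Id_on (car M)) &
 rsat A N N (H O G) = rsat A N N (Id_on (car N))"
 using qarr_eq_iff[OF mod(1,1) almost_comp[OF mod mod(1) G(2) H(2)] almost_Id[OF mod(1)]]
 qarr_eq_iff[OF mod(2,2) almost_comp[OF mod(2,1,2) H(2) G(2)] almost_Id[OF mod(2)]] G(2) H(2) by blast
next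
 assume "EX G H. almost A M N G & almost A N M H &
 rsat A M M (G O H) = rsat A M M (Id_on (car M)) &
 rsat A N N (H O G) = rsat A N N (Id_on (car N))"
 then obtain G H where G: "almost A M N G" and H: "almost A N M H"
 and e: "rsat A M M (G O H) = rsat A M M (Id_on (car M))" "rsat A N N (H O G) = rsat A N N (Id_on (car N))"
 by blast
 show "isomorphic (QGr K A) M N" by (rule isomorphicI[of "qarr K A M N G" _ _ _ "qarr K A N M H"])
 (use e G H mod almost_comp[OF mod mod(1) G H] almost_comp[OF mod(2,1,2) H G] in
 \<open>simp_all add: qarr_Hom Cmp_qarr Idn_qarr qarr_eq_iff almost_Id\<close>)
qed

text \<open>The composites of \<open>G\<close> with its converse contain a restriction of the identity to a submodule with
  torsion quotient.\<close>

lemma isomorphic_QGr_I: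
 assumes mod: "gr_mod K A M" "gr_mod K A N"
 and G: "almost A M N G" "almost A N M (G\<inverse>)"
 shows "isomorphic (QGr K A) M N"
proof -
 have *: "rsat A M M (G O G\<inverse>) = rsat A M M (Id_on (car M))"
 if mod: "gr_mod K A M" "gr_mod K A N"
 and G: "almost A M N G" "almost A N M (G\<inverse>)" for M N :: "('b, 'u) graded_module" and G
 proof -
 interpret MN: frac_pair K A M N by (rule frac_pairI[OF mod])
 interpret MM: frac_pair K A M M by (rule frac_pairI[OF mod(1,1)])
 have D: "almost A M M (Id_on (Domain G))"
 using almost_Id_on[OF mod(1) MN.gsub_Domain[OF MN.almostD(1)[OF G(1)]]] MN.almostD(2)[OF G(1)] by blast
 have "rsat A M M (Id_on (Domain G)) = rsat A M M (G O G\<inverse>)"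
 by (rule MM.rsat_eq_if_subset[OF D almost_comp[OF mod mod(1) G]]) auto
 moreover have "rsat A M M (Id_on (Domain G)) = rsat A M M (Id_on (car M))"
 by (rule MM.rsat_eq_if_subset[OF D almost_Id[OF mod(1)]])
 (use MN.gsub_relD(1)[OF MN.almostD(1)[OF G(1)]] in auto)
 ultimately show ?thesis by simp
 qed
 show ?thesis
 unfolding isomorphic_QGr_iff[OF mod]
 using G *[OF mod G] *[OF mod(2,1) G(2)] G(1) by (intro exI[of _ G] exI[of _ "G\<inverse>"]) simp
qed

end

subsection \<open>The shift\<close>

lemma shift_sel [simp]:
 "car (shift M) = car M" "add (shift M) = add M" "zero (shift M) = zero M"
 "ract (shift M) = ract M" "mdeg (shift M) = (%i. mdeg M (i + 1))" by (simp_all add: shift_def)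

context graded_right_module begin

lemma shift_module_component:
 shows shift_module: "gr_mod K A (shift M)"
 and component_shift: "x : car M ==> component (shift M) (mdeg (shift M)) x i = mg.cp x (i + 1)"
proof -
 have ab: "abelian_group (shift M)"
 proof (rule abelian_groupI)
 fix x assume "x : car (shift M)"
 then show "EX y:car (shift M). y \<oplus>\<^bsub>shift M\<^esub> x = \<zero>\<^bsub>shift M\<^esub>"
 by (intro bexI[of _ "\<ominus>\<^bsub>M\<^esub> x"]) (auto simp: mod.l_neg)
 next
 fix x y z assume "x : car (shift M)" "y : car (shift M)" "z : car (shift M)"
 then show "x \<oplus>\<^bsub>shift M\<^esub> y \<oplus>\<^bsub>shift M\<^esub> z = x \<oplus>\<^bsub>shift M\<^esub> (y \<oplus>\<^bsub>shift M\<^esub> z)"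
 by (simp add: mod.a_assoc)
 qed (auto simp: mod.a_comm)
 interpret s: abelian_group "shift M" by (rule ab)
 have neg: "\<ominus>\<^bsub>shift M\<^esub> x = \<ominus>\<^bsub>M\<^esub> x" if "x : car M" for x
 using s.minus_equality[of "\<ominus>\<^bsub>M\<^esub> x" x] that by (simp add: mod.l_neg)
 have dec: "direct_sum_decomp (shift M) (mdeg (shift M)) &
 (ALL x:car (shift M). component (shift M) (mdeg (shift M)) x = (%i. mg.cp x (i + 1)))"
 proof (rule direct_sum_decompI[OF ab, where c = "%x i. mg.cp x (i + 1)"])
 show "subgroup (mdeg (shift M) i) (add_monoid (shift M))" for i
 by (rule s.add_subgroupI) (auto simp: mg.D_zero mg.D_add mg.D_neg neg mg.D_carrier)
 next
 fix m assume m: "m : car (shift M)"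
 show "mg.cp m (i + 1) : mdeg (shift M) i" for i using m mg.component_props(1) by simp
 have "{i. mg.cp m (i + 1) ~= \<zero>\<^bsub>shift M\<^esub>} = (%i. i - 1) ` {i. mg.cp m i ~= \<zero>\<^bsub>M\<^esub>}"
 by (auto simp: image_iff) (metis diff_add_cancel add_diff_cancel_right')
 then show "finite {i. mg.cp m (i + 1) ~= \<zero>\<^bsub>shift M\<^esub>}" using m mg.component_props(2) by simp
 show "m = \<zero>\<^bsub>shift M\<^esub>" if z: "!!i. mg.cp m (i + 1) = \<zero>\<^bsub>shift M\<^esub>"
 using mg.components_zero[of m] z[of "i - 1" for i] m by simp
 qed (auto simp: mg.component_add mg.component_homogeneous)
 show "x : car M ==> component (shift M) (mdeg (shift M)) x i = mg.cp x (i + 1)"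
 using dec by simp
 show "gr_mod K A (shift M)"
 proof (intro graded_right_module.intro graded_right_module_axioms.intro)
 fix m i a j assume "m : mdeg (shift M) i" "a : adeg A j"
 then show "ract (shift M) m a : mdeg (shift M) (i + int j)"
 using mdeg_ract[of m "i + 1" a j] by (simp add: algebra_simps)
 qed (use ab dec[THEN conjunct1] graded_algebra_axioms in
 \<open>auto simp: ract_closed ract_add_left ract_add_right ract_mult ract_one\<close>)
qed

end

context graded_pair begin

lemma gsub_shift: "gsub A (prodmod (shift M) (shift N)) G \<longleftrightarrow> gsub A (prodmod M N) G"
proof -
 interpret s: graded_pair K A "shift M" "shift N" by (intro graded_pair.intro M.shift_module N.shift_module)
 show ?thesis
 proof
 assume G: "gsub A (prodmod (shift M) (shift N)) G"
 note g = s.gsub_relD[OF G]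
 show "gsub A (prodmod M N) G"
 proof (rule gsub_relI)
 fix m n i assume mn: "(m, n) : G"
 show "(M.mg.cp m i, N.mg.cp n i) : G"
 using g(7)[OF mn, of "i - 1"] g(1,2)[OF mn] M.component_shift[of m "i - 1"] N.component_shift[of n "i - 1"]
 by simp
 next
 show "(ract M m a, ract N n a) : G" if "(m, n) : G" "a : adeg A j" for m n a j
 using g(6)[OF that(1) M.adeg_carrier[OF that(2)]] by simp
 qed (use g(1-4) in auto)
 next
 assume G: "gsub A (prodmod M N) G"
 note g = gsub_relD[OF G]
 show "gsub A (prodmod (shift M) (shift N)) G"
 proof (rule s.gsub_relI)
 fix m n i assume mn: "(m, n) : G"
 show "(s.M.mg.cp m i, s.N.mg.cp n i) : G"
 using g(7)[OF mn, of "i + 1"] g(1,2)[OF mn] M.component_shift N.component_shift by simp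
 next
 show "(ract (shift M) m a, ract (shift N) n a) : G" if "(m, n) : G" "a : adeg A j" for m n a j
 using g(6)[OF that(1) M.adeg_carrier[OF that(2)]] by simp
 qed (use g(1-4) in auto)
 qed
qed

end

lemma sat_shift [simp]: "sat A (shift M) N = sat A M N"
 "sat A (prodmod (shift M) (shift P)) G = sat A (prodmod M P) G" by (simp_all add: sat_def)

lemma (in tame_algebra) almost_shift:
 assumes "gr_mod K A M" "gr_mod K A N"
 shows "almost A (shift M) (shift N) G \<longleftrightarrow> almost A M N G"
 using graded_pair.gsub_shift[OF graded_pair.intro[OF assms]] by (simp add: almost_def)

lemma (in tame_algebra) isomorphic_shift:
 assumes mod: "gr_mod K A M" "gr_mod K A N"
 and "isomorphic (QGr K A) M N"
 shows "isomorphic (QGr K A) (shift M) (shift N)"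
proof -
 note s = graded_right_module.shift_module[OF mod(1)] graded_right_module.shift_module[OF mod(2)]
 show ?thesis
 using assms(3) unfolding isomorphic_QGr_iff[OF s] isomorphic_QGr_iff[OF mod]
 by (simp add: almost_shift[OF mod] almost_shift[OF mod(2,1)])
qed

subsection \<open>Functors between quotient categories\<close>

text \<open>A functor of quotient categories given by a map \<open>R\<close> of modules and a monotone operation \<open>T\<close>
 on relations.\<close>

lemma ff_es_QGrI:
 fixes A :: "('k, 'a) graded_algebra" and B :: "('k, 'b) graded_algebra"
 and R :: "('b, 'u) graded_module => ('a, 'u) graded_module"
 assumes A: "tame_algebra K A" and B: "tame_algebra K B"
 and R: "!!M. graded_right_module K B M ==> graded_right_module K A (R M)"
 and T: "!!M N G. [| gr_mod K B M; gr_mod K B N; almost B M N G |]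
 ==> almost A (R M) (R N) (T M N G)"
 and mono: "!!M N G H. G \<subseteq> H ==> T M N G \<subseteq> T M N H"
 and comp: "!!M N P G H. [| gr_mod K B M; gr_mod K B N; gr_mod K B P;
 almost B M N G; almost B N P H |] ==> T M P (G O H) = T M N G O T N P H"
 and ident: "!!M. graded_right_module K B M ==> T M M (Id_on (car M)) = Id_on (car (R M))"
 and faithful: "!!M N G H. [| gr_mod K B M; gr_mod K B N; almost B M N G;
 almost B M N H; rsat A (R M) (R N) (T M N G) = rsat A (R M) (R N) (T M N H) |]
 ==> rsat B M N G = rsat B M N H"
 and full: "!!M N \<Theta>. [| gr_mod K B M; gr_mod K B N; almost A (R M) (R N) \<Theta> |]
 ==> EX G. almost B M N G & rsat A (R M) (R N) (T M N G) = rsat A (R M) (R N) \<Theta>"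
 and surj: "!!L. graded_right_module K A L ==>
 EX M. graded_right_module K B M & isomorphic (QGr K A) (R M) L"
 shows "EX F. ff_es (QGr K B :: ('b, 'u) qcat)
 (QGr K A :: ('a, 'u) qcat) F & fobj F = R"
proof -
 interpret A: tame_algebra K A by (rule A)
 interpret B: tame_algebra K B by (rule B)
 define F where "F = \<lparr>fobj = R, farr = (%(M, N, X). qarr K A (R M) (R N) (T M N (\<Union> (graph ` X))))\<rparr>"
 have Fq: "farr F (qarr K B M N G) = qarr K A (R M) (R N) (T M N G)"
 if mod: "gr_mod K B M" "gr_mod K B N" and G: "almost B M N G" for M N G
 proof -
 interpret p: frac_pair K B M N by (rule B.frac_pairI[OF mod])
 interpret q: frac_pair K A "R M" "R N" by (rule A.frac_pairI[OF R[OF mod(1)] R[OF mod(2)]])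
 have "farr F (qarr K B M N G) = qarr K A (R M) (R N) (T M N (rsat B M N G))"
 using B.UN_graph_qarr[OF mod G] by (simp add: F_def qarr_def)
 moreover have "rsat A (R M) (R N) (T M N G) = rsat A (R M) (R N) (T M N (rsat B M N G))"
 by (rule q.rsat_eq_if_subset[OF T[OF mod G] T[OF mod p.almost_rsat[OF G]]
 mono[OF p.MN.subset_sat[OF p.almostD(1)[OF G]]]])
 ultimately show ?thesis by (simp add: qarr_def)
 qed
 let ?B = "QGr K B :: ('b, 'u) qcat"
 let ?A = "QGr K A :: ('a, 'u) qcat"
 have F1: "fobj F = R" by (simp add: F_def)
 have Fu: "is_functor ?B ?A F"
 unfolding is_functor_def F1
 proof (intro conjI ballI)
 show "category ?B" "category ?A" by (rule B.category_QGr, rule A.category_QGr)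
 fix x assume x: "x : Obj ?B"
 then have ox: "gr_mod K B x" by (simp add: Obj_QGr)
 show "R x : Obj ?A" using R[OF ox] by (simp add: Obj_QGr)
 show "farr F (Idn ?B x) = Idn ?A (R x)"
 using Fq[OF ox ox B.almost_Id[OF ox]] ident[OF ox] B.Idn_qarr[OF ox] A.Idn_qarr[OF R[OF ox]] by simp
 fix y assume y: "y : Obj ?B"
 then have oy: "gr_mod K B y" by (simp add: Obj_QGr)
 fix f assume "f : Hom ?B x y"
 then obtain G where G: "f = qarr K B x y G" "almost B x y G" using B.Hom_QGr[OF ox oy] by blast
 show "farr F f : Hom ?A (R x) (R y)"
 using Fq[OF ox oy G(2)] A.qarr_Hom[OF R[OF ox] R[OF oy] T[OF ox oy G(2)]] G(1) by simp
 next
 fix x y z f g assume "x : Obj ?B" "y : Obj ?B" "z : Obj ?B" and fg: "f : Hom ?B x y" "g : Hom ?B y z"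
 then have o: "gr_mod K B x" "gr_mod K B y" "gr_mod K B z" by (simp_all add: Obj_QGr)
 obtain G where G: "f = qarr K B x y G" "almost B x y G" using fg(1) B.Hom_QGr[OF o(1,2)] by blast
 obtain H where H: "g = qarr K B y z H" "almost B y z H" using fg(2) B.Hom_QGr[OF o(2,3)] by blast
 show "farr F (Cmp ?B g f) = Cmp ?A (farr F g) (farr F f)"
 using Fq[OF o(1,2) G(2)] Fq[OF o(2,3) H(2)] Fq[OF o(1,3) B.almost_comp[OF o G(2) H(2)]]
 B.Cmp_qarr[OF o G(2) H(2)] comp[OF o G(2) H(2)]
 A.Cmp_qarr[OF R[OF o(1)] R[OF o(2)] R[OF o(3)] T[OF o(1,2) G(2)] T[OF o(2,3) H(2)]] G(1) H(1) by simp
 qed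
 have bij: "bij_betw (farr F) (Hom ?B x y) (Hom ?A (R x) (R y))"
 if "x : Obj ?B" "y : Obj ?B" for x y
 proof -
 have o: "gr_mod K B x" "gr_mod K B y" using that by (simp_all add: Obj_QGr)
 note Ro = R[OF o(1)] R[OF o(2)]
 show ?thesis
 unfolding bij_betw_def
 proof
 show "inj_on (farr F) (Hom ?B x y)"
 proof (rule inj_onI)
 fix f g assume fg: "f : Hom ?B x y" "g : Hom ?B x y" "farr F f = farr F g"
 obtain G where G: "f = qarr K B x y G" "almost B x y G" using fg(1) B.Hom_QGr[OF o] by blast
 obtain H where H: "g = qarr K B x y H" "almost B x y H" using fg(2) B.Hom_QGr[OF o] by blast
 have "rsat A (R x) (R y) (T x y G) = rsat A (R x) (R y) (T x y H)"
 using fg(3) Fq[OF o G(2)] Fq[OF o H(2)] A.qarr_eq_iff[OF Ro T[OF o G(2)] T[OF o H(2)]] G(1) H(1) by simp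
 then show "f = g" using faithful[OF o G(2) H(2)] B.qarr_eq_iff[OF o G(2) H(2)] G(1) H(1) by simp
 qed
 show "farr F ` Hom ?B x y = Hom ?A (R x) (R y)"
 proof (intro equalityI subsetI)
 fix f assume "f : farr F ` Hom ?B x y"
 then obtain g where g: "f = farr F g" "g : Hom ?B x y" by (rule imageE)
 obtain G where G: "g = qarr K B x y G" "almost B x y G" using g(2) B.Hom_QGr[OF o] by blast
 show "f : Hom ?A (R x) (R y)"
 using Fq[OF o G(2)] A.qarr_Hom[OF Ro T[OF o G(2)]] G(1) g(1) by simp
 next
 fix f assume "f : Hom ?A (R x) (R y)"
 then obtain \<Theta> where \<Theta>: "f = qarr K A (R x) (R y) \<Theta>" "almost A (R x) (R y) \<Theta>"
 using A.Hom_QGr[OF Ro] by blast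
 obtain G where G: "almost B x y G" "rsat A (R x) (R y) (T x y G) = rsat A (R x) (R y) \<Theta>"
 using full[OF o \<Theta>(2)] by blast
 have "f = farr F (qarr K B x y G)"
 using Fq[OF o G(1)] A.qarr_eq_iff[OF Ro T[OF o G(1)] \<Theta>(2)] G(2) \<Theta>(1) by simp
 then show "f : farr F ` Hom ?B x y" using B.qarr_Hom[OF o G(1)] by (rule image_eqI)
 qed
 qed
 qed
 have "ff_es ?B ?A F"
 unfolding ff_es_def F1
 proof (intro conjI ballI)
 show "is_functor ?B ?A F" by (rule Fu)
 show "bij_betw (farr F) (Hom ?B x y) (Hom ?A (R x) (R y))" if "x : Obj ?B" "y : Obj ?B" for x y
 using that by (rule bij)
 show "EX c:Obj ?B. isomorphic ?A (R c) d" if "d : Obj ?A" for d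
 proof -
 have "gr_mod K A d" using that by (simp add: Obj_QGr)
 from surj[OF this] obtain c where "gr_mod K B c" "isomorphic ?A (R c) d" by (elim exE conjE)
 then show ?thesis by (intro bexI[of _ c]) (simp_all add: Obj_QGr)
 qed
 qed
 then show ?thesis using F1 by blast
qed

section \<open>Path algebras\<close>

lemma qpath_end_Nil [simp]: "qpath_end Q (u, []) = u"
 by (simp add: qpath_end_def pre_digraph.awalk_verts.simps)

lemma qpath_end_Cons [simp]: "qpath_end Q (u, e # p) = qpath_end Q (head Q e, p)"
 by (cases p) (simp_all add: qpath_end_def pre_digraph.awalk_verts.simps)

lemma awalk_Nil: "pre_digraph.awalk Q u [] = (%v. u = v & u : verts Q)"
 by (auto simp: fun_eq_iff pre_digraph.awalk_def pre_digraph.cas.simps)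

lemma qpaths_Nil [simp]: "(u, []) : qpaths Q \<longleftrightarrow> u : verts Q"
 by (simp add: qpaths_def awalk_Nil)

context wf_digraph begin

lemma qpaths_Cons [simp]:
 "(u, e # p) : qpaths G \<longleftrightarrow> e : arcs G & u = tail G e & (head G e, p) : qpaths G"
 by (auto simp: qpaths_def awalk_Cons_iff)

lemma qpaths_arcs: "(u, p) : qpaths G ==> set p \<subseteq> arcs G" by (induction p arbitrary: u) auto

lemma qpaths_start: "(u, p) : qpaths G ==> u : verts G" by (cases p) auto

lemma qpath_end_verts: "(u, p) : qpaths G ==> qpath_end G (u, p) : verts G" by (induction p arbitrary: u) auto

lemma qpaths_append:
 "(u, p @ q) : qpaths G \<longleftrightarrow> (u, p) : qpaths G & (qpath_end G (u, p), q) : qpaths G"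
 by (induction p arbitrary: u) (auto simp: qpaths_start)

end

lemma qpath_end_append: "qpath_end Q (u, p @ q) = qpath_end Q (qpath_end Q (u, p), q)"
 by (induction p arbitrary: u) auto

definition weight :: "('e => nat) => 'e list => nat" where
 "weight w p = sum_list (map w p)"

lemma weight_simps [simp]: "weight w [] = 0" "weight w (e # p) = w e + weight w p"
 "weight w (p @ q) = weight w p + weight w q" by (simp_all add: weight_def)

lemma (in abelian_monoid) finsum_single:
 assumes "finite I" "i : I" "f i : car G" "!!j. j : I ==> j ~= i ==> f j = \<zero>"
 shows "finsum G f I = f i"
proof -
 have "finsum G f I = finsum G f {i}"
 proof (rule add.finprod_mono_neutral_cong_right)
 show "f : I \<rightarrow> car G" using assms(3,4) by (metis Pi_I zero_closed)
 qed (use assms in auto)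
 then show ?thesis using assms(3) by simp
qed

locale path_alg = field K for K :: "'k ring" (structure) +
 fixes Q :: "('v, 'e) pre_digraph" and w :: "'e => nat"
 assumes wq: "weighted_quiver Q w"
begin

sublocale fin_digraph Q
 using wq by (simp add: weighted_quiver_def)

lemma w_pos: "e : arcs Q ==> 1 <= w e"
 using wq by (simp add: weighted_quiver_def)

abbreviation "PA \<equiv> path_algebra K Q w"
abbreviation "paths \<equiv> qpaths Q"
abbreviation "pend \<equiv> qpath_end Q"
abbreviation mult_PA (infixl "\<diamond>" 70) where "f \<diamond> g \<equiv> f \<otimes>\<^bsub>PA\<^esub> g"

definition splits :: "('v, 'e) qpath => (('v, 'e) qpath \<times> ('v, 'e) qpath) set" where
 "splits x = {(y, z). y : paths & z : paths & pend y = fst z & x = (fst y, snd y @ snd z)}"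

definition monom :: "'k => ('v, 'e) qpath => ('v, 'e) qpath => 'k" where
 "monom c p = (%x. if x = p then c else \<zero>)"

lemma PA_carrier: "f : car PA \<longleftrightarrow> (ALL x. f x : car K) & finite {x. f x ~= \<zero>} & {x. f x ~= \<zero>} \<subseteq> paths"
 by (simp add: path_algebra_def Let_def)

lemma PA_zero: "\<zero>\<^bsub>PA\<^esub> = (%x. \<zero>)" and PA_add: "f \<oplus>\<^bsub>PA\<^esub> g = (%x. f x \<oplus> g x)"
 and PA_smult: "c \<odot>\<^bsub>PA\<^esub> f = (%x. c \<otimes> f x)"
 and PA_one: "\<one>\<^bsub>PA\<^esub> = (%x. if fst x : verts Q & snd x = [] then \<one> else \<zero>)"
 and PA_adeg: "adeg PA n = {f : car PA. ALL x. f x ~= \<zero> --> weight w (snd x) = n}"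
 by (auto simp: path_algebra_def Let_def weight_def case_prod_beta fun_eq_iff)

lemma PA_mult: "f \<diamond> g = (%x. \<Oplus>yz\<in>splits x. f (fst yz) \<otimes> g (snd yz))"
 by (simp add: path_algebra_def Let_def splits_def case_prod_unfold)

lemma finite_splits: "finite (splits x)"
proof (rule finite_subset)
 show "splits x \<subseteq> (%i. ((fst x, take i (snd x)), (pend (fst x, take i (snd x)), drop i (snd x)))) ` {..length (snd x)}"
 proof
 fix yz assume "yz : splits x"
 then obtain u p v q where "yz = ((u, p), (v, q))" "pend (u, p) = v" "x = (u, p @ q)"
 by (auto simp: splits_def)
 then show "yz : (%i. ((fst x, take i (snd x)), (pend (fst x, take i (snd x)), drop i (snd x)))) ` {..length (snd x)}"
 by (intro image_eqI[of _ _ "length p"]) auto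
 qed
qed simp

lemma splits_path: "yz : splits x ==> x : paths" by (auto simp: splits_def qpaths_append)

lemma PA_val: "f : car PA ==> f x : car K"
 using PA_carrier by blast

lemma mult_terms: "f : car PA ==> g : car PA ==>
 (%yz. f (fst yz) \<otimes> g (snd yz)) : I \<rightarrow> car K"
 using PA_val by auto

lemma mult_nonzeroD:
 assumes "f : car PA" "g : car PA" "(f \<diamond> g) x ~= \<zero>"
 shows "EX (y, z):splits x. f y ~= \<zero> & g z ~= \<zero>"
proof (rule ccontr)
 assume *: "~ ?thesis"
 have "(\<Oplus>yz\<in>splits x. f (fst yz) \<otimes> g (snd yz)) = \<zero>"
 proof (rule add.finprod_one_eqI)
 fix yz assume "yz : splits x"
 then have "f (fst yz) = \<zero> | g (snd yz) = \<zero>" using * by (cases yz) auto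
 then show "f (fst yz) \<otimes> g (snd yz) = \<zero>"
 using PA_val[OF assms(1), of "fst yz"] PA_val[OF assms(2), of "snd yz"] by auto
 qed
 then show False using assms(3) by (simp add: PA_mult)
qed

lemma PA_mult_closed:
 assumes f: "f : car PA" and g: "g : car PA"
 shows "f \<diamond> g : car PA"
proof -
 have "{x. (f \<diamond> g) x ~= \<zero>} \<subseteq>
 (%(y, z). (fst y, snd y @ snd z)) ` ({x. f x ~= \<zero>} \<times> {x. g x ~= \<zero>})"
 proof
 fix x assume "x : {x. (f \<diamond> g) x ~= \<zero>}"
 then obtain y z where "(y, z) : splits x" "f y ~= \<zero>" "g z ~= \<zero>" using mult_nonzeroD[OF f g] by blast
 then show "x : (%(y, z). (fst y, snd y @ snd z)) ` ({x. f x ~= \<zero>} \<times> {x. g x ~= \<zero>})"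
 by (intro image_eqI[of _ _ "(y, z)"]) (auto simp: splits_def)
 qed
 then have "finite {x. (f \<diamond> g) x ~= \<zero>}"
 using f g by (auto simp: PA_carrier intro: finite_subset)
 moreover have "(f \<diamond> g) x : car K" for x
 unfolding PA_mult by (rule finsum_closed[OF mult_terms[OF f g]])
 moreover have "x : paths" if "(f \<diamond> g) x ~= \<zero>" for x
 using mult_nonzeroD[OF f g that] splits_path by blast
 ultimately show ?thesis unfolding PA_carrier[of "f \<diamond> g"] by blast
qed

lemma PA_add_closed: "f : car PA ==> g : car PA ==> f \<oplus>\<^bsub>PA\<^esub> g : car PA"
proof -
 assume f: "f : car PA" and g: "g : car PA"
 have "{x. f x \<oplus> g x ~= \<zero>} \<subseteq> {x. f x ~= \<zero>} \<union> {x. g x ~= \<zero>}" by auto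
 moreover from this have "finite {x. f x \<oplus> g x ~= \<zero>}"
 using f g by (auto simp: PA_carrier intro: finite_subset)
 ultimately show ?thesis using f g by (auto simp: PA_carrier PA_add)
qed

lemma monom_closed: "c : car K ==> p : paths ==> monom c p : car PA" by (auto simp: PA_carrier monom_def)

lemma path_elem_monom: "path_elem K p = monom \<one> p" by (simp add: path_elem_def monom_def)

lemma smult_monom: "c : car K ==> d : car K ==> c \<odot>\<^bsub>PA\<^esub> monom d p = monom (c \<otimes> d) p"
 by (auto simp: PA_smult monom_def)

lemma PA_smult_closed: "c : car K ==> f : car PA ==> c \<odot>\<^bsub>PA\<^esub> f : car PA"
proof -
 assume c: "c : car K" and f: "f : car PA"
 have "{x. c \<otimes> f x ~= \<zero>} \<subseteq> {x. f x ~= \<zero>}" using c by auto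
 moreover from this have "finite {x. c \<otimes> f x ~= \<zero>}" using f by (auto simp: PA_carrier intro: finite_subset)
 ultimately show ?thesis using c f by (auto simp: PA_carrier PA_smult)
qed

lemma PA_abelian_group: "abelian_group PA"
proof (rule abelian_groupI)
 fix f assume f: "f : car PA"
 show "EX g:car PA. g \<oplus>\<^bsub>PA\<^esub> f = \<zero>\<^bsub>PA\<^esub>"
 by (rule bexI[OF _ PA_smult_closed[of "\<ominus> \<one>" f]])
 (use f in \<open>auto simp: PA_add PA_zero PA_smult PA_val l_minus l_neg\<close>)
next
 fix f g h assume "f : car PA" "g : car PA" "h : car PA"
 then show "f \<oplus>\<^bsub>PA\<^esub> g \<oplus>\<^bsub>PA\<^esub> h = f \<oplus>\<^bsub>PA\<^esub> (g \<oplus>\<^bsub>PA\<^esub> h)"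
 "f \<oplus>\<^bsub>PA\<^esub> g = g \<oplus>\<^bsub>PA\<^esub> f" "\<zero>\<^bsub>PA\<^esub> \<oplus>\<^bsub>PA\<^esub> f = f"
 by (simp_all add: PA_add PA_zero PA_val a_assoc) (simp add: PA_val a_comm)
qed (simp_all add: PA_add_closed, simp add: PA_zero PA_carrier)

text \<open>An element is the sum of the monomials over its finite support.\<close>

lemma PA_induct [consumes 1, case_names zero monom add]:
 assumes "f : car PA" and 0: "P (%x. \<zero>)" and m: "!!c p. c : car K ==> p : paths ==> P (monom c p)"
 and a: "!!f g. [| f : car PA; g : car PA; P f; P g |] ==> P (f \<oplus>\<^bsub>PA\<^esub> g)"
 shows "P f"
proof -
 have "P f" if "finite F" "{x. f x ~= \<zero>} \<subseteq> F" "f : car PA" for F f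
 using that
 proof (induction F arbitrary: f rule: finite_induct)
 case empty
 then have "f = (%x. \<zero>)" by auto
 then show ?case using 0 by simp
 next
 case (insert p F)
 note f = \<open>f : car PA\<close>
 show ?case
 proof (cases "f p = \<zero>")
 case True
 then have "{x. f x ~= \<zero>} \<subseteq> F" using insert.prems(1) by auto
 then show ?thesis using insert.IH f by blast
 next
 case False
 then have p: "p : paths" using f by (auto simp: PA_carrier)
 define g where "g = (%x. if x = p then \<zero> else f x)"
 have "{x. g x ~= \<zero>} \<subseteq> {x. f x ~= \<zero>}" by (auto simp: g_def)
 then have g: "g : car PA" using f by (auto simp: PA_carrier g_def intro: finite_subset)
 have "{x. g x ~= \<zero>} \<subseteq> F" using insert.prems(1) by (auto simp: g_def)
 then have "P g" using insert.IH g by blast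
 moreover have "f = monom (f p) p \<oplus>\<^bsub>PA\<^esub> g"
 using f by (auto simp: PA_add monom_def g_def PA_val)
 ultimately show ?thesis using a[OF monom_closed[OF PA_val[OF f] p] g m[OF PA_val[OF f] p]] by metis
 qed
 qed
 then show ?thesis using assms(1) by (auto simp: PA_carrier)
qed

lemma PA_distr:
 assumes "f : car PA" "g : car PA" "h : car PA"
 shows "(f \<oplus>\<^bsub>PA\<^esub> g) \<diamond> h = f \<diamond> h \<oplus>\<^bsub>PA\<^esub> g \<diamond> h"
 "h \<diamond> (f \<oplus>\<^bsub>PA\<^esub> g) = h \<diamond> f \<oplus>\<^bsub>PA\<^esub> h \<diamond> g"
proof -
 note v = PA_val[OF assms(1)] PA_val[OF assms(2)] PA_val[OF assms(3)]
 show "(f \<oplus>\<^bsub>PA\<^esub> g) \<diamond> h = f \<diamond> h \<oplus>\<^bsub>PA\<^esub> g \<diamond> h"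
 proof
 fix x
 have "(\<Oplus>yz\<in>splits x. (f (fst yz) \<oplus> g (fst yz)) \<otimes> h (snd yz))
 = (\<Oplus>yz\<in>splits x. f (fst yz) \<otimes> h (snd yz) \<oplus> g (fst yz) \<otimes> h (snd yz))"
 by (rule finsum_cong') (use v in \<open>simp_all add: l_distr\<close>)
 also have "... = (\<Oplus>yz\<in>splits x. f (fst yz) \<otimes> h (snd yz)) \<oplus> (\<Oplus>yz\<in>splits x. g (fst yz) \<otimes> h (snd yz))"
 by (rule finsum_addf) (use v in simp_all)
 finally show "((f \<oplus>\<^bsub>PA\<^esub> g) \<diamond> h) x = (f \<diamond> h \<oplus>\<^bsub>PA\<^esub> g \<diamond> h) x"
 by (simp add: PA_mult PA_add)
 qed
 show "h \<diamond> (f \<oplus>\<^bsub>PA\<^esub> g) = h \<diamond> f \<oplus>\<^bsub>PA\<^esub> h \<diamond> g"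
 proof
 fix x
 have "(\<Oplus>yz\<in>splits x. h (fst yz) \<otimes> (f (snd yz) \<oplus> g (snd yz)))
 = (\<Oplus>yz\<in>splits x. h (fst yz) \<otimes> f (snd yz) \<oplus> h (fst yz) \<otimes> g (snd yz))"
 by (rule finsum_cong') (use v in \<open>simp_all add: r_distr\<close>)
 also have "... = (\<Oplus>yz\<in>splits x. h (fst yz) \<otimes> f (snd yz)) \<oplus> (\<Oplus>yz\<in>splits x. h (fst yz) \<otimes> g (snd yz))"
 by (rule finsum_addf) (use v in simp_all)
 finally show "(h \<diamond> (f \<oplus>\<^bsub>PA\<^esub> g)) x = (h \<diamond> f \<oplus>\<^bsub>PA\<^esub> h \<diamond> g) x"
 by (simp add: PA_mult PA_add)
 qed
qed

text \<open>Only the given splitting of the concatenated path contributes to the convolution.\<close>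

lemma monom_mult:
 assumes c: "c : car K" "d : car K" and p: "p : paths" "q : paths"
 shows "monom c p \<diamond> monom d q
 = (if pend p = fst q then monom (c \<otimes> d) (fst p, snd p @ snd q) else (%x. \<zero>))"
proof
 fix x
 have m: "(monom c p \<diamond> monom d q) x = (\<Oplus>yz\<in>splits x. monom c p (fst yz) \<otimes> monom d q (snd yz))"
 by (simp add: PA_mult)
 show "(monom c p \<diamond> monom d q) x
 = (if pend p = fst q then monom (c \<otimes> d) (fst p, snd p @ snd q) else (%x. \<zero>)) x"
 proof (cases "(p, q) : splits x")
 case True
 have "(\<Oplus>yz\<in>splits x. monom c p (fst yz) \<otimes> monom d q (snd yz)) = c \<otimes> d"
 by (subst finsum_single[OF finite_splits True]) (use c in \<open>auto simp: monom_def prod_eq_iff\<close>)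
 then show ?thesis using m True by (auto simp: splits_def monom_def)
 next
 case False
 have "(\<Oplus>yz\<in>splits x. monom c p (fst yz) \<otimes> monom d q (snd yz)) = \<zero>"
 by (rule add.finprod_one_eqI) (use c False in \<open>auto simp: monom_def\<close>)
 then show ?thesis using m False p by (auto simp: splits_def monom_def)
 qed
qed

lemma PA_one_closed: "\<one>\<^bsub>PA\<^esub> : car PA"
proof -
 have "{x. \<one>\<^bsub>PA\<^esub> x ~= \<zero>} \<subseteq> (%v. (v, [])) ` verts Q" by (auto simp: PA_one split: if_splits)
 moreover from this have "finite {x. \<one>\<^bsub>PA\<^esub> x ~= \<zero>}" by (rule finite_subset) simp
 ultimately show ?thesis unfolding PA_carrier[of "\<one>\<^bsub>PA\<^esub>"] by (auto simp: PA_one)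
qed

lemma PA_one_mult:
 assumes f: "f : car PA"
 shows "\<one>\<^bsub>PA\<^esub> \<diamond> f = f" "f \<diamond> \<one>\<^bsub>PA\<^esub> = f"
proof -
 have z: "(f \<diamond> g) x = \<zero>" "f x = \<zero>" "(g \<diamond> f) x = \<zero>"
 if "g : car PA" "x \<notin> paths" for x g
 proof -
 have "splits x = {}" using splits_path[of _ x] that(2) by blast
 then show "(f \<diamond> g) x = \<zero>" "(g \<diamond> f) x = \<zero>" by (simp_all add: PA_mult)
 show "f x = \<zero>" using f that(2) by (auto simp: PA_carrier)
 qed
 show "\<one>\<^bsub>PA\<^esub> \<diamond> f = f"
 proof
 fix x show "(\<one>\<^bsub>PA\<^esub> \<diamond> f) x = f x"
 proof (cases "x : paths")
 case True
 then have v: "fst x : verts Q" using qpaths_start[of "fst x" "snd x"] by simp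
 have i: "((fst x, []), x) : splits x" using True v by (simp add: splits_def)
 have "(\<Oplus>yz\<in>splits x. \<one>\<^bsub>PA\<^esub> (fst yz) \<otimes> f (snd yz)) = \<one>\<^bsub>PA\<^esub> (fst x, []) \<otimes> f x"
 proof (subst finsum_single[OF finite_splits i])
 fix yz assume "yz : splits x" "yz ~= ((fst x, []), x)"
 then have "snd (fst yz) ~= []" by (auto simp: splits_def prod_eq_iff)
 then show "\<one>\<^bsub>PA\<^esub> (fst yz) \<otimes> f (snd yz) = \<zero>" using PA_val[OF f] by (simp add: PA_one)
 qed (use v PA_val[OF f] in \<open>auto simp: PA_one\<close>)
 then show ?thesis using v PA_val[OF f] by (simp add: PA_mult PA_one)
 qed (simp add: z[OF PA_one_closed])
 qed
 show "f \<diamond> \<one>\<^bsub>PA\<^esub> = f"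
 proof
 fix x show "(f \<diamond> \<one>\<^bsub>PA\<^esub>) x = f x"
 proof (cases "x : paths")
 case True
 then have v: "pend x : verts Q" using qpath_end_verts[of "fst x" "snd x"] by simp
 have i: "(x, (pend x, [])) : splits x" using True v by (simp add: splits_def)
 have "(\<Oplus>yz\<in>splits x. f (fst yz) \<otimes> \<one>\<^bsub>PA\<^esub> (snd yz)) = f x \<otimes> \<one>\<^bsub>PA\<^esub> (pend x, [])"
 proof (subst finsum_single[OF finite_splits i])
 fix yz assume yz: "yz : splits x" "yz ~= (x, (pend x, []))"
 have "snd (snd yz) ~= []"
 proof
 assume n: "snd (snd yz) = []"
 have x: "fst yz = x" using yz(1) n by (simp add: splits_def case_prod_unfold)
 moreover have "snd yz = (pend x, [])"
 using yz(1) n x by (simp add: splits_def case_prod_unfold prod_eq_iff)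
 ultimately show False using yz(2) by (simp add: prod_eq_iff)
 qed
 then show "f (fst yz) \<otimes> \<one>\<^bsub>PA\<^esub> (snd yz) = \<zero>" using PA_val[OF f] by (simp add: PA_one)
 qed (use v PA_val[OF f] in \<open>auto simp: PA_one\<close>)
 then show ?thesis using v PA_val[OF f] by (simp add: PA_mult PA_one)
 qed (simp add: z[OF PA_one_closed])
 qed
qed

lemma zero_closed': "(%x. \<zero>) : car PA" by (simp add: PA_carrier)

lemma PA_zero_mult: "f : car PA ==> (%x. \<zero>) \<diamond> f = (%x. \<zero>)" "f : car PA ==> f \<diamond> (%x. \<zero>) = (%x. \<zero>)"
 using mult_nonzeroD[OF zero_closed', of f] mult_nonzeroD[OF _ zero_closed', of f] by (auto simp: fun_eq_iff)

lemma PA_assoc: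
 assumes "f : car PA" "g : car PA" "h : car PA"
 shows "(f \<diamond> g) \<diamond> h = f \<diamond> (g \<diamond> h)"
 using assms(1)
proof (induction f rule: PA_induct)
 case zero then show ?case using assms by (simp add: PA_zero_mult PA_mult_closed)
next
 case (add f f') then show ?case using assms by (simp add: PA_distr PA_mult_closed)
next
 case m: (monom c p)
 note mc = monom_closed[OF m]
 show ?case using assms(2)
 proof (induction g rule: PA_induct)
 case zero then show ?case using assms mc by (simp add: PA_zero_mult)
 next
 case (add f f') then show ?case using assms mc by (simp add: PA_distr PA_mult_closed)
 next
 case m': (monom d q)
 note mc' = monom_closed[OF m']
 show ?case using assms(3)
 proof (induction h rule: PA_induct)
 case zero then show ?case using mc mc' by (simp add: PA_zero_mult PA_mult_closed)
 next
 case (add f f') then show ?case using mc mc' by (simp add: PA_distr PA_mult_closed)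
 next
 case m'': (monom e r)
 have pq: "(fst p, snd p @ snd q) : paths" if "pend p = fst q"
 using m(2) m'(2) that qpaths_append[of "fst p" "snd p" "snd q"] by simp
 have qr: "(fst q, snd q @ snd r) : paths" if "pend q = fst r"
 using m'(2) m''(2) that qpaths_append[of "fst q" "snd q" "snd r"] by simp
 have e: "pend (fst p, snd p @ snd q) = pend q" if "pend p = fst q"
 using that qpath_end_append[of Q "fst p" "snd p" "snd q"] by simp
 note mc'' = monom_closed[OF m'']
 show ?case
 proof (cases "pend p = fst q"; cases "pend q = fst r")
 assume a: "pend p = fst q" "pend q = fst r"
 have "monom (c \<otimes> d) (fst p, snd p @ snd q) \<diamond> monom e r
 = monom c p \<diamond> monom (d \<otimes> e) (fst q, snd q @ snd r)"
 using monom_mult[OF _ m''(1) pq[OF a(1)] m''(2), of "c \<otimes> d"]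
 monom_mult[OF m(1) _ m(2) qr[OF a(2)], of "d \<otimes> e"] m(1) m'(1) m''(1) a e[OF a(1)]
 by (simp add: m_assoc)
 then show ?thesis using monom_mult[OF m(1) m'(1) m(2) m'(2)] monom_mult[OF m'(1) m''(1) m'(2) m''(2)] a
 by simp
 next
 assume a: "pend p = fst q" "pend q ~= fst r"
 have "monom (c \<otimes> d) (fst p, snd p @ snd q) \<diamond> monom e r = (%x. \<zero>)"
 using monom_mult[OF _ m''(1) pq[OF a(1)] m''(2), of "c \<otimes> d"] m(1) m'(1) a e[OF a(1)] by simp
 then show ?thesis using monom_mult[OF m(1) m'(1) m(2) m'(2)] monom_mult[OF m'(1) m''(1) m'(2) m''(2)] a
 PA_zero_mult(2)[OF mc] by simp
 next
 assume a: "pend p ~= fst q" "pend q = fst r"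
 have "monom c p \<diamond> monom (d \<otimes> e) (fst q, snd q @ snd r) = (%x. \<zero>)"
 using monom_mult[OF m(1) _ m(2) qr[OF a(2)], of "d \<otimes> e"] m'(1) m''(1) a by simp
 then show ?thesis using monom_mult[OF m(1) m'(1) m(2) m'(2)] monom_mult[OF m'(1) m''(1) m'(2) m''(2)] a
 PA_zero_mult(1)[OF mc''] by simp
 next
 assume a: "pend p ~= fst q" "pend q ~= fst r"
 then show ?thesis using monom_mult[OF m(1) m'(1) m(2) m'(2)] monom_mult[OF m'(1) m''(1) m'(2) m''(2)]
 PA_zero_mult(1)[OF mc''] PA_zero_mult(2)[OF mc] by simp
 qed
 qed
 qed
qed

lemma PA_ring: "ring PA"
proof (rule ringI)
 show "abelian_group PA" by (rule PA_abelian_group)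
 show "monoid PA" by (rule monoidI) (simp_all add: PA_mult_closed PA_one_closed PA_assoc PA_one_mult)
qed (simp_all add: PA_distr)

lemma PA_module: "module K PA"
proof (rule module.intro[OF _ PA_abelian_group])
 show "cring K" by (rule is_cring)
 show "module_axioms K PA" by (rule module_axioms.intro, simp_all add: PA_smult_closed)
 (simp_all add: PA_smult PA_add l_distr r_distr m_assoc PA_val)
qed

lemma PA_smult_mult:
 assumes c: "c : car K" and fg: "f : car PA" "g : car PA"
 shows "(c \<odot>\<^bsub>PA\<^esub> f) \<diamond> g = c \<odot>\<^bsub>PA\<^esub> (f \<diamond> g)"
 "f \<diamond> (c \<odot>\<^bsub>PA\<^esub> g) = c \<odot>\<^bsub>PA\<^esub> (f \<diamond> g)"
proof -
 note v = PA_val[OF fg(1)] PA_val[OF fg(2)]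
 have *: "(\<Oplus>yz\<in>splits x. t yz) = c \<otimes> (\<Oplus>yz\<in>splits x. f (fst yz) \<otimes> g (snd yz))"
 if "!!yz. t yz = c \<otimes> (f (fst yz) \<otimes> g (snd yz))" for t x
 using finsum_rdistr[OF finite_splits c, of "%yz. f (fst yz) \<otimes> g (snd yz)" x] v that by simp
 show "(c \<odot>\<^bsub>PA\<^esub> f) \<diamond> g = c \<odot>\<^bsub>PA\<^esub> (f \<diamond> g)"
 using *[of "%yz. (c \<otimes> f (fst yz)) \<otimes> g (snd yz)"] v c by (simp add: PA_mult PA_smult m_assoc)
 show "f \<diamond> (c \<odot>\<^bsub>PA\<^esub> g) = c \<odot>\<^bsub>PA\<^esub> (f \<diamond> g)"
 using *[of "%yz. f (fst yz) \<otimes> (c \<otimes> g (snd yz))"] v c by (simp add: PA_mult PA_smult m_lcomm)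
qed

lemma PA_graded_algebra: "graded_algebra K PA"
proof -
 interpret P: ring PA by (rule PA_ring)
 have neg: "\<ominus>\<^bsub>PA\<^esub> f = (%x. \<ominus>\<^bsub>K\<^esub> f x)" if f: "f : car PA" for f
 proof -
 have "(\<ominus>\<^bsub>K\<^esub> \<one>\<^bsub>K\<^esub>) \<odot>\<^bsub>PA\<^esub> f \<oplus>\<^bsub>PA\<^esub> f = \<zero>\<^bsub>PA\<^esub>" "(\<ominus>\<^bsub>K\<^esub> \<one>\<^bsub>K\<^esub>) \<odot>\<^bsub>PA\<^esub> f = (%x. \<ominus>\<^bsub>K\<^esub> f x)"
 using f by (auto simp: PA_add PA_zero PA_smult PA_val l_minus l_neg)
 then show ?thesis using P.minus_equality[OF _ f PA_smult_closed[OF _ f, of "\<ominus>\<^bsub>K\<^esub> \<one>\<^bsub>K\<^esub>"]] by simp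
 qed
 define c where "c f n = (%x. if weight w (snd x) = n then f x else \<zero>\<^bsub>K\<^esub>)" for f :: "('v, 'e) qpath => 'k" and n
 have "direct_sum_decomp PA (adeg PA) & (ALL f:car PA. component PA (adeg PA) f = c f)"
 proof (rule direct_sum_decompI[OF PA_abelian_group])
 fix n show "subgroup (adeg PA n) (add_monoid PA)"
 proof (rule P.add_subgroupI)
 show "\<zero>\<^bsub>PA\<^esub> : adeg PA n" by (simp add: PA_adeg PA_zero zero_closed')
 fix f assume f: "f : adeg PA n"
 then show "\<ominus>\<^bsub>PA\<^esub> f : adeg PA n"
 proof -
 have fc: "f : car PA" using f by (simp add: PA_adeg)
 have "f x ~= \<zero>\<^bsub>K\<^esub>" if "\<ominus>\<^bsub>K\<^esub> f x ~= \<zero>\<^bsub>K\<^esub>" for x using that neg_zero by metis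
 then show ?thesis using P.a_inv_closed[OF fc] f unfolding PA_adeg neg[OF fc] by blast
 qed
 fix g assume g: "g : adeg PA n"
 then show "f \<oplus>\<^bsub>PA\<^esub> g : adeg PA n"
 proof -
 have fg: "f : car PA" "g : car PA" using f g by (simp_all add: PA_adeg)
 have "f x ~= \<zero>\<^bsub>K\<^esub> | g x ~= \<zero>\<^bsub>K\<^esub>" if "(f \<oplus>\<^bsub>PA\<^esub> g) x ~= \<zero>\<^bsub>K\<^esub>" for x
 using that by (auto simp: PA_add)
 then show ?thesis using P.a_closed[OF fg] f g unfolding PA_adeg by blast
 qed
 qed (auto simp: PA_adeg)
 next
 fix f assume f: "f : car PA"
 have cf: "c f n : car PA" for n
 proof -
 have "{x. c f n x ~= \<zero>\<^bsub>K\<^esub>} \<subseteq> {x. f x ~= \<zero>\<^bsub>K\<^esub>}" by (auto simp: c_def)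
 then show ?thesis using f by (auto simp: PA_carrier c_def intro: finite_subset)
 qed
 then show "c f n : adeg PA n" for n by (auto simp: PA_adeg c_def)
 have "{n. c f n ~= \<zero>\<^bsub>PA\<^esub>} \<subseteq> (%x. weight w (snd x)) ` {x. f x ~= \<zero>\<^bsub>K\<^esub>}"
 proof
 fix n assume "n : {n. c f n ~= \<zero>\<^bsub>PA\<^esub>}"
 then obtain x where "c f n x ~= \<zero>\<^bsub>K\<^esub>" unfolding PA_zero by blast
 then show "n : (%x. weight w (snd x)) ` {x. f x ~= \<zero>\<^bsub>K\<^esub>}" by (auto simp: c_def split: if_splits)
 qed
 then show "finite {n. c f n ~= \<zero>\<^bsub>PA\<^esub>}" using f by (auto simp: PA_carrier intro: finite_subset)
 show "f = \<zero>\<^bsub>PA\<^esub>" if z: "!!n. c f n = \<zero>\<^bsub>PA\<^esub>"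
 proof
 fix x show "f x = \<zero>\<^bsub>PA\<^esub> x"
 using fun_cong[OF z[of "weight w (snd x)"], of x] by (simp add: c_def PA_zero)
 qed
 next
 fix f i assume f: "f : adeg PA i"
 then have fi: "f x = \<zero>\<^bsub>K\<^esub>" if "weight w (snd x) ~= i" for x using that unfolding PA_adeg by blast
 show "c f i = f" using fi by (force simp: c_def)
 show "c f j = \<zero>\<^bsub>PA\<^esub>" if "i ~= j" for j using fi that by (force simp: c_def PA_zero)
 qed (auto simp: c_def PA_add fun_eq_iff)
 moreover have "f \<diamond> g : adeg PA (i + j)" if "f : adeg PA i" "g : adeg PA j" for f g i j
 proof -
 have fg: "f : car PA" "g : car PA" using that by (auto simp: PA_adeg)
 have "weight w (snd x) = i + j" if nz: "(f \<diamond> g) x ~= \<zero>\<^bsub>K\<^esub>" for x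
 proof -
 obtain y z where "(y, z) : splits x" "f y ~= \<zero>\<^bsub>K\<^esub>" "g z ~= \<zero>\<^bsub>K\<^esub>" using mult_nonzeroD[OF fg nz] by blast
 moreover from this have "weight w (snd y) = i" "weight w (snd z) = j"
 using \<open>f : adeg PA i\<close> \<open>g : adeg PA j\<close> unfolding PA_adeg by blast+
 ultimately show ?thesis by (auto simp: splits_def)
 qed
 then show ?thesis using PA_mult_closed[OF fg] unfolding PA_adeg by blast
 qed
 moreover have "d \<odot>\<^bsub>PA\<^esub> f : adeg PA i" if d: "d : car K" and f: "f : adeg PA i" for d f i
 proof -
 have "f x ~= \<zero>\<^bsub>K\<^esub>" if "(d \<odot>\<^bsub>PA\<^esub> f) x ~= \<zero>\<^bsub>K\<^esub>" for x using that d by (auto simp: PA_smult)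
 then show ?thesis using f PA_smult_closed[OF d, of f] unfolding PA_adeg by blast
 qed
 ultimately show ?thesis by (intro graded_algebra.intro graded_algebra_axioms.intro PA_module PA_ring)
 (simp_all add: PA_smult_mult)
qed

end

section \<open>Monomial algebras\<close>

text \<open>All laws pass to a homomorphic image; the grading does because the kernel is homogeneous.\<close>

lemma graded_algebra_image:
 assumes "graded_algebra K A"
 and surj: "\<pi> ` car A = car C"
 and add: "!!x y. x : car A ==> y : car A ==> \<pi> (x \<oplus>\<^bsub>A\<^esub> y) = \<pi> x \<oplus>\<^bsub>C\<^esub> \<pi> y"
 and mult: "!!x y. x : car A ==> y : car A ==> \<pi> (x \<otimes>\<^bsub>A\<^esub> y) = \<pi> x \<otimes>\<^bsub>C\<^esub> \<pi> y"
 and one: "\<pi> \<one>\<^bsub>A\<^esub> = \<one>\<^bsub>C\<^esub>" and zero: "\<pi> \<zero>\<^bsub>A\<^esub> = \<zero>\<^bsub>C\<^esub>"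
 and smult: "!!c x. c : car K ==> x : car A ==> \<pi> (c \<odot>\<^bsub>A\<^esub> x) = c \<odot>\<^bsub>C\<^esub> \<pi> x"
 and deg: "!!n. adeg C n = \<pi> ` adeg A n"
 and ker: "!!x n. x : car A ==> \<pi> x = \<zero>\<^bsub>C\<^esub> ==> \<pi> (component A (adeg A) x n) = \<zero>\<^bsub>C\<^esub>"
 shows "graded_algebra K C"
proof -
 interpret graded_algebra K A by fact
 interpret ag: graded_group A "adeg A" by (rule graded_group)
 have rep: "EX x:car A. X = \<pi> x" if "X : car C" for X using that surj by blast
 have cl: "\<pi> x : car C" if "x : car A" for x using that surj by blast
 have ab: "abelian_group C"
 proof (rule abelian_groupI)
 fix X Y assume "X : car C" "Y : car C"
 then obtain x y where xy: "x : car A" "y : car A" "X = \<pi> x" "Y = \<pi> y" using rep by meson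
 show "X \<oplus>\<^bsub>C\<^esub> Y : car C" using xy cl[of "x \<oplus>\<^bsub>A\<^esub> y"] add by simp
 show "X \<oplus>\<^bsub>C\<^esub> Y = Y \<oplus>\<^bsub>C\<^esub> X" using xy add[symmetric] by (simp add: a_comm)
 show "\<zero>\<^bsub>C\<^esub> \<oplus>\<^bsub>C\<^esub> X = X" using xy add[of "\<zero>\<^bsub>A\<^esub>" x] zero by simp
 show "EX Z:car C. Z \<oplus>\<^bsub>C\<^esub> X = \<zero>\<^bsub>C\<^esub>"
 using xy add[of "\<ominus>\<^bsub>A\<^esub> x" x] zero cl[of "\<ominus>\<^bsub>A\<^esub> x"] by (intro bexI[of _ "\<pi> (\<ominus>\<^bsub>A\<^esub> x)"]) (auto simp: l_neg)
 fix Z assume "Z : car C"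
 then obtain z where z: "z : car A" "Z = \<pi> z" using rep by meson
 show "X \<oplus>\<^bsub>C\<^esub> Y \<oplus>\<^bsub>C\<^esub> Z = X \<oplus>\<^bsub>C\<^esub> (Y \<oplus>\<^bsub>C\<^esub> Z)"
 using xy z add[symmetric] by (simp add: a_assoc)
 next
 show "\<zero>\<^bsub>C\<^esub> : car C" using cl[OF zero_closed] zero by simp
 qed
 interpret C: abelian_group C by (rule ab)
 have ring: "ring C"
 proof (rule ringI[OF ab])
 show "monoid C"
 proof (rule monoidI)
 fix X Y assume "X : car C" "Y : car C"
 then obtain x y where xy: "x : car A" "y : car A" "X = \<pi> x" "Y = \<pi> y" using rep by meson
 show "X \<otimes>\<^bsub>C\<^esub> Y : car C" using xy cl[of "x \<otimes>\<^bsub>A\<^esub> y"] mult by simp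
 show "\<one>\<^bsub>C\<^esub> \<otimes>\<^bsub>C\<^esub> X = X" "X \<otimes>\<^bsub>C\<^esub> \<one>\<^bsub>C\<^esub> = X"
 using xy mult[of "\<one>\<^bsub>A\<^esub>" x] mult[of x "\<one>\<^bsub>A\<^esub>"] one by simp_all
 fix Z assume "Z : car C"
 then obtain z where z: "z : car A" "Z = \<pi> z" using rep by meson
 show "X \<otimes>\<^bsub>C\<^esub> Y \<otimes>\<^bsub>C\<^esub> Z = X \<otimes>\<^bsub>C\<^esub> (Y \<otimes>\<^bsub>C\<^esub> Z)"
 using xy z mult[symmetric] by (simp add: m_assoc)
 next
 show "\<one>\<^bsub>C\<^esub> : car C" using cl[OF one_closed] one by simp
 qed
 next
 fix X Y Z assume "X : car C" "Y : car C" "Z : car C"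
 then obtain x y z where x: "x : car A" "y : car A" "z : car A" "X = \<pi> x" "Y = \<pi> y" "Z = \<pi> z"
 using rep by meson
 show "(X \<oplus>\<^bsub>C\<^esub> Y) \<otimes>\<^bsub>C\<^esub> Z = X \<otimes>\<^bsub>C\<^esub> Z \<oplus>\<^bsub>C\<^esub> Y \<otimes>\<^bsub>C\<^esub> Z"
 "Z \<otimes>\<^bsub>C\<^esub> (X \<oplus>\<^bsub>C\<^esub> Y) = Z \<otimes>\<^bsub>C\<^esub> X \<oplus>\<^bsub>C\<^esub> Z \<otimes>\<^bsub>C\<^esub> Y"
 using x mult[symmetric] add[symmetric] by (simp_all add: l_distr r_distr)
 qed
 have module: "module K C"
 proof (rule module.intro[OF R.is_cring ab], rule module_axioms.intro)
 fix a b X Y assume ab: "a : car K" "b : car K" and "X : car C" "Y : car C"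
 then obtain x y where xy: "x : car A" "y : car A" "X = \<pi> x" "Y = \<pi> y" using rep by meson
 show "a \<odot>\<^bsub>C\<^esub> (X \<oplus>\<^bsub>C\<^esub> Y) = a \<odot>\<^bsub>C\<^esub> X \<oplus>\<^bsub>C\<^esub> a \<odot>\<^bsub>C\<^esub> Y"
 using xy ab add[symmetric] smult[symmetric] by (simp add: smult_r_distr smult_closed)
 next
 fix a b X assume ab: "a : car K" "b : car K" and "X : car C"
 then obtain x where x: "x : car A" "X = \<pi> x" using rep by meson
 show "(a \<oplus>\<^bsub>K\<^esub> b) \<odot>\<^bsub>C\<^esub> X = a \<odot>\<^bsub>C\<^esub> X \<oplus>\<^bsub>C\<^esub> b \<odot>\<^bsub>C\<^esub> X"
 using x ab add[symmetric] smult[symmetric] by (simp add: smult_l_distr smult_closed)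
 show "a \<otimes>\<^bsub>K\<^esub> b \<odot>\<^bsub>C\<^esub> X = a \<odot>\<^bsub>C\<^esub> (b \<odot>\<^bsub>C\<^esub> X)"
 using x ab smult[symmetric] by (simp add: smult_assoc1 smult_closed)
 next
 fix a X assume a: "a : car K" and "X : car C"
 then obtain x where x: "x : car A" "X = \<pi> x" using rep by meson
 show "a \<odot>\<^bsub>C\<^esub> X : car C" using x a smult[symmetric] cl smult_closed by simp
 next
 fix X assume "X : car C"
 then obtain x where x: "x : car A" "X = \<pi> x" using rep by meson
 show "\<one>\<^bsub>K\<^esub> \<odot>\<^bsub>C\<^esub> X = X" using x smult[symmetric] smult_one by simp
 qed
 have neg: "\<ominus>\<^bsub>C\<^esub> \<pi> x = \<pi> (\<ominus>\<^bsub>A\<^esub> x)" if "x : car A" for x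
 using C.minus_equality[of "\<pi> (\<ominus>\<^bsub>A\<^esub> x)" "\<pi> x"] that cl add[of "\<ominus>\<^bsub>A\<^esub> x" x] zero by (simp add: l_neg)
 define c where "c X n = \<pi> (ag.cp (SOME x. x : car A & \<pi> x = X) n)" for X n
 have c: "c (\<pi> x) n = \<pi> (ag.cp x n)" if x: "x : car A" for x n
 proof -
 define y where "y = (SOME y. y : car A & \<pi> y = \<pi> x)"
 have y: "y : car A & \<pi> y = \<pi> x" unfolding y_def by (rule someI[of _ x]) (use x in simp)
 have "\<pi> (y \<ominus>\<^bsub>A\<^esub> x) = \<zero>\<^bsub>C\<^esub>"
 using x y add[of y "\<ominus>\<^bsub>A\<^esub> x"] neg[OF x] C.r_neg[OF cl[OF x]] by (simp add: a_minus_def)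
 then have "\<pi> (ag.cp (y \<ominus>\<^bsub>A\<^esub> x) n) = \<zero>\<^bsub>C\<^esub>" using ker[of "y \<ominus>\<^bsub>A\<^esub> x"] x y by simp
 moreover have "ag.cp (y \<ominus>\<^bsub>A\<^esub> x) n \<oplus>\<^bsub>A\<^esub> ag.cp x n = ag.cp y n"
 using ag.component_add[of "y \<ominus>\<^bsub>A\<^esub> x" x n] x y by (simp add: minus_add_cancel)
 ultimately have "\<pi> (ag.cp y n) = \<pi> (ag.cp x n)"
 using add[of "ag.cp (y \<ominus>\<^bsub>A\<^esub> x) n" "ag.cp x n"] x y ag.component_carrier cl by simp
 then show ?thesis unfolding c_def y_def by simp
 qed
 have "direct_sum_decomp C (adeg C) & (ALL X:car C. component C (adeg C) X = c X)"
 proof (rule direct_sum_decompI[OF ab])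
 fix n show "subgroup (adeg C n) (add_monoid C)"
 proof (rule C.add_subgroupI)
 fix X Y assume "X : adeg C n" "Y : adeg C n"
 then obtain x y where xy: "x : adeg A n" "y : adeg A n" "X = \<pi> x" "Y = \<pi> y" unfolding deg by blast
 show "X \<oplus>\<^bsub>C\<^esub> Y : adeg C n" using xy add[symmetric] ag.D_add adeg_carrier by (simp add: deg)
 show "\<ominus>\<^bsub>C\<^esub> X : adeg C n" using xy neg ag.D_neg adeg_carrier by (simp add: deg)
 next
 show "adeg C n \<subseteq> car C" using cl adeg_carrier by (auto simp: deg)
 show "\<zero>\<^bsub>C\<^esub> : adeg C n" unfolding deg zero[symmetric] using ag.D_zero by (rule imageI)
 qed
 next
 fix X n assume "X : car C"
 then obtain x where x: "x : car A" "X = \<pi> x" using rep by meson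
 show "c X n : adeg C n" using x c ag.component_props(1) by (simp add: deg)
 show "c (X \<oplus>\<^bsub>C\<^esub> Y) n = c X n \<oplus>\<^bsub>C\<^esub> c Y n" if "Y : car C" for Y
 proof -
 obtain y where y: "y : car A" "Y = \<pi> y" using rep[OF \<open>Y : car C\<close>] by meson
 show ?thesis using x y add[symmetric] c ag.component_carrier by (simp add: ag.component_add)
 qed
 next
 fix X assume "X : car C"
 then obtain x where x: "x : car A" "X = \<pi> x" using rep by meson
 have "{n. c X n ~= \<zero>\<^bsub>C\<^esub>} \<subseteq> {n. ag.cp x n ~= \<zero>\<^bsub>A\<^esub>}" using x c zero by auto
 then show "finite {n. c X n ~= \<zero>\<^bsub>C\<^esub>}" using ag.component_props(2)[OF x(1)] finite_subset by blast
 show "X = \<zero>\<^bsub>C\<^esub>" if z: "!!n. c X n = \<zero>\<^bsub>C\<^esub>"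
 proof -
 have "x : {x : car A. \<pi> x = \<zero>\<^bsub>C\<^esub>}" by (rule ag.in_subset_if_components[OF x(1)])
 (use z x c zero ag.component_carrier add C.zero_closed in auto)
 then show ?thesis using x by simp
 qed
 next
 fix X n assume "X : adeg C n"
 then obtain x where x: "x : adeg A n" "X = \<pi> x" unfolding deg by blast
 show "c X n = X" using x c[OF adeg_carrier[OF x(1)]] ag.component_homogeneous[OF x(1)] by simp
 show "c X m = \<zero>\<^bsub>C\<^esub>" if "n ~= m" for m
 using x c[OF adeg_carrier[OF x(1)]] ag.component_homogeneous[OF x(1)] that zero by simp
 qed
 then have dec: "direct_sum_decomp C (adeg C)" by blast
 show ?thesis
 proof (intro graded_algebra.intro graded_algebra_axioms.intro module ring dec)
 fix a X Y assume a: "a : car K" and "X : car C" "Y : car C"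
 then obtain x y where xy: "x : car A" "y : car A" "X = \<pi> x" "Y = \<pi> y" using rep by meson
 show "(a \<odot>\<^bsub>C\<^esub> X) \<otimes>\<^bsub>C\<^esub> Y = a \<odot>\<^bsub>C\<^esub> (X \<otimes>\<^bsub>C\<^esub> Y)" "X \<otimes>\<^bsub>C\<^esub> (a \<odot>\<^bsub>C\<^esub> Y) = a \<odot>\<^bsub>C\<^esub> (X \<otimes>\<^bsub>C\<^esub> Y)"
 using xy a smult[symmetric] mult[symmetric] by (simp_all add: smult_closed smult_mult_left smult_mult_right)
 next
 fix a X i assume a: "a : car K" and "X : adeg C i"
 then obtain x where x: "x : adeg A i" "X = \<pi> x" unfolding deg by blast
 show "a \<odot>\<^bsub>C\<^esub> X : adeg C i"
 using x a smult[OF a adeg_carrier[OF x(1)]] adeg_smult[OF a x(1)] unfolding deg by (metis imageI)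
 next
 fix X Y i j assume "X : adeg C i" "Y : adeg C j"
 then obtain x y where x: "x : adeg A i" "X = \<pi> x" "y : adeg A j" "Y = \<pi> y" unfolding deg by blast
 show "X \<otimes>\<^bsub>C\<^esub> Y : adeg C (i + j)"
 using x mult[OF adeg_carrier[OF x(1)] adeg_carrier[OF x(3)]] adeg_mult[OF x(1,3)] unfolding deg
 by (metis imageI)
 qed
qed

context graded_algebra begin

text \<open>The elements all of whose components lie in the ideal form an ideal that contains the
  generators.\<close>

lemma genideal_homogeneous:
 assumes X: "X \<subseteq> (\<Union>n. adeg A n)" and x: "x : Idl\<^bsub>A\<^esub> X"
 shows "component A (adeg A) x n : Idl\<^bsub>A\<^esub> X"
proof -
 interpret ag: graded_group A "adeg A" by (rule graded_group)
 have Xc: "X \<subseteq> car A" using X adeg_carrier by blast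
 interpret I: ideal "Idl\<^bsub>A\<^esub> X" A by (rule genideal_ideal[OF Xc])
 let ?J = "{x : Idl\<^bsub>A\<^esub> X. ALL n. ag.cp x n : Idl\<^bsub>A\<^esub> X}"
 have l: "a \<otimes>\<^bsub>A\<^esub> y : ?J" if a: "a : car A" and y: "y : ?J" for a y
 proof -
 have yc: "y : car A" using y I.a_subset by auto
 have "ag.cp (a \<otimes>\<^bsub>A\<^esub> y) n : Idl\<^bsub>A\<^esub> X" for n
 using a
 proof (induction a rule: ag.homogeneous_induct)
 case zero then show ?case using yc by simp
 next
 case (add a b) then show ?case using yc I.a_closed by (simp add: l_distr ag.component_add)
 next
 case (hom j a)
 note ac = adeg_carrier[OF hom]
 have "ag.cp (a \<otimes>\<^bsub>A\<^esub> z) n = \<zero>\<^bsub>A\<^esub>" if "n < j" "z : car A" for z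
 using that(2)
 proof (induction z rule: ag.homogeneous_induct)
 case (hom i z)
 then show ?case using ag.component_homogeneous[OF adeg_mult[OF \<open>a : adeg A j\<close> hom]] that(1) by simp
 qed (use ac in \<open>simp_all add: r_distr ag.component_add\<close>)
 moreover have "ag.cp (a \<otimes>\<^bsub>A\<^esub> y) n = a \<otimes>\<^bsub>A\<^esub> ag.cp y (n - j)" if "j <= n"
 using component_mult[OF hom yc, of "n - j"] that by simp
 ultimately show ?case using yc y I.I_l_closed[OF _ ac] by (cases "n < j") auto
 qed
 then show ?thesis using a y I.I_l_closed by auto
 qed
 have r: "y \<otimes>\<^bsub>A\<^esub> a : ?J" if a: "a : car A" and y: "y : ?J" for a y
 proof -
 have yc: "y : car A" using y I.a_subset by auto
 have "ag.cp (y \<otimes>\<^bsub>A\<^esub> a) n : Idl\<^bsub>A\<^esub> X" for n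
 using a
 proof (induction a rule: ag.homogeneous_induct)
 case zero then show ?case using yc by simp
 next
 case (add a b) then show ?case using yc I.a_closed by (simp add: r_distr ag.component_add)
 next
 case (hom j a)
 note ac = adeg_carrier[OF hom]
 have "ag.cp (z \<otimes>\<^bsub>A\<^esub> a) n = (if n < j then \<zero>\<^bsub>A\<^esub> else ag.cp z (n - j) \<otimes>\<^bsub>A\<^esub> a)" if "z : car A" for z
 using that
 proof (induction z rule: ag.homogeneous_induct)
 case (hom i z)
 then show ?case using ag.component_homogeneous[OF adeg_mult[OF hom \<open>a : adeg A j\<close>]]
 ag.component_homogeneous[OF hom] ac by auto
 qed (use ac in \<open>simp_all add: l_distr ag.component_add ag.component_carrier\<close>)
 then show ?case using yc y I.I_r_closed[OF _ ac] by simp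
 qed
 then show ?thesis using a y I.I_r_closed by auto
 qed
 have "ideal ?J A"
 proof (rule idealI[OF ring_axioms])
 show "subgroup ?J (add_monoid A)"
 proof (rule add_subgroupI)
 fix y assume y: "y : ?J"
 then have "y : car A" using I.a_subset by auto
 then show "\<ominus>\<^bsub>A\<^esub> y : ?J" using y I.a_inv_closed by (simp add: ag.component_neg)
 show "y \<oplus>\<^bsub>A\<^esub> z : ?J" if "z : ?J" for z
 proof -
 have "z : car A" using that I.a_subset by auto
 then show ?thesis using y that \<open>y : car A\<close> I.a_closed by (simp add: ag.component_add)
 qed
 qed (use I.a_subset in auto)
 next
 fix a y assume "a : ?J" "y : car A"
 then show "y \<otimes>\<^bsub>A\<^esub> a : ?J" "a \<otimes>\<^bsub>A\<^esub> y : ?J" using l r by simp_all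
 qed
 moreover have "X \<subseteq> ?J"
 proof
 fix y assume y: "y : X"
 then obtain i where "y : adeg A i" using X by blast
 then show "y : ?J" using genideal_self[OF Xc] y ag.component_homogeneous by auto
 qed
 ultimately have "Idl\<^bsub>A\<^esub> X \<subseteq> ?J" by (rule genideal_minimal)
 then show ?thesis using x by blast
qed

lemma quotient_algebra_sel:
 "car (quotient_algebra A I) = (%x. I +>\<^bsub>A\<^esub> x) ` car A"
 "zero (quotient_algebra A I) = I" "one (quotient_algebra A I) = I +>\<^bsub>A\<^esub> \<one>\<^bsub>A\<^esub>"
 "adeg (quotient_algebra A I) n = (%x. I +>\<^bsub>A\<^esub> x) ` adeg A n"
 by (auto simp: quotient_algebra_def FactRing_def A_RCOSETS_def')

lemma quotient_algebra_coset:
 assumes "ideal I A"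
 shows "[| x : car A; y : car A |] ==>
 (I +>\<^bsub>A\<^esub> x) \<oplus>\<^bsub>quotient_algebra A I\<^esub> (I +>\<^bsub>A\<^esub> y) = I +>\<^bsub>A\<^esub> (x \<oplus>\<^bsub>A\<^esub> y)"
 "[| x : car A; y : car A |] ==>
 (I +>\<^bsub>A\<^esub> x) \<otimes>\<^bsub>quotient_algebra A I\<^esub> (I +>\<^bsub>A\<^esub> y) = I +>\<^bsub>A\<^esub> (x \<otimes>\<^bsub>A\<^esub> y)"
 "[| c : car K; x : car A |] ==>
 c \<odot>\<^bsub>quotient_algebra A I\<^esub> (I +>\<^bsub>A\<^esub> x) = I +>\<^bsub>A\<^esub> (c \<odot>\<^bsub>A\<^esub> x)"
 "x : car A ==> I +>\<^bsub>A\<^esub> x = I \<longleftrightarrow> x : I"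
proof -
 interpret I: ideal I A by fact
 show "[| x : car A; y : car A |] ==>
 (I +>\<^bsub>A\<^esub> x) \<oplus>\<^bsub>quotient_algebra A I\<^esub> (I +>\<^bsub>A\<^esub> y) = I +>\<^bsub>A\<^esub> (x \<oplus>\<^bsub>A\<^esub> y)"
 by (simp add: quotient_algebra_def FactRing_def I.a_rcos_sum)
 show "[| x : car A; y : car A |] ==>
 (I +>\<^bsub>A\<^esub> x) \<otimes>\<^bsub>quotient_algebra A I\<^esub> (I +>\<^bsub>A\<^esub> y) = I +>\<^bsub>A\<^esub> (x \<otimes>\<^bsub>A\<^esub> y)"
 by (simp add: quotient_algebra_def FactRing_def I.rcoset_mult_add)
 show self: "x : car A ==> I +>\<^bsub>A\<^esub> x = I \<longleftrightarrow> x : I" for x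
 using I.a_rcos_self[of x] a_coset_join2[of x I] I.a_subgroup by auto
 show "[| c : car K; x : car A |] ==>
 c \<odot>\<^bsub>quotient_algebra A I\<^esub> (I +>\<^bsub>A\<^esub> x) = I +>\<^bsub>A\<^esub> (c \<odot>\<^bsub>A\<^esub> x)"
 proof -
 assume c: "c : car K" and x: "x : car A"
 have "I +>\<^bsub>A\<^esub> (c \<odot>\<^bsub>A\<^esub> y) = I +>\<^bsub>A\<^esub> (c \<odot>\<^bsub>A\<^esub> x)" if y: "y : I +>\<^bsub>A\<^esub> x" for y
 proof -
 obtain i where i: "i : I" "y = i \<oplus>\<^bsub>A\<^esub> x" using y unfolding a_r_coset_def' by blast
 have ic: "i : car A" using i(1) I.a_subset by blast
 have "c \<odot>\<^bsub>A\<^esub> i : I" using I.I_l_closed[OF i(1) scalar_carrier[OF c]] ic c by (simp add: scalar_mult)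
 moreover have "c \<odot>\<^bsub>A\<^esub> y = c \<odot>\<^bsub>A\<^esub> i \<oplus>\<^bsub>A\<^esub> c \<odot>\<^bsub>A\<^esub> x" using i ic x c by (simp add: smult_r_distr)
 ultimately have "c \<odot>\<^bsub>A\<^esub> y : I +>\<^bsub>A\<^esub> (c \<odot>\<^bsub>A\<^esub> x)" unfolding a_r_coset_def' by blast
 then show ?thesis
 using a_repr_independence[OF _ smult_closed[OF c x] I.a_subgroup] by blast
 qed
 then have "(\<Union>y\<in>I +>\<^bsub>A\<^esub> x. I +>\<^bsub>A\<^esub> (c \<odot>\<^bsub>A\<^esub> y)) = I +>\<^bsub>A\<^esub> (c \<odot>\<^bsub>A\<^esub> x)"
 using I.a_rcos_self[OF x] by blast
 then show ?thesis by (simp add: quotient_algebra_def)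
 qed
qed

lemma quotient_graded_algebra:
 assumes X: "X \<subseteq> (\<Union>n. adeg A n)"
 shows "graded_algebra K (quotient_algebra A (Idl\<^bsub>A\<^esub> X))"
proof -
 have Xc: "X \<subseteq> car A" using X adeg_carrier by blast
 note I = genideal_ideal[OF Xc]
 interpret I: ideal "Idl\<^bsub>A\<^esub> X" A by (rule I)
 interpret ag: graded_group A "adeg A" by (rule graded_group)
 note q = quotient_algebra_coset[OF I]
 show ?thesis
 by (rule graded_algebra_image[OF graded_algebra_axioms, where \<pi> = "%x. Idl\<^bsub>A\<^esub> X +>\<^bsub>A\<^esub> x"])
 (use q genideal_homogeneous[OF X] ag.component_carrier in \<open>simp_all add: quotient_algebra_sel\<close>)
qed

end

text \<open>A monomial algebra up to isomorphism: the algebra is given together with a surjection from the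
  path algebra whose kernel is generated by \<open>S\<close>. The sets \<open>S = {}\<close> give the weighted path
  algebras.\<close>

locale monomial_algebra = graded_algebra K A + p: path_alg K Q w
 for K :: "'k ring" and A :: "('k, 'a) graded_algebra" and Q :: "('v, 'e) pre_digraph" and w :: "'e => nat" +
 fixes S :: "('v, 'e) qpath set" and ev :: "(('v, 'e) qpath => 'k) => 'a"
 assumes S_paths: "S \<subseteq> qpaths Q"
 and ev_surj: "ev ` car (path_algebra K Q w) = car A"
 and ev_add: "[| f : car (path_algebra K Q w); g : car (path_algebra K Q w) |]
 ==> ev (f \<oplus>\<^bsub>path_algebra K Q w\<^esub> g) = ev f \<oplus>\<^bsub>A\<^esub> ev g"
 and ev_mult: "[| f : car (path_algebra K Q w); g : car (path_algebra K Q w) |]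
 ==> ev (f \<otimes>\<^bsub>path_algebra K Q w\<^esub> g) = ev f \<otimes>\<^bsub>A\<^esub> ev g"
 and ev_one: "ev \<one>\<^bsub>path_algebra K Q w\<^esub> = \<one>\<^bsub>A\<^esub>"
 and ev_smult: "[| c : car K; f : car (path_algebra K Q w) |]
 ==> ev (c \<odot>\<^bsub>path_algebra K Q w\<^esub> f) = c \<odot>\<^bsub>A\<^esub> ev f"
 and ev_deg: "ev ` adeg (path_algebra K Q w) n = adeg A n"
 and ev_ker: "f : car (path_algebra K Q w) ==>
 ev f = \<zero>\<^bsub>A\<^esub> \<longleftrightarrow> f : Idl\<^bsub>path_algebra K Q w\<^esub> (path_elem K ` S)"
begin

sublocale P: graded_algebra K p.PA by (rule p.PA_graded_algebra)

text \<open>The image of a path.\<close>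

definition mono :: "('v, 'e) qpath => 'a" where
 "mono q = ev (path_elem K q)"

lemma ev_closed: "f : car p.PA ==> ev f : car A"
 using ev_surj by blast

lemma path_elem_closed: "q : p.paths ==> path_elem K q : car p.PA"
 by (simp add: p.path_elem_monom p.monom_closed)

lemma mono_closed: "q : p.paths ==> mono q : car A"
 unfolding mono_def by (rule ev_closed[OF path_elem_closed])

lemma path_elem_adeg: "q : p.paths ==> path_elem K q : adeg p.PA (weight w (snd q))"
 using path_elem_closed unfolding p.PA_adeg by (auto simp: path_elem_def)

lemma mono_adeg: "q : p.paths ==> mono q : adeg A (weight w (snd q))"
 using ev_deg path_elem_adeg unfolding mono_def by blast

lemma ev_monom: "c : car K ==> q : p.paths ==> ev (p.monom c q) = c \<odot>\<^bsub>A\<^esub> mono q"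
 using ev_smult[of c "path_elem K q"] path_elem_closed[of q] p.smult_monom[of c "\<one>\<^bsub>K\<^esub>" q]
 by (simp add: mono_def p.path_elem_monom)

lemma zero_carrier: "(%x. \<zero>\<^bsub>K\<^esub>) : car p.PA" by (rule p.zero_closed')

lemma ev_zero: "ev (%x. \<zero>\<^bsub>K\<^esub>) = \<zero>\<^bsub>A\<^esub>"
 using ev_smult[of "\<zero>\<^bsub>K\<^esub>" "%x. \<zero>\<^bsub>K\<^esub>"] ev_closed[OF zero_carrier] by (simp add: p.PA_smult zero_carrier)

lemma mono_mult:
 assumes "q : p.paths" "r : p.paths"
 shows "mono q \<otimes>\<^bsub>A\<^esub> mono r = (if p.pend q = fst r then mono (fst q, snd q @ snd r) else \<zero>\<^bsub>A\<^esub>)"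
 using ev_mult[OF path_elem_closed[OF assms(1)] path_elem_closed[OF assms(2)]]
 p.monom_mult[OF _ _ assms, of "\<one>\<^bsub>K\<^esub>" "\<one>\<^bsub>K\<^esub>"] ev_zero
 by (auto simp: mono_def p.path_elem_monom)

lemma mono_S: "q : S ==> mono q = \<zero>\<^bsub>A\<^esub>"
proof -
 assume q: "q : S"
 have "path_elem K ` S \<subseteq> car p.PA" using path_elem_closed S_paths by blast
 then have "path_elem K q : Idl\<^bsub>p.PA\<^esub> (path_elem K ` S)" using P.genideal_self q by blast
 then show ?thesis unfolding mono_def using ev_ker[OF path_elem_closed] q S_paths by blast
qed

definition paths_of_weight :: "nat => ('v, 'e) qpath set" where
 "paths_of_weight n = {q : p.paths. weight w (snd q) = n}"

text \<open>A homogeneous element has a homogeneous preimage, and its preimage is a combination of the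
  paths of the right weight.\<close>

lemma adeg_spanned: "spanned_by K A (mono ` paths_of_weight n) (adeg A n)"
 unfolding spanned_by_def
proof (intro allI impI subsetI)
 fix P a assume P0: "\<zero>\<^bsub>A\<^esub> : P" and Pa: "ALL x:P. ALL y:P. x \<oplus>\<^bsub>A\<^esub> y : P"
 and Pm: "ALL c:car K. ALL x:mono ` paths_of_weight n. c \<odot>\<^bsub>A\<^esub> x : P" and a: "a : adeg A n"
 obtain f where f: "f : adeg p.PA n" "a = ev f" using a ev_deg by blast
 define c where "c f = (%x. if weight w (snd x) = n then f x else \<zero>\<^bsub>K\<^esub>)" for f :: "('v, 'e) qpath => 'k"
 have cc: "c g : car p.PA" if "g : car p.PA" for g
 proof -
 have "{x. c g x ~= \<zero>\<^bsub>K\<^esub>} \<subseteq> {x. g x ~= \<zero>\<^bsub>K\<^esub>}" by (auto simp: c_def)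
 then show ?thesis using that by (auto simp: p.PA_carrier c_def intro: finite_subset)
 qed
 have "f : car p.PA" using f by (simp add: p.PA_adeg)
 then have "ev (c f) : P"
 proof (induction f rule: p.PA_induct)
 case zero then show ?case using P0 ev_zero by (simp add: c_def)
 next
 case (monom d q)
 have "c (p.monom d q) = (if weight w (snd q) = n then p.monom d q else (%x. \<zero>\<^bsub>K\<^esub>))"
 by (rule ext) (simp add: c_def p.monom_def)
 moreover have "d \<odot>\<^bsub>A\<^esub> mono q : P" if "weight w (snd q) = n"
 proof -
 have "mono q : mono ` paths_of_weight n" using monom(2) that by (simp add: paths_of_weight_def)
 then show ?thesis using Pm monom(1) by blast
 qed
 ultimately show ?case using P0 ev_zero ev_monom[OF monom] by simp
 next
 case (add f g)
 have "c (f \<oplus>\<^bsub>p.PA\<^esub> g) = c f \<oplus>\<^bsub>p.PA\<^esub> c g" using add by (auto simp: c_def p.PA_add p.PA_val)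
 then show ?case using ev_add[OF cc cc] add Pa by simp
 qed
 moreover have "c f = f"
 proof
 fix x
 have "f x ~= \<zero>\<^bsub>K\<^esub> --> weight w (snd x) = n" using f(1) unfolding p.PA_adeg by blast
 then show "c f x = f x" by (auto simp: c_def)
 qed
 ultimately show "a : P" using f(2) by simp
qed

lemma weight_ge_length: "set q \<subseteq> arcs Q ==> length q <= weight w q"
 by (induction q) (use p.w_pos in force)+

lemma finite_paths_of_weight: "finite (paths_of_weight n)"
proof (rule finite_subset)
 show "paths_of_weight n \<subseteq> verts Q \<times> {q. set q \<subseteq> arcs Q & length q <= n}"
 using p.qpaths_start p.qpaths_arcs weight_ge_length unfolding paths_of_weight_def by fastforce
 show "finite (verts Q \<times> {q. set q \<subseteq> arcs Q & length q <= n})"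
 by (intro finite_cartesian_product finite_lists_length_le) simp_all
qed

definition maxw :: nat where
 "maxw = Max (insert 1 (w ` arcs Q))"

lemma w_le_maxw: "e : arcs Q ==> w e <= maxw"
 unfolding maxw_def by (intro Max_ge) auto

lemma split_weight:
 assumes "set q \<subseteq> arcs Q" "k <= weight w q"
 shows "EX q1 q2. q = q1 @ q2 & k <= weight w q1 & weight w q1 <= k + maxw"
 using assms
proof (induction q arbitrary: k)
 case Nil then show ?case by auto
next
 case (Cons e q)
 show ?case
 proof (cases "k <= w e")
 case True
 then show ?thesis using Cons.prems w_le_maxw[of e] by (intro exI[of _ "[e]"] exI[of _ q]) auto
 next
 case False
 then have "set q \<subseteq> arcs Q" "k - w e <= weight w q" using Cons.prems by auto
 from Cons.IH[OF this]
 obtain q1 q2 where "q = q1 @ q2" "k - w e <= weight w q1" "weight w q1 <= k - w e + maxw" by blast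
 then show ?thesis using False by (intro exI[of _ "e # q1"] exI[of _ q2]) auto
 qed
qed

text \<open>Cutting a path of weight \<open>n\<close> at weight \<open>k\<close> overshoots by less than the weight of one arrow.\<close>

lemma tame_monomial: "tame K A"
 unfolding tame_def
proof (rule exI[of _ "%n. mono ` paths_of_weight n"], rule exI[of _ maxw], intro allI conjI impI)
 fix n
 show "finite (mono ` paths_of_weight n)" using finite_paths_of_weight by simp
 show "mono ` paths_of_weight n \<subseteq> adeg A n" using mono_adeg by (auto simp: paths_of_weight_def)
 show "spanned_by K A (mono ` paths_of_weight n) (adeg A n)" by (rule adeg_spanned)
 fix k u assume "k + maxw <= n & u : mono ` paths_of_weight n"
 then obtain v q where q: "u = mono (v, q)" "(v, q) : p.paths" "weight w q = n" "k <= n"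
 by (auto simp: paths_of_weight_def)
 obtain q1 q2 where s: "q = q1 @ q2" "k <= weight w q1" "weight w q1 <= k + maxw"
 using split_weight[OF p.qpaths_arcs[OF q(2)]] q by blast
 have pp: "(v, q1) : p.paths" "(p.pend (v, q1), q2) : p.paths" using q(2) s(1) p.qpaths_append by auto
 show "EX i v v'. k <= i & i <= k + maxw & v : mono ` paths_of_weight i &
 v' : mono ` paths_of_weight (n - i) & u = v \<otimes>\<^bsub>A\<^esub> v'"
 by (rule exI[of _ "weight w q1"], rule exI[of _ "mono (v, q1)"], rule exI[of _ "mono (p.pend (v, q1), q2)"])
 (use s q pp mono_mult[OF pp] in \<open>auto simp: paths_of_weight_def\<close>)
qed

sublocale tame_algebra K A by unfold_locales (rule tame_monomial)

text \<open>Over a monomial algebra, a module is the same thing as a graded vector space with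
  operators \<open>T q\<close> for the paths \<open>q\<close> that compose like paths and vanish on \<open>S\<close>.\<close>

context
 fixes N :: "('a, 'n) graded_module" and sm :: "'k => 'n => 'n" and T :: "('v, 'e) qpath => 'n => 'n"
 assumes gg: "graded_group N (mdeg N)"
 and sm_closed: "!!c x. [| c : car K; x : car N |] ==> sm c x : car N"
 and sm_add: "!!c x y. [| c : car K; x : car N; y : car N |] ==> sm c (x \<oplus>\<^bsub>N\<^esub> y) = sm c x \<oplus>\<^bsub>N\<^esub> sm c y"
 and sm_add': "!!c d x. [| c : car K; d : car K; x : car N |]
 ==> sm (c \<oplus>\<^bsub>K\<^esub> d) x = sm c x \<oplus>\<^bsub>N\<^esub> sm d x"
 and sm_mult: "!!c d x. [| c : car K; d : car K; x : car N |] ==> sm (c \<otimes>\<^bsub>K\<^esub> d) x = sm c (sm d x)"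
 and sm_one: "!!x. x : car N ==> sm \<one>\<^bsub>K\<^esub> x = x"
 and sm_deg: "!!c x i. [| c : car K; x : mdeg N i |] ==> sm c x : mdeg N i"
 and T_closed: "!!q x. [| q : qpaths Q; x : car N |] ==> T q x : car N"
 and T_add: "!!q x y. [| q : qpaths Q; x : car N; y : car N |] ==> T q (x \<oplus>\<^bsub>N\<^esub> y) = T q x \<oplus>\<^bsub>N\<^esub> T q y"
 and T_sm: "!!q c x. [| q : qpaths Q; c : car K; x : car N |] ==> T q (sm c x) = sm c (T q x)"
 and T_mult: "!!q r x. [| q : qpaths Q; r : qpaths Q; x : car N |]
 ==> T r (T q x) = (if qpath_end Q q = fst r then T (fst q, snd q @ snd r) x else \<zero>\<^bsub>N\<^esub>)"
 and T_one: "!!x. x : car N ==> (\<Oplus>\<^bsub>N\<^esub>v\<in>verts Q. T (v, []) x) = x"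
 and T_S: "!!q x. [| q : S; x : car N |] ==> T q x = \<zero>\<^bsub>N\<^esub>"
 and T_deg: "!!q x i. [| q : qpaths Q; x : mdeg N i |] ==> T q x : mdeg N (i + int (weight w (snd q)))"
begin

interpretation N: graded_group N "mdeg N" by (rule gg)

lemma sm_zero: "c : car K ==> sm c \<zero>\<^bsub>N\<^esub> = \<zero>\<^bsub>N\<^esub>" "x : car N ==> sm \<zero>\<^bsub>K\<^esub> x = \<zero>\<^bsub>N\<^esub>"
 using sm_add[of c "\<zero>\<^bsub>N\<^esub>" "\<zero>\<^bsub>N\<^esub>"] sm_closed[of c "\<zero>\<^bsub>N\<^esub>"]
 sm_add'[of "\<zero>\<^bsub>K\<^esub>" "\<zero>\<^bsub>K\<^esub>" x] sm_closed[of "\<zero>\<^bsub>K\<^esub>" x] by simp_all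

definition pact :: "'n => (('v, 'e) qpath => 'k) => 'n" where
 "pact x f = (\<Oplus>\<^bsub>N\<^esub>q\<in>{q. f q ~= \<zero>\<^bsub>K\<^esub>}. sm (f q) (T q x))"

lemma pact_term:
 assumes "f : car p.PA" "x : car N"
 shows "f q ~= \<zero>\<^bsub>K\<^esub> ==> q : p.paths" "f q ~= \<zero>\<^bsub>K\<^esub> ==> sm (f q) (T q x) : car N"
proof -
 show q: "f q ~= \<zero>\<^bsub>K\<^esub> ==> q : p.paths" using assms by (auto simp: p.PA_carrier)
 show "f q ~= \<zero>\<^bsub>K\<^esub> ==> sm (f q) (T q x) : car N"
 using q sm_closed T_closed p.PA_val assms by blast
qed

lemma pact_superset:
 assumes f: "f : car p.PA" and x: "x : car N" and I: "finite I" "{q. f q ~= \<zero>\<^bsub>K\<^esub>} \<subseteq> I" "I \<subseteq> p.paths"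
 shows "pact x f = (\<Oplus>\<^bsub>N\<^esub>q\<in>I. sm (f q) (T q x))"
 unfolding pact_def
proof (rule N.add.finprod_mono_neutral_cong_left[OF I(1,2)])
 show "sm (f q) (T q x) = \<zero>\<^bsub>N\<^esub>" if "q : I - {q. f q ~= \<zero>\<^bsub>K\<^esub>}" for q
 proof -
 have "q : p.paths" "f q = \<zero>\<^bsub>K\<^esub>" using that I(3) by auto
 then show ?thesis using sm_zero(2)[OF T_closed[OF _ x]] by simp
 qed
 show "(%q. sm (f q) (T q x)) : I \<rightarrow> car N"
 using I(3) sm_closed T_closed x p.PA_val[OF f] by blast
qed simp

lemma pact_closed: "f : car p.PA ==> x : car N ==> pact x f : car N"
 unfolding pact_def using pact_term by (intro N.finsum_closed) auto

lemma pact_zero: "pact x (%q. \<zero>\<^bsub>K\<^esub>) = \<zero>\<^bsub>N\<^esub>" by (simp add: pact_def)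

lemma pact_monom:
 assumes "c : car K" "q : p.paths" "x : car N"
 shows "pact x (p.monom c q) = sm c (T q x)"
proof -
 have "pact x (p.monom c q) = (\<Oplus>\<^bsub>N\<^esub>r\<in>{q}. sm (p.monom c q r) (T r x))"
 by (rule pact_superset[OF p.monom_closed[OF assms(1,2)] assms(3)])
 (use assms in \<open>auto simp: p.monom_def split: if_splits\<close>)
 then show ?thesis using sm_closed[OF assms(1) T_closed[OF assms(2,3)]] by (simp add: p.monom_def)
qed

lemma pact_add:
 assumes f: "f : car p.PA" and g: "g : car p.PA" and x: "x : car N"
 shows "pact x (f \<oplus>\<^bsub>p.PA\<^esub> g) = pact x f \<oplus>\<^bsub>N\<^esub> pact x g"
proof -
 let ?I = "{q. f q ~= \<zero>\<^bsub>K\<^esub>} \<union> {q. g q ~= \<zero>\<^bsub>K\<^esub>}"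
 have I: "finite ?I" "?I \<subseteq> p.paths" using f g by (auto simp: p.PA_carrier)
 have c: "sm (h q) (T q x) : car N" if "q : ?I" "h : car p.PA" for q h
 using that I(2) sm_closed T_closed x p.PA_val by blast
 have "pact x (f \<oplus>\<^bsub>p.PA\<^esub> g) = (\<Oplus>\<^bsub>N\<^esub>q\<in>?I. sm ((f \<oplus>\<^bsub>p.PA\<^esub> g) q) (T q x))"
 by (rule pact_superset[OF p.PA_add_closed[OF f g] x I(1) _ I(2)]) (auto simp: p.PA_add)
 also have "... = (\<Oplus>\<^bsub>N\<^esub>q\<in>?I. sm (f q) (T q x) \<oplus>\<^bsub>N\<^esub> sm (g q) (T q x))"
 proof (rule N.finsum_cong')
 fix q assume "q : ?I"
 then have "q : p.paths" using I(2) by blast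
 then show "sm ((f \<oplus>\<^bsub>p.PA\<^esub> g) q) (T q x) = sm (f q) (T q x) \<oplus>\<^bsub>N\<^esub> sm (g q) (T q x)"
 using sm_add'[OF p.PA_val[OF f] p.PA_val[OF g] T_closed[OF _ x]] by (simp add: p.PA_add)
 qed (use c f g in auto)
 also have "... = (\<Oplus>\<^bsub>N\<^esub>q\<in>?I. sm (f q) (T q x)) \<oplus>\<^bsub>N\<^esub> (\<Oplus>\<^bsub>N\<^esub>q\<in>?I. sm (g q) (T q x))"
 by (rule N.finsum_addf) (use c f g in auto)
 also have "... = pact x f \<oplus>\<^bsub>N\<^esub> pact x g"
 using pact_superset[OF f x I(1) _ I(2)] pact_superset[OF g x I(1) _ I(2)] by simp
 finally show ?thesis .
qed

lemma pact_add_left: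
 assumes f: "f : car p.PA" and x: "x : car N" "y : car N"
 shows "pact (x \<oplus>\<^bsub>N\<^esub> y) f = pact x f \<oplus>\<^bsub>N\<^esub> pact y f"
 using f
proof (induction f rule: p.PA_induct)
 case zero then show ?case by (simp add: pact_zero)
next
 case (monom c q)
 then show ?case using x by (simp add: pact_monom T_add sm_add T_closed)
next
 case (add f g)
 then show ?case using x pact_closed by (simp add: pact_add N.a_ac)
qed

lemma pact_zero_left: "f : car p.PA ==> pact \<zero>\<^bsub>N\<^esub> f = \<zero>\<^bsub>N\<^esub>"
 using pact_add_left[of f "\<zero>\<^bsub>N\<^esub>" "\<zero>\<^bsub>N\<^esub>"] pact_closed[of f "\<zero>\<^bsub>N\<^esub>"] by simp

lemma pact_mult:
 assumes f: "f : car p.PA" and g: "g : car p.PA" and x: "x : car N"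
 shows "pact x (f \<otimes>\<^bsub>p.PA\<^esub> g) = pact (pact x f) g"
 using f
proof (induction f rule: p.PA_induct)
 case zero then show ?case using g by (simp add: p.PA_zero_mult pact_zero pact_zero_left)
next
 case (add f f')
 then show ?case using g x by (simp add: p.PA_distr pact_add p.PA_mult_closed pact_add_left pact_closed)
next
 case m: (monom c q)
 note mc = p.monom_closed[OF m]
 show ?case using g
 proof (induction g rule: p.PA_induct)
 case zero then show ?case using mc by (simp add: p.PA_zero_mult pact_zero)
 next
 case (add f f')
 then show ?case using mc x by (simp add: p.PA_distr pact_add p.PA_mult_closed pact_closed)
 next
 case m': (monom d r)
 have qr: "(fst q, snd q @ snd r) : p.paths" if "p.pend q = fst r"
 using m(2) m'(2) that p.qpaths_append[of "fst q" "snd q" "snd r"] by simp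
 have Tq: "T q x : car N" using T_closed[OF m(2) x] .
 have r: "pact (pact x (p.monom c q)) (p.monom d r) = sm d (sm c (T r (T q x)))"
 using pact_monom[OF m x] pact_monom[OF m' sm_closed[OF m(1) Tq]] T_sm[OF m'(2) m(1) Tq] by simp
 show ?case
 proof (cases "p.pend q = fst r")
 case True
 have "pact x (p.monom c q \<otimes>\<^bsub>p.PA\<^esub> p.monom d r) = sm (c \<otimes>\<^bsub>K\<^esub> d) (T (fst q, snd q @ snd r) x)"
 using p.monom_mult[OF m(1) m'(1) m(2) m'(2)] True pact_monom[OF _ qr[OF True] x, of "c \<otimes>\<^bsub>K\<^esub> d"] m m' by simp
 also have "c \<otimes>\<^bsub>K\<^esub> d = d \<otimes>\<^bsub>K\<^esub> c" using m m' by (simp add: R.m_comm)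
 finally show ?thesis
 using r T_mult[OF m(2) m'(2) x] True sm_mult[OF m'(1) m(1) T_closed[OF qr[OF True] x]] by simp
 next
 case False
 then show ?thesis
 using r T_mult[OF m(2) m'(2) x] p.monom_mult[OF m(1) m'(1) m(2) m'(2)] m(1) m'(1)
 by (simp add: pact_zero sm_zero(1))
 qed
 qed
qed

lemma pact_one:
 assumes x: "x : car N"
 shows "pact x \<one>\<^bsub>p.PA\<^esub> = x"
proof -
 have inj: "inj_on (%v. (v, [])) (verts Q)" by (auto intro: inj_onI)
 have c: "sm \<one>\<^bsub>K\<^esub> (T (v, []) x) = T (v, []) x" "T (v, []) x : car N" if "v : verts Q" for v
 using sm_one T_closed[OF _ x] that by auto
 have "pact x \<one>\<^bsub>p.PA\<^esub> = (\<Oplus>\<^bsub>N\<^esub>q\<in>(%v. (v, [])) ` verts Q. sm (\<one>\<^bsub>p.PA\<^esub> q) (T q x))"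
 by (rule pact_superset[OF p.PA_one_closed x]) (auto simp: p.PA_one split: if_splits)
 also have "... = (\<Oplus>\<^bsub>N\<^esub>v\<in>verts Q. sm (\<one>\<^bsub>p.PA\<^esub> (v, [])) (T (v, []) x))"
 by (rule N.finsum_reindex[OF _ inj]) (use c in \<open>auto simp: p.PA_one\<close>)
 also have "... = (\<Oplus>\<^bsub>N\<^esub>v\<in>verts Q. T (v, []) x)"
 by (rule N.finsum_cong') (use c in \<open>auto simp: p.PA_one\<close>)
 finally show ?thesis using T_one[OF x] by simp
qed

text \<open>The elements of the path algebra that act as 0 form an ideal, which contains the generators
  because the operators vanish on \<open>S\<close>.\<close>

lemma pact_ideal:
 assumes f: "f : Idl\<^bsub>p.PA\<^esub> (path_elem K ` S)" and x: "x : car N"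
 shows "pact x f = \<zero>\<^bsub>N\<^esub>"
proof -
 let ?J = "{f : car p.PA. ALL x:car N. pact x f = \<zero>\<^bsub>N\<^esub>}"
 have "ideal ?J p.PA"
 proof (rule idealI[OF p.PA_ring])
 show "subgroup ?J (add_monoid p.PA)"
 proof (rule P.add_subgroupI)
 show "\<zero>\<^bsub>p.PA\<^esub> : ?J" using P.zero_closed by (simp add: p.PA_zero pact_zero)
 fix f assume f: "f : ?J"
 then show "f \<oplus>\<^bsub>p.PA\<^esub> g : ?J" if "g : ?J" for g using that by (simp add: pact_add)
 have "pact x (\<ominus>\<^bsub>p.PA\<^esub> f) = \<zero>\<^bsub>N\<^esub>" if "x : car N" for x
 proof -
 have "pact x (\<ominus>\<^bsub>p.PA\<^esub> f \<oplus>\<^bsub>p.PA\<^esub> f) = pact x (\<ominus>\<^bsub>p.PA\<^esub> f)"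
 using f that pact_add[of "\<ominus>\<^bsub>p.PA\<^esub> f" f x] pact_closed by simp
 then show ?thesis using f P.l_neg[of f] by (simp add: p.PA_zero pact_zero)
 qed
 then show "\<ominus>\<^bsub>p.PA\<^esub> f : ?J" using f by simp
 qed auto
 next
 fix f g assume "f : ?J" "g : car p.PA"
 then show "g \<otimes>\<^bsub>p.PA\<^esub> f : ?J" "f \<otimes>\<^bsub>p.PA\<^esub> g : ?J"
 by (simp_all add: pact_mult pact_closed pact_zero_left)
 qed
 moreover have "path_elem K ` S \<subseteq> ?J"
 proof
 fix f assume "f : path_elem K ` S"
 then obtain q where q: "q : S" "f = path_elem K q" by blast
 then have "pact x f = \<zero>\<^bsub>N\<^esub>" if "x : car N" for x
 using pact_monom[of "\<one>\<^bsub>K\<^esub>" q x] S_paths that T_S[OF q(1) that] sm_zero(1)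
 by (auto simp: p.path_elem_monom)
 moreover have "path_elem K q : car p.PA" using path_elem_closed q(1) S_paths by blast
 ultimately show "f : ?J" using q(2) by simp
 qed
 ultimately have "Idl\<^bsub>p.PA\<^esub> (path_elem K ` S) \<subseteq> ?J" by (rule P.genideal_minimal)
 then show ?thesis using f x by blast
qed

definition mact :: "'n => 'a => 'n" where
 "mact x a = pact x (SOME f. f : car p.PA & ev f = a)"

lemma mact_ev:
 assumes f: "f : car p.PA" and x: "x : car N"
 shows "mact x (ev f) = pact x f"
proof -
 define g where "g = (SOME g. g : car p.PA & ev g = ev f)"
 have g: "g : car p.PA & ev g = ev f" unfolding g_def by (rule someI[of _ f]) (use f in simp)
 have "ev (f \<ominus>\<^bsub>p.PA\<^esub> g) = \<zero>\<^bsub>A\<^esub>"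
 proof -
 have "ev (f \<ominus>\<^bsub>p.PA\<^esub> g \<oplus>\<^bsub>p.PA\<^esub> g) = ev (f \<ominus>\<^bsub>p.PA\<^esub> g) \<oplus>\<^bsub>A\<^esub> ev f"
 using ev_add[of "f \<ominus>\<^bsub>p.PA\<^esub> g" g] f g by simp
 then show ?thesis
 using f g ev_closed[of f] ev_closed[of "f \<ominus>\<^bsub>p.PA\<^esub> g"] by (simp add: P.minus_add_cancel)
 qed
 then have "pact x (f \<ominus>\<^bsub>p.PA\<^esub> g) = \<zero>\<^bsub>N\<^esub>" using ev_ker[of "f \<ominus>\<^bsub>p.PA\<^esub> g"] f g pact_ideal x by simp
 then have "pact x (f \<ominus>\<^bsub>p.PA\<^esub> g \<oplus>\<^bsub>p.PA\<^esub> g) = pact x g"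
 using f g x pact_add[of "f \<ominus>\<^bsub>p.PA\<^esub> g" g x] pact_closed[of g x] by simp
 then show ?thesis using f g by (simp add: P.minus_add_cancel mact_def g_def)
qed

lemma mact_module:
 shows "gr_mod K A (N\<lparr>ract := mact\<rparr>)"
 and "q : p.paths ==> x : car N ==> mact x (mono q) = T q x"
 and "c : car K ==> x : car N ==> mact x (c \<odot>\<^bsub>A\<^esub> \<one>\<^bsub>A\<^esub>) = sm c x"
proof -
 show "q : p.paths ==> x : car N ==> mact x (mono q) = T q x" for q x
 using mact_ev[OF path_elem_closed] pact_monom[of "\<one>\<^bsub>K\<^esub>" q x] sm_one[OF T_closed]
 by (simp add: mono_def p.path_elem_monom)
 have one: "mact x \<one>\<^bsub>A\<^esub> = x" if "x : car N" for x
 using mact_ev[OF p.PA_one_closed that] ev_one pact_one[OF that] by simp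
 have "pact x (c \<odot>\<^bsub>p.PA\<^esub> f) = sm c (pact x f)"
 if c: "c : car K" and x: "x : car N" and f: "f : car p.PA" for c x f
 using f
 proof (induction f rule: p.PA_induct)
 case zero
 have "c \<odot>\<^bsub>p.PA\<^esub> (%x. \<zero>\<^bsub>K\<^esub>) = (%x. \<zero>\<^bsub>K\<^esub>)" using c by (simp add: p.PA_smult)
 then show ?case using c by (simp add: pact_zero sm_zero)
 next
 case (monom d q)
 then show ?case using c x pact_monom[of "c \<otimes>\<^bsub>K\<^esub> d" q x]
 by (simp add: p.smult_monom pact_monom sm_mult T_closed)
 next
 case (add f g)
 then show ?case using c x by (simp add: P.smult_r_distr pact_add P.smult_closed sm_add pact_closed)
 qed
 then show "mact x (c \<odot>\<^bsub>A\<^esub> \<one>\<^bsub>A\<^esub>) = sm c x" if "c : car K" "x : car N" for c x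
 using that mact_ev[of "c \<odot>\<^bsub>p.PA\<^esub> \<one>\<^bsub>p.PA\<^esub>" x] ev_smult[OF that(1) p.PA_one_closed] ev_one pact_one
 by (simp add: P.smult_closed p.PA_one_closed)
 let ?M = "N\<lparr>ract := mact\<rparr>"
 have rep: "EX f. f : car p.PA & a = ev f" if "a : car A" for a using that ev_surj by blast
 have sel: "car ?M = car N" "add ?M = add N" "zero ?M = zero N" "ract ?M = mact" "mdeg ?M = mdeg N" by simp_all
 have am: "abelian_group ?M"
 proof (rule abelian_groupI)
 fix x y z assume "x : car ?M" "y : car ?M" "z : car ?M"
 then show "x \<oplus>\<^bsub>?M\<^esub> y \<oplus>\<^bsub>?M\<^esub> z = x \<oplus>\<^bsub>?M\<^esub> (y \<oplus>\<^bsub>?M\<^esub> z)" by (simp add: N.a_assoc)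
 next
 fix x assume "x : car ?M"
 then show "EX y:car ?M. y \<oplus>\<^bsub>?M\<^esub> x = \<zero>\<^bsub>?M\<^esub>" by (intro bexI[of _ "\<ominus>\<^bsub>N\<^esub> x"]) (auto simp: N.l_neg)
 qed (auto simp: N.a_comm)
 interpret m: abelian_group ?M by (rule am)
 have neg: "\<ominus>\<^bsub>?M\<^esub> x = \<ominus>\<^bsub>N\<^esub> x" if "x : car N" for x
 using m.minus_equality[of "\<ominus>\<^bsub>N\<^esub> x" x] that by (simp add: N.l_neg)
 have "direct_sum_decomp ?M (mdeg ?M) & (ALL m:car ?M. component ?M (mdeg ?M) m = N.cp m)"
 proof (rule direct_sum_decompI[OF am])
 fix i show "subgroup (mdeg ?M i) (add_monoid ?M)"
 by (rule m.add_subgroupI) (auto simp: neg N.D_carrier N.D_zero N.D_add N.D_neg)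
 next
 fix x assume x: "x : car ?M"
 show "finite {i. N.cp x i ~= \<zero>\<^bsub>?M\<^esub>}" using x N.component_props(2) by simp
 show "x = \<zero>\<^bsub>?M\<^esub>" if "!!i. N.cp x i = \<zero>\<^bsub>?M\<^esub>" using x that N.components_zero by simp
 qed (simp_all add: N.component_props(1) N.component_add N.component_homogeneous)
 then have dec: "direct_sum_decomp ?M (mdeg ?M)" by blast
 show "gr_mod K A ?M"
 proof (intro graded_right_module.intro graded_right_module_axioms.intro graded_algebra_axioms am dec,
 unfold sel)
 fix x a assume x: "x : car N" and a: "a : car A"
 obtain f where f: "f : car p.PA" "a = ev f" using rep[OF a] by blast
 show "mact x a : car N" using f x by (simp add: mact_ev pact_closed)
 show "mact (x \<oplus>\<^bsub>N\<^esub> y) a = mact x a \<oplus>\<^bsub>N\<^esub> mact y a" if "y : car N" for y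
 using f x that by (simp add: mact_ev pact_add_left)
 fix b assume b: "b : car A"
 obtain g where g: "g : car p.PA" "b = ev g" using rep[OF b] by blast
 show "mact x (a \<oplus>\<^bsub>A\<^esub> b) = mact x a \<oplus>\<^bsub>N\<^esub> mact x b"
 using f g x mact_ev[OF p.PA_add_closed[OF f(1) g(1)] x] by (simp add: mact_ev pact_add ev_add)
 show "mact x (a \<otimes>\<^bsub>A\<^esub> b) = mact (mact x a) b"
 using f g x mact_ev[OF p.PA_mult_closed[OF f(1) g(1)] x] by (simp add: mact_ev pact_mult ev_mult pact_closed)
 next
 fix x assume "x : car N" then show "mact x \<one>\<^bsub>A\<^esub> = x" by (rule one)
 next
 fix x i a j assume x: "x : mdeg N i" and "a : adeg A j"
 then obtain f where f: "f : adeg p.PA j" "a = ev f" using ev_deg by blast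
 have fc: "f : car p.PA" using f by (simp add: p.PA_adeg)
 note xc = N.D_carrier[OF x]
 have t: "sm (f q) (T q x) : mdeg N (i + int j)" if "f q ~= \<zero>\<^bsub>K\<^esub>" for q
 proof -
 have "weight w (snd q) = j" using f(1) that unfolding p.PA_adeg by blast
 then show ?thesis using sm_deg[OF p.PA_val[OF fc] T_deg[OF pact_term(1)[OF fc xc that] x]] by simp
 qed
 have "pact x f : mdeg N (i + int j)"
 unfolding pact_def
 proof (rule N.finsum_closed_under)
 show "finite {q. f q ~= \<zero>\<^bsub>K\<^esub>}" using fc by (simp add: p.PA_carrier)
 show "sm (f q) (T q x) : car N & sm (f q) (T q x) : mdeg N (i + int j)"
 if "q : {q. f q ~= \<zero>\<^bsub>K\<^esub>}" for q
 using t[of q] N.D_carrier that by blast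
 qed (use N.D_zero N.D_add in auto)
 then show "mact x a : mdeg N (i + int j)" using f fc xc by (simp add: mact_ev)
 qed
qed

end

end

section \<open>The classes of algebras\<close>

context path_alg begin

lemma gens_adeg: "S \<subseteq> qpaths Q ==> path_elem K ` S \<subseteq> (\<Union>n. adeg PA n)"
proof
 fix f assume "S \<subseteq> qpaths Q" "f : path_elem K ` S"
 then obtain q where q: "q : paths" "f = monom \<one> q" by (auto simp: path_elem_monom)
 have "f : adeg PA (weight w (snd q))"
 using q monom_closed[of "\<one>" q] unfolding PA_adeg by (auto simp: monom_def)
 then show "f : (\<Union>n. adeg PA n)" by blast
qed

lemma gens_carrier: "S \<subseteq> qpaths Q ==> path_elem K ` S \<subseteq> car PA"
 using monom_closed by (auto simp: path_elem_monom)

lemma monomial_quotient_graded_algebra: "S \<subseteq> qpaths Q ==> graded_algebra K (monomial_quotient K Q w S)"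
 unfolding monomial_quotient_def
 by (rule graded_algebra.quotient_graded_algebra[OF PA_graded_algebra gens_adeg])

lemma monomial_algebra_quotient:
 assumes S: "S \<subseteq> qpaths Q"
 shows "monomial_algebra K (monomial_quotient K Q w S) Q w S
 (%f. Idl\<^bsub>PA\<^esub> (path_elem K ` S) +>\<^bsub>PA\<^esub> f)"
proof -
 interpret P: graded_algebra K PA by (rule PA_graded_algebra)
 note I = P.genideal_ideal[OF gens_carrier[OF S]]
 note q = P.quotient_algebra_coset[OF I] and sel = P.quotient_algebra_sel
 show ?thesis
 unfolding monomial_algebra_def monomial_algebra_axioms_def
 proof (intro conjI allI impI)
 show "graded_algebra K (monomial_quotient K Q w S)" by (rule monomial_quotient_graded_algebra[OF S])
 show "path_alg K Q w" by (rule path_alg_axioms)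
 qed (use S q in \<open>simp_all add: monomial_quotient_def sel\<close>)
qed

lemma genideal_empty: "Idl\<^bsub>PA\<^esub> {} = {\<zero>\<^bsub>PA\<^esub>}"
proof -
 interpret P: graded_algebra K PA by (rule PA_graded_algebra)
 have "Idl\<^bsub>PA\<^esub> {} \<subseteq> {\<zero>\<^bsub>PA\<^esub>}" by (rule P.genideal_minimal[OF P.zeroideal]) simp
 moreover have "\<zero>\<^bsub>PA\<^esub> : Idl\<^bsub>PA\<^esub> {}"
 using P.genideal_ideal[of "{}"] additive_subgroup.zero_closed ideal.axioms(1) by blast
 ultimately show ?thesis by blast
qed

lemma monomial_algebra_self: "monomial_algebra K PA Q w {} id"
 unfolding monomial_algebra_def monomial_algebra_axioms_def
 using PA_graded_algebra path_alg_axioms genideal_empty by simp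

end

text \<open>Compose the surjection with the inverse of the isomorphism.\<close>

lemma monomial_algebra_transport:
 assumes "monomial_algebra K C Q w S ev" "graded_algebra K A" "graded_algebra_isomorphic K A C"
 shows "EX ev. monomial_algebra K A Q w S ev"
proof -
 interpret C: monomial_algebra K C Q w S ev by fact
 interpret A: graded_algebra K A by fact
 obtain h where h: "h : ring_hom A C" "bij_betw h (car A) (car C)"
 and hs: "!!c x. c : car K ==> x : car A ==> h (c \<odot>\<^bsub>A\<^esub> x) = c \<odot>\<^bsub>C\<^esub> h x"
 and hd: "!!n. h ` adeg A n = adeg C n"
 using assms(3) unfolding graded_algebra_isomorphic_def by blast
 define g where "g = inv_into (car A) h"
 have hg: "h (g x) = x" "g x : car A" if "x : car C" for x
 using h(2) that unfolding g_def bij_betw_def by (auto intro: f_inv_into_f inv_into_into)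
 have gh: "g (h x) = x" if "x : car A" for x
 using h(2) that unfolding g_def bij_betw_def by (auto intro: inv_into_f_f)
 have inj: "x = y" if "x : car A" "y : car A" "h x = h y" for x y
 using gh[OF that(1)] gh[OF that(2)] that(3) by metis
 have g0: "x = \<zero>\<^bsub>A\<^esub> \<longleftrightarrow> h x = \<zero>\<^bsub>C\<^esub>" if "x : car A" for x
 proof -
 have "h \<zero>\<^bsub>A\<^esub> \<oplus>\<^bsub>C\<^esub> h \<zero>\<^bsub>A\<^esub> = h \<zero>\<^bsub>A\<^esub>" using ring_hom_add[OF h(1), of "\<zero>\<^bsub>A\<^esub>" "\<zero>\<^bsub>A\<^esub>"] by simp
 then have "h \<zero>\<^bsub>A\<^esub> = \<zero>\<^bsub>C\<^esub>" using ring_hom_closed[OF h(1), of "\<zero>\<^bsub>A\<^esub>"] by simp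
 then show ?thesis using inj[OF that, of "\<zero>\<^bsub>A\<^esub>"] by auto
 qed
 have gim: "g ` car C = car A"
 using h(2) unfolding g_def by (metis bij_betw_imp_surj_on bij_betw_inv_into)
 have evc: "ev f : car C" if "f : car C.p.PA" for f by (rule C.ev_closed[OF that])
 have "monomial_algebra K A Q w S (g \<circ> ev)"
 unfolding monomial_algebra_def monomial_algebra_axioms_def
 proof (intro conjI allI impI)
 show "graded_algebra K A" "path_alg K Q w" by (rule assms(2), rule C.p.path_alg_axioms)
 show "S \<subseteq> qpaths Q" by (rule C.S_paths)
 show "(g \<circ> ev) ` car C.p.PA = car A" using C.ev_surj gim by (metis image_comp)
 show "(g \<circ> ev) \<one>\<^bsub>C.p.PA\<^esub> = \<one>\<^bsub>A\<^esub>"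
 using C.ev_one gh[OF A.one_closed] ring_hom_one[OF h(1)] by simp
 next
 fix f1 f2 assume f: "f1 : car C.p.PA" "f2 : car C.p.PA"
 show "(g \<circ> ev) (f1 \<oplus>\<^bsub>C.p.PA\<^esub> f2) = (g \<circ> ev) f1 \<oplus>\<^bsub>A\<^esub> (g \<circ> ev) f2"
 using f hg evc C.ev_add ring_hom_add[OF h(1)] by (intro inj) (simp_all add: evc C.P.a_closed)
 show "(g \<circ> ev) (f1 \<otimes>\<^bsub>C.p.PA\<^esub> f2) = (g \<circ> ev) f1 \<otimes>\<^bsub>A\<^esub> (g \<circ> ev) f2"
 using f hg evc C.ev_mult ring_hom_mult[OF h(1)] by (intro inj) (simp_all add: evc C.P.m_closed)
 next
 fix c f assume f: "c : car K" "f : car C.p.PA"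
 show "(g \<circ> ev) (c \<odot>\<^bsub>C.p.PA\<^esub> f) = c \<odot>\<^bsub>A\<^esub> (g \<circ> ev) f"
 using f hg evc C.ev_smult hs by (intro inj) (simp_all add: evc C.P.smult_closed A.smult_closed)
 next
 fix n
 have "(g \<circ> ev) ` adeg C.p.PA n = g ` h ` adeg A n" using C.ev_deg[of n] hd[of n] by (metis image_comp)
 also have "... = adeg A n" using gh A.adeg_carrier[of _ n] by (force simp: image_image)
 finally show "(g \<circ> ev) ` adeg C.p.PA n = adeg A n" .
 next
 fix f assume f: "f : car C.p.PA"
 show "((g \<circ> ev) f = \<zero>\<^bsub>A\<^esub>) = (f : Idl\<^bsub>C.p.PA\<^esub> (path_elem K ` S))"
 using g0[OF hg(2)[OF evc[OF f]]] hg(1)[OF evc[OF f]] C.ev_ker[OF f] by simp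
 qed
 then show ?thesis by blast
qed

lemma graded_algebra_isomorphic_refl:
 assumes "graded_algebra K A"
 shows "graded_algebra_isomorphic K A A"
 unfolding graded_algebra_isomorphic_def by (rule bexI[of _ id]) (auto simp: ring_hom_def)

text \<open>Path algebras are the case without relations; the other classes are defined as monomial
  algebras.\<close>

lemma in_class_monomial:
 fixes K :: "'k ring" and A :: "('k, 'a) graded_algebra"
 assumes K: "field K" and "in_class K C A"
 shows "\<exists>(Q :: (nat, nat) pre_digraph) w S ev. finite S & monomial_algebra K A Q w S ev"
proof -
 have pa: "\<exists>(Q :: (nat, nat) pre_digraph) w S ev. finite S & monomial_algebra K A Q w S ev"
 if A: "graded_algebra K A" and wq: "weighted_quiver Q w"
 and iso: "graded_algebra_isomorphic K A (path_algebra K Q w)" for Q :: "(nat, nat) pre_digraph" and w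
 proof -
 interpret path_alg K Q w using K wq by (simp add: path_alg_def path_alg_axioms_def)
 show ?thesis using monomial_algebra_transport[OF monomial_algebra_self A iso] by blast
 qed
 have mo: "\<exists>(Q :: (nat, nat) pre_digraph) w S ev. finite S & monomial_algebra K A Q w S ev"
 if "is_monomial_via K A Q w S" for Q w S
 proof -
 have wq: "weighted_quiver Q w" and A: "graded_algebra K A" and S: "finite S" "S \<subseteq> qpaths Q"
 and iso: "graded_algebra_isomorphic K A (monomial_quotient K Q w S)"
 using that by (simp_all add: is_monomial_via_def)
 interpret path_alg K Q w using K wq by (simp add: path_alg_def path_alg_axioms_def)
 show ?thesis using monomial_algebra_transport[OF monomial_algebra_quotient[OF S(2)] A iso] S(1) by blast
 qed
 show ?thesis
 proof (cases C)
 case PA1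
 then obtain Q :: "(nat, nat) pre_digraph" where Q: "graded_algebra K A" "fin_digraph Q"
 "graded_algebra_isomorphic K A (path_algebra K Q (%_. 1))" using assms(2) by auto
 show ?thesis by (rule pa[OF Q(1) _ Q(3)]) (use Q(2) in \<open>simp add: weighted_quiver_def\<close>)
 next
 case WPA then show ?thesis using assms(2) pa by auto
 next
 case MA then show ?thesis using assms(2) mo by auto
 next
 case CMA then show ?thesis using assms(2) mo by auto
 next
 case CMA1 then show ?thesis using assms(2) mo by auto
 qed
qed

context path_alg begin

text \<open>The ideal is zero, so its cosets are singletons.\<close>

lemma monomial_quotient_empty_iso:
 "graded_algebra_isomorphic K (monomial_quotient K Q w {}) PA"
proof -
 interpret P: graded_algebra K PA by (rule PA_graded_algebra)
 interpret M: monomial_algebra K "monomial_quotient K Q w {}" Q w "{}"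
 "%f. Idl\<^bsub>PA\<^esub> (path_elem K ` {}) +>\<^bsub>PA\<^esub> f" by (rule monomial_algebra_quotient) simp
 have s: "Idl\<^bsub>PA\<^esub> (path_elem K ` {}) +>\<^bsub>PA\<^esub> f = {f}" if "f : car PA" for f
 using that genideal_empty by (simp add: a_r_coset_def')
 let ?M = "monomial_quotient K Q w {}"
 have car: "car ?M = (%f. {f}) ` car PA" using M.ev_surj s by (metis (no_types, lifting) image_cong)
 have ops: "{f} \<oplus>\<^bsub>?M\<^esub> {g} = {f \<oplus>\<^bsub>PA\<^esub> g}" "{f} \<otimes>\<^bsub>?M\<^esub> {g} = {f \<diamond> g}"
 if "f : car PA" "g : car PA" for f g
 using M.ev_add[OF that] M.ev_mult[OF that] s that by simp_all
 have sm: "c \<odot>\<^bsub>?M\<^esub> {f} = {c \<odot>\<^bsub>PA\<^esub> f}" if "c : car K" "f : car PA" for c f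
 using M.ev_smult[OF that] s that P.smult_closed by simp
 have one: "\<one>\<^bsub>?M\<^esub> = {\<one>\<^bsub>PA\<^esub>}" using M.ev_one s by simp
 have deg: "adeg ?M n = (%f. {f}) ` adeg PA n" for n
 using M.ev_deg[of n] s P.adeg_carrier[of _ n] by (metis (no_types, lifting) image_cong)
 show ?thesis
 unfolding graded_algebra_isomorphic_def
 proof (intro bexI[of _ the_elem] conjI ballI allI)
 show "bij_betw the_elem (car ?M) (car PA)"
 unfolding car by (intro bij_betw_byWitness[where f' = "%f. {f}"]) auto
 show "the_elem : ring_hom ?M PA" by (rule ring_hom_memI) (auto simp: car ops one)
 show "the_elem (c \<odot>\<^bsub>?M\<^esub> x) = c \<odot>\<^bsub>PA\<^esub> the_elem x" if "c : car K" "x : car ?M" for c x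
 using that by (auto simp: car sm)
 show "the_elem ` adeg ?M n = adeg PA n" for n unfolding deg by (simp add: image_image)
 qed
qed

end

section \<open>Words of a monomial algebra\<close>

text \<open>With \<open>l + 1\<close> as a bound for the length of the forbidden paths, words of length \<open>l\<close> remember
  enough of the past to decide which letters may follow.\<close>

locale word_graph = monomial_algebra K A Q w S ev
 for K :: "'k ring" and A :: "('k, 'a) graded_algebra" and Q :: "('v, 'e) pre_digraph" and w S ev +
 fixes l :: nat
 assumes l_pos: "1 <= l" and S_length: "(v, q) : S ==> length q <= l + 1"
begin

definition start :: "'e list => 'v" where
 "start z = tail Q (hd z)"

text \<open>The nonempty paths without a forbidden subpath, written as words.\<close>

definition okw :: "'e list => bool" where
 "okw z \<longleftrightarrow> z ~= [] & (start z, z) : p.paths &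
 (ALL i n. i + n <= length z --> (p.pend (start z, take i z), take n (drop i z)) \<notin> S)"

definition M :: "'e list => 'a" where
 "M z = mono (start z, z)"

lemma start_path: "(v, z) : p.paths ==> z ~= [] ==> v = start z" by (cases z) (auto simp: start_def)

lemma start_append: "a ~= [] ==> start (a @ b) = start a" by (simp add: start_def)

lemma okw_path: "okw z ==> (start z, z) : p.paths" by (simp add: okw_def)

lemma okw_arcs: "okw z ==> set z \<subseteq> arcs Q"
 using okw_path p.qpaths_arcs by blast

lemma pend_start:
 assumes "(start (a @ b), a @ b) : p.paths" "b ~= []"
 shows "p.pend (start (a @ b), a) = start b"
 using assms p.qpaths_append start_path by blast

lemma okw_prefix:
 assumes "okw (a @ b)" "a ~= []"
 shows "okw a"
proof -
 have s: "start (a @ b) = start a" using assms(2) by (rule start_append)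
 have "(p.pend (start a, take i a), take n (drop i a)) \<notin> S" if "i + n <= length a" for i n
 proof -
 have "i + n <= length (a @ b)" "take i (a @ b) = take i a" "take n (drop i (a @ b)) = take n (drop i a)"
 using that by simp_all
 then show ?thesis using assms(1) s unfolding okw_def by metis
 qed
 then show ?thesis using assms s p.qpaths_append unfolding okw_def by auto
qed

lemma okw_suffix:
 assumes "okw (a @ b)" "b ~= []"
 shows "okw b"
proof -
 have p: "(start (a @ b), a @ b) : p.paths" using assms(1) by (rule okw_path)
 note e = pend_start[OF p assms(2)]
 have "(p.pend (start b, take i b), take n (drop i b)) \<notin> S" if "i + n <= length b" for i n
 proof -
 have "(length a + i) + n <= length (a @ b)" "take (length a + i) (a @ b) = a @ take i b"
 "take n (drop (length a + i) (a @ b)) = take n (drop i b)"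
 using that by simp_all
 moreover have "p.pend (start (a @ b), a @ take i b) = p.pend (start b, take i b)"
 using qpath_end_append[of Q "start (a @ b)" a "take i b"] e by simp
 ultimately show ?thesis using assms(1) unfolding okw_def by metis
 qed
 then show ?thesis using assms p p.qpaths_append[of "start (a @ b)" a b] e unfolding okw_def by auto
qed

text \<open>A forbidden path is too short to meet both sides of an overlap of length \<open>l\<close>.\<close>

lemma okw_glue:
 assumes au: "okw (a @ u)" and ub: "okw (u @ b)" and u: "l <= length u"
 shows "okw (a @ u @ b)"
proof -
 have une: "u ~= []" using u l_pos by auto
 have s: "start (a @ u @ b) = start (a @ u)" "start (u @ b) = start u"
 using une start_append[of "a @ u" b] start_append[of u b] by auto
 have pau: "(start (a @ u), a @ u) : p.paths" and pub: "(start (u @ b), u @ b) : p.paths"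
 using okw_path au ub by auto
 have e: "p.pend (start (a @ u), a) = start u" by (rule pend_start[OF pau une])
 have path: "(start (a @ u @ b), a @ u @ b) : p.paths"
 using p.qpaths_append[of "start (a @ u)" a "u @ b"] p.qpaths_append[of "start (a @ u)" a u] pau pub s e by simp
 have "(p.pend (start (a @ u @ b), take i (a @ u @ b)), take n (drop i (a @ u @ b))) \<notin> S"
 if i: "i + n <= length (a @ u @ b)" for i n
 proof (cases "i + n <= length (a @ u)")
 case True
 have "take i (a @ u @ b) = take i (a @ u)" "take n (drop i (a @ u @ b)) = take n (drop i (a @ u))"
 using True by (simp_all add: take_append drop_append)
 then show ?thesis using au True s unfolding okw_def by metis
 next
 case False
 note F = False
 show ?thesis
 proof (cases "length a <= i")
 case True
 then obtain k where k: "i = length a + k" using le_Suc_ex by blast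
 have "take i (a @ u @ b) = a @ take k (u @ b)" "take n (drop i (a @ u @ b)) = take n (drop k (u @ b))"
 by (simp_all add: k)
 moreover have "p.pend (start (a @ u), a @ take k (u @ b)) = p.pend (start (u @ b), take k (u @ b))"
 using qpath_end_append[of Q "start (a @ u)" a "take k (u @ b)"] e s by simp
 moreover have "k + n <= length (u @ b)" using i k by simp
 ultimately show ?thesis using ub s unfolding okw_def by metis
 next
 case False
 then have "l + 1 < length (take n (drop i (a @ u @ b)))" using F u i by auto
 then show ?thesis using S_length by fastforce
 qed
 qed
 then show ?thesis using path une unfolding okw_def by auto
qed

text \<open>A path with a forbidden subpath is a multiple of it.\<close>

lemma mono_not_okw:
 assumes z: "(v, z) : p.paths" "z ~= []" and n: "~ okw z"
 shows "mono (v, z) = \<zero>\<^bsub>A\<^esub>"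
proof -
 have v: "v = start z" by (rule start_path[OF z])
 obtain i n where i: "i + n <= length z" "(p.pend (v, take i z), take n (drop i z)) : S"
 using z n v unfolding okw_def by blast
 define a b c where "a = take i z" and "b = take n (drop i z)" and "c = drop n (drop i z)"
 have zabc: "z = a @ b @ c" by (simp only: a_def b_def c_def append_take_drop_id)
 have pa: "(v, a) : p.paths" and pbc: "(p.pend (v, a), b @ c) : p.paths"
 using z(1) p.qpaths_append unfolding zabc by auto
 have pb: "(p.pend (v, a), b) : p.paths" and pc: "(p.pend (p.pend (v, a), b), c) : p.paths"
 using pbc p.qpaths_append by auto
 have "mono (v, z) = mono (v, a) \<otimes>\<^bsub>A\<^esub> (mono (p.pend (v, a), b) \<otimes>\<^bsub>A\<^esub> mono (p.pend (p.pend (v, a), b), c))"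
 using mono_mult[OF pb pc] mono_mult[OF pa pbc] zabc by simp
 moreover have "mono (p.pend (v, a), b) = \<zero>\<^bsub>A\<^esub>" using mono_S i(2) by (simp add: a_def b_def)
 ultimately show ?thesis using mono_closed[OF pa] mono_closed[OF pc] by simp
qed

text \<open>The states are pairs of a word \<open>u\<close> of length \<open>l\<close> and a clock that counts the degrees in
  which the first arrow of \<open>u\<close> is consumed.\<close>

definition X0 :: "'e list set" where
 "X0 = {u. okw u & length u = l}"

definition X :: "('e list \<times> nat) set" where
 "X = {(u, j). u : X0 & j < w (hd u)}"

text \<open>Either the clock ticks, or the first letter has been consumed and the window moves on by one
  letter.\<close>

definition edge :: "'e list \<times> nat => 'e list \<times> nat => bool" where
 "edge s t \<longleftrightarrow> (snd s + 1 < w (hd (fst s)) & t = (fst s, snd s + 1)) \<or>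
 (snd s + 1 = w (hd (fst s)) & (EX y. okw (fst s @ [y]) & t = (tl (fst s) @ [y], 0)))"

lemma X0_ne: "u : X0 ==> u ~= []"
 using l_pos by (auto simp: X0_def)

lemma X0_hd: "u : X0 ==> hd u : arcs Q"
proof -
 assume u: "u : X0"
 then have "set u \<subseteq> arcs Q" using okw_arcs by (simp add: X0_def)
 then show ?thesis using X0_ne[OF u] by (cases u) auto
qed

lemma X0_clock: "u : X0 ==> (u, 0) : X"
 using p.w_pos[OF X0_hd] by (auto simp: X_def Suc_le_eq)

lemma finite_X0: "finite X0"
proof (rule finite_subset)
 show "X0 \<subseteq> {u. set u \<subseteq> arcs Q & length u = l}" using okw_arcs by (auto simp: X0_def)
 show "finite {u. set u \<subseteq> arcs Q & length u = l}" by (rule finite_lists_length_eq) simp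
qed

lemma finite_X: "finite X"
proof (rule finite_subset)
 show "X \<subseteq> X0 \<times> {..<maxw}" using w_le_maxw X0_hd by (fastforce simp: X_def)
 show "finite (X0 \<times> {..<maxw})" using finite_X0 by simp
qed

lemma shift_word:
 assumes u: "u : X0" and y: "okw (u @ [y])"
 shows "tl u @ [y] : X0"
proof -
 have e: "u @ [y] = [hd u] @ (tl u @ [y])" using X0_ne[OF u] by simp
 have "okw (tl u @ [y])" by (rule okw_suffix[of "[hd u]"]) (use y e in auto)
 then show ?thesis using u l_pos by (simp add: X0_def)
qed

lemma take_X0: "okw z ==> l <= length z ==> take l z : X0"
 using okw_prefix[of "take l z" "drop l z"] l_pos by (cases z) (auto simp: X0_def)

lemma length_weight: "set z \<subseteq> arcs Q ==> weight w z <= length z * maxw"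
 by (induction z) (use w_le_maxw in \<open>fastforce simp: add_mono\<close>)+

end

section \<open>The unfolded quiver\<close>

text \<open>\<open>B\<close> is the path algebra of the quiver of states. The states are numbered by \<open>enc\<close>, and an
  arrow is coded by the pair of its ends, since there is at most one arrow between two states.\<close>

locale unfolded_quiver = A: word_graph K A Q w S evA l + B: monomial_algebra K B G "%_. 1" "{}" evB
 for K :: "'k ring" and A :: "('k, 'a) graded_algebra" and Q :: "('v, 'e) pre_digraph" and w S evA l
  and B :: "('k, 'b) graded_algebra" and G :: "(nat, nat) pre_digraph" and evB +
 fixes enc :: "'e list \<times> nat => nat"
 assumes enc_bij: "bij_betw enc A.X (verts G)"
  and arcs_G: "arcs G = {prod_encode (enc s, enc t) | s t. s : A.X & t : A.X & A.edge s t}"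
  and tail_G: "tail G = (%e. fst (prod_decode e))" and head_G: "head G = (%e. snd (prod_decode e))"
begin

abbreviation mult_B (infixl "\<star>" 70) where "x \<star> y \<equiv> x \<otimes>\<^bsub>B\<^esub> y"

lemma enc_inj: "s : A.X ==> t : A.X ==> enc s = enc t ==> s = t"
 using enc_bij unfolding bij_betw_def by (meson inj_onD)

lemma enc_verts: "s : A.X ==> enc s : verts G"
 using enc_bij unfolding bij_betw_def by blast

lemma vertsE: "v : verts G ==> EX s:A.X. v = enc s"
 using enc_bij unfolding bij_betw_def by blast

definition code :: "'e list \<times> nat => 'e list \<times> nat => nat" where
 "code s t = prod_encode (enc s, enc t)"

lemma code_sel [simp]: "tail G (code s t) = enc s" "head G (code s t) = enc t"
 by (simp_all add: code_def tail_G head_G)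

lemma arcsE: "e : arcs G ==> EX s t. s : A.X & t : A.X & A.edge s t & e = code s t"
 using arcs_G by (auto simp: code_def)

lemma arcsI: "s : A.X ==> t : A.X ==> A.edge s t ==> code s t : arcs G"
 unfolding arcs_G code_def by blast

lemma weight_G: "weight (%_. 1) p = length p" by (induction p) simp_all

lemma weight_G' [simp]: "weight (%_. Suc 0) p = length p" by (induction p) simp_all

text \<open>The path that reads the first arrow of \<open>u\<close>, starting at time \<open>j\<close> and ending in \<open>(u', 0)\<close>.\<close>

definition blk :: "nat => 'e list => 'e list => nat list" where
 "blk j u u' = map (%i. code (u, i) (if i + 1 < w (hd u) then (u, i + 1) else (u', 0))) [j..<w (hd u)]"

lemma blk_Cons: "j < w (hd u) ==>
  blk j u u' = code (u, j) (if j + 1 < w (hd u) then (u, j + 1) else (u', 0)) # blk (j + 1) u u'"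
 by (simp add: blk_def upt_conv_Cons)

lemma blk_path:
 assumes u: "u : A.X0" and y: "A.okw (u @ [y])" and "j < w (hd u)"
 shows "(enc (u, j), blk j u (tl u @ [y])) : B.p.paths &
  B.p.pend (enc (u, j), blk j u (tl u @ [y])) = enc (tl u @ [y], 0)"
 using assms(3)
proof (induction "w (hd u) - j" arbitrary: j rule: less_induct)
 case less
 note u' = A.X0_clock[OF A.shift_word[OF u y]]
 have s: "(u, j) : A.X" using u less.prems by (simp add: A.X_def)
 show ?case
 proof (cases "j + 1 < w (hd u)")
  case True
  then have t: "(u, j + 1) : A.X" using u by (simp add: A.X_def)
  have "code (u, j) (u, j + 1) : arcs G"
  by (rule arcsI[OF s t]) (use True in \<open>simp add: A.edge_def\<close>)
  then show ?thesis using less.hyps[of "j + 1"] True blk_Cons[OF less.prems, of "tl u @ [y]"] by simp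
 next
  case False
  then have j: "j + 1 = w (hd u)" using less.prems by simp
  have "code (u, j) (tl u @ [y], 0) : arcs G"
  by (rule arcsI[OF s u']) (use j y in \<open>auto simp: A.edge_def\<close>)
  moreover have "blk (j + 1) u (tl u @ [y]) = []" using j by (simp add: blk_def)
  ultimately show ?thesis using False enc_verts[OF u'] blk_Cons[OF less.prems, of "tl u @ [y]"] by simp
 qed
qed

text \<open>The walk that reads \<open>z\<close>: it starts in the window of the first \<open>l\<close> letters of \<open>z\<close> and ends in the
  window of the last \<open>l\<close>.\<close>

primrec rp :: "'e list => nat list" where
 "rp [] = []"
| "rp (x # z) = (if length z < l then [] else blk 0 (take l (x # z)) (take l z) @ rp z)"

lemma rp_short: "length z <= l ==> rp z = []" by (cases z) auto

lemma rp_append: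
 assumes "length u = l"
 shows "rp (a @ u @ b) = rp (a @ u) @ rp (u @ b)"
 using assms by (induction a) (auto simp: rp_short take_Cons')

lemma take_l_split:
 assumes "l <= length z"
 shows "take l (x # z) @ [z ! (l - 1)] = take (l + 1) (x # z)" "tl (take l (x # z)) @ [z ! (l - 1)] = take l z"
proof -
 obtain k where k: "l = Suc k" using A.l_pos by (cases l) auto
 show "take l (x # z) @ [z ! (l - 1)] = take (l + 1) (x # z)" "tl (take l (x # z)) @ [z ! (l - 1)] = take l z"
  using assms by (simp_all add: k take_Suc_conv_app_nth)
qed

lemma rp_path:
 assumes "A.okw z" "l <= length z"
 shows "(enc (take l z, 0), rp z) : B.p.paths &
  B.p.pend (enc (take l z, 0), rp z) = enc (drop (length z - l) z, 0) &
  length (rp z) = weight w (take (length z - l) z)"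
 using assms
proof (induction z)
 case Nil then show ?case using A.l_pos by simp
next
 case (Cons x z)
 show ?case
 proof (cases "length z < l")
  case True
  then have "length (x # z) = l" using Cons.prems by simp
  then show ?thesis using True A.X0_clock enc_verts Cons.prems(1) by (auto simp: A.X0_def)
 next
  case False
  define y where "y = z ! (l - 1)"
  note s = take_l_split[of z x, folded y_def]
  have zne: "z ~= []" using False A.l_pos by auto
  have okz: "A.okw z" by (rule A.okw_suffix[of "[x]"]) (use Cons.prems zne in auto)
  have u: "take l (x # z) : A.X0" by (rule A.take_X0) (use Cons.prems in auto)
  have ok1: "A.okw (take l (x # z) @ [y])"
  unfolding s(1)[OF leI[OF False]]
  by (rule A.okw_prefix[of _ "drop (l + 1) (x # z)"]) (use Cons.prems in \<open>simp_all only: append_take_drop_id, simp_all\<close>)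
  have hd: "hd (take l (x # z)) = x" using A.l_pos by (cases l) auto
  have wx: "0 < w (hd (take l (x # z)))" using A.p.w_pos[OF A.X0_hd[OF u]] by simp
  note b = blk_path[OF u ok1 wx, unfolded s(2)[OF leI[OF False]]]
  note IH = Cons.IH[OF okz leI[OF False]]
  have "length (blk 0 (take l (x # z)) (take l z)) = w x" by (simp add: blk_def hd)
  moreover have "take (length (x # z) - l) (x # z) = x # take (length z - l) z"
  "drop (length (x # z) - l) (x # z) = drop (length z - l) z"
  using False by (simp_all add: Suc_diff_le)
  ultimately show ?thesis
  using False b IH B.p.qpaths_append qpath_end_append[of G "enc (take l (x # z), 0)"] by simp
 qed
qed

text \<open>The walk of \<open>z\<close> as an element of \<open>B\<close>. It has the degree of \<open>z\<close> without its last \<open>l\<close> letters.\<close>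

definition P :: "'e list => 'b" where
 "P z = B.mono (enc (take l z, 0), rp z)"

lemma P_closed: "A.okw z ==> l <= length z ==> P z : car B"
 unfolding P_def using rp_path B.mono_closed by blast

lemma P_adeg: "A.okw z ==> l <= length z ==> P z : adeg B (weight w (take (length z - l) z))"
 unfolding P_def using rp_path[of z] B.mono_adeg[of "(enc (take l z, 0), rp z)"] by (simp add: weight_G)

lemma P_mult:
 assumes "A.okw (a @ u)" "u : A.X0" "A.okw (u' @ b)" "u' : A.X0"
 shows "P (a @ u) \<star> P (u' @ b) = (if u = u' then P (a @ u @ b) else \<zero>\<^bsub>B\<^esub>)"
proof -
 have len: "length u = l" "length u' = l" using assms by (auto simp: A.X0_def)
 note r1 = rp_path[OF assms(1)] and r2 = rp_path[OF assms(3)]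
 have "u = u'" if "enc (u, 0) = enc (u', 0)"
  using enc_inj[OF A.X0_clock[OF assms(2)] A.X0_clock[OF assms(4)] that] by simp
 then have iff: "enc (u, 0) = enc (u', 0) \<longleftrightarrow> u = u'" by blast
 have tk: "take l (a @ u @ b) = take l (a @ u)" "take l (u' @ b) = u'" "drop (length (a @ u) - l) (a @ u) = u"
  using len by simp_all
 have l1: "l <= length (a @ u)" and l2: "l <= length (u' @ b)" using len by simp_all
 have "P (a @ u) \<star> P (u' @ b)
  = (if u = u' then B.mono (enc (take l (a @ u), 0), rp (a @ u) @ rp (u' @ b)) else \<zero>\<^bsub>B\<^esub>)"
  using B.mono_mult[OF r1[OF l1, THEN conjunct1] r2[OF l2, THEN conjunct1]] r1[OF l1] iff tk
  unfolding P_def by simp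
 then show ?thesis using rp_append[OF len(1), of a b] tk unfolding P_def by auto
qed

text \<open>The states at which a walk that has read \<open>q\<close> may arrive.\<close>

definition Y :: "('v, 'e) qpath => 'e list set" where
 "Y q = {u : A.X0. A.okw (snd q @ u) & A.start (snd q @ u) = fst q}"

text \<open>The sum of the walks that read exactly \<open>q\<close>, one for each state of arrival.\<close>

definition bb :: "('v, 'e) qpath => 'b" where
 "bb q = (\<Oplus>\<^bsub>B\<^esub>u\<in>Y q. P (snd q @ u))"

text \<open>The idempotent whose corner \<open>ee B ee\<close> contains the image of \<open>A\<close>.\<close>

definition ee :: 'b where
 "ee = (\<Oplus>\<^bsub>B\<^esub>u\<in>A.X0. P u)"

lemma Y_finite: "finite (Y q)"
 using A.finite_X0 by (simp add: Y_def)

lemma Y_P: "u : Y q ==> P (snd q @ u) : adeg B (weight w (snd q))"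
 using P_adeg[of "snd q @ u"] by (auto simp: Y_def A.X0_def)

lemma Y_Pc: "u : Y q ==> P (snd q @ u) : car B"
 using Y_P B.adeg_carrier by blast

lemma X0_P: "u : A.X0 ==> P u : car B" "u : A.X0 ==> A.okw u"
 using P_closed by (auto simp: A.X0_def)

lemma bb_adeg: "bb q : adeg B (weight w (snd q))"
proof -
 interpret ag: graded_group B "adeg B" by (rule B.graded_group)
 show ?thesis
  unfolding bb_def by (rule B.finsum_closed_under[OF Y_finite]) (use Y_P Y_Pc ag.D_zero ag.D_add in auto)
qed

lemma bb_closed: "bb q : car B"
 using bb_adeg B.adeg_carrier by blast

lemma ee_closed: "ee : car B"
 unfolding ee_def using X0_P by (intro B.finsum_closed) auto

text \<open>Only the walk that arrives in \<open>u\<close> can be continued.\<close>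

lemma bb_P:
 assumes "A.okw (u @ c)" "u : A.X0"
 shows "bb q \<star> P (u @ c) = (if u : Y q then P (snd q @ u @ c) else \<zero>\<^bsub>B\<^esub>)"
proof -
 have len: "l <= length (u @ c)" using assms by (simp add: A.X0_def)
 have m: "P (snd q @ u') \<star> P (u @ c) = (if u' = u then P (snd q @ u' @ c) else \<zero>\<^bsub>B\<^esub>)" if "u' : Y q" for u'
  by (rule P_mult) (use that assms in \<open>auto simp: Y_def\<close>)
 have "bb q \<star> P (u @ c) = (\<Oplus>\<^bsub>B\<^esub>u'\<in>Y q. P (snd q @ u') \<star> P (u @ c))"
  unfolding bb_def by (rule B.finsum_ldistr[OF Y_finite P_closed[OF assms(1) len]]) (use Y_Pc in auto)
 also have "... = (if u : Y q then P (snd q @ u @ c) else \<zero>\<^bsub>B\<^esub>)"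
 proof (cases "u : Y q")
  case True
  have "P (snd q @ u) \<star> P (u @ c) : car B" using Y_Pc[OF True] P_closed[OF assms(1) len] by simp
  then show ?thesis
  using B.finsum_single[OF Y_finite True, of "%u'. P (snd q @ u') \<star> P (u @ c)"] m True by simp
 next
  case False
  have "(\<Oplus>\<^bsub>B\<^esub>u'\<in>Y q. P (snd q @ u') \<star> P (u @ c)) = \<zero>\<^bsub>B\<^esub>"
  by (rule B.add.finprod_one_eqI) (use m False in auto)
  then show ?thesis using False by simp
 qed
 finally show ?thesis .
qed

lemma ee_P:
 assumes "A.okw (u @ c)" "u : A.X0"
 shows "ee \<star> P (u @ c) = P (u @ c)"
proof -
 have len: "l <= length (u @ c)" using assms by (simp add: A.X0_def)
 have m: "P u' \<star> P (u @ c) = (if u' = u then P (u' @ c) else \<zero>\<^bsub>B\<^esub>)" if "u' : A.X0" for u'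
  using P_mult[of "[]" u' u c] that assms X0_P by simp
 have "ee \<star> P (u @ c) = (\<Oplus>\<^bsub>B\<^esub>u'\<in>A.X0. P u' \<star> P (u @ c))"
  unfolding ee_def by (rule B.finsum_ldistr[OF A.finite_X0 P_closed[OF assms(1) len]]) (use X0_P in auto)
 also have "... = P u \<star> P (u @ c)"
 proof (rule B.finsum_single[OF A.finite_X0 assms(2)])
  show "P u \<star> P (u @ c) : car B" using X0_P(1)[OF assms(2)] P_closed[OF assms(1) len] by simp
  show "P u' \<star> P (u @ c) = \<zero>\<^bsub>B\<^esub>" if "u' : A.X0" "u' ~= u" for u' using m[OF that(1)] that(2) by simp
 qed
 finally show ?thesis using m[OF assms(2)] by simp
qed

lemma Y_word: "u : Y q ==> A.okw (snd q @ u) & l <= length (snd q @ u) & take l (snd q @ u) : A.X0"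
 using A.take_X0[of "snd q @ u"] by (auto simp: Y_def A.X0_def)

lemma ee_ee: "ee \<star> ee = ee"
proof -
 have "ee \<star> ee = (\<Oplus>\<^bsub>B\<^esub>u\<in>A.X0. ee \<star> P u)"
  by (subst (2) ee_def, rule B.finsum_rdistr[OF A.finite_X0 ee_closed]) (use X0_P in auto)
 also have "... = ee" by (subst (2) ee_def, rule B.finsum_cong') (use ee_P[of _ "[]"] X0_P in auto)
 finally show ?thesis .
qed

lemma bb_ee: "bb q \<star> ee = bb q"
proof -
 have "bb q \<star> ee = (\<Oplus>\<^bsub>B\<^esub>u\<in>A.X0. bb q \<star> P u)"
  unfolding ee_def by (rule B.finsum_rdistr[OF A.finite_X0 bb_closed]) (use X0_P in auto)
 also have "... = (\<Oplus>\<^bsub>B\<^esub>u\<in>Y q. P (snd q @ u))"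
  by (rule B.add.finprod_mono_neutral_cong_right[OF A.finite_X0])
  (use bb_P[of _ "[]"] X0_P Y_Pc bb_closed in \<open>auto simp: Y_def\<close>)
 finally show ?thesis by (simp add: bb_def)
qed

text \<open>A walk that reads \<open>q\<close> and then \<open>r\<close> is determined by its state of arrival, since the window in
  between consists of letters of \<open>r\<close> and of that state. All of these walks exist because allowed words
  that overlap in \<open>l\<close> letters can be glued.\<close>

lemma bb_mult:
 assumes q: "q : A.p.paths" and r: "r : A.p.paths"
 shows "bb q \<star> bb r = (if A.p.pend q = fst r then bb (fst q, snd q @ snd r) else \<zero>\<^bsub>B\<^esub>)"
proof -
 let ?qr = "(fst q, snd q @ snd r)"
 have t: "bb q \<star> P (snd r @ u) = (if take l (snd r @ u) : Y q then P (snd q @ snd r @ u) else \<zero>\<^bsub>B\<^esub>)"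
  if "u : Y r" for u
  using bb_P[of "take l (snd r @ u)" "drop l (snd r @ u)" q] Y_word[OF that] by (simp only: append_take_drop_id)
 have iff: "take l (snd r @ u) : Y q \<longleftrightarrow> u : Y ?qr & A.p.pend q = fst r" if u: "u : Y r" for u
 proof
  let ?z = "snd r @ u"
  note yw = Y_word[OF u]
  have rs: "A.start ?z = fst r" using u by (simp add: Y_def)
  have zne: "?z ~= []" using yw A.l_pos by auto
  assume tk: "take l ?z : Y q"
  then have ok: "A.okw (snd q @ take l ?z)" "A.start (snd q @ take l ?z) = fst q" by (auto simp: Y_def)
  have lz: "length (take l ?z) = l" using yw unfolding A.X0_def by blast
  have "A.okw (snd q @ take l ?z @ drop l ?z)"
  proof (rule A.okw_glue[OF ok(1)])
  show "A.okw (take l ?z @ drop l ?z)" using yw by (simp only: append_take_drop_id)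
  show "l <= length (take l ?z)" by (simp only: lz)
  qed
  then have okz: "A.okw (snd q @ ?z)" by (simp only: append_take_drop_id)
  have sz: "A.start (snd q @ ?z) = fst q"
  proof -
  have "snd q @ take l ?z ~= []" using ok(1) by (auto simp: A.okw_def)
  from A.start_append[OF this, of "drop l ?z"] show ?thesis using ok(2)
  by (simp only: append_assoc append_take_drop_id)
  qed
  have "A.p.pend q = fst r" using A.pend_start[OF A.okw_path[OF okz] zne] sz rs by simp
  then show "u : Y ?qr & A.p.pend q = fst r" using u okz sz by (simp add: Y_def)
 next
  let ?z = "snd r @ u"
  note yw = Y_word[OF u]
  assume a: "u : Y ?qr & A.p.pend q = fst r"
  then have okz: "A.okw (snd q @ ?z)" "A.start (snd q @ ?z) = fst q" by (auto simp: Y_def)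
  have tne: "take l ?z ~= []" using yw A.X0_ne by blast
  have "A.okw ((snd q @ take l ?z) @ drop l ?z)" using okz(1) by (simp only: append_assoc append_take_drop_id)
  then have "A.okw (snd q @ take l ?z)" by (rule A.okw_prefix) (use tne in simp)
  moreover have "A.start (snd q @ take l ?z) = fst q"
  proof -
  have "snd q @ take l ?z ~= []" using tne by simp
  from A.start_append[OF this, of "drop l ?z"] show ?thesis using okz(2)
  by (simp only: append_assoc append_take_drop_id)
  qed
  ultimately show "take l ?z : Y q" using yw by (simp add: Y_def)
 qed
 have sub: "Y ?qr \<subseteq> Y r" if "A.p.pend q = fst r"
 proof
  fix u assume u: "u : Y ?qr"
  then have okz: "A.okw (snd q @ snd r @ u)" "A.start (snd q @ snd r @ u) = fst q" "u : A.X0" by (auto simp: Y_def)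
  have ne: "snd r @ u ~= []" using A.X0_ne[OF okz(3)] by simp
  have "A.start (snd r @ u) = fst r" using A.pend_start[OF A.okw_path[OF okz(1)] ne] okz(2) that by simp
  then show "u : Y r" using A.okw_suffix[OF okz(1) ne] okz(3) by (simp add: Y_def)
 qed
 have "bb q \<star> bb r = (\<Oplus>\<^bsub>B\<^esub>u\<in>Y r. bb q \<star> P (snd r @ u))"
  by (subst (2) bb_def, rule B.finsum_rdistr[OF Y_finite bb_closed]) (use Y_Pc in auto)
 also have "... = (if A.p.pend q = fst r then bb ?qr else \<zero>\<^bsub>B\<^esub>)"
 proof (cases "A.p.pend q = fst r")
  case True
  have "(\<Oplus>\<^bsub>B\<^esub>u\<in>Y r. bb q \<star> P (snd r @ u)) = (\<Oplus>\<^bsub>B\<^esub>u\<in>Y ?qr. P (snd ?qr @ u))"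
  proof (rule B.add.finprod_mono_neutral_cong_right[OF Y_finite sub[OF True]])
  show "bb q \<star> P (snd r @ u) = \<zero>\<^bsub>B\<^esub>" if "u : Y r - Y ?qr" for u
  proof -
  have u: "u : Y r" "u \<notin> Y ?qr" using that by auto
  show ?thesis unfolding t[OF u(1)] iff[OF u(1)] using u(2) by simp
  qed
  show "bb q \<star> P (snd r @ u) = P (snd ?qr @ u)" if "u : Y ?qr" for u
  proof -
  have u: "u : Y r" using that sub[OF True] by blast
  show ?thesis unfolding t[OF u] iff[OF u] using that True by simp
  qed
  show "(%u. bb q \<star> P (snd r @ u)) : Y r \<rightarrow> car B"
  using B.m_closed[OF bb_closed Y_Pc] by blast
  qed
  then show ?thesis using True by (simp add: bb_def)
 next
  case False
  have "(\<Oplus>\<^bsub>B\<^esub>u\<in>Y r. bb q \<star> P (snd r @ u)) = \<zero>\<^bsub>B\<^esub>"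
  proof (rule B.add.finprod_one_eqI)
  show "bb q \<star> P (snd r @ u) = \<zero>\<^bsub>B\<^esub>" if "u : Y r" for u
  unfolding t[OF that] iff[OF that] using False by simp
  qed
  then show ?thesis using False by simp
 qed
 finally show ?thesis .
qed

text \<open>No allowed word begins with a forbidden path.\<close>

lemma bb_S: "q : S ==> bb q = \<zero>\<^bsub>B\<^esub>"
proof -
 assume q: "q : S"
 have "False" if "u : Y q" for u
 proof -
  have ok: "A.okw (snd q @ u)" "A.start (snd q @ u) = fst q" using that by (auto simp: Y_def)
  have "(A.p.pend (A.start (snd q @ u), take 0 (snd q @ u)), take (length (snd q)) (drop 0 (snd q @ u))) \<notin> S"
  using ok(1) unfolding A.okw_def by (metis add_0 le_add1 length_append)
  then show False using ok(2) q by simp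
 qed
 then have "Y q = {}" by blast
 then show ?thesis by (simp add: bb_def)
qed

lemma ee_sum: "(\<Oplus>\<^bsub>B\<^esub>v\<in>verts Q. bb (v, [])) = ee"
proof -
 have "(\<Union>v\<in>verts Q. Y (v, [])) = A.X0"
  using A.okw_path A.p.qpaths_start by (fastforce simp: Y_def A.X0_def)
 moreover have "finsum B P (\<Union>v\<in>verts Q. Y (v, [])) = (\<Oplus>\<^bsub>B\<^esub>v\<in>verts Q. finsum B P (Y (v, [])))"
 proof (rule B.add.finprod_UN_disjoint)
  show "finite (verts Q)" by simp
  show "finite (Y (v, []))" for v by (rule Y_finite)
  show "pairwise (%v v'. disjnt (Y (v, [])) (Y (v', []))) (verts Q)"
  by (auto simp: pairwise_def disjnt_def Y_def)
  show "P u : car B" if "u : Y (v, [])" for v u using Y_Pc[OF that] by simp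
 qed
 ultimately show ?thesis by (simp add: bb_def ee_def)
qed

end

context unfolded_quiver begin

text \<open>A walk either stops before the clock runs out or completes the block of the first letter.\<close>

lemma G_path_step:
 assumes u: "u : A.X0" and "j < w (hd u)" "(enc (u, j), es) : B.p.paths"
 shows "(length es < w (hd u) - j & B.p.pend (enc (u, j), es) = enc (u, j + length es)) \<or>
  (EX y es'. A.okw (u @ [y]) & es = blk j u (tl u @ [y]) @ es' & (enc (tl u @ [y], 0), es') : B.p.paths)"
 using assms(2,3)
proof (induction es arbitrary: j)
 case Nil then show ?case by simp
next
 case (Cons e es)
 then have e: "e : arcs G" "enc (u, j) = tail G e" "(head G e, es) : B.p.paths" by simp_all
 obtain s t where st: "s : A.X" "t : A.X" "A.edge s t" "e = code s t" using arcsE[OF e(1)] by blast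
 have "(u, j) : A.X" using u Cons.prems(1) by (simp add: A.X_def)
 then have s: "s = (u, j)" using enc_inj[of "(u, j)" s] st e(2) by simp
 from st(3) s consider (tick) "j + 1 < w (hd u)" "t = (u, j + 1)" |
  (last) y where "j + 1 = w (hd u)" "A.okw (u @ [y])" "t = (tl u @ [y], 0)" by (auto simp: A.edge_def)
 then show ?case
 proof cases
  case tick
  have p: "(enc (u, j + 1), es) : B.p.paths" using e(3) st(4) tick(2) by simp
  have pe: "B.p.pend (enc (u, j), e # es) = B.p.pend (enc (u, j + 1), es)" using st(4) tick(2) by simp
  from Cons.IH[OF tick(1) p] show ?thesis
  proof (elim disjE exE conjE)
  assume "length es < w (hd u) - (j + 1)" "B.p.pend (enc (u, j + 1), es) = enc (u, j + 1 + length es)"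
  then show ?thesis unfolding pe by (intro disjI1) simp
  next
  fix y es' assume a: "A.okw (u @ [y])" "es = blk (j + 1) u (tl u @ [y]) @ es'"
  "(enc (tl u @ [y], 0), es') : B.p.paths"
  have "e # es = blk j u (tl u @ [y]) @ es'"
  unfolding blk_Cons[OF Cons.prems(1)] using a(2) tick st(4) s by simp
  then show ?thesis using a(1,3) by blast
  qed
 next
  case last
  have "blk (j + 1) u (tl u @ [y]) = []" using last(1) by (simp add: blk_def)
  then have "e # es = blk j u (tl u @ [y]) @ es"
  unfolding blk_Cons[OF Cons.prems(1)] using last st(4) s by simp
  moreover have "(enc (tl u @ [y], 0), es) : B.p.paths" using e(3) st(4) last(3) by simp
  ultimately show ?thesis using last(2) by blast
 qed
qed

text \<open>A walk that starts at clock 0 is a sequence of complete blocks, hence the walk of a word,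
  followed by a few ticks.\<close>

lemma G_path_main:
 assumes "u : A.X0" "(enc (u, 0), es) : B.p.paths"
 shows "EX a u' r. u' : A.X0 & A.okw (a @ u') & take l (a @ u') = u & es = rp (a @ u') @ r &
  (enc (u', 0), r) : B.p.paths & length r < w (hd u') & B.p.pend (enc (u', 0), r) = enc (u', length r)"
 using assms
proof (induction "length es" arbitrary: u es rule: less_induct)
 case less
 note u = less.prems(1)
 have ulen: "length u = l" "A.okw u" using u by (simp_all add: A.X0_def)
 have w0: "0 < w (hd u)" using A.p.w_pos[OF A.X0_hd[OF u]] by simp
 from G_path_step[OF u w0 less.prems(2)] show ?case
 proof (elim disjE exE conjE)
  assume "length es < w (hd u) - 0" "B.p.pend (enc (u, 0), es) = enc (u, 0 + length es)"
  then show ?thesis using u ulen less.prems(2)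
  by (intro exI[of _ "[]"] exI[of _ u] exI[of _ es]) (simp add: rp_short)
 next
  fix y es' assume y: "A.okw (u @ [y])" "es = blk 0 u (tl u @ [y]) @ es'" "(enc (tl u @ [y], 0), es') : B.p.paths"
  define u1 where "u1 = tl u @ [y]"
  have u1: "u1 : A.X0" unfolding u1_def by (rule A.shift_word[OF u y(1)])
  have "length es' < length es" using y(2) w0 by (simp add: blk_def)
  from less.hyps[OF this u1 y(3)[folded u1_def]]
  obtain a u' r where IH: "u' : A.X0" "A.okw (a @ u')" "take l (a @ u') = u1" "es' = rp (a @ u') @ r"
  "(enc (u', 0), r) : B.p.paths" "length r < w (hd u')" "B.p.pend (enc (u', 0), r) = enc (u', length r)"
  by blast
  have l1: "l <= length (a @ u')" using IH(1) by (simp add: A.X0_def)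
  have uu: "hd u # tl u = u" using A.X0_ne[OF u] by simp
  have ok: "A.okw ([hd u] @ u1 @ drop l (a @ u'))"
  proof (rule A.okw_glue)
  show "A.okw ([hd u] @ u1)" using y(1) uu unfolding u1_def by (metis append_Cons append_Nil)
  show "A.okw (u1 @ drop l (a @ u'))" unfolding IH(3)[symmetric] append_take_drop_id by (rule IH(2))
  show "l <= length u1" using u1 by (simp add: A.X0_def)
  qed
  have ok': "A.okw ((hd u # a) @ u')"
  using ok unfolding IH(3)[symmetric] append_take_drop_id by simp
  have "take (l - 1) (a @ u') = tl u"
  proof -
  have "take (l - 1) (a @ u') = take (l - 1) (take l (a @ u'))" by (simp only: take_take) (simp add: min_def)
  also have "... = tl u" unfolding IH(3) u1_def using ulen(1) by simp
  finally show ?thesis .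
  qed
  then have tk: "take l (hd u # (a @ u')) = u" using A.l_pos uu by (cases l) auto
  have "rp ((hd u # a) @ u') = blk 0 u u1 @ rp (a @ u')"
  using l1 tk IH(3) by simp
  then show ?thesis
  using IH ok' tk y(2) by (intro exI[of _ "hd u # a"] exI[of _ u'] exI[of _ r]) (simp add: u1_def)
 qed
qed

lemma P_ee: "A.okw (a @ u) ==> u : A.X0 ==> P (a @ u) \<star> ee = P (a @ u)"
proof -
 assume ok: "A.okw (a @ u)" and u: "u : A.X0"
 have uY: "u : Y (A.start (a @ u), a)" using ok u by (simp add: Y_def)
 have b: "P (a @ u) = bb (A.start (a @ u), a) \<star> P u"
  using bb_P[of u "[]" "(A.start (a @ u), a)"] uY u X0_P(2)[OF u] by simp
 have m: "P u \<star> P u' = (if u = u' then P u else \<zero>\<^bsub>B\<^esub>)" if "u' : A.X0" for u'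
  using P_mult[of "[]" u u' "[]"] u that X0_P(2) by simp
 have "P u \<star> ee = (\<Oplus>\<^bsub>B\<^esub>u'\<in>A.X0. P u \<star> P u')"
  unfolding ee_def by (rule B.finsum_rdistr[OF A.finite_X0 X0_P(1)[OF u]]) (use X0_P in auto)
 also have "... = P u \<star> P u"
 proof (rule B.finsum_single[OF A.finite_X0 u])
  show "P u \<star> P u' = \<zero>\<^bsub>B\<^esub>" if "u' : A.X0" "u' ~= u" for u' using m[OF that(1)] that(2) by simp
 qed (use X0_P(1)[OF u] in simp)
 finally have "P u \<star> ee = P u" using m[OF u] by simp
 then show ?thesis unfolding b using B.m_assoc[OF bb_closed X0_P(1)[OF u] ee_closed] by simp
qed

lemma mono_ee:
 assumes "(v, r) : B.p.paths" "B.p.pend (v, r) = enc (u, 0)" "u : A.X0"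
 shows "B.mono (v, r) \<star> ee = B.mono (v, r)"
proof -
 have ulen: "length u = l" using assms(3) by (simp add: A.X0_def)
 have Pu: "P u = B.mono (enc (u, 0), [])" using ulen by (simp add: P_def rp_short)
 have v: "(enc (u, 0), []) : B.p.paths" using enc_verts[OF A.X0_clock[OF assms(3)]] by simp
 have m: "B.mono (v, r) \<star> P u = B.mono (v, r)" unfolding Pu using B.mono_mult[OF assms(1) v] assms(2) by simp
 have "P u \<star> ee = P u" using P_ee[of "[]" u] X0_P(2)[OF assms(3)] assms(3) by simp
 then show ?thesis
  using B.m_assoc[OF B.mono_closed[OF assms(1)] X0_P(1)[OF assms(3)] ee_closed] m by simp
qed

text \<open>Up to short pieces at both ends, a long path of the unfolded quiver is the unfolding of a path
  of \<open>Q\<close>.\<close>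

lemma long_path:
 assumes "(v, es) : B.p.paths" "A.maxw <= length es"
 shows "EX r0 u q c. (v, r0) : B.p.paths & length r0 <= A.maxw & u : A.X0 & B.p.pend (v, r0) = enc (u, 0) &
  q : A.p.paths & length es <= weight w (snd q) + 2 * A.maxw & c : car B &
  B.mono (v, es) = (B.mono (v, r0) \<star> bb q) \<star> c"
proof -
 obtain s where s: "s : A.X" "v = enc s" using vertsE[OF B.p.qpaths_start[OF assms(1)]] by blast
 obtain u j where uj: "s = (u, j)" by (cases s)
 have u: "u : A.X0" and j: "j < w (hd u)" using s(1) uj by (auto simp: A.X_def)
 have wm: "w (hd u) <= A.maxw" by (rule A.w_le_maxw[OF A.X0_hd[OF u]])
 have "(enc (u, j), es) : B.p.paths" using assms(1) s(2) uj by simp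
 from G_path_step[OF u j this] assms(2) wm obtain y es' where
  y: "A.okw (u @ [y])" "es = blk j u (tl u @ [y]) @ es'" "(enc (tl u @ [y], 0), es') : B.p.paths" by auto
 define r0 u1 where "r0 = blk j u (tl u @ [y])" and "u1 = tl u @ [y]"
 have u1: "u1 : A.X0" unfolding u1_def by (rule A.shift_word[OF u y(1)])
 have r0: "(v, r0) : B.p.paths" "B.p.pend (v, r0) = enc (u1, 0)"
  using blk_path[OF u y(1) j] s(2) uj by (simp_all add: r0_def u1_def)
 have l0: "length r0 <= A.maxw" using wm by (simp add: r0_def blk_def)
 obtain a u' r where a: "u' : A.X0" "A.okw (a @ u')" "take l (a @ u') = u1" "es' = rp (a @ u') @ r"
  "(enc (u', 0), r) : B.p.paths" "length r < w (hd u')"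
  using G_path_main[OF u1 y(3)[folded u1_def]] by blast
 have l1: "l <= length (a @ u')" and tk: "take (length (a @ u') - l) (a @ u') = a"
  "drop (length (a @ u') - l) (a @ u') = u'" using a(1) by (simp_all add: A.X0_def)
 note rpz = rp_path[OF a(2) l1, unfolded tk a(3)]
 let ?q = "(A.start (a @ u'), a)"
 have qp: "?q : A.p.paths" using A.okw_path[OF a(2)] A.p.qpaths_append by blast
 have uY: "u' : Y ?q" using a by (simp add: Y_def)
 have Pz: "P (a @ u') = bb ?q \<star> P u'"
  using bb_P[of u' "[]" ?q] uY a(1) X0_P(2)[OF a(1)] by simp
 have mr: "B.mono (enc (u', 0), r) : car B" by (rule B.mono_closed[OF a(5)])
 let ?c = "P u' \<star> B.mono (enc (u', 0), r)"
 have cc: "?c : car B" using X0_P(1)[OF a(1)] mr by simp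
 have m0: "B.mono (v, r0) : car B" by (rule B.mono_closed[OF r0(1)])
 have pz: "(enc (u1, 0), rp (a @ u')) : B.p.paths" using rpz by simp
 have Pdef: "P (a @ u') = B.mono (enc (u1, 0), rp (a @ u'))" by (simp only: P_def a(3))
 have p1: "(v, r0 @ rp (a @ u')) : B.p.paths" using r0 pz B.p.qpaths_append by auto
 have e1: "B.p.pend (v, r0 @ rp (a @ u')) = enc (u', 0)"
  using qpath_end_append[of G v r0 "rp (a @ u')"] r0(2) rpz by simp
 have "B.mono (v, es) = B.mono (v, r0 @ rp (a @ u')) \<star> B.mono (enc (u', 0), r)"
  using B.mono_mult[OF p1 a(5)] e1 y(2) a(4) by (simp add: r0_def)
 also have "B.mono (v, r0 @ rp (a @ u')) = B.mono (v, r0) \<star> P (a @ u')"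
  unfolding Pdef using B.mono_mult[OF r0(1) pz] r0(2) by simp
 also have "... = (B.mono (v, r0) \<star> bb ?q) \<star> P u'"
  unfolding Pz using B.m_assoc[OF m0 bb_closed X0_P(1)[OF a(1)]] by simp
 also have "... \<star> B.mono (enc (u', 0), r) = (B.mono (v, r0) \<star> bb ?q) \<star> ?c"
  using B.m_assoc[OF _ X0_P(1)[OF a(1)] mr] m0 bb_closed by simp
 finally have eq: "B.mono (v, es) = (B.mono (v, r0) \<star> bb ?q) \<star> ?c" .
 have "length r <= A.maxw" using a(6) A.w_le_maxw[OF A.X0_hd[OF a(1)]] by simp
 then have "length es <= weight w (snd ?q) + 2 * A.maxw"
  using y(2) a(4) l0 rpz by (simp add: r0_def)
 then show ?thesis using r0 l0 u1 qp cc eq by blast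
qed

text \<open>By \<open>long_path\<close> a long path of \<open>G\<close> begins with one of finitely many short paths \<open>r0\<close> and
  continues with a long \<open>bb q\<close>; finiteness makes the bounds \<open>k\<close> for the different \<open>r0\<close> uniform.\<close>

lemma sat_by_words:
 assumes L: "gr_mod K B L" and \<Gamma>: "gsub B L \<Gamma>" and x: "x : car L"
  and H: "!!v r0 u. [| (v, r0) : B.p.paths; u : A.X0; B.p.pend (v, r0) = enc (u, 0) |] ==>
  EX k. ALL q:A.p.paths. k <= weight w (snd q) --> ract L (ract L x (B.mono (v, r0))) (bb q) : \<Gamma>"
 shows "x : sat B L \<Gamma>"
proof -
 interpret L: graded_right_module K B L by (rule L)
 let ?ok = "%p k. ALL q:A.p.paths. k <= weight w (snd q) --> ract L (ract L x (B.mono p)) (bb q) : \<Gamma>"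
 define R where "R = {p : B.p.paths. length (snd p) <= A.maxw}"
 have pw: "p : B.paths_of_weight n \<longleftrightarrow> p : B.p.paths & length (snd p) = n" for p n
  unfolding B.paths_of_weight_def weight_G by simp
 have "R \<subseteq> (\<Union>n\<in>{..A.maxw}. B.paths_of_weight n)" unfolding R_def by (blast intro: pw[THEN iffD2])
 then have fR: "finite R" using B.finite_paths_of_weight finite_subset by blast
 define kf where "kf p = (SOME k. ?ok p k)" for p
 define k where "k = Max (insert 0 (kf ` R))"
 have kk: "?ok (v, r0) (kf (v, r0))" if "(v, r0) : B.p.paths" "u : A.X0" "B.p.pend (v, r0) = enc (u, 0)" for v r0 u
  unfolding kf_def by (rule someI_ex[OF H[OF that]])
 have kR: "kf p <= k" if "p : R" for p unfolding k_def using fR that by (intro Max_ge) auto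
 \<comment> \<open>The short piece at the start and the unread rest at the end have length at most \<open>A.maxw\<close> each.\<close>
 show ?thesis
 proof (rule L.satI[OF x, of "2 * A.maxw + k"])
  fix n a assume n: "2 * A.maxw + k <= n" and a: "a : adeg B n"
  show "ract L x a : \<Gamma>"
  proof (rule L.ract_spanned[OF \<Gamma> x B.adeg_spanned _ _ a])
  show "B.mono ` B.paths_of_weight n \<subseteq> car B" using B.mono_closed pw by blast
  fix m assume "m : B.mono ` B.paths_of_weight n"
  then obtain p where p: "m = B.mono p" "p : B.paths_of_weight n" by blast
  obtain v es where ves: "p = (v, es)" by (cases p)
  have es: "(v, es) : B.p.paths" "length es = n" using p(2) unfolding ves pw by simp_all
  have "A.maxw <= length es" using n es(2) by simp
  from long_path[OF es(1) this] obtain r0 u q c where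
  r: "(v, r0) : B.p.paths" "length r0 <= A.maxw" "u : A.X0" "B.p.pend (v, r0) = enc (u, 0)"
  "q : A.p.paths" "length es <= weight w (snd q) + 2 * A.maxw" "c : car B"
  "B.mono (v, es) = (B.mono (v, r0) \<star> bb q) \<star> c" by blast
  have "kf (v, r0) <= k" by (rule kR) (simp add: R_def r(1,2))
  then have "kf (v, r0) <= weight w (snd q)" using n es(2) r(6) by simp
  then have g: "ract L (ract L x (B.mono (v, r0))) (bb q) : \<Gamma>" using kk[OF r(1,3,4)] r(5) by blast
  have "ract L x m = ract L (ract L (ract L x (B.mono (v, r0))) (bb q)) c"
  unfolding p(1) ves r(8)
  using L.ract_mult x B.mono_closed[OF r(1)] bb_closed r(7) by simp
  then show "ract L x m : \<Gamma>" using L.gsub_ract[OF \<Gamma> g r(7)] by simp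
  qed
 qed
qed

subsection \<open>The corner functor\<close>

text \<open>The underlying graded group of \<open>M ee\<close>.\<close>

definition corner :: "('b, 'u) graded_module => ('a, 'u) graded_module" where
 "corner M = \<lparr> carrier = {m : car M. ract M m ee = m}, mult = mult M, one = one M, zero = zero M,
  add = add M, ract = undefined, mdeg = (%i. mdeg M i \<inter> {m : car M. ract M m ee = m}) \<rparr>"

text \<open>The corner \<open>M ee\<close>, where a path \<open>q\<close> of \<open>Q\<close> acts as \<open>bb q\<close>.\<close>

definition Rm :: "('b, 'u) graded_module => ('a, 'u) graded_module" where
 "Rm M = corner M\<lparr> ract := A.mact (corner M) (%c m. ract M m (c \<odot>\<^bsub>B\<^esub> \<one>\<^bsub>B\<^esub>)) (%q m. ract M m (bb q)) \<rparr>"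

lemma Rm_sel [simp]: "car (Rm M) = {m : car M. ract M m ee = m}" "zero (Rm M) = zero M"
  "add (Rm M) = add M" "mdeg (Rm M) i = mdeg M i \<inter> {m : car M. ract M m ee = m}"
 by (simp_all add: Rm_def corner_def)

lemma ee_adeg: "ee : adeg B 0"
proof -
 interpret ag: graded_group B "adeg B" by (rule B.graded_group)
 have "P u : adeg B 0" if "u : A.X0" for u using P_adeg[of u] that by (simp add: A.X0_def)
 then show ?thesis
  unfolding ee_def
  by (intro B.finsum_closed_under[OF A.finite_X0, of P "%x. x : adeg B 0"] conjI X0_P(1) ag.D_zero ag.D_add)
qed

context
 fixes M :: "('b, 'u) graded_module"
 assumes gM: "gr_mod K B M"
begin

interpretation M: graded_right_module K B M by (rule gM)

lemma corner_component_ee: "m : car (corner M) ==> ract M (M.mg.cp m i) ee = M.mg.cp m i"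
 using M.component_ract[OF _ ee_adeg, of m i] by (simp add: corner_def)

lemma corner_abelian: "abelian_group (corner M)"
proof (rule abelian_groupI)
 fix x y z assume "x : car (corner M)" "y : car (corner M)" "z : car (corner M)"
 then show "x \<oplus>\<^bsub>corner M\<^esub> y \<oplus>\<^bsub>corner M\<^esub> z = x \<oplus>\<^bsub>corner M\<^esub> (y \<oplus>\<^bsub>corner M\<^esub> z)"
  by (simp add: corner_def M.mod.a_assoc)
next
 fix x assume x: "x : car (corner M)"
 then have "\<ominus>\<^bsub>M\<^esub> x : car (corner M)" using M.ract_neg_left ee_closed by (simp add: corner_def)
 then show "EX y:car (corner M). y \<oplus>\<^bsub>corner M\<^esub> x = \<zero>\<^bsub>corner M\<^esub>"
  using x by (intro bexI[of _ "\<ominus>\<^bsub>M\<^esub> x"]) (simp_all add: corner_def M.mod.l_neg)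
qed (auto simp: corner_def M.ract_add_left ee_closed M.mod.a_comm)

lemma corner_decomp: "direct_sum_decomp (corner M) (mdeg (corner M)) &
  (ALL m:car (corner M). component (corner M) (mdeg (corner M)) m = M.mg.cp m)"
proof (rule direct_sum_decompI[OF corner_abelian])
 interpret C: abelian_group "corner M" by (rule corner_abelian)
 have neg: "\<ominus>\<^bsub>corner M\<^esub> x = \<ominus>\<^bsub>M\<^esub> x" if "x : car (corner M)" for x
  using C.minus_equality[of "\<ominus>\<^bsub>M\<^esub> x" x] that M.ract_neg_left ee_closed
  by (simp add: corner_def M.mod.l_neg)
 fix i show "subgroup (mdeg (corner M) i) (add_monoid (corner M))"
 proof (rule C.add_subgroupI)
  fix x assume x: "x : mdeg (corner M) i"
  then have xc: "x : car (corner M)" by (simp add: corner_def)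
  show "\<ominus>\<^bsub>corner M\<^esub> x : mdeg (corner M) i"
  using x C.a_inv_closed[OF xc] M.mg.D_neg unfolding neg[OF xc] by (simp add: corner_def)
  show "x \<oplus>\<^bsub>corner M\<^esub> y : mdeg (corner M) i" if "y : mdeg (corner M) i" for y
  using x that M.mg.D_add ee_closed by (simp add: corner_def M.ract_add_left)
 next
  show "mdeg (corner M) i \<subseteq> car (corner M)" by (auto simp: corner_def)
  show "\<zero>\<^bsub>corner M\<^esub> : mdeg (corner M) i" using M.mg.D_zero ee_closed by (simp add: corner_def)
 qed
next
 fix m assume m: "m : car (corner M)"
 then have mc: "m : car M" by (simp add: corner_def)
 show "M.mg.cp m i : mdeg (corner M) i" for i
  using corner_component_ee[OF m] M.mg.component_props(1)[OF mc] M.mg.component_carrier[OF mc]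
  by (simp add: corner_def)
 show "finite {i. M.mg.cp m i ~= \<zero>\<^bsub>corner M\<^esub>}" using M.mg.component_props(2)[OF mc] by (simp add: corner_def)
 show "m = \<zero>\<^bsub>corner M\<^esub>" if "!!i. M.mg.cp m i = \<zero>\<^bsub>corner M\<^esub>"
  using M.mg.components_zero[OF mc] that by (simp add: corner_def)
 show "M.mg.cp (m \<oplus>\<^bsub>corner M\<^esub> n) i = M.mg.cp m i \<oplus>\<^bsub>corner M\<^esub> M.mg.cp n i"
  if "n : car (corner M)" for n i
  using mc that by (simp add: corner_def M.mg.component_add)
next
 fix m i assume "m : mdeg (corner M) i"
 then have "m : mdeg M i" by (simp add: corner_def)
 then show "M.mg.cp m i = m" "!!j. i ~= j ==> M.mg.cp m j = \<zero>\<^bsub>corner M\<^esub>"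
  by (simp_all add: M.mg.component_homogeneous corner_def)
qed

lemma corner_graded: "graded_group (corner M) (mdeg (corner M))"
 by (intro graded_group.intro corner_abelian graded_group_axioms.intro corner_decomp[THEN conjunct1])

lemma corner_finsum:
 assumes "finite I" "!!i. i : I ==> f i : car (corner M)"
 shows "finsum (corner M) f I = finsum M f I"
 using assms
proof (induction I rule: finite_induct)
 interpret C: abelian_group "corner M" by (rule corner_abelian)
 case empty then show ?case by (simp add: C.finsum_empty M.mod.finsum_empty) (simp add: corner_def)
next
 interpret C: abelian_group "corner M" by (rule corner_abelian)
 case (insert i I)
 have "car (corner M) \<subseteq> car M" by (auto simp: corner_def)
 then have "f : I \<rightarrow> car (corner M)" "f : I \<rightarrow> car M" "f i : car (corner M)" "f i : car M"
  using insert.prems by auto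
 then show ?case using insert by (simp add: C.finsum_insert M.mod.finsum_insert) (simp add: corner_def)
qed

lemma ract_finsum:
 assumes "finite I" "!!i. i : I ==> f i : car B" "m : car M"
 shows "ract M m (finsum B f I) = (\<Oplus>\<^bsub>M\<^esub>i\<in>I. ract M m (f i))"
 using assms(1,2)
proof (induction I rule: finite_induct)
 case empty then show ?case using assms(3) by simp
next
 case (insert i I)
 then have "f : I \<rightarrow> car B" "f i : car B" "(%i. ract M m (f i)) : I \<rightarrow> car M"
  using M.ract_closed[OF assms(3)] by auto
 then show ?case using insert assms(3) by (simp add: M.ract_add_right M.ract_closed)
qed

lemma bb_corner: "m : car M ==> ract M m (bb q) : car (corner M)"
 using bb_closed ee_closed by (simp add: corner_def M.ract_closed M.ract_mult[symmetric] bb_ee)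

text \<open>The operators \<open>bb q\<close> satisfy the hypotheses of \<open>mact_module\<close> by \<open>bb_mult\<close>, \<open>ee_sum\<close> and
  \<open>bb_S\<close>.\<close>

lemma Rm_facts:
 shows Rm_module: "gr_mod K A (Rm M)"
  and Rm_mono: "[| q : A.p.paths; m : car (Rm M) |] ==> ract (Rm M) m (A.mono q) = ract M m (bb q)"
  and Rm_scalar: "[| c : car K; m : car (Rm M) |] ==> ract (Rm M) m (c \<odot>\<^bsub>A\<^esub> \<one>\<^bsub>A\<^esub>) = ract M m (c \<odot>\<^bsub>B\<^esub> \<one>\<^bsub>B\<^esub>)"
proof -
 let ?sm = "%c m. ract M m (c \<odot>\<^bsub>B\<^esub> \<one>\<^bsub>B\<^esub>)" and ?T = "%q m. ract M m (bb q)"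
 have sc: "c \<odot>\<^bsub>B\<^esub> \<one>\<^bsub>B\<^esub> : car B" if "c : car K" for c by (rule B.scalar_carrier[OF that])
 have cM: "m : car M" "ract M m ee = m" if "m : car (corner M)" for m
  using that by (simp_all add: corner_def)
 have se: "ract M (ract M m (c \<odot>\<^bsub>B\<^esub> \<one>\<^bsub>B\<^esub>)) b = ract M (ract M m b) (c \<odot>\<^bsub>B\<^esub> \<one>\<^bsub>B\<^esub>)"
  if "c : car K" "m : car M" "b : car B" for c m b
  using M.ract_mult[OF that(2) sc[OF that(1)] that(3)] M.ract_mult[OF that(2,3) sc[OF that(1)]]
  B.scalar_mult[OF that(1,3)] B.mult_scalar[OF that(1,3)] by simp
 have sel: "add (corner M) = add M" "zero (corner M) = zero M" "mdeg (corner M) i \<subseteq> car (corner M)"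
  "mdeg (corner M) i \<subseteq> mdeg M i" for i by (auto simp: corner_def)
 have main: "gr_mod K A (corner M\<lparr>ract := A.mact (corner M) ?sm ?T\<rparr>) &
  (ALL q m. q : A.p.paths --> m : car (corner M) --> A.mact (corner M) ?sm ?T m (A.mono q) = ?T q m) &
  (ALL c m. c : car K --> m : car (corner M) -->
  A.mact (corner M) ?sm ?T m (c \<odot>\<^bsub>A\<^esub> \<one>\<^bsub>A\<^esub>) = ?sm c m)"
 proof -
  have 1: "?sm c x : car (corner M)" if "c : car K" "x : car (corner M)" for c x
  using se[OF that(1) cM(1)[OF that(2)] ee_closed] cM[OF that(2)] M.ract_closed sc[OF that(1)]
  by (simp add: corner_def)
  have 6: "?sm c x : mdeg (corner M) i" if "c : car K" "x : mdeg (corner M) i" for c x i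
  proof -
  have x: "x : car (corner M)" "x : mdeg M i" using that(2) sel(3,4) by auto
  have "?sm c x : mdeg M i" using M.mdeg_ract[OF x(2) B.scalar_adeg[OF that(1)]] by simp
  then show ?thesis using 1[OF that(1) x(1)] by (simp add: corner_def)
  qed
  have 13: "?T q x : mdeg (corner M) (i + int (weight w (snd q)))" if "x : mdeg (corner M) i" for q x i
  proof -
  have x: "x : car (corner M)" "x : mdeg M i" using that sel(3,4) by auto
  have "?T q x : mdeg M (i + int (weight w (snd q)))" by (rule M.mdeg_ract[OF x(2) bb_adeg])
  then show ?thesis using bb_corner[OF cM(1)[OF x(1)], of q] by (simp add: corner_def)
  qed
  have 11: "(\<Oplus>\<^bsub>corner M\<^esub>v\<in>verts Q. ?T (v, []) x) = x" if "x : car (corner M)" for x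
  proof -
  have "(\<Oplus>\<^bsub>corner M\<^esub>v\<in>verts Q. ?T (v, []) x) = (\<Oplus>\<^bsub>M\<^esub>v\<in>verts Q. ?T (v, []) x)"
  by (rule corner_finsum) (use bb_corner[OF cM(1)[OF that]] in auto)
  also have "... = ract M x (\<Oplus>\<^bsub>B\<^esub>v\<in>verts Q. bb (v, []))"
  using ract_finsum[of "verts Q" "%v. bb (v, [])" x] bb_closed cM(1)[OF that] by simp
  finally show ?thesis using ee_sum cM(2)[OF that] by simp
  qed
  have 10: "?T r (?T q x) = (if A.p.pend q = fst r then ?T (fst q, snd q @ snd r) x else \<zero>\<^bsub>corner M\<^esub>)"
  if "q : A.p.paths" "r : A.p.paths" "x : car (corner M)" for q r x
  unfolding M.ract_mult[OF cM(1)[OF that(3)] bb_closed bb_closed, symmetric] bb_mult[OF that(1,2)] sel(2)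
  using M.ract_zero_right[OF cM(1)[OF that(3)]] by simp
  have 2: "?sm c (x \<oplus>\<^bsub>corner M\<^esub> y) = ?sm c x \<oplus>\<^bsub>corner M\<^esub> ?sm c y"
  if "c : car K" "x : car (corner M)" "y : car (corner M)" for c x y
  unfolding sel using M.ract_add_left[OF cM(1)[OF that(2)] cM(1)[OF that(3)] sc[OF that(1)]] .
  have 3: "?sm (c \<oplus>\<^bsub>K\<^esub> d) x = ?sm c x \<oplus>\<^bsub>corner M\<^esub> ?sm d x"
  if "c : car K" "d : car K" "x : car (corner M)" for c d x
  unfolding sel B.smult_l_distr[OF that(1,2) B.one_closed]
  using M.ract_add_right[OF cM(1)[OF that(3)] sc[OF that(1)] sc[OF that(2)]] .
  have 4: "?sm (c \<otimes>\<^bsub>K\<^esub> d) x = ?sm c (?sm d x)"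
  if "c : car K" "d : car K" "x : car (corner M)" for c d x
  proof -
  have "c \<otimes>\<^bsub>K\<^esub> d \<odot>\<^bsub>B\<^esub> \<one>\<^bsub>B\<^esub> = (d \<odot>\<^bsub>B\<^esub> \<one>\<^bsub>B\<^esub>) \<star> (c \<odot>\<^bsub>B\<^esub> \<one>\<^bsub>B\<^esub>)"
  unfolding B.mult_scalar[OF that(1) sc[OF that(2)]] using B.smult_assoc1[OF that(1,2) B.one_closed] .
  then show ?thesis using M.ract_mult[OF cM(1)[OF that(3)] sc[OF that(2)] sc[OF that(1)]] by simp
  qed
  have 5: "?sm \<one>\<^bsub>K\<^esub> x = x" if "x : car (corner M)" for x
  unfolding B.smult_one[OF B.one_closed] by (rule M.ract_one[OF cM(1)[OF that]])
  have 7: "?T q x : car (corner M)" if "x : car (corner M)" for q x by (rule bb_corner[OF cM(1)[OF that]])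
  have 8: "?T q (x \<oplus>\<^bsub>corner M\<^esub> y) = ?T q x \<oplus>\<^bsub>corner M\<^esub> ?T q y"
  if "x : car (corner M)" "y : car (corner M)" for q x y
  unfolding sel by (rule M.ract_add_left[OF cM(1)[OF that(1)] cM(1)[OF that(2)] bb_closed])
  have 9: "?T q (?sm c x) = ?sm c (?T q x)" if "c : car K" "x : car (corner M)" for q c x
  by (rule se[OF that(1) cM(1)[OF that(2)] bb_closed])
  have 12: "?T q x = \<zero>\<^bsub>corner M\<^esub>" if "q : S" "x : car (corner M)" for q x
  unfolding sel bb_S[OF that(1)] by (rule M.ract_zero_right[OF cM(1)[OF that(2)]])
  note mm = A.mact_module[of "corner M" ?sm ?T, OF corner_graded 1 2 3 4 5 6 7 8 9 10 11 12 13]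
  show ?thesis by (intro conjI allI impI; rule mm)
 qed
 show "gr_mod K A (Rm M)" unfolding Rm_def using main by blast
 have carr: "car (Rm M) = car (corner M)" and act: "ract (Rm M) = A.mact (corner M) ?sm ?T"
  by (simp_all add: Rm_def)
 show "[| q : A.p.paths; m : car (Rm M) |] ==> ract (Rm M) m (A.mono q) = ract M m (bb q)"
  unfolding carr act using main by blast
 show "[| c : car K; m : car (Rm M) |] ==> ract (Rm M) m (c \<odot>\<^bsub>A\<^esub> \<one>\<^bsub>A\<^esub>) = ract M m (c \<odot>\<^bsub>B\<^esub> \<one>\<^bsub>B\<^esub>)"
  unfolding carr act using main by blast
qed

lemma Rm_component:
 assumes "m : car (Rm M)"
 shows "component (Rm M) (mdeg (Rm M)) m = M.mg.cp m"
proof -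
 interpret R: graded_right_module K A "Rm M" by (rule Rm_module)
 have m: "m : car (corner M)" and mc: "m : car M" using assms by (simp_all add: corner_def)
 have cc: "M.mg.cp m i : car (corner M)" for i
  using corner_component_ee[OF m] M.mg.component_carrier[OF mc] by (simp add: corner_def)
 show ?thesis
 proof (rule R.mg.component_eqI[OF M.mg.component_props(2)[OF mc]])
  show "M.mg.cp m i : mdeg (Rm M) i" for i
  using cc[of i] M.mg.component_props(1)[OF mc] by (simp add: corner_def)
  have "finsum (Rm M) (M.mg.cp m) I = finsum (corner M) (M.mg.cp m) I" for I
  by (simp add: finsum_def finprod_def Rm_def)
  then show "m = finsum (Rm M) (M.mg.cp m) {i. M.mg.cp m i ~= \<zero>\<^bsub>M\<^esub>}"
  using corner_finsum[OF M.mg.component_props(2)[OF mc] cc] M.mg.component_props(3)[OF mc] by simp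
 qed simp
qed

end

end

lemma (in monomial_algebra) mono_induct [consumes 1, case_names zero mono add]:
 assumes "a : car A" "P \<zero>\<^bsub>A\<^esub>" "!!c q. [| c : car K; q : p.paths |] ==> P (c \<odot>\<^bsub>A\<^esub> mono q)"
  "!!x y. [| x : car A; y : car A; P x; P y |] ==> P (x \<oplus>\<^bsub>A\<^esub> y)"
 shows "P a"
proof -
 obtain f where f: "f : car p.PA" "a = ev f" using assms(1) ev_surj by blast
 have "P (ev f)" using f(1)
 proof (induction f rule: p.PA_induct)
  case zero then show ?case using assms(2) ev_zero by simp
 next
  case (monom c q) then show ?case using assms(3) ev_monom by simp
 next
  case (add f g)
  then show ?case using assms(4)[OF ev_closed ev_closed] ev_add by simp
 qed
 then show ?thesis using f(2) by simp
qed

context unfolded_quiver begin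

context
 fixes L :: "('b, 'u) graded_module"
 assumes gL: "gr_mod K B L"
begin

interpretation L: graded_right_module K B L by (rule gL)
interpretation R: graded_right_module K A "Rm L" by (rule Rm_module[OF gL])

lemma Rm_smono:
 assumes x: "x : car (Rm L)" and q: "q : A.p.paths" and c: "c : car K"
 shows "ract (Rm L) x (c \<odot>\<^bsub>A\<^esub> A.mono q) = ract L (ract L x (bb q)) (c \<odot>\<^bsub>B\<^esub> \<one>\<^bsub>B\<^esub>)"
proof -
 have m: "A.mono q : car A" by (rule A.mono_closed[OF q])
 have "ract (Rm L) x (A.mono q) : car (Rm L)" by (rule R.ract_closed[OF x m])
 then show ?thesis
  unfolding A.mult_scalar[OF c m, symmetric] R.ract_mult[OF x m A.scalar_carrier[OF c]]
  using Rm_scalar[OF gL c] Rm_mono[OF gL q x] by simp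
qed

lemma Rm_act_in:
 assumes \<Gamma>: "gsub B L \<Gamma>" and x: "x : car (Rm L)" "x : \<Gamma>" and a: "a : car A"
 shows "ract (Rm L) x a : \<Gamma>"
 using a
proof (induction a rule: A.mono_induct)
 case zero
 show ?case unfolding R.ract_zero_right[OF x(1)] using L.gsub_zero \<Gamma> gsubD(2) by (simp add: gsubD(2)[OF \<Gamma>])
next
 case (mono c q)
 show ?case unfolding Rm_smono[OF x(1) mono(2,1)]
  by (rule L.gsub_ract[OF \<Gamma> L.gsub_ract[OF \<Gamma> x(2) bb_closed] B.scalar_carrier[OF mono(1)]])
next
 case (add a b)
 show ?case unfolding R.ract_add_right[OF x(1) add(1,2)] using gsubD(3)[OF \<Gamma> add(3,4)] by simp
qed

lemma gsub_corner:
 assumes \<Gamma>: "gsub B L \<Gamma>"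
 shows "gsub A (Rm L) (\<Gamma> \<inter> car (Rm L))"
 unfolding gsub_def
proof (intro conjI ballI allI)
 fix x assume x: "x : \<Gamma> \<inter> car (Rm L)"
 show "x \<oplus>\<^bsub>Rm L\<^esub> y : \<Gamma> \<inter> car (Rm L)" if "y : \<Gamma> \<inter> car (Rm L)" for y
  using x that R.mod.a_closed[of x y] gsubD(3)[OF \<Gamma>, of x y] by simp
 show "ract (Rm L) x a : \<Gamma> \<inter> car (Rm L)" if "a : adeg A j" for j a
  using x Rm_act_in[OF \<Gamma>] R.ract_closed A.adeg_carrier[OF that] by blast
 show "component (Rm L) (mdeg (Rm L)) x i : \<Gamma> \<inter> car (Rm L)" for i
  using x gsubD(5)[OF \<Gamma>, of x i] R.mg.component_carrier[of x i] Rm_component[OF gL, of x] by simp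
qed (use gsubD(2)[OF \<Gamma>] R.mod.zero_closed in simp_all)

lemma Rm_satI:
 assumes \<Delta>: "gsub A (Rm L) \<Delta>" and x: "x : car (Rm L)"
  and H: "!!q. [| q : A.p.paths; k <= weight w (snd q) |] ==> ract L x (bb q) : \<Delta>"
 shows "x : sat A (Rm L) \<Delta>"
proof (rule R.satI[OF x, of k])
 fix n a assume n: "k <= n" and a: "a : adeg A n"
 show "ract (Rm L) x a : \<Delta>"
 proof (rule R.ract_spanned[OF \<Delta> x A.adeg_spanned _ _ a])
  show "A.mono ` A.paths_of_weight n \<subseteq> car A" using A.mono_closed by (auto simp: A.paths_of_weight_def)
  fix m assume "m : A.mono ` A.paths_of_weight n"
  then obtain q where q: "m = A.mono q" "q : A.p.paths" "weight w (snd q) = n"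
  unfolding A.paths_of_weight_def by blast
  show "ract (Rm L) x m : \<Delta>" unfolding q(1) Rm_mono[OF gL q(2) x] by (rule H[OF q(2)]) (use n q(3) in simp)
 qed
qed

lemma Rm_satE:
 assumes "x : sat A (Rm L) \<Delta>"
 shows "EX k. ALL q:A.p.paths. k <= weight w (snd q) --> ract L x (bb q) : \<Delta>"
proof -
 have x: "x : car (Rm L)" by (rule R.sat_carrier[OF assms])
 obtain k where k: "!!j a. k <= j ==> a : adeg A j ==> ract (Rm L) x a : \<Delta>" using R.satE[OF assms] by blast
 have "ract L x (bb q) : \<Delta>" if "q : A.p.paths" "k <= weight w (snd q)" for q
  using k[OF that(2) A.mono_adeg[OF that(1)]] unfolding Rm_mono[OF gL that(1) x] .
 then show ?thesis by blast
qed

lemma sat_corner: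
 assumes \<Gamma>: "gsub B L \<Gamma>" and x: "x : sat B L \<Gamma>" "x : car (Rm L)"
 shows "x : sat A (Rm L) (\<Gamma> \<inter> car (Rm L))"
proof -
 obtain k where k: "!!j a. k <= j ==> a : adeg B j ==> ract L x a : \<Gamma>" using L.satE[OF x(1)] by blast
 have c: "ract L x (bb q) : car (Rm L)" for q
  using bb_corner[OF gL L.sat_carrier[OF x(1)], of q] by (simp add: corner_def)
 show ?thesis by (rule Rm_satI[OF gsub_corner[OF \<Gamma>] x(2), of k]) (use c k[OF _ bb_adeg] in blast)
qed

text \<open>Multiplying by a path that ends at clock 0 moves \<open>x\<close> into the corner, where saturation over
  \<open>B\<close> and over \<open>A\<close> can be compared by \<open>sat_by_words\<close>.\<close>

lemma sat_from_corner:
 assumes \<Gamma>: "gsub B L \<Gamma>" and x: "x : car L" and sub: "\<Delta> \<subseteq> \<Gamma>"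
  and H: "!!b. [| b : car B; b \<star> ee = b; EX j. b : adeg B j |] ==> ract L x b : sat A (Rm L) \<Delta>"
 shows "x : sat B L \<Gamma>"
proof (rule sat_by_words[OF gL \<Gamma> x])
 fix v r0 u assume r: "(v, r0) : B.p.paths" "u : A.X0" "B.p.pend (v, r0) = enc (u, 0)"
 have "ract L x (B.mono (v, r0)) : sat A (Rm L) \<Delta>"
  using H[OF B.mono_closed[OF r(1)] mono_ee[OF r(1,3,2)]] B.mono_adeg[OF r(1)] by blast
 from Rm_satE[OF this] sub
 show "EX k. ALL q:A.p.paths. k <= weight w (snd q) --> ract L (ract L x (B.mono (v, r0))) (bb q) : \<Gamma>" by blast
qed

text \<open>The largest \<open>B\<close>-submodule whose corner is contained in \<open>\<Delta>\<close>.\<close>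

definition induced :: "'u set => 'u set" where
 "induced \<Delta> = {x : car L. ALL j. ALL b:adeg B j. ract L (ract L x b) ee : \<Delta>}"

lemma gsub_induced:
 assumes \<Delta>: "gsub A (Rm L) \<Delta>"
 shows "gsub B L (induced \<Delta>)"
 unfolding gsub_def
proof (intro conjI ballI allI)
 note d = gsubD[OF \<Delta>]
 show "induced \<Delta> \<subseteq> car L" by (auto simp: induced_def)
 show "\<zero>\<^bsub>L\<^esub> : induced \<Delta>"
  using d(2) B.adeg_carrier ee_closed by (simp add: induced_def L.ract_zero_left)
 fix x assume "x : induced \<Delta>"
 then have x: "x : car L" "!!j b. b : adeg B j ==> ract L (ract L x b) ee : \<Delta>" by (auto simp: induced_def)
 show "x \<oplus>\<^bsub>L\<^esub> y : induced \<Delta>" if "y : induced \<Delta>" for y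
 proof -
  have y: "y : car L" "!!j b. b : adeg B j ==> ract L (ract L y b) ee : \<Delta>" using that by (auto simp: induced_def)
  have "ract L (ract L (x \<oplus>\<^bsub>L\<^esub> y) b) ee : \<Delta>" if b: "b : adeg B j" for b j
  proof -
  have bc: "b : car B" by (rule B.adeg_carrier[OF b])
  show ?thesis
  using d(3)[OF x(2)[OF b] y(2)[OF b]] x(1) y(1) bc ee_closed by (simp add: L.ract_add_left L.ract_closed)
  qed
  then show ?thesis using x(1) y(1) by (simp add: induced_def)
 qed
 show "ract L x a : induced \<Delta>" if a: "a : adeg B i" for i a
 proof -
  have "ract L (ract L (ract L x a) b) ee : \<Delta>" if b: "b : adeg B j" for b j
  using x(2)[OF B.adeg_mult[OF a b]] L.ract_mult[OF x(1) B.adeg_carrier[OF a] B.adeg_carrier[OF b]] by simp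
  then show ?thesis using L.ract_closed[OF x(1) B.adeg_carrier[OF a]] by (simp add: induced_def)
 qed
 show "L.mg.cp x i : induced \<Delta>" for i
 proof -
  have "ract L (ract L (L.mg.cp x i) b) ee : \<Delta>" if b: "b : adeg B j" for b j
  proof -
  have xb: "ract L x b : car L" by (rule L.ract_closed[OF x(1) B.adeg_carrier[OF b]])
  have "ract L (ract L (L.mg.cp x i) b) ee = L.mg.cp (ract L (ract L x b) ee) (i + int j)"
  using L.component_ract[OF x(1) b, of "i + int j"] L.component_ract[OF xb ee_adeg, of "i + int j"] by simp
  moreover have "ract L (ract L x b) ee : car (Rm L)" using d(1)[OF x(2)[OF b]] .
  ultimately show ?thesis
  using d(5)[OF x(2)[OF b], of "i + int j"] Rm_component[OF gL] by simp
  qed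
  then show ?thesis using L.mg.component_carrier[OF x(1)] by (simp add: induced_def)
 qed
qed

lemma induced_corner: "x : induced \<Delta> ==> x : car (Rm L) ==> x : \<Delta>"
proof -
 assume x: "x : induced \<Delta>" "x : car (Rm L)"
 have "ract L (ract L x \<one>\<^bsub>B\<^esub>) ee : \<Delta>" using x(1) B.one_adeg unfolding induced_def by blast
 then show "x : \<Delta>" using x(2) by (simp add: L.ract_one)
qed

text \<open>If \<open>q\<close> has at least \<open>l\<close> letters, the window in which the walk of \<open>a @ u'\<close> ends is either the
  initial window of \<open>q\<close>, and then the two words can be glued, or it is not, and the product
  vanishes.\<close>

lemma P_bb:
 assumes z: "A.okw (a @ u')" "u' : A.X0" and q: "q : A.p.paths" "l <= length (snd q)"
 shows "P (a @ u') \<star> bb q = \<zero>\<^bsub>B\<^esub> \<or>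
  (EX q':A.p.paths. P (a @ u') \<star> bb q = bb q')"
proof -
 let ?q' = "(A.start (a @ snd q), a @ snd q)"
 have sne: "snd q ~= []" using q(2) A.l_pos by auto
 have zl: "l <= length (a @ u')" using z(2) by (simp add: A.X0_def)
 have Pc: "P (a @ u') : car B" by (rule P_closed[OF z(1) zl])
 have t: "P (a @ u') \<star> P (snd q @ u) = (if u' = take l (snd q) then P (a @ snd q @ u) else \<zero>\<^bsub>B\<^esub>)"
  if u: "u : Y q" for u
 proof -
  define s d where "s = take l (snd q @ u)" and "d = drop l (snd q @ u)"
  have sd: "s @ d = snd q @ u" unfolding s_def d_def by (rule append_take_drop_id)
  have tk: "s = take l (snd q)" unfolding s_def using q(2) by simp
  have "A.okw (s @ d)" unfolding sd using Y_word[OF u] by blast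
  moreover have "s : A.X0" unfolding s_def using Y_word[OF u] by blast
  ultimately have "P (a @ u') \<star> P (s @ d) = (if u' = s then P (a @ u' @ d) else \<zero>\<^bsub>B\<^esub>)" by (rule P_mult[OF z])
  moreover have "P (a @ u' @ d) = P (a @ snd q @ u)" if "u' = s" using sd unfolding that by simp
  ultimately show ?thesis unfolding sd using tk by auto
 qed
 have sum: "P (a @ u') \<star> bb q = (\<Oplus>\<^bsub>B\<^esub>u\<in>Y q. P (a @ u') \<star> P (snd q @ u))"
  unfolding bb_def by (rule B.finsum_rdistr[OF Y_finite Pc]) (use Y_Pc in auto)
 show ?thesis
 proof (cases "u' = take l (snd q) & Y q ~= {}")
  case False
  have "(\<Oplus>\<^bsub>B\<^esub>u\<in>Y q. P (a @ u') \<star> P (snd q @ u)) = \<zero>\<^bsub>B\<^esub>"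
  proof (rule B.add.finprod_one_eqI)
  fix u assume "u : Y q"
  then show "P (a @ u') \<star> P (snd q @ u) = \<zero>\<^bsub>B\<^esub>" using t[of u] False by auto
  qed
  then show ?thesis using sum by simp
 next
  case True
  have st: "fst q = A.start (snd q)" using A.start_path[of "fst q" "snd q"] q(1) sne by simp
  have ok: "A.okw (a @ snd q @ u)" if u: "u : Y q" for u
  proof -
  define d where "d = drop l (snd q) @ u"
  have d: "u' @ d = snd q @ u" unfolding d_def True[THEN conjunct1] by simp
  have "A.okw (a @ u' @ d)"
  proof (rule A.okw_glue[OF z(1)])
  show "A.okw (u' @ d)" unfolding d using Y_word[OF u] by blast
  show "l <= length u'" using z(2) by (simp add: A.X0_def)
  qed
  then show ?thesis unfolding d .
  qed
  have YY: "Y ?q' = Y q"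
  proof (rule equalityI; rule subsetI)
  fix u assume u: "u : Y ?q'"
  then have "A.okw (snd q @ u)" using A.okw_suffix[of a "snd q @ u"] sne by (simp add: Y_def)
  then show "u : Y q" using u A.start_append[OF sne, of u] st A.start_append[of "a @ snd q" u] by (simp add: Y_def)
  next
  fix u assume u: "u : Y q"
  then show "u : Y ?q'" using ok[OF u] A.start_append[of "a @ snd q" u] sne by (simp add: Y_def)
  qed
  obtain u where u: "u : Y q" using True by blast
  have "?q' : A.p.paths"
  using A.okw_path[OF ok[OF u]] A.start_append[of "a @ snd q" u] sne
  A.p.qpaths_append[of "A.start (a @ snd q)" "a @ snd q" u] by simp
  moreover have "(\<Oplus>\<^bsub>B\<^esub>u\<in>Y q. P (a @ u') \<star> P (snd q @ u)) = bb ?q'"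
  unfolding bb_def YY by (rule B.finsum_cong') (use t True Y_Pc[of _ ?q'] YY in auto)
  ultimately show ?thesis unfolding sum by (intro disjI2 bexI[of _ ?q'])
 qed
qed

text \<open>The corner \<open>ee B ee\<close> is spanned by the walks \<open>P\<close>. Although \<open>\<Delta>\<close> is only closed under the
  elements \<open>bb q\<close>, the element \<open>x P\<close> is multiplied into \<open>\<Delta>\<close> by all long \<open>bb q\<close> by \<open>P_bb\<close>, and
  \<open>\<Delta>\<close> is saturated.\<close>

lemma corner_induced:
 assumes \<Delta>: "gsub A (Rm L) \<Delta>" "sat A (Rm L) \<Delta> \<subseteq> \<Delta>" and x: "x : \<Delta>"
 shows "x : induced \<Delta>"
proof -
 note d = gsubD[OF \<Delta>(1)]
 have xR: "x : car (Rm L)" by (rule d(1)[OF x])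
 then have xL: "x : car L" "ract L x ee = x" by simp_all
 have PD: "ract L x (P (a @ u')) : \<Delta>" if z: "A.okw (a @ u')" "u' : A.X0" for a u'
 proof -
  have zl: "l <= length (a @ u')" using z(2) by (simp add: A.X0_def)
  have Pc: "P (a @ u') : car B" by (rule P_closed[OF z(1) zl])
  have yR: "ract L x (P (a @ u')) : car (Rm L)"
  using L.ract_closed[OF xL(1) Pc] L.ract_mult[OF xL(1) Pc ee_closed] P_ee[OF z] by simp
  \<comment> \<open>Paths of this weight have at least \<open>l\<close> letters.\<close>
  have "ract L x (P (a @ u')) : sat A (Rm L) \<Delta>"
  proof (rule Rm_satI[OF \<Delta>(1) yR, of "l * A.maxw"])
  fix q assume q: "q : A.p.paths" "l * A.maxw <= weight w (snd q)"
  have "set (snd q) \<subseteq> arcs Q" using A.p.qpaths_arcs[of "fst q" "snd q"] q(1) by simp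
  then have "l * A.maxw <= length (snd q) * A.maxw" using A.length_weight q(2) le_trans by blast
  moreover have "0 < A.maxw" using A.w_le_maxw A.maxw_def by (simp add: A.maxw_def Max_gr_iff)
  ultimately have len: "l <= length (snd q)" by simp
  have e: "ract L (ract L x (P (a @ u'))) (bb q) = ract L x (P (a @ u') \<star> bb q)"
  using L.ract_mult[OF xL(1) Pc bb_closed] by simp
  from P_bb[OF z q(1) len] show "ract L (ract L x (P (a @ u'))) (bb q) : \<Delta>"
  proof (elim disjE bexE)
  assume "P (a @ u') \<star> bb q = \<zero>\<^bsub>B\<^esub>"
  then show ?thesis unfolding e using d(2) L.ract_zero_right[OF xL(1)] by simp
  next
  fix q' assume q': "q' : A.p.paths" "P (a @ u') \<star> bb q = bb q'"
  show ?thesis unfolding e q'(2) Rm_mono[OF gL q'(1) xR, symmetric] by (rule d(4)[OF x A.mono_adeg[OF q'(1)]])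
  qed
  qed
  then show ?thesis using \<Delta>(2) by blast
 qed
 have mD: "ract L (ract L x (B.mono p)) ee : \<Delta>" if p: "p : B.p.paths" for p
 proof -
  obtain v es where ves: "p = (v, es)" by (cases p)
  have mc: "B.mono p : car B" by (rule B.mono_closed[OF p])
  have Pu: "P u = B.mono (enc (u, 0), [])" "(enc (u, 0), []) : B.p.paths" if "u : A.X0" for u
  using that enc_verts[OF A.X0_clock[OF that]] by (simp_all add: P_def rp_short A.X0_def)
  show ?thesis
  proof (cases "(EX u:A.X0. v = enc (u, 0)) & (EX u:A.X0. B.p.pend p = enc (u, 0))")
  case True
  then obtain u u1 where u: "u : A.X0" "v = enc (u, 0)" and u1: "u1 : A.X0" "B.p.pend p = enc (u1, 0)" by blast
  have pp: "(enc (u, 0), es) : B.p.paths" using p ves u(2) by simp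
  obtain a u' r where a: "u' : A.X0" "A.okw (a @ u')" "take l (a @ u') = u" "es = rp (a @ u') @ r"
  "(enc (u', 0), r) : B.p.paths" "length r < w (hd u')" "B.p.pend (enc (u', 0), r) = enc (u', length r)"
  using G_path_main[OF u(1) pp] by blast
  have zl: "l <= length (a @ u')" and dr: "drop (length (a @ u') - l) (a @ u') = u'"
  using a(1) by (simp_all add: A.X0_def)
  have "B.p.pend (enc (u, 0), rp (a @ u')) = enc (u', 0)" using rp_path[OF a(2) zl] unfolding a(3) dr by simp
  then have "enc (u', length r) = enc (u1, 0)"
  using u1(2) qpath_end_append[of G "enc (u, 0)" "rp (a @ u')" r] a(4,7) ves u(2) by simp
  then have "(u', length r) = (u1, 0)"
  by (rule enc_inj[rotated 2]) (use a(1,6) u1(1) A.X0_clock in \<open>auto simp: A.X_def\<close>)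
  then have "B.mono p = P (a @ u')" unfolding P_def a(3) ves using a(4) u(2) by simp
  then show ?thesis using PD[OF a(2,1)] d(1)[OF PD[OF a(2,1)]] by simp
  next
  case False
  then have "(ALL u:A.X0. v ~= enc (u, 0)) | (ALL u:A.X0. B.p.pend p ~= enc (u, 0))" by blast
  then have "ract L (ract L x (B.mono p)) ee = \<zero>\<^bsub>L\<^esub>"
  proof
  assume v: "ALL u:A.X0. v ~= enc (u, 0)"
  have "P u \<star> B.mono p = \<zero>\<^bsub>B\<^esub>" if "u : A.X0" for u
  unfolding Pu(1)[OF that] using B.mono_mult[OF Pu(2)[OF that] p] v that ves by auto
  then have "(\<Oplus>\<^bsub>B\<^esub>u\<in>A.X0. P u \<star> B.mono p) = \<zero>\<^bsub>B\<^esub>" by (rule B.add.finprod_one_eqI)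
  moreover have "ee \<star> B.mono p = (\<Oplus>\<^bsub>B\<^esub>u\<in>A.X0. P u \<star> B.mono p)"
  unfolding ee_def by (rule B.finsum_ldistr[OF A.finite_X0 mc]) (use X0_P in auto)
  ultimately have "ee \<star> B.mono p = \<zero>\<^bsub>B\<^esub>" by simp
  then have "ract L (ract L x ee) (B.mono p) = \<zero>\<^bsub>L\<^esub>"
  using L.ract_mult[OF xL(1) ee_closed mc] L.ract_zero_right[OF xL(1)] by simp
  then show ?thesis using xL(2) L.ract_zero_left[OF ee_closed] by simp
  next
  assume e: "ALL u:A.X0. B.p.pend p ~= enc (u, 0)"
  have "B.mono p \<star> P u = \<zero>\<^bsub>B\<^esub>" if "u : A.X0" for u
  unfolding Pu(1)[OF that] using B.mono_mult[OF p Pu(2)[OF that]] e that by auto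
  then have "(\<Oplus>\<^bsub>B\<^esub>u\<in>A.X0. B.mono p \<star> P u) = \<zero>\<^bsub>B\<^esub>" by (rule B.add.finprod_one_eqI)
  moreover have "B.mono p \<star> ee = (\<Oplus>\<^bsub>B\<^esub>u\<in>A.X0. B.mono p \<star> P u)"
  unfolding ee_def by (rule B.finsum_rdistr[OF A.finite_X0 mc]) (use X0_P in auto)
  ultimately have "B.mono p \<star> ee = \<zero>\<^bsub>B\<^esub>" by simp
  then show ?thesis using L.ract_mult[OF xL(1) mc ee_closed] L.ract_zero_right[OF xL(1)] by simp
  qed
  then show ?thesis using d(2) by simp
  qed
 qed
 have "ract L (ract L x b) ee : \<Delta>" if "b : car B" for b
  using that
 proof (induction b rule: B.mono_induct)
  case zero
  show ?case using d(2) by (simp add: L.ract_zero_right[OF xL(1)] L.ract_zero_left[OF ee_closed])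
 next
  case (mono c p)
  have mc: "B.mono p : car B" by (rule B.mono_closed[OF mono(2)])
  have sc: "c \<odot>\<^bsub>B\<^esub> \<one>\<^bsub>B\<^esub> : car B" by (rule B.scalar_carrier[OF mono(1)])
  have yD: "ract L (ract L x (B.mono p)) ee : \<Delta>" by (rule mD[OF mono(2)])
  have "(c \<odot>\<^bsub>B\<^esub> B.mono p) \<star> ee = (B.mono p \<star> ee) \<star> (c \<odot>\<^bsub>B\<^esub> \<one>\<^bsub>B\<^esub>)"
  using B.smult_mult_left[OF mono(1) mc ee_closed] B.mult_scalar[OF mono(1) B.m_closed[OF mc ee_closed]] by simp
  then have "ract L (ract L x (c \<odot>\<^bsub>B\<^esub> B.mono p)) ee = ract L (ract L (ract L x (B.mono p)) ee) (c \<odot>\<^bsub>B\<^esub> \<one>\<^bsub>B\<^esub>)"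
  using L.ract_mult[OF xL(1) B.smult_closed[OF mono(1) mc] ee_closed]
  L.ract_mult[OF xL(1) B.m_closed[OF mc ee_closed] sc] L.ract_mult[OF xL(1) mc ee_closed] by simp
  also have "... = ract (Rm L) (ract L (ract L x (B.mono p)) ee) (c \<odot>\<^bsub>A\<^esub> \<one>\<^bsub>A\<^esub>)"
  by (rule Rm_scalar[OF gL mono(1) d(1)[OF yD], symmetric])
  also have "... : \<Delta>" by (rule d(4)[OF yD A.scalar_adeg[OF mono(1)]])
  finally show ?case .
 next
  case (add b b')
  show ?case
  using d(3)[OF add(3,4)] by (simp add: L.ract_add_right[OF xL(1) add(1,2)]
  L.ract_add_left[OF L.ract_closed[OF xL(1) add(1)] L.ract_closed[OF xL(1) add(2)] ee_closed])
 qed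
 then show ?thesis using xL(1) B.adeg_carrier unfolding induced_def by blast
qed

end

end

context unfolded_quiver begin

text \<open>The action of the corner functor on relations.\<close>

definition cut :: "('b, 'u) graded_module => ('b, 'u) graded_module => ('u \<times> 'u) set => ('u \<times> 'u) set" where
 "cut M N E = E \<inter> (car (Rm M) \<times> car (Rm N))"

context
 fixes M N :: "('b, 'u) graded_module"
 assumes gM: "gr_mod K B M" and gN: "gr_mod K B N"
begin

interpretation B: tame_pair K B M N by (rule B.tame_pairI[OF gM gN])
interpretation A: tame_pair K A "Rm M" "Rm N" by (rule A.tame_pairI[OF Rm_module[OF gM] Rm_module[OF gN]])
interpretation R: graded_right_module K A "Rm (prodmod M N)" by (rule Rm_module[OF B.MN.graded_right_module_axioms])

lemma Rm_prodmod_carrier: "car (Rm (prodmod M N)) = car (Rm M) \<times> car (Rm N)" by auto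

text \<open>The corner functor commutes with products. Therefore the lemmas on submodules of a single
  module apply to relations.\<close>

lemma Rm_prodmod_ract:
 assumes x: "x : car (Rm (prodmod M N))" and a: "a : car A"
 shows "ract (Rm (prodmod M N)) x a = ract (prodmod (Rm M) (Rm N)) x a"
 using a
proof (induction a rule: A.mono_induct)
 case zero
 have "x : car (prodmod (Rm M) (Rm N))" using x unfolding Rm_prodmod_carrier by simp
 from A.MN.ract_zero_right[OF this] show ?case unfolding R.ract_zero_right[OF x] by simp
next
 case (mono c q)
 have m: "fst x : car (Rm M)" "snd x : car (Rm N)" using x unfolding Rm_prodmod_carrier by auto
 show ?case
  unfolding Rm_smono[OF B.MN.graded_right_module_axioms x mono(2,1)]
  using Rm_smono[OF gM m(1) mono(2,1)] Rm_smono[OF gN m(2) mono(2,1)] by simp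
next
 case (add a b)
 have x': "x : car (prodmod (Rm M) (Rm N))" using x unfolding Rm_prodmod_carrier by simp
 show ?case unfolding R.ract_add_right[OF x add(1,2)] A.MN.ract_add_right[OF x' add(1,2)] add(3,4) by simp
qed

lemma Rm_prodmod_sat: "sat A (Rm (prodmod M N)) \<Delta> = rsat A (Rm M) (Rm N) \<Delta>"
proof -
 let ?S = "prodmod (Rm M) (Rm N)"
 have c: "car (Rm (prodmod M N)) = car ?S" unfolding Rm_prodmod_carrier by simp
 have r: "ract (Rm (prodmod M N)) x a = ract ?S x a"
  if "x : car (Rm (prodmod M N))" "a : adeg A j" for x a j
  using Rm_prodmod_ract[OF that(1)] A.adeg_carrier[OF that(2)] by blast
 have "(EX k. \<forall>j\<ge>k. ALL a:adeg A j. ract (Rm (prodmod M N)) x a : \<Delta>) \<longleftrightarrow>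
  (EX k. \<forall>j\<ge>k. ALL a:adeg A j. ract ?S x a : \<Delta>)" if x: "x : car (Rm (prodmod M N))" for x
 proof -
  have "(ALL a:adeg A j. ract (Rm (prodmod M N)) x a : \<Delta>) \<longleftrightarrow> (ALL a:adeg A j. ract ?S x a : \<Delta>)" for j
  by (rule ball_cong[OF refl]) (simp only: r[OF x])
  then show ?thesis by (simp only:)
 qed
 then show ?thesis unfolding sat_def c[symmetric] by blast
qed

lemma Rm_prodmod_gsub: "gsub A (Rm (prodmod M N)) \<Delta> \<longleftrightarrow> gsub A (prodmod (Rm M) (Rm N)) \<Delta>"
proof -
 have c: "car (Rm (prodmod M N)) = car (prodmod (Rm M) (Rm N))"
  unfolding Rm_prodmod_carrier by simp
 have r: "ract (Rm (prodmod M N)) x a = ract (prodmod (Rm M) (Rm N)) x a"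
  if "x : car (Rm (prodmod M N))" "a : adeg A j" for x a j
  using Rm_prodmod_ract[OF that(1)] A.adeg_carrier[OF that(2)] by blast
 have cp: "R.mg.cp x i = A.MN.mg.cp x i" if x: "x : car (Rm (prodmod M N))" for x i
 proof -
  obtain m n where mn: "x = (m, n)" by (cases x)
  have m: "m : car (Rm M)" "n : car (Rm N)" using x unfolding Rm_prodmod_carrier mn by auto
  show ?thesis
  unfolding Rm_component[OF B.MN.graded_right_module_axioms x] unfolding mn
  using B.component_pair[of m n i] A.component_pair[of m n i] m Rm_component[OF gM m(1)] Rm_component[OF gN m(2)]
  by simp
 qed
 have z: "zero (Rm (prodmod M N)) = zero (prodmod (Rm M) (Rm N))"
  "x \<oplus>\<^bsub>Rm (prodmod M N)\<^esub> y = x \<oplus>\<^bsub>prodmod (Rm M) (Rm N)\<^esub> y" for x y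
  by simp_all
 show ?thesis
 proof (cases "\<Delta> \<subseteq> car (Rm (prodmod M N))")
  case True
  have "(ALL a:adeg A j. ALL x:\<Delta>. ract (Rm (prodmod M N)) x a : \<Delta>) \<longleftrightarrow>
  (ALL a:adeg A j. ALL x:\<Delta>. ract (prodmod (Rm M) (Rm N)) x a : \<Delta>)" for j
  by (intro ball_cong refl) (simp only: r[OF subsetD[OF True]])
  moreover have "(ALL x:\<Delta>. ALL i. R.mg.cp x i : \<Delta>) \<longleftrightarrow> (ALL x:\<Delta>. ALL i. A.MN.mg.cp x i : \<Delta>)"
  by (intro ball_cong refl) (simp only: cp[OF subsetD[OF True]])
  ultimately show ?thesis unfolding gsub_def z c by blast
 next
  case False
  then show ?thesis unfolding gsub_def c by blast
 qed
qed

lemma cut_corner: "cut M N E = E \<inter> car (Rm (prodmod M N))"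
 unfolding cut_def Rm_prodmod_carrier ..

text \<open>If \<open>m\<close> is in the corner and \<open>(m, n)\<close> is in the relation, then so is \<open>(m, n ee)\<close>.\<close>

lemma almost_cut:
 assumes E: "almost B M N E"
 shows "almost A (Rm M) (Rm N) (cut M N E)"
 unfolding almost_def
proof (intro conjI subsetI)
 note g = B.almostD[OF E]
 note gr = B.gsub_relD[OF g(1)]
 show "gsub A (prodmod (Rm M) (Rm N)) (cut M N E)"
  unfolding Rm_prodmod_gsub[symmetric] cut_corner by (rule gsub_corner[OF B.MN.graded_right_module_axioms g(1)])
 fix m assume m: "m : car (Rm M)"
 have "m : sat A (Rm M) (Domain E \<inter> car (Rm M))"
  by (rule sat_corner[OF gM B.gsub_Domain[OF g(1)] _ m]) (use g(2) m in simp)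
 moreover have "Domain E \<inter> car (Rm M) \<subseteq> Domain (cut M N E)"
 proof
  fix m assume m: "m : Domain E \<inter> car (Rm M)"
  then obtain n where n: "(m, n) : E" by blast
  have "(ract M m ee, ract N n ee) : E" by (rule gr(6)[OF n ee_closed])
  moreover have "ract N n ee : car (Rm N)"
  using B.N.ract_mult[OF gr(2)[OF n] ee_closed ee_closed] B.N.ract_closed[OF gr(2)[OF n] ee_closed] ee_ee by simp
  ultimately show "m : Domain (cut M N E)" using m unfolding cut_def by auto
 qed
 ultimately show "m : sat A (Rm M) (Domain (cut M N E))" using A.M.sat_mono by blast
next
 fix n assume "n : cut M N E `` {\<zero>\<^bsub>Rm M\<^esub>}"
 then have n: "(\<zero>\<^bsub>M\<^esub>, n) : E" "n : car (Rm N)" unfolding cut_def by auto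
 have "n : sat A (Rm N) ({\<zero>\<^bsub>N\<^esub>} \<inter> car (Rm N))"
  by (rule sat_corner[OF gN B.N.gsub_zero B.almostD(3)[OF E n(1)] n(2)])
 then show "n : tors A (Rm N)" using A.N.sat_mono[of "{\<zero>\<^bsub>N\<^esub>} \<inter> car (Rm N)" "{\<zero>\<^bsub>Rm N\<^esub>}"] by auto
qed

text \<open>Saturation over \<open>B\<close> can be tested in the corner.\<close>

lemma cut_faithful_subset:
 assumes E: "almost B M N E" and H: "almost B M N H"
  and sub: "rsat A (Rm M) (Rm N) (cut M N E) \<subseteq> rsat A (Rm M) (Rm N) (cut M N H)"
 shows "rsat B M N E \<subseteq> rsat B M N H"
proof -
 note g = B.almostD[OF E] and h = B.almostD[OF H]
 have "x : rsat B M N H" if x: "x : E" for x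
 proof (rule sat_from_corner[OF B.MN.graded_right_module_axioms h(1)])
  show xc: "x : car (prodmod M N)" by (rule gsubD(1)[OF g(1) x])
  show "cut M N H \<subseteq> H" by (simp add: cut_def)
  fix b assume b: "b : car B" "b \<star> ee = b"
  have "ract (prodmod M N) x b : E" by (rule B.MN.gsub_ract[OF g(1) x b(1)])
  moreover have "ract (prodmod M N) x b : car (Rm (prodmod M N))"
  using B.MN.ract_mult[OF xc b(1) ee_closed] B.MN.ract_closed[OF xc b(1)] unfolding b(2) by simp
  ultimately have "ract (prodmod M N) x b : cut M N E" unfolding cut_corner by blast
  then have "ract (prodmod M N) x b : rsat A (Rm M) (Rm N) (cut M N E)"
  using A.MN.subset_sat[OF A.almostD(1)[OF almost_cut[OF E]]] by blast
  then show "ract (prodmod M N) x b : sat A (Rm (prodmod M N)) (cut M N H)"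
  unfolding Rm_prodmod_sat using sub by blast
 qed
 then have "rsat B M N E \<subseteq> rsat B M N (rsat B M N H)" by (intro B.MN.sat_mono) blast
 then show ?thesis unfolding B.rsat_rsat[OF H] .
qed

text \<open>A saturated relation \<open>\<Delta>\<close> between corners is the corner of the relation that it induces.\<close>

lemma cut_full:
 assumes \<Theta>: "almost A (Rm M) (Rm N) \<Theta>"
 shows "EX E. almost B M N E & rsat A (Rm M) (Rm N) (cut M N E) = rsat A (Rm M) (Rm N) \<Theta>"
proof -
 define \<Delta> where "\<Delta> = rsat A (Rm M) (Rm N) \<Theta>"
 define E where "E = induced (prodmod M N) \<Delta>"
 note gL = B.MN.graded_right_module_axioms
 have D: "almost A (Rm M) (Rm N) \<Delta>" unfolding \<Delta>_def by (rule A.almost_rsat[OF \<Theta>])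
 note d = A.almostD[OF D]
 have Dg: "gsub A (Rm (prodmod M N)) \<Delta>" using d(1) unfolding Rm_prodmod_gsub .
 have Ds: "sat A (Rm (prodmod M N)) \<Delta> = \<Delta>" unfolding Rm_prodmod_sat \<Delta>_def by (rule A.rsat_rsat[OF \<Theta>])
 have Gg: "gsub B (prodmod M N) E" unfolding E_def by (rule gsub_induced[OF gL Dg])
 have DG: "\<Delta> \<subseteq> E" unfolding E_def using corner_induced[OF gL Dg] Ds by blast
 have cutG: "cut M N E = \<Delta>"
 proof
  show "cut M N E \<subseteq> \<Delta>" unfolding cut_corner E_def using induced_corner[OF gL] by blast
  show "\<Delta> \<subseteq> cut M N E" unfolding cut_corner using DG gsubD(1)[OF Dg] by blast
 qed
 have "almost B M N E"
  unfolding almost_def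
 proof (intro conjI subsetI Gg)
  fix m assume m: "m : car M"
  show "m : sat B M (Domain E)"
  proof (rule sat_from_corner[OF gM B.gsub_Domain[OF Gg] m])
  show "Domain \<Delta> \<subseteq> Domain E" using DG by blast
  fix b assume b: "b : car B" "b \<star> ee = b"
  have "ract M m b : car (Rm M)"
  using B.M.ract_mult[OF m b(1) ee_closed] B.M.ract_closed[OF m b(1)] unfolding b(2) by simp
  then show "ract M m b : sat A (Rm M) (Domain \<Delta>)" by (rule d(2))
  qed
 next
  fix n assume n: "n : E `` {\<zero>\<^bsub>M\<^esub>}"
  then have nG: "(\<zero>\<^bsub>M\<^esub>, n) : E" by blast
  have nc: "n : car N" by (rule B.gsub_relD(2)[OF Gg nG])
  show "n : tors B N"
  proof (rule sat_from_corner[OF gN B.N.gsub_zero nc, of "{\<zero>\<^bsub>Rm N\<^esub>}"])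
  fix b assume b: "b : car B" "b \<star> ee = b" "EX j. b : adeg B j"
  have nb: "ract N n b : car (Rm N)"
  using B.N.ract_mult[OF nc b(1) ee_closed] B.N.ract_closed[OF nc b(1)] unfolding b(2) by simp
  have "(ract M \<zero>\<^bsub>M\<^esub> b, ract N n b) : E" by (rule B.gsub_relD(6)[OF Gg nG b(1)])
  then have "(\<zero>\<^bsub>M\<^esub>, ract N n b) : E" unfolding B.M.ract_zero_left[OF b(1)] .
  then have "(\<zero>\<^bsub>Rm M\<^esub>, ract N n b) : cut M N E"
  using nb A.M.mod.zero_closed unfolding cut_def by auto
  then show "ract N n b : tors A (Rm N)" unfolding cutG by (rule d(3))
  qed simp
 qed
 moreover have "rsat A (Rm M) (Rm N) (cut M N E) = rsat A (Rm M) (Rm N) \<Theta>"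
  unfolding cutG unfolding \<Delta>_def by (rule A.rsat_rsat[OF \<Theta>])
 ultimately show ?thesis by blast
qed

end

text \<open>An intermediate element can be replaced by its product with \<open>ee\<close>.\<close>

lemma cut_comp:
 assumes gN: "gr_mod K B N"
  and E: "gsub B (prodmod M N) E" and H: "gsub B (prodmod N P') H"
  and mod: "gr_mod K B M" "gr_mod K B P'"
 shows "cut M P' (E O H) = cut M N E O cut N P' H"
proof
 show "cut M N E O cut N P' H \<subseteq> cut M P' (E O H)" unfolding cut_def by blast
 interpret MN: graded_pair K B M N by (intro graded_pair.intro mod(1) gN)
 interpret NP: graded_pair K B N P' by (intro graded_pair.intro mod(2) gN)
 show "cut M P' (E O H) \<subseteq> cut M N E O cut N P' H"
 proof
  fix x assume "x : cut M P' (E O H)"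
  then obtain m n q where x: "x = (m, q)" "(m, n) : E" "(n, q) : H" "m : car (Rm M)" "q : car (Rm P')"
  unfolding cut_def by blast
  have nc: "n : car N" by (rule MN.gsub_relD(2)[OF E x(2)])
  have "ract N n ee : car (Rm N)"
  using MN.N.ract_mult[OF nc ee_closed ee_closed] MN.N.ract_closed[OF nc ee_closed] ee_ee by simp
  moreover have "(m, ract N n ee) : E" using MN.gsub_relD(6)[OF E x(2) ee_closed] x(4) by simp
  moreover have "(ract N n ee, q) : H" using NP.gsub_relD(6)[OF H x(3) ee_closed] x(5) by simp
  ultimately show "x : cut M N E O cut N P' H" using x(1,4,5) unfolding cut_def by blast
 qed
qed

lemma cut_Id: "cut M M (Id_on (car M)) = Id_on (car (Rm M))" by (auto simp: cut_def)

lemma cut_faithful: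
 assumes "gr_mod K B M" "gr_mod K B N" "almost B M N E" "almost B M N H"
  "rsat A (Rm M) (Rm N) (cut M N E) = rsat A (Rm M) (Rm N) (cut M N H)"
 shows "rsat B M N E = rsat B M N H"
 using cut_faithful_subset[OF assms(1-4)] cut_faithful_subset[OF assms(1,2,4,3)] assms(5) by blast

end

section \<open>Coinduction\<close>

text \<open>A module over \<open>B\<close> built from finitely many copies of a module on \<open>'u\<close> has to live on \<open>'u\<close>
 again. This is possible because \<open>'u \<times> 'u\<close> embeds into the infinite type \<open>'u\<close>.\<close>

lemma inj_on_finite_support:
 assumes "infinite (UNIV :: 'u set)" "finite X"
 shows "EX f :: ('x => 'u) => 'u. inj_on f {v. ALL x. x \<notin> X --> v x = d}"
 using assms(2)
proof (induction X rule: finite_induct)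
 case empty
 show ?case by (intro exI[of _ "%_. d"] inj_onI) auto
next
 case (insert x X)
 obtain f :: "('x => 'u) => 'u" where f: "inj_on f {v. ALL x. x \<notin> X --> v x = d}" using insert.IH by blast
 obtain p :: "'u \<times> 'u => 'u" where "bij_betw p (UNIV \<times> UNIV) UNIV"
  using card_of_Times_same_infinite[OF assms(1), folded card_of_ordIso] by blast
 then have p: "inj p" by (simp add: bij_betw_def)
 show ?case
 proof (intro exI[of _ "%v. p (v x, f (v(x := d)))"] inj_onI)
  fix v w assume v: "v : {v. ALL y. y \<notin> insert x X --> v y = d}" "w : {v. ALL y. y \<notin> insert x X --> v y = d}"
  and "p (v x, f (v(x := d))) = p (w x, f (w(x := d)))"
  then have e: "v x = w x" "f (v(x := d)) = f (w(x := d))" using injD[OF p] by blast+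
  have "v(x := d) = w(x := d)" by (rule inj_onD[OF f, OF e(2)]) (use v in auto)
  then show "v = w" using e(1) by (metis fun_upd_triv fun_upd_upd)
 qed
qed

text \<open>Transport of structure along a map that is injective on the carrier.\<close>

definition relabel :: "('m => 'n) => ('a, 'm) graded_module => ('a, 'n) graded_module" where
 "relabel f M = \<lparr> carrier = f ` car M, mult = undefined, one = undefined, zero = f \<zero>\<^bsub>M\<^esub>,
  add = (%x y. f (inv_into (car M) f x \<oplus>\<^bsub>M\<^esub> inv_into (car M) f y)),
  ract = (%x a. f (ract M (inv_into (car M) f x) a)), mdeg = (%i. f ` mdeg M i) \<rparr>"

context graded_right_module begin

lemma relabel_sel:
 assumes f: "inj_on f (car M)"
 shows "car (relabel f M) = f ` car M" "zero (relabel f M) = f \<zero>\<^bsub>M\<^esub>" "mdeg (relabel f M) i = f ` mdeg M i"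
  "[| x : car M; y : car M |] ==> f x \<oplus>\<^bsub>relabel f M\<^esub> f y = f (x \<oplus>\<^bsub>M\<^esub> y)"
  "x : car M ==> ract (relabel f M) (f x) a = f (ract M x a)" by (simp_all add: relabel_def inv_into_f_f[OF f])

lemma relabel_module:
 assumes f: "inj_on f (car M)"
 shows "gr_mod K A (relabel f M)"
proof -
 note s = relabel_sel[OF f]
 have ab: "abelian_group (relabel f M)"
 proof (rule abelian_groupI)
  fix X Y Z assume "X : car (relabel f M)" "Y : car (relabel f M)" "Z : car (relabel f M)"
  then obtain x y z where "x : car M" "y : car M" "z : car M" "X = f x" "Y = f y" "Z = f z"
  unfolding s(1) by blast
  then show "X \<oplus>\<^bsub>relabel f M\<^esub> Y \<oplus>\<^bsub>relabel f M\<^esub> Z = X \<oplus>\<^bsub>relabel f M\<^esub> (Y \<oplus>\<^bsub>relabel f M\<^esub> Z)"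
  by (simp add: s mod.a_assoc)
 next
  fix X Y assume "X : car (relabel f M)" "Y : car (relabel f M)"
  then obtain x y where x: "x : car M" "y : car M" "X = f x" "Y = f y" unfolding s(1) by blast
  then show "X \<oplus>\<^bsub>relabel f M\<^esub> Y = Y \<oplus>\<^bsub>relabel f M\<^esub> X" by (simp add: s mod.a_comm)
  show "X \<oplus>\<^bsub>relabel f M\<^esub> Y : car (relabel f M)" using x by (simp add: s)
 next
  fix X assume "X : car (relabel f M)"
  then obtain x where x: "x : car M" "X = f x" unfolding s(1) by blast
  then show "\<zero>\<^bsub>relabel f M\<^esub> \<oplus>\<^bsub>relabel f M\<^esub> X = X" by (simp add: s)
  show "EX Y:car (relabel f M). Y \<oplus>\<^bsub>relabel f M\<^esub> X = \<zero>\<^bsub>relabel f M\<^esub>"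
  using x by (intro bexI[of _ "f (\<ominus>\<^bsub>M\<^esub> x)"]) (simp_all add: s mod.l_neg)
 qed (simp add: s)
 interpret lab: abelian_group "relabel f M" by (rule ab)
 let ?c = "%X i. f (mg.cp (inv_into (car M) f X) i)"
 have feq: "f x = f y \<longleftrightarrow> x = y" if "x : car M" "y : car M" for x y using inj_onD[OF f] that by blast
 have decomp: "direct_sum_decomp (relabel f M) (mdeg (relabel f M)) &
  (ALL m:car (relabel f M). component (relabel f M) (mdeg (relabel f M)) m = ?c m)"
 proof (rule direct_sum_decompI[OF ab])
  fix i show "subgroup (mdeg (relabel f M) i) (add_monoid (relabel f M))"
  proof (rule lab.add_subgroupI)
  show "mdeg (relabel f M) i \<subseteq> car (relabel f M)" unfolding s using mg.D_carrier by blast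
  show "\<zero>\<^bsub>relabel f M\<^esub> : mdeg (relabel f M) i" unfolding s using mg.D_zero by blast
  fix X assume "X : mdeg (relabel f M) i"
  then obtain x where x: "x : mdeg M i" "X = f x" unfolding s(3) by blast
  have xc: "x : car M" by (rule mg.D_carrier[OF x(1)])
  have "\<ominus>\<^bsub>relabel f M\<^esub> X = f (\<ominus>\<^bsub>M\<^esub> x)"
  using xc by (intro lab.minus_equality) (simp_all add: s x(2) mod.l_neg)
  then show "\<ominus>\<^bsub>relabel f M\<^esub> X : mdeg (relabel f M) i" unfolding s using mg.D_neg[OF x(1)] by blast
  show "X \<oplus>\<^bsub>relabel f M\<^esub> Y : mdeg (relabel f M) i" if Y: "Y : mdeg (relabel f M) i" for Y
  proof -
  obtain y where y: "y : mdeg M i" "Y = f y" using Y unfolding s(3) by blast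
  show ?thesis unfolding x(2) y(2) s(4)[OF xc mg.D_carrier[OF y(1)]] s(3) using mg.D_add[OF x(1) y(1)] by blast
  qed
  qed
 next
  fix X assume "X : car (relabel f M)"
  then obtain x where x: "x : car M" "X = f x" unfolding s(1) by blast
  have gx: "inv_into (car M) f X = x" using x f by (simp add: inv_into_f_f)
  show "?c X i : mdeg (relabel f M) i" for i unfolding gx s(3) using mg.component_props(1)[OF x(1)] by blast
  have z: "?c X i = \<zero>\<^bsub>relabel f M\<^esub> \<longleftrightarrow> mg.cp x i = \<zero>\<^bsub>M\<^esub>" for i
  unfolding gx s(2) using feq[OF mg.component_carrier[OF x(1)] mod.zero_closed] .
  show "finite {i. ?c X i ~= \<zero>\<^bsub>relabel f M\<^esub>}" unfolding z by (rule mg.component_props(2)[OF x(1)])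
  show "X = \<zero>\<^bsub>relabel f M\<^esub>" if "!!i. ?c X i = \<zero>\<^bsub>relabel f M\<^esub>"
  unfolding x(2) s(2) using mg.components_zero[OF x(1)] that[unfolded z] by simp
  show "?c (X \<oplus>\<^bsub>relabel f M\<^esub> Y) i = ?c X i \<oplus>\<^bsub>relabel f M\<^esub> ?c Y i" if Y: "Y : car (relabel f M)" for Y i
  proof -
  obtain y where y: "y : car M" "Y = f y" using Y unfolding s(1) by blast
  have gy: "inv_into (car M) f Y = y" using y f by (simp add: inv_into_f_f)
  have "inv_into (car M) f (X \<oplus>\<^bsub>relabel f M\<^esub> Y) = x \<oplus>\<^bsub>M\<^esub> y"
  unfolding x(2) y(2) s(4)[OF x(1) y(1)] using f x(1) y(1) by (simp add: inv_into_f_f)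
  then show ?thesis
  unfolding gx gy using s(4)[OF mg.component_carrier[OF x(1)] mg.component_carrier[OF y(1)]]
  mg.component_add[OF x(1) y(1)] by simp
  qed
 next
  fix X i assume "X : mdeg (relabel f M) i"
  then obtain x where x: "x : mdeg M i" "X = f x" unfolding s(3) by blast
  have gx: "inv_into (car M) f X = x" using x f mg.D_carrier[OF x(1)] by (simp add: inv_into_f_f)
  show "?c X i = X" unfolding gx using mg.component_homogeneous[OF x(1), of i] x(2) by simp
  show "?c X j = \<zero>\<^bsub>relabel f M\<^esub>" if "i ~= j" for j
  unfolding gx s(2) using mg.component_homogeneous[OF x(1), of j] that by simp
 qed
 show ?thesis
 proof (intro graded_right_module.intro graded_right_module_axioms.intro ab decomp[THEN conjunct1])
  show "graded_algebra K A" by (rule graded_algebra_axioms)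
  fix X a assume "X : car (relabel f M)" and a: "a : car A"
  then obtain x where x: "x : car M" "X = f x" unfolding s(1) by blast
  show "ract (relabel f M) X a : car (relabel f M)" using x a by (simp add: s ract_closed)
  fix b assume b: "b : car A"
  show "ract (relabel f M) X (a \<oplus>\<^bsub>A\<^esub> b) = ract (relabel f M) X a \<oplus>\<^bsub>relabel f M\<^esub> ract (relabel f M) X b"
  "ract (relabel f M) X (a \<otimes>\<^bsub>A\<^esub> b) = ract (relabel f M) (ract (relabel f M) X a) b"
  using x a b by (simp_all add: s ract_closed ract_add_right ract_mult)
 next
  fix X Y a assume "X : car (relabel f M)" "Y : car (relabel f M)" and a: "a : car A"
  then obtain x y where "x : car M" "X = f x" "y : car M" "Y = f y" unfolding s(1) by blast
  then show "ract (relabel f M) (X \<oplus>\<^bsub>relabel f M\<^esub> Y) a = ract (relabel f M) X a \<oplus>\<^bsub>relabel f M\<^esub> ract (relabel f M) Y a"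
  using a by (simp add: s ract_closed ract_add_left)
 next
  fix X assume "X : car (relabel f M)"
  then obtain x where "x : car M" "X = f x" unfolding s(1) by blast
  then show "ract (relabel f M) X \<one>\<^bsub>A\<^esub> = X" by (simp add: s ract_one)
 next
  fix X i a j assume "X : mdeg (relabel f M) i" and a: "a : adeg A j"
  then obtain x where x: "x : mdeg M i" "X = f x" unfolding s(3) by blast
  show "ract (relabel f M) X a : mdeg (relabel f M) (i + int j)"
  unfolding x(2) s(5)[OF mg.D_carrier[OF x(1)]] s(3) using mdeg_ract[OF x(1) a] by blast
 qed
qed

end

text \<open>The graph of a homomorphism with torsion kernel and cokernel is an almost map in both
  directions.\<close>

lemma (in tame_algebra) isomorphic_QGr_hom:
 assumes mod: "gr_mod K A M" "gr_mod K A N"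
  and cl: "!!m. m : car M ==> f m : car N"
  and add: "!!m n. [| m : car M; n : car M |] ==> f (m \<oplus>\<^bsub>M\<^esub> n) = f m \<oplus>\<^bsub>N\<^esub> f n"
  and act: "!!m a. [| m : car M; a : car A |] ==> f (ract M m a) = ract N (f m) a"
  and deg: "!!m i. m : mdeg M i ==> f m : mdeg N i"
  and ker: "!!m. [| m : car M; f m = \<zero>\<^bsub>N\<^esub> |] ==> m : tors A M"
  and coker: "!!n. [| gsub A N (f ` car M); n : car N |] ==> n : sat A N (f ` car M)"
 shows "isomorphic (QGr K A) M N"
proof -
 interpret MN: tame_pair K A M N by (rule tame_pairI[OF mod])
 interpret NM: tame_pair K A N M by (rule tame_pairI[OF mod(2,1)])
 define E where "E = {(m, f m) | m. m : car M}"
 have f0: "f \<zero>\<^bsub>M\<^esub> = \<zero>\<^bsub>N\<^esub>" using add[of "\<zero>\<^bsub>M\<^esub>" "\<zero>\<^bsub>M\<^esub>"] cl[of "\<zero>\<^bsub>M\<^esub>"] by simp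
 have cp: "f (MN.M.mg.cp m i) = MN.N.mg.cp (f m) i" if "m : car M" for m i
  using that
 proof (induction m rule: MN.M.mg.homogeneous_induct)
  case zero then show ?case using f0 MN.M.mg.component_zero MN.N.mg.component_zero by simp
 next
  case (hom j x)
  then show ?case using MN.M.mg.component_homogeneous[OF hom] MN.N.mg.component_homogeneous[OF deg[OF hom]] f0 by simp
 next
  case (add x y)
  then show ?case using assms(4) cl by (simp add: MN.M.mg.component_add MN.N.mg.component_add MN.M.mg.component_carrier)
 qed
 have E: "gsub A (prodmod M N) E"
 proof (rule MN.gsub_relI)
  show "(m \<oplus>\<^bsub>M\<^esub> m', n \<oplus>\<^bsub>N\<^esub> n') : E" if "(m, n) : E" "(m', n') : E" for m n m' n'
  using that add by (auto simp: E_def)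
  show "(ract M m a, ract N n a) : E" if "(m, n) : E" "a : adeg A j" for m n a j
  using that act MN.M.ract_closed adeg_carrier by (auto simp: E_def)
  show "(MN.M.mg.cp m i, MN.N.mg.cp n i) : E" if "(m, n) : E" for m n i
  using that cp MN.M.mg.component_carrier by (auto simp: E_def)
 qed (use cl f0 in \<open>auto simp: E_def\<close>)
 note er = MN.gsub_relD[OF E]
 have E': "gsub A (prodmod N M) (E\<inverse>)" by (rule NM.gsub_relI) (use er adeg_carrier in auto)
 have D: "Domain E = car M" "Domain (E\<inverse>) = f ` car M" by (auto simp: E_def)
 have "\<zero>\<^bsub>N\<^esub> : tors A N" using MN.N.subset_sat[OF MN.N.gsub_zero] by blast
 then have "almost A M N E"
  unfolding almost_def D(1) using E MN.M.subset_sat[OF MN.M.gsub_carrier] f0 by (auto simp: E_def)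
 moreover have "almost A N M (E\<inverse>)"
  unfolding almost_def D(2) using E' coker[OF NM.gsub_Domain[OF E', unfolded D(2)]] ker by (auto simp: E_def)
 ultimately show ?thesis by (rule isomorphic_QGr_I[OF mod])
qed

context unfolded_quiver begin

definition dec :: "nat => 'e list \<times> nat" where
 "dec = inv_into A.X enc"

lemma dec_enc: "s : A.X ==> dec (enc s) = s"
 unfolding dec_def by (rule inv_into_f_f) (use enc_bij in \<open>auto simp: bij_betw_def\<close>)

lemma dec_verts: "v : verts G ==> dec v : A.X & enc (dec v) = v"
 using vertsE[of v] dec_enc by auto

text \<open>An arrow that ends at clock 0 has moved the window to the right; its letter is the one that
  has entered the window. A tick reads nothing.\<close>

definition letter :: "nat => 'a" where
 "letter e = (if snd (dec (head G e)) = 0 then A.M [last (fst (dec (head G e)))] else \<one>\<^bsub>A\<^esub>)"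

primrec reading :: "nat list => 'a" where
 "reading [] = \<one>\<^bsub>A\<^esub>"
| "reading (e # es) = letter e \<otimes>\<^bsub>A\<^esub> reading es"

text \<open>The degree by which the copy of \<open>L\<close> at a state is shifted, chosen such that all arrows of \<open>G\<close>
 act with degree 1: reading the letter \<open>y\<close> adds \<open>w y\<close> to the weight of the window.\<close>

definition height :: "'e list \<times> nat => int" where
 "height s = int (weight w (fst s)) - int (snd s)"

lemma M_single: "y : arcs Q ==> A.M [y] : adeg A (w y)"
 using A.mono_adeg[of "(A.start [y], [y])"] by (simp add: A.M_def A.start_def)

lemma letter_adeg:
 assumes e: "e : arcs G"
 shows "EX k. letter e : adeg A k & int k = 1 + height (dec (head G e)) - height (dec (tail G e))"
proof -
 obtain s t where st: "s : A.X" "t : A.X" "A.edge s t" "e = code s t" using arcsE[OF e] by blast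
 have d: "dec (tail G e) = s" "dec (head G e) = t" using st dec_enc by simp_all
 obtain u j where s: "s = (u, j)" by (cases s)
 from st(3) s consider (tick) "t = (u, j + 1)" |
  (last) y where "j + 1 = w (hd u)" "A.okw (u @ [y])" "t = (tl u @ [y], 0)" by (auto simp: A.edge_def)
 then show ?thesis
 proof cases
  case tick
  then show ?thesis unfolding d using s A.one_adeg by (intro exI[of _ 0]) (simp add: letter_def d height_def)
 next
  case last
  have u: "u : A.X0" using st(1) s by (simp add: A.X_def)
  then obtain x u1 where u1: "u = x # u1" using A.X0_ne by (cases u) auto
  have y: "y : arcs Q" using A.okw_arcs[OF last(2)] by simp
  show ?thesis
  unfolding d using M_single[OF y] last s u1 by (intro exI[of _ "w y"]) (simp add: letter_def d height_def)
 qed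
qed

lemma letter_closed: "e : arcs G ==> letter e : car A"
 using letter_adeg A.adeg_carrier by blast

lemma reading_closed: "set es \<subseteq> arcs G ==> reading es : car A"
 by (induction es) (simp_all add: letter_closed)

lemma reading_append:
 "set xs \<subseteq> arcs G ==> set ys \<subseteq> arcs G ==> reading (xs @ ys) = reading xs \<otimes>\<^bsub>A\<^esub> reading ys"
 by (induction xs) (simp_all add: reading_closed letter_closed A.m_assoc)

lemma reading_adeg:
 assumes "q : B.p.paths"
 shows "EX k. reading (snd q) : adeg A k &
  int k = int (length (snd q)) + height (dec (B.p.pend q)) - height (dec (fst q))"
proof -
 have "EX k. reading es : adeg A k & int k = int (length es) + height (dec (B.p.pend (v, es))) - height (dec v)"
  if "(v, es) : B.p.paths" for v es
  using that
 proof (induction es arbitrary: v)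
  case Nil then show ?case using A.one_adeg by (intro exI[of _ 0]) simp
 next
  case (Cons e es)
  then have e: "e : arcs G" "v = tail G e" "(head G e, es) : B.p.paths" by simp_all
  obtain k where k: "letter e : adeg A k" "int k = 1 + height (dec (head G e)) - height (dec (tail G e))"
  using letter_adeg[OF e(1)] by blast
  obtain n where n: "reading es : adeg A n"
  "int n = int (length es) + height (dec (B.p.pend (head G e, es))) - height (dec (head G e))"
  using Cons.IH[OF e(3)] by blast
  show ?case using A.adeg_mult[OF k(1) n(1)] k(2) n(2) e(2) by (intro exI[of _ "k + n"]) simp
 qed
 from this[of "fst q" "snd q"] assms show ?thesis by simp
qed

primrec word :: "'e list => 'a" where
 "word [] = \<one>\<^bsub>A\<^esub>"
| "word (y # z) = A.M [y] \<otimes>\<^bsub>A\<^esub> word z"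

lemma M_single_closed: "y : arcs Q ==> A.M [y] : car A" by (rule A.adeg_carrier[OF M_single])

lemma word_closed: "set z \<subseteq> arcs Q ==> word z : car A"
 by (induction z) (simp_all add: M_single_closed)

lemma word_append: "set a \<subseteq> arcs Q ==> set b \<subseteq> arcs Q ==> word (a @ b) = word a \<otimes>\<^bsub>A\<^esub> word b"
 by (induction a) (simp_all add: word_closed M_single_closed A.m_assoc)

lemma word_path: "(v, z) : A.p.paths ==> z ~= [] ==> word z = A.mono (v, z)"
proof (induction z arbitrary: v)
 case (Cons y z)
 then have y: "y : arcs Q" "v = tail Q y" "(head Q y, z) : A.p.paths" by simp_all
 have yp: "(v, [y]) : A.p.paths" using y A.p.qpaths_start[OF y(3)] by simp
 have My: "A.M [y] = A.mono (v, [y])" using y(2) by (simp add: A.M_def A.start_def)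
 show ?case
 proof (cases "z = []")
  case True
  then show ?thesis using My M_single_closed[OF y(1)] by simp
 next
  case False
  then show ?thesis using Cons.IH[OF y(3)] My A.mono_mult[OF yp y(3)] by simp
 qed
qed simp

text \<open>The product is a path that is not composable or contains a forbidden subpath.\<close>

lemma word_M_zero:
 assumes d: "(v, d) : A.p.paths" "d ~= []" and u: "u : A.X0" and n: "~ A.okw (d @ u)"
 shows "word d \<otimes>\<^bsub>A\<^esub> A.M u = \<zero>\<^bsub>A\<^esub>"
proof -
 have up: "(A.start u, u) : A.p.paths" using u A.okw_path by (simp add: A.X0_def)
 have "A.mono (v, d @ u) = \<zero>\<^bsub>A\<^esub>" if "A.p.pend (v, d) = A.start u"
  by (rule A.mono_not_okw) (use d up that n A.p.qpaths_append in auto)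
 then show ?thesis unfolding word_path[OF d] A.M_def A.mono_mult[OF d(1) up] by simp
qed

lemma long_word:
 assumes "(v, z) : A.p.paths" "k * A.maxw <= weight w z"
 shows "k <= length z"
proof -
 have "k * A.maxw <= length z * A.maxw"
  using A.length_weight[OF A.p.qpaths_arcs[OF assms(1)]] assms(2) le_trans by blast
 moreover have "0 < A.maxw" by (simp add: A.maxw_def Max_gr_iff)
 ultimately show ?thesis by simp
qed

lemma reading_blk:
 assumes u: "u : A.X0" and y: "A.okw (u @ [y])" and "j < w (hd u)"
 shows "reading (blk j u (tl u @ [y])) = A.M [y]"
 using assms(3)
proof (induction "w (hd u) - j" arbitrary: j rule: less_induct)
 case less
 have My: "A.M [y] : car A" using A.okw_arcs[OF y] by (simp add: M_single_closed)
 show ?case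
 proof (cases "j + 1 < w (hd u)")
  case True
  then have "(u, j + 1) : A.X" using u by (simp add: A.X_def)
  then have "letter (code (u, j) (u, j + 1)) = \<one>\<^bsub>A\<^esub>" using dec_enc by (simp add: letter_def)
  then show ?thesis using less.hyps[of "j + 1"] True blk_Cons[OF less.prems, of "tl u @ [y]"] My by simp
 next
  case False
  have "letter (code (u, j) (tl u @ [y], 0)) = A.M [y]"
  using dec_enc[OF A.X0_clock[OF A.shift_word[OF u y]]] by (simp add: letter_def)
  moreover have "blk (j + 1) u (tl u @ [y]) = []" using False less.prems by (simp add: blk_def)
  ultimately show ?thesis using False blk_Cons[OF less.prems, of "tl u @ [y]"] My by simp
 qed
qed

lemma reading_rp: "A.okw z ==> l <= length z ==> reading (rp z) = word (drop l z)"
proof (induction z)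
 case Nil then show ?case by (simp add: A.okw_def)
next
 case (Cons x z)
 show ?case
 proof (cases "length z < l")
  case True
  then have "length (x # z) = l" using Cons.prems by simp
  then show ?thesis using True by simp
 next
  case False
  define y where "y = z ! (l - 1)"
  note s = take_l_split[of z x, folded y_def]
  have zne: "z ~= []" using False A.l_pos by auto
  have okz: "A.okw z" by (rule A.okw_suffix[of "[x]"]) (use Cons.prems zne in auto)
  have u: "take l (x # z) : A.X0" by (rule A.take_X0) (use Cons.prems in auto)
  have ok1: "A.okw (take l (x # z) @ [y])"
  unfolding s(1)[OF leI[OF False]]
  by (rule A.okw_prefix[of _ "drop (l + 1) (x # z)"]) (use Cons.prems in \<open>simp_all only: append_take_drop_id, simp_all\<close>)
  have wx: "0 < w (hd (take l (x # z)))" using A.p.w_pos[OF A.X0_hd[OF u]] by simp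
  note b = blk_path[OF u ok1 wx, unfolded s(2)[OF leI[OF False]]]
  note rb = reading_blk[OF u ok1 wx, unfolded s(2)[OF leI[OF False]]]
  note zp = rp_path[OF okz leI[OF False], THEN conjunct1]
  have "reading (blk 0 (take l (x # z)) (take l z) @ rp z) = A.M [y] \<otimes>\<^bsub>A\<^esub> word (drop l z)"
  unfolding reading_append[OF B.p.qpaths_arcs[OF b[THEN conjunct1]] B.p.qpaths_arcs[OF zp]] rb
  Cons.IH[OF okz leI[OF False]] ..
  moreover have "drop l (x # z) = y # drop l z"
  proof -
  have "drop l (x # z) = drop (l - 1) z" using A.l_pos by (cases l) auto
  also have "... = z ! (l - 1) # drop (Suc (l - 1)) z"
  by (rule Cons_nth_drop_Suc[symmetric]) (use False A.l_pos in simp)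
  finally show ?thesis using A.l_pos by (simp add: y_def)
  qed
  ultimately show ?thesis using False by simp
 qed
qed

context
 fixes L :: "('a, 'u) graded_module"
 assumes gL: "gr_mod K A L"
begin

interpretation L: graded_right_module K A L by (rule gL)

text \<open>Families indexed by the states, normalised to be zero elsewhere.\<close>

definition families :: "(('e list \<times> nat) => 'u) set" where
 "families = {v. (ALL s:A.X. v s : car L) & (ALL s. s \<notin> A.X --> v s = \<zero>\<^bsub>L\<^esub>)}"

definition fam :: "('b, ('e list \<times> nat) => 'u) graded_module" where
 "fam = \<lparr> carrier = families, mult = undefined, one = undefined, zero = (%s. \<zero>\<^bsub>L\<^esub>),
  add = (%v v' s. v s \<oplus>\<^bsub>L\<^esub> v' s), ract = undefined,
  mdeg = (%i. {v : families. ALL s:A.X. v s : mdeg L (i + height s)}) \<rparr>"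

text \<open>The action of a path of \<open>G\<close>: the entry at its start, multiplied by the word that it reads, is
  moved to its end.\<close>

definition move :: "(nat, nat) qpath => (('e list \<times> nat) => 'u) => ('e list \<times> nat) => 'u" where
 "move q v = (%t. if t : A.X & B.p.pend q = enc t then ract L (v (dec (fst q))) (reading (snd q)) else \<zero>\<^bsub>L\<^esub>)"

definition coind :: "('b, ('e list \<times> nat) => 'u) graded_module" where
 "coind = fam\<lparr> ract := B.mact fam (%c v s. ract L (v s) (c \<odot>\<^bsub>A\<^esub> \<one>\<^bsub>A\<^esub>)) move \<rparr>"

lemma fam_sel [simp]:
 "car fam = families" "zero fam = (%s. \<zero>\<^bsub>L\<^esub>)" "add fam = (%v v' s. v s \<oplus>\<^bsub>L\<^esub> v' s)"
 "mdeg fam i = {v : families. ALL s:A.X. v s : mdeg L (i + height s)}" by (simp_all add: fam_def)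

lemma coind_sel [simp]:
 "car coind = families" "zero coind = (%s. \<zero>\<^bsub>L\<^esub>)" "add coind = (%v v' s. v s \<oplus>\<^bsub>L\<^esub> v' s)"
 "mdeg coind i = {v : families. ALL s:A.X. v s : mdeg L (i + height s)}" by (simp_all add: coind_def)

lemma familiesI: "(!!s. s : A.X ==> v s : car L) ==> (!!s. s \<notin> A.X ==> v s = \<zero>\<^bsub>L\<^esub>) ==> v : families"
 unfolding families_def by blast

lemma families_zero: "v : families ==> s \<notin> A.X ==> v s = \<zero>\<^bsub>L\<^esub>"
 unfolding families_def by blast

lemma families_val: "v : families ==> v s : car L"
proof (cases "s : A.X")
 case True then show "v : families ==> v s : car L" unfolding families_def by blast
next
 case False then show "v : families ==> v s : car L" using families_zero[of v s] by simp
qed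

lemma fam_abelian: "abelian_group fam"
proof (rule abelian_groupI)
 fix x assume x: "x : car fam"
 then show "EX y:car fam. y \<oplus>\<^bsub>fam\<^esub> x = \<zero>\<^bsub>fam\<^esub>"
  by (intro bexI[of _ "%s. \<ominus>\<^bsub>L\<^esub> x s"] familiesI[THEN subst[OF fam_sel(1)[symmetric], of "%A. _ : A"]])
  (simp_all add: families_val L.mod.l_neg families_zero)
qed (auto simp: families_val L.mod.a_ac families_zero intro!: familiesI)

lemma fam_graded: "graded_group fam (mdeg fam)"
proof -
 interpret F: abelian_group fam by (rule fam_abelian)
 let ?c = "%v i s. if s : A.X then L.mg.cp (v s) (i + height s) else \<zero>\<^bsub>L\<^esub>"
 have decomp: "direct_sum_decomp fam (mdeg fam) & (ALL v:car fam. component fam (mdeg fam) v = ?c v)"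
 proof (rule direct_sum_decompI[OF fam_abelian])
  fix i show "subgroup (mdeg fam i) (add_monoid fam)"
  proof (rule F.add_subgroupI)
  show "mdeg fam i \<subseteq> car fam" by auto
  show "\<zero>\<^bsub>fam\<^esub> : mdeg fam i" by (auto intro!: familiesI L.mg.D_zero)
  fix x assume x: "x : mdeg fam i"
  then have xf: "x : families" by simp
  have "\<ominus>\<^bsub>fam\<^esub> x = (%s. \<ominus>\<^bsub>L\<^esub> x s)"
  by (rule F.minus_equality) (use xf in \<open>auto simp: families_val L.mod.l_neg families_zero intro!: familiesI\<close>)
  then show "\<ominus>\<^bsub>fam\<^esub> x : mdeg fam i"
  using x xf by (auto simp: families_val families_zero intro!: familiesI L.mg.D_neg)
  show "x \<oplus>\<^bsub>fam\<^esub> y : mdeg fam i" if "y : mdeg fam i" for y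
  using x that by (auto simp: families_val families_zero intro!: familiesI L.mg.D_add)
  qed
 next
  fix v assume "v : car fam"
  then have v: "v : families" by simp
  show "?c v i : mdeg fam i" for i
  using L.mg.component_props(1)[OF families_val[OF v]] L.mg.component_carrier[OF families_val[OF v]]
  by (auto intro!: familiesI)
  have "{i. ?c v i ~= \<zero>\<^bsub>fam\<^esub>} \<subseteq> (\<Union>s\<in>A.X. (%j. j - height s) ` {j. L.mg.cp (v s) j ~= \<zero>\<^bsub>L\<^esub>})"
  proof
  fix i assume "i : {i. ?c v i ~= \<zero>\<^bsub>fam\<^esub>}"
  then obtain s where "s : A.X" "L.mg.cp (v s) (i + height s) ~= \<zero>\<^bsub>L\<^esub>" by (auto simp: fun_eq_iff split: if_splits)
  then show "i : (\<Union>s\<in>A.X. (%j. j - height s) ` {j. L.mg.cp (v s) j ~= \<zero>\<^bsub>L\<^esub>})"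
  by (intro UN_I[of s] image_eqI[of _ _ "i + height s"]) auto
  qed
  then show "finite {i. ?c v i ~= \<zero>\<^bsub>fam\<^esub>}"
  by (rule finite_subset) (intro finite_UN_I A.finite_X finite_imageI L.mg.component_props(2) families_val[OF v])
  show "v = \<zero>\<^bsub>fam\<^esub>" if z: "!!i. ?c v i = \<zero>\<^bsub>fam\<^esub>"
  proof
  fix s
  show "v s = \<zero>\<^bsub>fam\<^esub> s"
  proof (cases "s : A.X")
  case True
  have "L.mg.cp (v s) i = \<zero>\<^bsub>L\<^esub>" for i using fun_cong[OF z[of "i - height s"], of s] True by simp
  then show ?thesis using L.mg.components_zero[OF families_val[OF v]] by simp
  qed (simp add: families_zero[OF v])
  qed
  show "?c (v \<oplus>\<^bsub>fam\<^esub> v') i = ?c v i \<oplus>\<^bsub>fam\<^esub> ?c v' i" if "v' : car fam" for v' i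
  using that by (auto simp: fun_eq_iff L.mg.component_add families_val v)
 next
  fix v i assume "v : mdeg fam i"
  then have v: "v : families" "!!s. s : A.X ==> v s : mdeg L (i + height s)" by auto
  show "?c v i = v" using L.mg.component_homogeneous[OF v(2)] families_zero[OF v(1)] by (auto simp: fun_eq_iff)
  show "?c v j = \<zero>\<^bsub>fam\<^esub>" if "i ~= j" for j
  using L.mg.component_homogeneous[OF v(2)] that by (auto simp: fun_eq_iff)
 qed
 show ?thesis by (intro graded_group.intro fam_abelian graded_group_axioms.intro decomp[THEN conjunct1])
qed

lemma fam_finsum:
 assumes "finite I" "!!i. i : I ==> f i : families"
 shows "finsum fam f I s = (\<Oplus>\<^bsub>L\<^esub>i\<in>I. f i s)"
 using assms
proof (induction I rule: finite_induct)
 interpret F: abelian_group fam by (rule fam_abelian)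
 case empty then show ?case by simp
next
 interpret F: abelian_group fam by (rule fam_abelian)
 case (insert i I)
 then have "f i : car fam" "f : I \<rightarrow> car fam" "f i s : car L" "(%i. f i s) : I \<rightarrow> car L"
  using families_val by auto
 then show ?case using insert by (simp add: F.finsum_insert L.mod.finsum_insert)
qed

lemma path_facts:
 assumes "q : B.p.paths"
 shows "dec (fst q) : A.X" "enc (dec (fst q)) = fst q" "set (snd q) \<subseteq> arcs G"
proof -
 obtain v es where q: "q = (v, es)" by (cases q)
 show "dec (fst q) : A.X" "enc (dec (fst q)) = fst q"
  using dec_verts B.p.qpaths_start assms unfolding q by auto
 show "set (snd q) \<subseteq> arcs G" using B.p.qpaths_arcs assms unfolding q by auto
qed

lemma coind_facts:
 shows coind_module: "gr_mod K B coind"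
  and coind_mono: "[| q : B.p.paths; v : families |] ==> ract coind v (B.mono q) = move q v"
  and coind_scalar: "[| c : car K; v : families |] ==>
  ract coind v (c \<odot>\<^bsub>B\<^esub> \<one>\<^bsub>B\<^esub>) = (%s. ract L (v s) (c \<odot>\<^bsub>A\<^esub> \<one>\<^bsub>A\<^esub>))"
proof -
 let ?sm = "%c v s. ract L (v s) (c \<odot>\<^bsub>A\<^esub> \<one>\<^bsub>A\<^esub>)"
 have sc: "c \<odot>\<^bsub>A\<^esub> \<one>\<^bsub>A\<^esub> : car A" if "c : car K" for c by (rule A.scalar_carrier[OF that])
 note val = families_val
 have 1: "?sm c v : car fam" if "c : car K" "v : car fam" for c v
  using that by (auto simp: val L.ract_closed sc families_zero L.ract_zero_left intro!: familiesI)
 have 2: "?sm c (x \<oplus>\<^bsub>fam\<^esub> y) = ?sm c x \<oplus>\<^bsub>fam\<^esub> ?sm c y" if "c : car K" "x : car fam" "y : car fam" for c x y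
  using that by (simp add: val L.ract_add_left sc)
 have 3: "?sm (c \<oplus>\<^bsub>K\<^esub> d) x = ?sm c x \<oplus>\<^bsub>fam\<^esub> ?sm d x" if "c : car K" "d : car K" "x : car fam" for c d x
  using that by (simp add: A.scalar_add val L.ract_add_right sc)
 have 4: "?sm (c \<otimes>\<^bsub>K\<^esub> d) x = ?sm c (?sm d x)" if "c : car K" "d : car K" "x : car fam" for c d x
 proof -
  have "c \<otimes>\<^bsub>K\<^esub> d \<odot>\<^bsub>A\<^esub> \<one>\<^bsub>A\<^esub> = (d \<odot>\<^bsub>A\<^esub> \<one>\<^bsub>A\<^esub>) \<otimes>\<^bsub>A\<^esub> (c \<odot>\<^bsub>A\<^esub> \<one>\<^bsub>A\<^esub>)"
  unfolding A.mult_scalar[OF that(1) sc[OF that(2)]] using A.smult_assoc1[OF that(1,2) A.one_closed] .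
  then show ?thesis using that L.ract_mult[OF val sc sc] by simp
 qed
 have 5: "?sm \<one>\<^bsub>K\<^esub> x = x" if "x : car fam" for x
  using that by (simp add: A.smult_one L.ract_one val)
 have 6: "?sm c x : mdeg fam i" if "c : car K" "x : mdeg fam i" for c x i
 proof -
  have "ract L (x s) (c \<odot>\<^bsub>A\<^esub> \<one>\<^bsub>A\<^esub>) : mdeg L (i + height s)" if "s : A.X" for s
  using L.mdeg_ract[OF _ A.scalar_adeg[OF \<open>c : car K\<close>], of "x s" "i + height s"] \<open>x : mdeg fam i\<close> that by simp
  then show ?thesis using 1[of c x] that by simp
 qed
 have rc: "ract L (x (dec (fst q))) (reading (snd q)) : car L" if "q : B.p.paths" "x : families" for q x
  by (rule L.ract_closed[OF val[OF that(2)] reading_closed[OF path_facts(3)[OF that(1)]]])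
 have 7: "move q x : car fam" if "q : B.p.paths" "x : car fam" for q x
  using rc[OF that(1)] that(2) by (auto simp: move_def intro!: familiesI)
 have 8: "move q (x \<oplus>\<^bsub>fam\<^esub> y) = move q x \<oplus>\<^bsub>fam\<^esub> move q y"
  if "q : B.p.paths" "x : car fam" "y : car fam" for q x y
 proof -
  have "x (dec (fst q)) : car L" "y (dec (fst q)) : car L" using that(2,3) by (simp_all add: val)
  from L.ract_add_left[OF this reading_closed[OF path_facts(3)[OF that(1)]]]
  show ?thesis by (intro ext) (simp add: move_def)
 qed
 have 9: "move q (?sm c x) = ?sm c (move q x)" if "q : B.p.paths" "c : car K" "x : car fam" for q c x
 proof -
  have r: "reading (snd q) : car A" by (rule reading_closed[OF path_facts(3)[OF that(1)]])
  have "ract L (ract L y (c \<odot>\<^bsub>A\<^esub> \<one>\<^bsub>A\<^esub>)) (reading (snd q)) = ract L (ract L y (reading (snd q))) (c \<odot>\<^bsub>A\<^esub> \<one>\<^bsub>A\<^esub>)"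
  if "y : car L" for y
  using L.ract_mult[OF that sc[OF \<open>c : car K\<close>] r] L.ract_mult[OF that r sc[OF \<open>c : car K\<close>]]
  A.scalar_mult[OF \<open>c : car K\<close> r] A.mult_scalar[OF \<open>c : car K\<close> r] by simp
  from this[of "x (dec (fst q))"] show ?thesis
  using that(3) L.ract_zero_left[OF sc[OF that(2)]] by (intro ext) (simp add: move_def val)
 qed
 have 10: "move r (move q x) = (if B.p.pend q = fst r then move (fst q, snd q @ snd r) x else \<zero>\<^bsub>fam\<^esub>)"
  if q: "q : B.p.paths" and r: "r : B.p.paths" and x: "x : car fam" for q r x
 proof
  fix t
  note rr = reading_closed[OF path_facts(3)[OF r]] and rq = reading_closed[OF path_facts(3)[OF q]]
  have xv: "x (dec (fst q)) : car L" using x by (simp add: val)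
  have m: "move q x (dec (fst r)) = (if B.p.pend q = fst r then ract L (x (dec (fst q))) (reading (snd q)) else \<zero>\<^bsub>L\<^esub>)"
  using path_facts(1,2)[OF r] by (simp add: move_def)
  show "move r (move q x) t = (if B.p.pend q = fst r then move (fst q, snd q @ snd r) x else \<zero>\<^bsub>fam\<^esub>) t"
  proof (cases "B.p.pend q = fst r")
  case True
  have e: "B.p.pend (fst q, snd q @ snd r) = B.p.pend r"
  using qpath_end_append[of G "fst q" "snd q" "snd r"] True by simp
  show ?thesis
  unfolding move_def[of r] m
  using True e L.ract_mult[OF xv rq rr] reading_append[OF path_facts(3)[OF q] path_facts(3)[OF r]]
  by (simp add: move_def)
  next
  case False
  then show ?thesis unfolding move_def[of r] m using L.ract_zero_left[OF rr] by simp
  qed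
 qed
 have 11: "(\<Oplus>\<^bsub>fam\<^esub>v\<in>verts G. move (v, []) x) = x" if x: "x : car fam" for x
 proof
  fix s
  have c: "move (v, []) x : families" if "v : verts G" for v
  using 7[of "(v, [])" x] x that by simp
  have "(\<Oplus>\<^bsub>fam\<^esub>v\<in>verts G. move (v, []) x) s = (\<Oplus>\<^bsub>L\<^esub>v\<in>verts G. move (v, []) x s)"
  by (rule fam_finsum) (use c in simp_all)
  also have "... = x s"
  proof (cases "s : A.X")
  case True
  have xs: "move (enc s, []) x s = x s" using True x by (simp add: move_def dec_enc L.ract_one val)
  have "(\<Oplus>\<^bsub>L\<^esub>v\<in>verts G. move (v, []) x s) = move (enc s, []) x s"
  proof (rule L.mod.finsum_single)
  show "move (v, []) x s = \<zero>\<^bsub>L\<^esub>" if "v : verts G" "v ~= enc s" for v using that by (simp add: move_def)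
  show "move (enc s, []) x s : car L" unfolding xs using x by (simp add: val)
  qed (simp_all add: enc_verts[OF True])
  then show ?thesis unfolding xs .
  next
  case False
  then have "(\<Oplus>\<^bsub>L\<^esub>v\<in>verts G. move (v, []) x s) = \<zero>\<^bsub>L\<^esub>"
  by (intro L.mod.add.finprod_one_eqI) (simp add: move_def)
  then show ?thesis using False x by (simp add: families_zero)
  qed
  finally show "(\<Oplus>\<^bsub>fam\<^esub>v\<in>verts G. move (v, []) x) s = x s" .
 qed
 have 13: "move q x : mdeg fam (i + int (weight (%_. 1) (snd q)))" if q: "q : B.p.paths" and x: "x : mdeg fam i" for q x i
 proof -
  obtain k where k: "reading (snd q) : adeg A k"
  "int k = int (length (snd q)) + height (dec (B.p.pend q)) - height (dec (fst q))" using reading_adeg[OF q] by blast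
  have xd: "x (dec (fst q)) : mdeg L (i + height (dec (fst q)))" using x path_facts(1)[OF q] by simp
  have "move q x t : mdeg L (i + int (length (snd q)) + height t)" if t: "t : A.X" for t
  proof (cases "B.p.pend q = enc t")
  case True
  then have "dec (B.p.pend q) = t" using dec_enc[OF t] by simp
  then have i: "i + int (length (snd q)) + height t = i + height (dec (fst q)) + int k" using k(2) by simp
  show ?thesis unfolding i using L.mdeg_ract[OF xd k(1)] t True by (simp add: move_def)
  qed (simp add: move_def L.mg.D_zero)
  then show ?thesis using 7[OF q, of x] x unfolding weight_G by simp
 qed
 have 12: "move q x = \<zero>\<^bsub>fam\<^esub>" if "q : {}" "x : car fam" for q x using that(1) by simp
 note mm = B.mact_module[of fam ?sm move, OF fam_graded 1 2 3 4 5 6 7 8 9 10 11 12 13]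
 show "gr_mod K B coind" unfolding coind_def by (rule mm(1))
 have act: "ract coind = B.mact fam ?sm move" by (simp add: coind_def)
 show "[| q : B.p.paths; v : families |] ==> ract coind v (B.mono q) = move q v"
  unfolding act fam_sel(1)[symmetric] by (rule mm(2))
 show "[| c : car K; v : families |] ==>
  ract coind v (c \<odot>\<^bsub>B\<^esub> \<one>\<^bsub>B\<^esub>) = (%s. ract L (v s) (c \<odot>\<^bsub>A\<^esub> \<one>\<^bsub>A\<^esub>))"
  unfolding act fam_sel(1)[symmetric] by (rule mm(3))
qed

interpretation Co: graded_right_module K B coind by (rule coind_module)

lemma coind_finsum:
 assumes "finite I" "!!i. i : I ==> f i : families"
 shows "finsum coind f I s = (\<Oplus>\<^bsub>L\<^esub>i\<in>I. f i s)"
proof -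
 have "finsum coind f I = finsum fam f I" by (simp add: finsum_def finprod_def coind_def)
 then show ?thesis using fam_finsum[OF assms] by simp
qed

lemma act_P:
 assumes z: "A.okw (a @ u)" "u : A.X0" and v: "v : families"
 shows "ract coind v (P (a @ u)) t =
  (if t = (u, 0) then ract L (v (take l (a @ u), 0)) (word (drop l (a @ u))) else \<zero>\<^bsub>L\<^esub>)"
proof -
 have zl: "l <= length (a @ u)" and dr: "drop (length (a @ u) - l) (a @ u) = u" using z(2) by (simp_all add: A.X0_def)
 define s where "s = take l (a @ u)"
 have s: "(s, 0) : A.X" unfolding s_def by (rule A.X0_clock[OF A.take_X0[OF z(1) zl]])
 have uX: "(u, 0) : A.X" by (rule A.X0_clock[OF z(2)])
 have p: "(enc (s, 0), rp (a @ u)) : B.p.paths" "B.p.pend (enc (s, 0), rp (a @ u)) = enc (u, 0)"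
  using rp_path[OF z(1) zl] unfolding dr s_def by blast+
 have e: "ract coind v (P (a @ u)) = move (enc (s, 0), rp (a @ u)) v"
  unfolding P_def s_def[symmetric] by (rule coind_mono[OF p(1) v])
 show ?thesis
 proof (cases "t = (u, 0)")
  case True
  then show ?thesis unfolding e move_def using p(2) uX dec_enc[OF s] reading_rp[OF z(1) zl] by (simp add: s_def)
 next
  case False
  have "~ (t : A.X & enc (u, 0) = enc t)" using enc_inj[OF uX, of t] False by blast
  then show ?thesis unfolding e move_def p(2) using False by auto
 qed
qed

text \<open>Among the walks that read \<open>q\<close>, exactly the one that arrives in the state of \<open>t\<close> contributes to the
  entry at \<open>t\<close>. Its start is the initial window of the word \<open>snd q @ fst t\<close>.\<close>

lemma act_bb:
 assumes v: "v : families"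
 shows "ract coind v (bb q) t = (if snd t = 0 & fst t : Y q
  then ract L (v (take l (snd q @ fst t), 0)) (word (drop l (snd q @ fst t))) else \<zero>\<^bsub>L\<^esub>)"
proof -
 have ok: "A.okw (snd q @ u) & u : A.X0" if "u : Y q" for u using that unfolding Y_def by blast
 have vc: "v : car coind" using v by simp
 have cl: "ract coind v (P (snd q @ u)) : families" if "u : Y q" for u
  using Co.ract_closed[OF vc Y_Pc[OF that]] by simp
 have "ract coind v (bb q) = (\<Oplus>\<^bsub>coind\<^esub>u\<in>Y q. ract coind v (P (snd q @ u)))"
  unfolding bb_def by (rule ract_finsum[OF coind_module Y_finite Y_Pc vc])
 then have "ract coind v (bb q) t = (\<Oplus>\<^bsub>L\<^esub>u\<in>Y q. ract coind v (P (snd q @ u)) t)"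
  using coind_finsum[OF Y_finite cl] by simp
 also have "... = (if snd t = 0 & fst t : Y q
  then ract L (v (take l (snd q @ fst t), 0)) (word (drop l (snd q @ fst t))) else \<zero>\<^bsub>L\<^esub>)"
 proof (cases "snd t = 0 & fst t : Y q")
  case True
  then have t: "t = (fst t, 0)" by (simp add: prod_eq_iff)
  have tY: "fst t : Y q" using True by blast
  have "(\<Oplus>\<^bsub>L\<^esub>u\<in>Y q. ract coind v (P (snd q @ u)) t) = ract coind v (P (snd q @ fst t)) t"
  proof (rule L.mod.finsum_single[OF Y_finite tY])
  show "ract coind v (P (snd q @ u)) t = \<zero>\<^bsub>L\<^esub>" if "u : Y q" "u ~= fst t" for u
  using act_P[of "snd q" u v t] ok[OF that(1)] v that(2) by auto
  show "ract coind v (P (snd q @ fst t)) t : car L" by (rule families_val[OF cl[OF tY]])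
  qed
  also have "... = ract L (v (take l (snd q @ fst t), 0)) (word (drop l (snd q @ fst t)))"
  using act_P[of "snd q" "fst t" v t] ok[OF tY] v t by (simp only: if_True simp_thms)
  finally show ?thesis using True by (simp only: simp_thms if_True)
 next
  case False
  have "(\<Oplus>\<^bsub>L\<^esub>u\<in>Y q. ract coind v (P (snd q @ u)) t) = \<zero>\<^bsub>L\<^esub>"
  proof (rule L.mod.add.finprod_one_eqI)
  fix u assume u: "u : Y q"
  have "t ~= (u, 0)" using False u by auto
  then show "ract coind v (P (snd q @ u)) t = \<zero>\<^bsub>L\<^esub>" using act_P[of "snd q" u v t] ok[OF u] v by simp
  qed
  then show ?thesis unfolding if_not_P[OF False] .
 qed
 finally show ?thesis .
qed

lemma act_ee:
 assumes v: "v : families"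
 shows "ract coind v ee t = (if snd t = 0 then v t else \<zero>\<^bsub>L\<^esub>)"
proof -
 have vc: "v : car coind" using v by simp
 have cl: "ract coind v (P u) : families" if "u : A.X0" for u
  using Co.ract_closed[OF vc X0_P(1)[OF that]] by simp
 have aP: "ract coind v (P u) s = (if s = (u, 0) then v s else \<zero>\<^bsub>L\<^esub>)" if u: "u : A.X0" for u s
  using act_P[of "[]" u v s] u X0_P(2)[OF u] v families_val[OF v, of "(u, 0)"] by (auto simp: A.X0_def L.ract_one)
 have "ract coind v ee = (\<Oplus>\<^bsub>coind\<^esub>u\<in>A.X0. ract coind v (P u))"
  unfolding ee_def by (rule ract_finsum[OF coind_module A.finite_X0 X0_P(1) vc])
 then have e: "ract coind v ee t = (\<Oplus>\<^bsub>L\<^esub>u\<in>A.X0. ract coind v (P u) t)"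
  using coind_finsum[OF A.finite_X0 cl] by simp
 show ?thesis
 proof (cases "snd t = 0 & fst t : A.X0")
  case True
  then have t: "t = (fst t, 0)" by (simp add: prod_eq_iff)
  have tX: "fst t : A.X0" using True by blast
  have tt: "ract coind v (P (fst t)) t = v t" using aP[OF tX, of t] t by simp
  have "(\<Oplus>\<^bsub>L\<^esub>u\<in>A.X0. ract coind v (P u) t) = ract coind v (P (fst t)) t"
  proof (rule L.mod.finsum_single[OF A.finite_X0 tX])
  show "ract coind v (P u) t = \<zero>\<^bsub>L\<^esub>" if "u : A.X0" "u ~= fst t" for u using aP[OF that(1), of t] that(2) by auto
  show "ract coind v (P (fst t)) t : car L" by (rule families_val[OF cl[OF tX]])
  qed
  then show ?thesis using e tt True by simp
 next
  case False
  have "(\<Oplus>\<^bsub>L\<^esub>u\<in>A.X0. ract coind v (P u) t) = \<zero>\<^bsub>L\<^esub>"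
  proof (rule L.mod.add.finprod_one_eqI)
  fix u assume u: "u : A.X0"
  have "t ~= (u, 0)" using False u by auto
  then show "ract coind v (P u) t = \<zero>\<^bsub>L\<^esub>" using aP[OF u] by simp
  qed
  moreover have "v t = \<zero>\<^bsub>L\<^esub>" if "snd t = 0"
  by (rule families_zero[OF v]) (use False that in \<open>auto simp: A.X_def\<close>)
  ultimately show ?thesis using e by simp
 qed
qed

text \<open>The comparison map from \<open>L\<close> to the corner of \<open>coind\<close>.\<close>

definition unit_fam :: "'u => ('e list \<times> nat) => 'u" where
 "unit_fam m = (%s. if snd s = 0 & fst s : A.X0 then ract L m (A.M (fst s)) else \<zero>\<^bsub>L\<^esub>)"

lemma X0_M: "u : A.X0 ==> A.M u : adeg A (weight w u)" "u : A.X0 ==> A.M u : car A"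
  "u : A.X0 ==> word u = A.M u"
proof -
 assume u: "u : A.X0"
 have p: "(A.start u, u) : A.p.paths" "u ~= []" using u A.okw_path A.X0_ne by (auto simp: A.X0_def)
 show "A.M u : adeg A (weight w u)" using A.mono_adeg[OF p(1)] by (simp add: A.M_def)
 then show "A.M u : car A" by (rule A.adeg_carrier)
 show "word u = A.M u" using word_path[OF p] by (simp add: A.M_def)
qed

lemma unit_fam_closed: "m : car L ==> unit_fam m : families"
proof (rule familiesI)
 assume m: "m : car L"
 show "unit_fam m s : car L" for s using L.ract_closed[OF m X0_M(2)] by (simp add: unit_fam_def)
 show "unit_fam m s = \<zero>\<^bsub>L\<^esub>" if "s \<notin> A.X" for s
  using that A.X0_clock[of "fst s"] by (cases s) (auto simp: unit_fam_def)
qed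

lemma unit_fam_zero: "unit_fam \<zero>\<^bsub>L\<^esub> = (%s. \<zero>\<^bsub>L\<^esub>)"
 using L.ract_zero_left[OF X0_M(2)] by (auto simp: unit_fam_def fun_eq_iff)

lemma unit_fam_add: "m : car L ==> n : car L ==> unit_fam (m \<oplus>\<^bsub>L\<^esub> n) = unit_fam m \<oplus>\<^bsub>coind\<^esub> unit_fam n"
 using L.ract_add_left[OF _ _ X0_M(2)] by (auto simp: unit_fam_def fun_eq_iff)

lemma unit_fam_ee: "m : car L ==> ract coind (unit_fam m) ee = unit_fam m"
 using act_ee[OF unit_fam_closed] by (auto simp: unit_fam_def fun_eq_iff)

lemma unit_fam_deg:
 assumes m: "m : mdeg L i"
 shows "unit_fam m : mdeg coind i"
proof -
 have "unit_fam m s : mdeg L (i + height s)" for s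
  using L.mdeg_ract[OF m X0_M(1), of "fst s"] L.mg.D_zero by (auto simp: unit_fam_def height_def)
 then show ?thesis using unit_fam_closed[OF L.mg.D_carrier[OF m]] by simp
qed

lemma unit_fam_scalar:
 assumes m: "m : car L" and c: "c : car K"
 shows "unit_fam (ract L m (c \<odot>\<^bsub>A\<^esub> \<one>\<^bsub>A\<^esub>)) = ract coind (unit_fam m) (c \<odot>\<^bsub>B\<^esub> \<one>\<^bsub>B\<^esub>)"
proof -
 have sc: "c \<odot>\<^bsub>A\<^esub> \<one>\<^bsub>A\<^esub> : car A" by (rule A.scalar_carrier[OF c])
 have "ract L (ract L m (c \<odot>\<^bsub>A\<^esub> \<one>\<^bsub>A\<^esub>)) a = ract L (ract L m a) (c \<odot>\<^bsub>A\<^esub> \<one>\<^bsub>A\<^esub>)" if "a : car A" for a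
  using L.ract_mult[OF m sc that] L.ract_mult[OF m that sc] A.scalar_mult[OF c that] A.mult_scalar[OF c that] by simp
 then show ?thesis
  unfolding coind_scalar[OF c unit_fam_closed[OF m]]
  using X0_M(2) L.ract_zero_left[OF sc] by (auto simp: unit_fam_def fun_eq_iff)
qed

text \<open>Both sides multiply \<open>m\<close> by the word \<open>snd q @ u\<close>, once cut in front of \<open>u\<close> and once cut behind
  its first \<open>l\<close> letters.\<close>

lemma unit_fam_mono:
 assumes m: "m : car L" and q: "q : A.p.paths"
 shows "unit_fam (ract L m (A.mono q)) = ract coind (unit_fam m) (bb q)"
proof
 fix t :: "'e list \<times> nat"
 obtain v a where va: "q = (v, a)" by (cases q)
 have qp: "(v, a) : A.p.paths" using q va by simp
 have mq: "A.mono (v, a) : car A" by (rule A.mono_closed[OF qp])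
 note r = act_bb[OF unit_fam_closed[OF m], of q t]
 show "unit_fam (ract L m (A.mono q)) t = ract coind (unit_fam m) (bb q) t"
 proof (cases "snd t = 0 & fst t : A.X0")
  case False
  then have "~ (snd t = 0 & fst t : Y q)" by (auto simp: Y_def)
  then show ?thesis unfolding r using False by (simp only: unit_fam_def if_False)
 next
  case True
  define u where "u = fst t"
  have u: "u : A.X0" using True u_def by simp
  have up: "(A.start u, u) : A.p.paths" "u ~= []" using u A.okw_path A.X0_ne by (auto simp: A.X0_def)
  have mm: "A.mono (v, a) \<otimes>\<^bsub>A\<^esub> A.M u = (if A.p.pend (v, a) = A.start u then A.mono (v, a @ u) else \<zero>\<^bsub>A\<^esub>)"
  unfolding A.M_def using A.mono_mult[OF qp up(1)] by simp
  have lhs: "unit_fam (ract L m (A.mono q)) t = ract L m (A.mono (v, a) \<otimes>\<^bsub>A\<^esub> A.M u)"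
  using True L.ract_mult[OF m mq X0_M(2)[OF u]] by (simp add: unit_fam_def u_def va)
  show ?thesis
  proof (cases "u : Y q")
  case uY: True
  define z where "z = a @ u"
  have z: "A.okw z" "A.start z = v" "l <= length z" "take l z : A.X0"
  using uY Y_word[OF uY] unfolding z_def va Y_def by auto
  have zp: "(v, z) : A.p.paths" "z ~= []" using A.okw_path[OF z(1)] z(2) up(2) by (auto simp: z_def)
  have "A.p.pend (v, a) = A.start u"
  using A.pend_start[of a u] A.okw_path[OF z(1)] z(2) up(2) by (simp add: z_def)
  then have l1: "unit_fam (ract L m (A.mono q)) t = ract L m (A.mono (v, z))" unfolding lhs mm z_def by simp
  have arcs: "set z \<subseteq> arcs Q" by (rule A.okw_arcs[OF z(1)])
  have arcs': "set (take l z) \<subseteq> arcs Q" "set (drop l z) \<subseteq> arcs Q"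
  using arcs set_take_subset[of l z] set_drop_subset[of l z] by blast+
  have "ract coind (unit_fam m) (bb q) t = ract L (unit_fam m (take l z, 0)) (word (drop l z))"
  unfolding r using uY True by (simp only: va snd_conv u_def[symmetric] z_def[symmetric] simp_thms if_True)
  also have "unit_fam m (take l z, 0) = ract L m (word (take l z))"
  using z(4) X0_M(3)[OF z(4)] by (simp add: unit_fam_def)
  also have "ract L ... (word (drop l z)) = ract L m (word (take l z) \<otimes>\<^bsub>A\<^esub> word (drop l z))"
  by (rule L.ract_mult[OF m word_closed[OF arcs'(1)] word_closed[OF arcs'(2)], symmetric])
  also have "word (take l z) \<otimes>\<^bsub>A\<^esub> word (drop l z) = word z"
  using word_append[OF arcs'] by (simp only: append_take_drop_id)
  also have "word z = A.mono (v, z)" by (rule word_path[OF zp])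
  finally show ?thesis unfolding l1 by simp
  next
  case uY: False
  have "A.mono (v, a) \<otimes>\<^bsub>A\<^esub> A.M u = \<zero>\<^bsub>A\<^esub>"
  proof (cases "A.p.pend (v, a) = A.start u")
  case True
  have p: "(v, a @ u) : A.p.paths" using qp up(1) True A.p.qpaths_append by auto
  have ne: "a @ u ~= []" using up(2) by simp
  have "~ A.okw (a @ u)" using uY u A.start_path[OF p ne] by (auto simp: Y_def va)
  then show ?thesis unfolding mm using A.mono_not_okw[OF p ne] by simp
  qed (simp add: mm)
  then have "unit_fam (ract L m (A.mono q)) t = \<zero>\<^bsub>L\<^esub>" unfolding lhs using L.ract_zero_right[OF m] by simp
  then show ?thesis unfolding r using uY by (simp add: u_def)
  qed
 qed
qed

text \<open>The kernel is killed by all allowed words with at least \<open>l\<close> letters, since these start with a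
  state. For the cokernel let \<open>q\<close> have at least \<open>2 l\<close> letters. The entry of \<open>v (bb q)\<close> at \<open>u\<close> is
  \<open>m u\<close>, where \<open>m\<close> is the entry of \<open>v\<close> at the first \<open>l\<close> letters of \<open>q\<close>, multiplied by the
  remaining ones; so \<open>v (bb q)\<close> is the image of \<open>m\<close>.\<close>

lemma ess_surj:
 assumes inf: "infinite (UNIV :: 'u set)"
 shows "EX N :: ('b, 'u) graded_module. graded_right_module K B N & isomorphic (QGr K A) (Rm N) L"
proof -
 obtain f :: "(('e list \<times> nat) => 'u) => 'u" where "inj_on f {v. ALL x. x \<notin> A.X --> v x = \<zero>\<^bsub>L\<^esub>}"
  using inj_on_finite_support[OF inf A.finite_X] by blast
 then have f: "inj_on f (car coind)" by (rule inj_on_subset) (auto simp: families_def)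
 define N where "N = relabel f coind"
 note s = Co.relabel_sel[OF f, folded N_def]
 have gN: "gr_mod K B N" unfolding N_def by (rule Co.relabel_module[OF f])
 interpret R: graded_right_module K A "Rm N" by (rule Rm_module[OF gN])
 have uc: "unit_fam m : car coind" if "m : car L" for m using unit_fam_closed[OF that] by simp
 have zc: "(%s. \<zero>\<^bsub>L\<^esub>) : car coind" using Co.mod.zero_closed by simp
 have cl: "f (unit_fam m) : car (Rm N)" if m: "m : car L" for m
  using s(1) s(5)[OF uc[OF m], of ee] uc[OF m] unit_fam_ee[OF m] by simp
 have act: "f (unit_fam (ract L m a)) = ract (Rm N) (f (unit_fam m)) a" if m: "m : car L" and a: "a : car A" for m a
  using a
 proof (induction a rule: A.mono_induct)
  case zero
  show ?case unfolding R.ract_zero_right[OF cl[OF m]] L.ract_zero_right[OF m] unit_fam_zero by (simp add: s(2))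
 next
  case (mono c q)
  have mq: "A.mono q : car A" by (rule A.mono_closed[OF mono(2)])
  have mm: "ract L m (A.mono q) : car L" by (rule L.ract_closed[OF m mq])
  have "ract L m (c \<odot>\<^bsub>A\<^esub> A.mono q) = ract L (ract L m (A.mono q)) (c \<odot>\<^bsub>A\<^esub> \<one>\<^bsub>A\<^esub>)"
  using L.ract_mult[OF m mq A.scalar_carrier[OF mono(1)]] A.mult_scalar[OF mono(1) mq] by simp
  then show ?case
  unfolding Rm_smono[OF gN cl[OF m] mono(2,1)] s(5)[OF uc[OF m]] unit_fam_mono[OF m mono(2), symmetric]
  s(5)[OF uc[OF mm]] unit_fam_scalar[OF mm mono(1), symmetric] by simp
 next
  case (add a b)
  have c: "ract L m a : car L" "ract L m b : car L" using L.ract_closed[OF m] add(1,2) by auto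
  show ?case
  unfolding L.ract_add_right[OF m add(1,2)] R.ract_add_right[OF cl[OF m] add(1,2)] add(3,4)[symmetric]
  unit_fam_add[OF c] using s(4)[OF uc[OF c(1)] uc[OF c(2)]] by simp
 qed
 have "isomorphic (QGr K A) L (Rm N)"
 proof (rule A.isomorphic_QGr_hom[OF gL Rm_module[OF gN], of "%m. f (unit_fam m)"])
  show "f (unit_fam m) : car (Rm N)" if "m : car L" for m by (rule cl[OF that])
  show "f (unit_fam (m \<oplus>\<^bsub>L\<^esub> n)) = f (unit_fam m) \<oplus>\<^bsub>Rm N\<^esub> f (unit_fam n)" if "m : car L" "n : car L" for m n
  unfolding unit_fam_add[OF that] Rm_sel(3) by (rule s(4)[OF uc[OF that(1)] uc[OF that(2)], symmetric])
  show "f (unit_fam (ract L m a)) = ract (Rm N) (f (unit_fam m)) a" if "m : car L" "a : car A" for m a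
  by (rule act[OF that])
  show "f (unit_fam m) : mdeg (Rm N) i" if m: "m : mdeg L i" for m i
  proof -
  have "f (unit_fam m) : mdeg N i" unfolding s(3) using unit_fam_deg[OF m] by blast
  then show ?thesis using cl[OF L.mg.D_carrier[OF m]] by simp
  qed
 next
  fix m assume m: "m : car L" and fz: "f (unit_fam m) = \<zero>\<^bsub>Rm N\<^esub>"
  have "f (unit_fam m) = f (%s. \<zero>\<^bsub>L\<^esub>)" using fz s(2) by simp
  then have uz: "unit_fam m = (%s. \<zero>\<^bsub>L\<^esub>)" by (rule inj_onD[OF f _ uc[OF m] zc])
  have mz: "ract L m (A.M u) = \<zero>\<^bsub>L\<^esub>" if "u : A.X0" for u
  using fun_cong[OF uz, of "(u, 0)"] that by (simp add: unit_fam_def)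
  show "m : tors A L"
  proof (rule L.satI[OF m, of "l * A.maxw"])
  fix n a assume n: "l * A.maxw <= n" and a: "a : adeg A n"
  show "ract L m a : {\<zero>\<^bsub>L\<^esub>}"
  proof (rule L.ract_spanned[OF L.gsub_zero m A.adeg_spanned _ _ a])
  show "A.mono ` A.paths_of_weight n \<subseteq> car A" using A.mono_closed by (auto simp: A.paths_of_weight_def)
  fix x assume "x : A.mono ` A.paths_of_weight n"
  then obtain q where q: "x = A.mono q" "q : A.p.paths" "weight w (snd q) = n"
  unfolding A.paths_of_weight_def by blast
  obtain v z where vz: "q = (v, z)" by (cases q)
  have zp: "(v, z) : A.p.paths" using q(2) vz by simp
  have len: "l <= length z" by (rule long_word[OF zp]) (use n q(3) vz in simp)
  then have ne: "z ~= []" using A.l_pos by auto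
  have "ract L m (A.mono (v, z)) = \<zero>\<^bsub>L\<^esub>"
  proof (cases "A.okw z")
  case False
  then show ?thesis using A.mono_not_okw[OF zp ne] L.ract_zero_right[OF m] by simp
  next
  case True
  have t: "take l z : A.X0" by (rule A.take_X0[OF True len])
  have arcs: "set z \<subseteq> arcs Q" by (rule A.okw_arcs[OF True])
  have arcs': "set (take l z) \<subseteq> arcs Q" "set (drop l z) \<subseteq> arcs Q"
  using arcs set_take_subset[of l z] set_drop_subset[of l z] by blast+
  have "A.mono (v, z) = A.M (take l z) \<otimes>\<^bsub>A\<^esub> word (drop l z)"
  using word_path[OF zp ne] word_append[OF arcs'] X0_M(3)[OF t] by (simp only: append_take_drop_id)
  then show ?thesis
  using L.ract_mult[OF m X0_M(2)[OF t] word_closed[OF arcs'(2)]] mz[OF t]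
  L.ract_zero_left[OF word_closed[OF arcs'(2)]] by simp
  qed
  then show "ract L m x : {\<zero>\<^bsub>L\<^esub>}" using q(1) vz by simp
  qed
  qed
 next
  fix x assume im: "gsub A (Rm N) ((%m. f (unit_fam m)) ` car L)" and x: "x : car (Rm N)"
  obtain v where v: "v : families" "x = f v" using x s(1) by auto
  have vc: "v : car coind" using v by simp
  show "x : sat A (Rm N) ((%m. f (unit_fam m)) ` car L)"
  proof (rule Rm_satI[OF gN im x, of "(2 * l) * A.maxw"])
  fix q assume q: "q : A.p.paths" "(2 * l) * A.maxw <= weight w (snd q)"
  obtain p a where pa: "q = (p, a)" by (cases q)
  have ap: "(p, a) : A.p.paths" using q(1) pa by simp
  have len: "2 * l <= length a" by (rule long_word[OF ap]) (use q(2) pa in simp)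
  have ane: "a ~= []" using len A.l_pos by auto
  have st: "A.start a = p" using A.start_path[OF ap ane] by simp
  have "EX m:car L. ract coind v (bb q) = unit_fam m"
  proof (cases "A.okw a")
  case False
  have "Y q = {}" using A.okw_prefix[of a] ane False by (auto simp: Y_def pa)
  then have "ract coind v (bb q) = unit_fam \<zero>\<^bsub>L\<^esub>" unfolding unit_fam_zero using act_bb[OF v(1), of q] by (simp add: fun_eq_iff)
  then show ?thesis using L.mod.zero_closed by blast
  next
  case True
  define d where "d = drop l a"
  have tk: "take l a @ d = a" unfolding d_def by (rule append_take_drop_id)
  have dl: "l <= length d" "d ~= []" using len A.l_pos by (auto simp: d_def)
  have okd: "A.okw d" by (rule A.okw_suffix[of "take l a"]) (use True tk dl in simp_all)
  have darcs: "set d \<subseteq> arcs Q" by (rule A.okw_arcs[OF okd])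
  have vt: "v (take l a, 0) : car L" by (rule families_val[OF v(1)])
  let ?m = "ract L (v (take l a, 0)) (word d)"
  have mc: "?m : car L" by (rule L.ract_closed[OF vt word_closed[OF darcs]])
  have "ract coind v (bb q) t = unit_fam ?m t" for t
  proof (cases "snd t = 0 & fst t : A.X0")
  case False
  then have "~ (snd t = 0 & fst t : Y q)" by (auto simp: Y_def)
  then show ?thesis unfolding act_bb[OF v(1)] using False by (simp only: unit_fam_def if_False)
  next
  case t: True
  define u where "u = fst t"
  have u: "u : A.X0" using t u_def by simp
  have rhs: "unit_fam ?m t = ract L (v (take l a, 0)) (word d \<otimes>\<^bsub>A\<^esub> A.M u)"
  using t L.ract_mult[OF vt word_closed[OF darcs] X0_M(2)[OF u]] by (simp add: unit_fam_def u_def)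
  have td: "take l (a @ u) = take l a" "drop l (a @ u) = d @ u" using len by (simp_all add: d_def)
  show ?thesis
  proof (cases "u : Y q")
  case uY: True
  have uarcs: "set u \<subseteq> arcs Q" using u A.okw_arcs by (simp add: A.X0_def)
  have "ract coind v (bb q) t = ract L (v (take l a, 0)) (word (d @ u))"
  unfolding act_bb[OF v(1)] using t uY by (simp only: u_def[symmetric] pa snd_conv td simp_thms if_True)
  then show ?thesis unfolding rhs word_append[OF darcs uarcs] X0_M(3)[OF u] .
  next
  case uY: False
  have "~ A.okw (a @ u)" using uY u st A.start_append[OF ane, of u] by (auto simp: Y_def pa)
  then have nok: "~ A.okw (d @ u)" using A.okw_glue[of "take l a" d u] True dl tk by (metis append_assoc)
  have "word d \<otimes>\<^bsub>A\<^esub> A.M u = \<zero>\<^bsub>A\<^esub>"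
  by (rule word_M_zero[OF A.okw_path[OF okd] dl(2) u nok])
  then show ?thesis unfolding rhs act_bb[OF v(1)] using uY L.ract_zero_right[OF vt] by (simp add: u_def)
  qed
  qed
  then show ?thesis using mc by blast
  qed
  then show "ract N x (bb q) : (%m. f (unit_fam m)) ` car L"
  unfolding v(2) s(5)[OF vc] by auto
  qed
 qed
 then have "isomorphic (QGr K A) (Rm N) L" by (rule isomorphic_sym)
 then show ?thesis using gN by blast
qed

end

end

context unfolded_quiver begin

lemma corner_functor:
 assumes inf: "infinite (UNIV :: 'u set)"
 shows "EX F. ff_es (QGr K B :: ('b, 'u) qcat)
  (QGr K A :: ('a, 'u) qcat) F & fobj F = Rm"
proof (rule ff_es_QGrI[where R = Rm and T = cut])
 show "tame_algebra K A" by (rule A.tame_algebra_axioms)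
 show "tame_algebra K B" by (rule B.tame_algebra_axioms)
 fix M N P' :: "('b, 'u) graded_module" and E H :: "('u \<times> 'u) set"
 show "cut M N E \<subseteq> cut M N H" if "E \<subseteq> H" using that by (auto simp: cut_def)
 assume M: "gr_mod K B M"
 show "gr_mod K A (Rm M)" by (rule Rm_module[OF M])
 show "cut M M (Id_on (car M)) = Id_on (car (Rm M))" by (rule cut_Id)
 assume N: "gr_mod K B N"
 show "EX E. almost B M N E & rsat A (Rm M) (Rm N) (cut M N E) = rsat A (Rm M) (Rm N) \<Theta>"
  if "almost A (Rm M) (Rm N) \<Theta>" for \<Theta> by (rule cut_full[OF M N that])
 assume E: "almost B M N E"
 show "almost A (Rm M) (Rm N) (cut M N E)" by (rule almost_cut[OF M N E])
 show "rsat B M N E = rsat B M N H"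
  if "almost B M N H" "rsat A (Rm M) (Rm N) (cut M N E) = rsat A (Rm M) (Rm N) (cut M N H)"
  by (rule cut_faithful[OF M N E that])
 assume P': "gr_mod K B P'" and H: "almost B N P' H"
 show "cut M P' (E O H) = cut M N E O cut N P' H"
  by (rule cut_comp[OF N _ _ M P']) (use E H in \<open>simp_all add: almost_def\<close>)
next
 fix L :: "('a, 'u) graded_module" assume "gr_mod K A L"
 then show "EX M. graded_right_module K B M & isomorphic (QGr K A) (Rm M) L" by (rule ess_surj[OF _ inf])
qed

text \<open>The identity map of the corner is an isomorphism of graded modules.\<close>

lemma Rm_shift:
 fixes M :: "('b, 'u) graded_module"
 assumes M: "gr_mod K B M"
 shows "isomorphic (QGr K A) (Rm (shift M)) (shift (Rm M))"
proof -
 note sM = graded_right_module.shift_module[OF M]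
 interpret R: graded_right_module K A "Rm M" by (rule Rm_module[OF M])
 interpret S: graded_right_module K A "Rm (shift M)" by (rule Rm_module[OF sM])
 interpret T: graded_right_module K A "shift (Rm M)" by (rule R.shift_module)
 have c: "car (Rm (shift M)) = car (Rm M)" by simp
 have r: "ract (Rm (shift M)) m a = ract (Rm M) m a" if m: "m : car (Rm M)" and a: "a : car A" for m a
  using a
 proof (induction a rule: A.mono_induct)
  case zero
  have m': "m : car (Rm (shift M))" using m c by simp
  show ?case unfolding R.ract_zero_right[OF m] S.ract_zero_right[OF m'] by simp
 next
  case (mono d q)
  have m': "m : car (Rm (shift M))" using m c by simp
  show ?case unfolding Rm_smono[OF M m mono(2,1)] Rm_smono[OF sM m' mono(2,1)] by simp
 next
  case (add a b)
  have m': "m : car (Rm (shift M))" using m c by simp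
  show ?case unfolding R.ract_add_right[OF m add(1,2)] S.ract_add_right[OF m' add(1,2)] add(3,4) by simp
 qed
 show ?thesis
 proof (rule A.isomorphic_QGr_hom[OF S.graded_right_module_axioms T.graded_right_module_axioms, of "%m. m"])
  fix m a assume "m : car (Rm (shift M))" "a : car A"
  then show "ract (Rm (shift M)) m a = ract (shift (Rm M)) m a" using r[of m a] by simp
 next
  fix m assume "m : car (Rm (shift M))" "m = \<zero>\<^bsub>shift (Rm M)\<^esub>"
  then have "m : {\<zero>\<^bsub>Rm (shift M)\<^esub>}" by simp
  then show "m : tors A (Rm (shift M))" using S.subset_sat[OF S.gsub_zero] by blast
 next
  fix n assume n: "gsub A (shift (Rm M)) ((%m. m) ` car (Rm (shift M)))" "n : car (shift (Rm M))"
  have "n : (%m. m) ` car (Rm (shift M))" using n(2) by simp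
  then show "n : sat A (shift (Rm M)) ((%m. m) ` car (Rm (shift M)))" using T.subset_sat[OF n(1)] by blast
 qed auto
qed

end

section \<open>Equivalences that commute with the shift\<close>

text \<open>The type \<open>'u\<close> of the elements of the modules occurs only inside the definition; the argument
  \<open>U\<close> makes it explicit.\<close>

definition QGr_equivalent :: "'u itself => 'k ring => ('k, 'a) graded_algebra => ('k, 'b) graded_algebra => bool" where
 "QGr_equivalent U K A B \<longleftrightarrow> (EX F. ff_es (QGr K A :: ('a, 'u) qcat)
  (QGr K B :: ('b, 'u) qcat) F &
  (ALL M. graded_right_module K A M --> isomorphic (QGr K B) (fobj F (shift M)) (shift (fobj F M))))"

lemma ff_es_functor: "ff_es C D F ==> is_functor C D F" by (simp add: ff_es_def)

text \<open>If \<open>F\<close> commutes with the shift, then \<open>F\<close> maps \<open>H (shift N)\<close> and \<open>shift (H N)\<close> to isomorphic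
  objects, and \<open>F\<close> reflects isomorphism.\<close>

lemma QGr_equivalent_sym:
 fixes A :: "('k, 'a) graded_algebra" and B :: "('k, 'b) graded_algebra" and U :: "'u itself"
 assumes A: "tame_algebra K A" and B: "tame_algebra K B" and AB: "QGr_equivalent U K A B"
 shows "QGr_equivalent U K B A"
proof -
 interpret A: tame_algebra K A by (rule A)
 interpret B: tame_algebra K B by (rule B)
 let ?A = "QGr K A :: ('a, 'u) qcat"
 let ?B = "QGr K B :: ('b, 'u) qcat"
 interpret cB: category ?B by (rule B.category_QGr)
 obtain F where F: "ff_es ?A ?B F"
  "!!M. graded_right_module K A M ==> isomorphic ?B (fobj F (shift M)) (shift (fobj F M))"
  using AB unfolding QGr_equivalent_def by blast
 obtain H where H: "ff_es ?B ?A H" "ALL N:Obj ?B. isomorphic ?B (fobj F (fobj H N)) N"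
  using ff_es_inverse[OF F(1)] by blast
 note Fo = is_functorD(3)[OF ff_es_functor[OF F(1)], unfolded Obj_QGr]
 note Ho = is_functorD(3)[OF ff_es_functor[OF H(1)], unfolded Obj_QGr]
 have "isomorphic ?A (fobj H (shift N)) (shift (fobj H N))" if N: "gr_mod K B N" for N
 proof -
  note sN = graded_right_module.shift_module[OF N] and HN = Ho[OF N]
  note sHN = graded_right_module.shift_module[OF HN] and FHN = Fo[OF HN]
  note sFHN = graded_right_module.shift_module[OF FHN] and FsHN = Fo[OF sHN] and HsN = Ho[OF sN]
  have 1: "isomorphic ?B (fobj F (fobj H (shift N))) (shift N)" by (rule bspec[OF H(2)]) (simp add: Obj_QGr sN)
  have "isomorphic ?B (fobj F (fobj H N)) N" by (rule bspec[OF H(2)]) (simp add: Obj_QGr N)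
  then have 2: "isomorphic ?B (shift (fobj F (fobj H N))) (shift N)" by (rule B.isomorphic_shift[OF FHN N])
  note 3 = F(2)[OF HN]
  have "isomorphic ?B (fobj F (shift (fobj H N))) (shift N)"
  by (rule cB.isomorphic_trans[OF 3 2]) (use FsHN sFHN sN in \<open>simp_all add: Obj_QGr\<close>)
  then have "isomorphic ?B (fobj F (fobj H (shift N))) (fobj F (shift (fobj H N)))"
  by (intro cB.isomorphic_trans[OF 1 isomorphic_sym]) (use FsHN sN Fo[OF HsN] in \<open>simp_all add: Obj_QGr\<close>)
  then show ?thesis by (rule ff_es_reflects[OF F(1)]) (use HsN sHN in \<open>simp_all add: Obj_QGr\<close>)
 qed
 then show ?thesis unfolding QGr_equivalent_def using H(1) by blast
qed

lemma QGr_equivalent_trans: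
 fixes A :: "('k, 'a) graded_algebra" and B :: "('k, 'b) graded_algebra" and C :: "('k, 'c) graded_algebra"
  and U :: "'u itself"
 assumes C: "tame_algebra K C" and AB: "QGr_equivalent U K A B" and BC: "QGr_equivalent U K B C"
 shows "QGr_equivalent U K A C"
proof -
 interpret C: tame_algebra K C by (rule C)
 let ?A = "QGr K A :: ('a, 'u) qcat"
 let ?B = "QGr K B :: ('b, 'u) qcat"
 let ?C = "QGr K C :: ('c, 'u) qcat"
 interpret cC: category ?C by (rule C.category_QGr)
 obtain F where F: "ff_es ?A ?B F"
  "!!M. graded_right_module K A M ==> isomorphic ?B (fobj F (shift M)) (shift (fobj F M))"
  using AB unfolding QGr_equivalent_def by blast
 obtain H where H: "ff_es ?B ?C H"
  "!!M. graded_right_module K B M ==> isomorphic ?C (fobj H (shift M)) (shift (fobj H M))"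
  using BC unfolding QGr_equivalent_def by blast
 note Fo = is_functorD(3)[OF ff_es_functor[OF F(1)], unfolded Obj_QGr]
 note Ho = is_functorD(3)[OF ff_es_functor[OF H(1)], unfolded Obj_QGr]
 have "isomorphic ?C (fobj (comp_funct H F) (shift M)) (shift (fobj (comp_funct H F) M))"
  if M: "gr_mod K A M" for M
 proof -
  note FsM = Fo[OF graded_right_module.shift_module[OF M]] and FM = Fo[OF M]
  note sFM = graded_right_module.shift_module[OF FM]
  note sHFM = graded_right_module.shift_module[OF Ho[OF FM]]
  have "isomorphic ?C (fobj H (fobj F (shift M))) (fobj H (shift (fobj F M)))"
  by (rule functor_isomorphic[OF ff_es_functor[OF H(1)] F(2)[OF M]]) (use FsM sFM in \<open>simp_all add: Obj_QGr\<close>)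
  from cC.isomorphic_trans[OF this H(2)[OF FM]] show ?thesis
  using Ho[OF FsM] Ho[OF sFM] sHFM by (simp add: comp_funct_def Obj_QGr)
 qed
 then show ?thesis unfolding QGr_equivalent_def using ff_es_comp[OF F(1) H(1)] by blast
qed

lemma (in unfolded_quiver) QGr_equivalent_unfolding:
 assumes "infinite (UNIV :: 'u set)"
 shows "QGr_equivalent TYPE('u) K B A"
proof -
 obtain F where F: "ff_es (QGr K B :: ('b, 'u) qcat)
  (QGr K A :: ('a, 'u) qcat) F" "fobj F = Rm"
  using corner_functor[OF assms] by blast
 show ?thesis unfolding QGr_equivalent_def
  by (intro exI[of _ F] conjI allI impI F(1)) (unfold F(2), rule Rm_shift)
qed

section \<open>The state quiver and its one-vertex algebra\<close>

definition pair_quiver :: "nat set => (nat \<times> nat) set => (nat, nat) pre_digraph" where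
 "pair_quiver V E = \<lparr> verts = V, arcs = prod_encode ` E, tail = (%e. fst (prod_decode e)), head = (%e. snd (prod_decode e)) \<rparr>"

lemma pair_quiver_sel [simp]:
 "verts (pair_quiver V E) = V" "arcs (pair_quiver V E) = prod_encode ` E"
 "tail (pair_quiver V E) = (%e. fst (prod_decode e))" "head (pair_quiver V E) = (%e. snd (prod_decode e))"
 by (simp_all add: pair_quiver_def)

lemma pair_quiver_finite:
 assumes "finite V" "E \<subseteq> V \<times> V"
 shows "fin_digraph (pair_quiver V E)"
proof
 have "finite E" by (rule finite_subset[OF assms(2)]) (simp add: assms(1))
 then show "finite (arcs (pair_quiver V E))" by simp
qed (use assms in auto)

definition state_edges :: "('s => 's => bool) => 's set => ('s => nat) => (nat \<times> nat) set" where
 "state_edges R X enc = {(enc s, enc t) | s t. s : X & t : X & R s t}"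

lemma (in word_graph) unfolded_quiverI:
 assumes B: "monomial_algebra K B (pair_quiver V E) (%_. 1) {} evB"
  and enc: "bij_betw enc X V" and E: "E = state_edges edge X enc"
 shows "unfolded_quiver K A Q w S ev l B (pair_quiver V E) evB enc"
proof (intro unfolded_quiver.intro unfolded_quiver_axioms.intro word_graph_axioms B)
 show "bij_betw enc X (verts (pair_quiver V E))" using enc by simp
 show "arcs (pair_quiver V E) = {prod_encode (enc s, enc t) |s t. s : X & t : X & edge s t}"
  unfolding E state_edges_def pair_quiver_sel by blast
qed simp_all

text \<open>The quiver of the free algebra on \<open>V\<close>.\<close>

definition loop_quiver :: "nat set => (nat, nat) pre_digraph" where
 "loop_quiver V = \<lparr> verts = {0}, arcs = V, tail = (%_. 0), head = (%_. 0) \<rparr>"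

lemma loop_quiver_sel [simp]:
 "verts (loop_quiver V) = {0}" "arcs (loop_quiver V) = V" "tail (loop_quiver V) = (%_. 0)" "head (loop_quiver V) = (%_. 0)"
 by (simp_all add: loop_quiver_def)

lemma loop_quiver_finite: "finite V ==> fin_digraph (loop_quiver V)" by unfold_locales auto

text \<open>The products of two generators that are to vanish.\<close>

definition nonedges :: "nat set => (nat \<times> nat) set => (nat, nat) qpath set" where
 "nonedges V E = (%(x, y). (0, [x, y])) ` (V \<times> V - E)"

lemma path_algI:
 assumes "field K" "fin_digraph Q"
 shows "path_alg K Q (%_. 1)"
 using assms by (simp add: path_alg_def path_alg_axioms_def weighted_quiver_def)

lemma loop_paths:
 assumes "finite V"
 shows "(v, p) : qpaths (loop_quiver V) \<longleftrightarrow> v = 0 & set p \<subseteq> V" "qpath_end (loop_quiver V) (0, p) = 0"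
proof -
 interpret fin_digraph "loop_quiver V" by (rule loop_quiver_finite[OF assms])
 show "(v, p) : qpaths (loop_quiver V) \<longleftrightarrow> v = 0 & set p \<subseteq> V" by (induction p arbitrary: v) auto
 show "qpath_end (loop_quiver V) (0, p) = 0" by (induction p) auto
qed

lemma nonedges_paths: "finite V ==> nonedges V E \<subseteq> qpaths (loop_quiver V)"
 unfolding nonedges_def using loop_paths(1) by auto

text \<open>For words of length 1 a state is a single letter without a proper clock, and \<open>x y\<close> is allowed iff
  \<open>(x, y) \<in> E\<close>.\<close>

lemma loop_unfolding:
 assumes V: "finite V" and E: "E \<subseteq> V \<times> V"
  and A: "monomial_algebra K A (loop_quiver V) (%_. 1) (nonedges V E) ev"
  and B: "monomial_algebra K B (pair_quiver V E) (%_. 1) {} evB"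
 shows "unfolded_quiver K A (loop_quiver V) (%_. 1) (nonedges V E) ev 1 B (pair_quiver V E) evB (%s. hd (fst s))"
proof -
 interpret A: monomial_algebra K A "loop_quiver V" "%_. 1" "nonedges V E" ev by (rule A)
 interpret A: word_graph K A "loop_quiver V" "%_. 1" "nonedges V E" ev 1
  by unfold_locales (auto simp: nonedges_def)
 have start: "A.start z = 0" for z by (simp add: A.start_def)
 have len: "length p = 2" if "(v, p) : nonedges V E" for v p using that by (auto simp: nonedges_def)
 have ok1: "A.okw [x] \<longleftrightarrow> x : V" for x
 proof -
  have "(0, take n (drop i [x])) \<notin> nonedges V E" for i n using len[of 0 "take n (drop i [x])"] by auto
  then show ?thesis unfolding A.okw_def start loop_paths(2)[OF V] using loop_paths(1)[OF V, of 0 "[x]"] by simp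
 qed
 have ok2: "A.okw [x, y] \<longleftrightarrow> (x, y) : E" if x: "x : V" "y : V" for x y
 proof
  assume "A.okw [x, y]"
  then have "ALL i n. i + n <= length [x, y] --> (0, take n (drop i [x, y])) \<notin> nonedges V E"
  unfolding A.okw_def start loop_paths(2)[OF V] by blast
  from this[rule_format, of 0 2] have "(0, [x, y]) \<notin> nonedges V E" by simp
  then show "(x, y) : E" using x by (auto simp: nonedges_def)
 next
  assume e: "(x, y) : E"
  have "(0, take n (drop i [x, y])) \<notin> nonedges V E" if i: "i + n <= length [x, y]" for i n
  proof
  assume n: "(0, take n (drop i [x, y])) : nonedges V E"
  have "length (take n (drop i [x, y])) = 2" by (rule len[OF n])
  then have "i = 0" "n = 2" using i by auto
  then show False using n e by (auto simp: nonedges_def)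
  qed
  moreover have "(0, [x, y]) : qpaths (loop_quiver V)" using loop_paths(1)[OF V] x by simp
  ultimately show "A.okw [x, y]" unfolding A.okw_def start loop_paths(2)[OF V] by blast
 qed
 have X0: "A.X0 = (%x. [x]) ` V"
  unfolding A.X0_def by (auto simp: length_Suc_conv ok1 image_iff)
 have X: "A.X = (%x. ([x], 0)) ` V" unfolding A.X_def X0 by auto
 have edge: "A.edge ([x], 0) ([y], 0) \<longleftrightarrow> (x, y) : E" if "x : V" "y : V" for x y
  unfolding A.edge_def using ok2[OF that] by auto
 show ?thesis
 proof (rule A.unfolded_quiverI[OF B])
  show "bij_betw (%s. hd (fst s)) A.X V" unfolding X by (auto simp: bij_betw_def inj_on_def image_image)
  show "E = state_edges A.edge A.X (%s. hd (fst s))"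
  proof (rule equalityI; rule subsetI)
  fix e assume e: "e : E"
  then obtain x y where xy: "e = (x, y)" "x : V" "y : V" using E by auto
  have X': "([x], 0) : A.X" "([y], 0) : A.X" using xy unfolding X by blast+
  have "A.edge ([x], 0) ([y], 0)" using edge[OF xy(2,3)] e xy(1) by blast
  then show "e : state_edges A.edge A.X (%s. hd (fst s))"
  unfolding state_edges_def mem_Collect_eq
  by (intro exI[of _ "([x], 0)"] exI[of _ "([y], 0)"] conjI X') (simp_all add: xy(1))
  next
  fix e assume "e : state_edges A.edge A.X (%s. hd (fst s))"
  then obtain s t where st: "e = (hd (fst s), hd (fst t))" "s : A.X" "t : A.X" "A.edge s t"
  unfolding state_edges_def by blast
  obtain x y where xy: "s = ([x], 0)" "x : V" "t = ([y], 0)" "y : V" using st(2,3) unfolding X by blast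
  show "e : E" using edge[OF xy(2,4)] st(4) unfolding st(1) xy(1,3) by simp
  qed
 qed
qed

text \<open>The identity is the only trivial path, and every other path is a product of arrows, which have
  degree 1.\<close>

lemma loop_generated:
 assumes V: "finite V" and A: "monomial_algebra K A (loop_quiver V) (%_. 1) S ev"
 shows "generated_subalgebra K A (adeg A 1) = car A"
proof
 interpret A: monomial_algebra K A "loop_quiver V" "%_. 1" S ev by (rule A)
 have "subring (car A) A" by (rule A.carrier_is_subring)
 moreover have "submodule (car A) K A" by (rule A.carrier_is_submodule)
 ultimately show "generated_subalgebra K A (adeg A 1) \<subseteq> car A"
  unfolding generated_subalgebra_def using A.adeg_carrier by blast
 have "a : H" if a: "a : car A" and H: "subring H A" "submodule H K A" "adeg A 1 \<subseteq> H" for a H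
 proof -
  note h = subringE[OF H(1)]
  have one: "A.mono (0, []) = \<one>\<^bsub>A\<^esub>"
  proof -
  have "path_elem K (0, []) = \<one>\<^bsub>A.p.PA\<^esub>"
  by (auto simp: path_elem_def path_algebra_def fun_eq_iff Let_def)
  then show ?thesis using A.ev_one by (simp add: A.mono_def)
  qed
  have m: "A.mono (0, z) : H" if "set z \<subseteq> V" for z
  using that
  proof (induction z)
  case Nil then show ?case using one h(3) by simp
  next
  case (Cons e z)
  have p: "(0, [e]) : A.p.paths" "(0, z) : A.p.paths" using Cons.prems loop_paths(1)[OF V] by simp_all
  have "A.mono (0, [e]) : H" using A.mono_adeg[OF p(1)] H(3) by auto
  then have "A.mono (0, [e]) \<otimes>\<^bsub>A\<^esub> A.mono (0, z) : H" using h(6) Cons by simp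
  then show ?case using A.mono_mult[OF p] loop_paths(2)[OF V] by simp
  qed
  show ?thesis using a
  proof (induction a rule: A.mono_induct)
  case zero show ?case by (rule h(2))
  next
  case (mono c q)
  have "A.mono q : H" using m[of "snd q"] mono(2) loop_paths(1)[OF V, of "fst q" "snd q"] by (cases q) auto
  then show ?case using submodule.smult_closed[OF H(2) mono(1)] by blast
  next
  case (add x y) then show ?case using h(7) by blast
  qed
 qed
 then show "car A \<subseteq> generated_subalgebra K A (adeg A 1)"
  unfolding generated_subalgebra_def by (intro subsetI InterI) blast
qed

text \<open>The bound \<open>l\<close> exists because \<open>S\<close> is finite, and the finitely many states can be numbered.\<close>

lemma unfolding_exists:
 fixes K :: "'k ring" and A :: "('k, 'a) graded_algebra"
 assumes S: "finite S" and A: "monomial_algebra K A Q w S ev"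
 shows "EX V E. finite V & E \<subseteq> V \<times> V & (\<forall>(B :: ('k, 'd) graded_algebra) evB.
  monomial_algebra K B (pair_quiver V E) (%_. 1) {} evB -->
  (EX l enc. unfolded_quiver K A Q w S ev l B (pair_quiver V E) evB enc))"
proof -
 interpret A: monomial_algebra K A Q w S ev by (rule A)
 \<comment> \<open>Any bound for the lengths of the forbidden paths will do.\<close>
 define l where "l = Suc (\<Sum>q\<in>S. length (snd q))"
 have len: "length p <= l + 1" if "(v, p) : S" for v p
  using member_le_sum[OF that, of "%q. length (snd q)"] S by (simp add: l_def)
 interpret A: word_graph K A Q w S ev l by unfold_locales (use len in \<open>auto simp: l_def\<close>)
 obtain enc :: "_ => nat" where enc: "inj_on enc A.X" using finite_imp_inj_to_nat_seg[OF A.finite_X] by blast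
 let ?V = "enc ` A.X" and ?E = "state_edges A.edge A.X enc"
 show ?thesis
 proof (rule exI[of _ ?V], rule exI[of _ ?E], intro conjI allI impI)
  show "finite ?V" using A.finite_X by simp
  show "?E \<subseteq> ?V \<times> ?V" unfolding state_edges_def by blast
  fix B :: "('k, 'd) graded_algebra" and evB
  assume "monomial_algebra K B (pair_quiver ?V ?E) (%_. 1) {} evB"
  from A.unfolded_quiverI[OF this inj_on_imp_bij_betw[OF enc] refl]
  show "EX l enc'. unfolded_quiver K A Q w S ev l B (pair_quiver ?V ?E) evB enc'" by (intro exI)
 qed
qed

theorem theorem1p1:
  fixes K :: "'k ring"
    and A :: "('k, 'a) graded_algebra"
    and C C' :: algebra_class
  assumes "field K"
    and "infinite (UNIV :: 'u set)"
    and "carrier K \<lesssim> (UNIV :: 'u set)"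
    and "in_class K C A"
  shows "\<exists>A' :: ('k, ((nat, nat) qpath \<Rightarrow> 'k) set) graded_algebra.
           in_class K C' A' \<and>
           (\<exists>F. is_equivalence
                  (QGr K A :: (('a, 'u) graded_module, ('a, 'u) qgr_arrow) cat)
                  (QGr K A' :: ((((nat, nat) qpath \<Rightarrow> 'k) set, 'u) graded_module,
                               (((nat, nat) qpath \<Rightarrow> 'k) set, 'u) qgr_arrow) cat) F \<and>
                (\<forall>M \<in> Obj (QGr K A :: (('a, 'u) graded_module, ('a, 'u) qgr_arrow) cat).
                   isomorphic (QGr K A') (fobj F (shift M)) (shift (fobj F M))))"
proof -
 obtain Q :: "(nat, nat) pre_digraph" and w S ev where S: "finite S" and A: "monomial_algebra K A Q w S ev"
  using in_class_monomial[OF assms(1,4)] by blast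
 interpret A: monomial_algebra K A Q w S ev by (rule A)
 obtain V E where VE: "finite V & E \<subseteq> V \<times> V & (\<forall>(B :: ('k, ((nat, nat) qpath => 'k) set) graded_algebra) evB.
  monomial_algebra K B (pair_quiver V E) (%_. 1) {} evB -->
  (EX l enc. unfolded_quiver K A Q w S ev l B (pair_quiver V E) evB enc))"
  using unfolding_exists[OF S A] by (elim exE)
 then have V: "finite V" "E \<subseteq> V \<times> V" by blast+
 note U = VE[THEN conjunct2, THEN conjunct2, rule_format]
 note fG = pair_quiver_finite[OF V]
 interpret G: path_alg K "pair_quiver V E" "%_. 1" by (rule path_algI[OF assms(1) fG])
 define B where "B = monomial_quotient K (pair_quiver V E) (%_. 1) {}"
 obtain evB where B: "monomial_algebra K B (pair_quiver V E) (%_. 1) {} evB"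
  unfolding B_def using G.monomial_algebra_quotient[of "{}"] by blast
 interpret B: monomial_algebra K B "pair_quiver V E" "%_. 1" "{}" evB by (rule B)
 obtain l enc where "unfolded_quiver K A Q w S ev l B (pair_quiver V E) evB enc" using U[OF B] by blast
 then interpret U: unfolded_quiver K A Q w S ev l B "pair_quiver V E" evB enc .
 have AB: "QGr_equivalent TYPE('u) K A B"
  by (rule QGr_equivalent_sym[OF B.tame_algebra_axioms A.tame_algebra_axioms U.QGr_equivalent_unfolding[OF assms(2)]])
 have gB: "graded_algebra K B" by (rule B.graded_algebra_axioms)
 have isoB: "graded_algebra_isomorphic K B (path_algebra K (pair_quiver V E) (%_. 1))"
  unfolding B_def by (rule G.monomial_quotient_empty_iso)
 note fQ = loop_quiver_finite[OF V(1)]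
 interpret L: path_alg K "loop_quiver V" "%_. 1" by (rule path_algI[OF assms(1) fQ])
 define A1 where "A1 = monomial_quotient K (loop_quiver V) (%_. 1) (nonedges V E)"
 obtain ev1 where A1: "monomial_algebra K A1 (loop_quiver V) (%_. 1) (nonedges V E) ev1"
  unfolding A1_def using L.monomial_algebra_quotient[OF nonedges_paths[OF V(1)]] by blast
 interpret A1: monomial_algebra K A1 "loop_quiver V" "%_. 1" "nonedges V E" ev1 by (rule A1)
 interpret U1: unfolded_quiver K A1 "loop_quiver V" "%_. 1" "nonedges V E" ev1 1 B "pair_quiver V E" evB
  "%s. hd (fst s)" by (rule loop_unfolding[OF V A1 B])
 have AA1: "QGr_equivalent TYPE('u) K A A1"
  by (rule QGr_equivalent_trans[OF A1.tame_algebra_axioms AB U1.QGr_equivalent_unfolding[OF assms(2)]])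
 have mA1: "is_monomial_via K A1 (loop_quiver V) (%_. 1) (nonedges V E)"
  unfolding is_monomial_via_def weighted_quiver_def A1_def[symmetric]
  by (intro conjI A1.graded_algebra_axioms fQ nonedges_paths[OF V(1)] graded_algebra_isomorphic_refl)
  (simp_all add: nonedges_def V(1))
 have mB: "is_monomial_via K B (pair_quiver V E) (%_. 1) {}"
  unfolding is_monomial_via_def weighted_quiver_def B_def[symmetric]
  by (intro conjI gB fG graded_algebra_isomorphic_refl) simp_all
 have wG: "weighted_quiver (pair_quiver V E) (%_. 1)" using fG by (simp add: weighted_quiver_def)
 have one: "card (verts (loop_quiver V)) = 1" by simp
 have "EX A' :: ('k, ((nat, nat) qpath => 'k) set) graded_algebra. in_class K C' A' & QGr_equivalent TYPE('u) K A A'"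
 proof (cases C')
  case PA1
  have "in_class K C' B" unfolding PA1 in_class.simps using gB fG isoB by blast
  then show ?thesis using AB by blast
 next
  case WPA
  have "in_class K C' B" unfolding WPA in_class.simps using gB wG isoB by blast
  then show ?thesis using AB by blast
 next
  case MA
  have "in_class K C' B" unfolding MA in_class.simps using mB by blast
  then show ?thesis using AB by blast
 next
  case CMA
  have "in_class K C' A1" unfolding CMA in_class.simps using mA1 one by blast
  then show ?thesis using AA1 by blast
 next
  case CMA1
  have "in_class K C' A1" unfolding CMA1 in_class.simps
  using mA1 one loop_generated[OF V(1) A1] by blast
  then show ?thesis using AA1 by blast
 qed
 then obtain A' :: "('k, ((nat, nat) qpath => 'k) set) graded_algebra" where
  A': "in_class K C' A'" "QGr_equivalent TYPE('u) K A A'" by blast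
 from A'(2) obtain F where F: "ff_es (QGr K A :: ('a, 'u) qcat)
  (QGr K A' :: ((((nat, nat) qpath => 'k) set, 'u) graded_module,
  (((nat, nat) qpath => 'k) set, 'u) qgr_arrow) cat) F"
  "!!M. graded_right_module K A M ==> isomorphic (QGr K A') (fobj F (shift M)) (shift (fobj F M))"
  unfolding QGr_equivalent_def by blast
 have eq: "is_equivalence (QGr K A :: ('a, 'u) qcat)
  (QGr K A' :: ((((nat, nat) qpath => 'k) set, 'u) graded_module,
  (((nat, nat) qpath => 'k) set, 'u) qgr_arrow) cat) F" using ff_es_inverse[OF F(1)] by blast
 show ?thesis
  by (rule exI[of _ A'], intro conjI A'(1), rule exI[of _ F], intro conjI eq ballI F(2)) (simp add: Obj_QGr)
qed

end
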